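(* Suppose a data structure of size $n$ satisfies: (1) there is a sequence of $O(n)$ queries that extracts its whole state $\mathcal{S}$; (2) for any state $\mathcal{S}$ of size $n$, there is a sequence of $O(n)$ operations that brings the data structure from the empty initial state to $\mathcal{S}$; (3) it has a partially retroactive data structure with operation time $T_{\mathsf{op}}(n,m)$. Then the corresponding problem has an amortized fully retroactive data structure with operation time $O\left(\min\{\sqrt m,\, n\log m\}\cdot T_{\mathsf{op}}(n,m)\right)$.
   Context: The state of a data structure is a description of all data it currently stores. A data structure is viewed as a sequence of updates (the timeline) applied to an initial state; $m$ is the number of operations in the timeline. A retroactive data structure allows inserting or deleting an update at any point of the timeline. It is partially retroactive if queries may only be asked about the state resulting from the whole timeline; it is fully retroactive if queries may also be asked about the state resulting from any prefix of the timeline. The model is the word-RAM with word size $\Theta(\log\max\{n,m\})$. *)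

theory Defs
  imports Complex_Main "HOL-Library.Log_Nat"
begin

unbundle bit_operations_syntax

section \<open>Word-RAM\<close>

text \<open>
  Programs are finite and do not depend on the word size \<open>w\<close>, which they can read by \<open>WordSize\<close>.
  All values and addresses are words, i.e. natural numbers below \<open>2 ^ w\<close>, and arithmetic wraps
  around. Division by zero yields zero.
\<close>

datatype binop = Add | Sub | Mul | Div | Mod | And | Or | Xor | Shl | Shr | Less | Eq

datatype expr =
    Lit nat
  | WordSize
  | Reg nat
  | Load expr
  | Bin binop expr expr

datatype com =
    Skip
  | Assign nat expr
  | Store expr expr
  | Seq com com
  | If expr com com
  | While expr com

type_synonym mem = "nat \<Rightarrow> nat"

type_synonym config = "(nat \<Rightarrow> nat) \<times> mem"

fun binop_val :: "nat \<Rightarrow> binop \<Rightarrow> nat \<Rightarrow> nat \<Rightarrow> nat" where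
  "binop_val w Add x y = x + y"
| "binop_val w Sub x y = x + 2 ^ w - y"
| "binop_val w Mul x y = x * y"
| "binop_val w Div x y = x div y"
| "binop_val w Mod x y = x mod y"
| "binop_val w And x y = x AND y"
| "binop_val w Or x y = x OR y"
| "binop_val w Xor x y = x XOR y"
| "binop_val w Shl x y = push_bit y x"
| "binop_val w Shr x y = drop_bit y x"
| "binop_val w Less x y = of_bool (x < y)"
| "binop_val w Eq x y = of_bool (x = y)"

fun eval_expr :: "nat \<Rightarrow> config \<Rightarrow> expr \<Rightarrow> nat" where
  "eval_expr w s (Lit k) = k mod 2 ^ w"
| "eval_expr w s WordSize = w mod 2 ^ w"
| "eval_expr w s (Reg r) = fst s r"
| "eval_expr w s (Load a) = snd s (eval_expr w s a)"
| "eval_expr w s (Bin b x y) = binop_val w b (eval_expr w s x) (eval_expr w s y) mod 2 ^ w"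

fun expr_cost :: "expr \<Rightarrow> nat" where
  "expr_cost (Load a) = 1 + expr_cost a"
| "expr_cost (Bin b x y) = 1 + expr_cost x + expr_cost y"
| "expr_cost _ = 1"

text \<open>\<open>exec w c s t s'\<close>: started in \<open>s\<close>, the program \<open>c\<close> halts in \<open>s'\<close> after \<open>t\<close> steps.\<close>

inductive exec :: "nat \<Rightarrow> com \<Rightarrow> config \<Rightarrow> nat \<Rightarrow> config \<Rightarrow> bool" for w :: nat where
  Skip: "exec w Skip s 1 s"
| Assign: "exec w (Assign r e) (R, M) (1 + expr_cost e) (R(r := eval_expr w (R, M) e), M)"
| Store: "exec w (Store a e) (R, M) (1 + expr_cost a + expr_cost e)
      (R, M(eval_expr w (R, M) a := eval_expr w (R, M) e))"
| Seq: "exec w c\<^sub>1 s t\<^sub>1 s' \<Longrightarrow> exec w c\<^sub>2 s' t\<^sub>2 s'' \<Longrightarrow> exec w (Seq c\<^sub>1 c\<^sub>2) s (t\<^sub>1 + t\<^sub>2) s''"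
| IfTrue: "eval_expr w s e \<noteq> 0 \<Longrightarrow> exec w c\<^sub>1 s t s'
      \<Longrightarrow> exec w (If e c\<^sub>1 c\<^sub>2) s (1 + expr_cost e + t) s'"
| IfFalse: "eval_expr w s e = 0 \<Longrightarrow> exec w c\<^sub>2 s t s'
      \<Longrightarrow> exec w (If e c\<^sub>1 c\<^sub>2) s (1 + expr_cost e + t) s'"
| WhileFalse: "eval_expr w s e = 0 \<Longrightarrow> exec w (While e c) s (1 + expr_cost e) s"
| WhileTrue: "eval_expr w s e \<noteq> 0 \<Longrightarrow> exec w c s t\<^sub>1 s' \<Longrightarrow> exec w (While e c) s' t\<^sub>2 s''
      \<Longrightarrow> exec w (While e c) s (1 + expr_cost e + t\<^sub>1 + t\<^sub>2) s''"

inductive_cases exec_SkipE: "exec w Skip s t s'"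
inductive_cases exec_AssignE: "exec w (Assign r e) s t s'"
inductive_cases exec_StoreE: "exec w (Store a e) s t s'"
inductive_cases exec_SeqE: "exec w (Seq c\<^sub>1 c\<^sub>2) s t s'"
inductive_cases exec_IfE: "exec w (If e c\<^sub>1 c\<^sub>2) s t s'"
inductive_cases exec_WhileE: "exec w (While e c) s t s'"

lemma exec_deterministic:
  "exec w c s t s' \<Longrightarrow> exec w c s u s'' \<Longrightarrow> t = u \<and> s' = s''"
proof (induction arbitrary: u s'' rule: exec.induct)
  case (Skip s)
  then show ?case by (rule exec_SkipE) simp
next
  case (Assign r e R M)
  then show ?case by (rule exec_AssignE) simp
next
  case (Store a e R M)
  then show ?case by (rule exec_StoreE) simp
next
  case (Seq c\<^sub>1 s t\<^sub>1 s' c\<^sub>2 t\<^sub>2 s3)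
  from Seq.prems obtain u\<^sub>1 u\<^sub>2 v where
    "exec w c\<^sub>1 s u\<^sub>1 v" "exec w c\<^sub>2 v u\<^sub>2 s''" "u = u\<^sub>1 + u\<^sub>2"
    by (rule exec_SeqE)
  with Seq.IH(1)[of u\<^sub>1 v] Seq.IH(2)[of u\<^sub>2 s''] show ?case by simp
next
  case (IfTrue s e c\<^sub>1 t s' c\<^sub>2)
  from IfTrue.prems IfTrue.hyps obtain v where
    "exec w c\<^sub>1 s v s''" "u = 1 + expr_cost e + v"
    by - (erule exec_IfE; simp)
  with IfTrue.IH[of v s''] show ?case by simp
next
  case (IfFalse s e c\<^sub>2 t s' c\<^sub>1)
  from IfFalse.prems IfFalse.hyps obtain v where
    "exec w c\<^sub>2 s v s''" "u = 1 + expr_cost e + v"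
    by - (erule exec_IfE; simp)
  with IfFalse.IH[of v s''] show ?case by simp
next
  case (WhileFalse s e c)
  from WhileFalse.prems WhileFalse.hyps show ?case
    by - (erule exec_WhileE; simp)
next
  case (WhileTrue s e c t\<^sub>1 s' t\<^sub>2 s3)
  from WhileTrue.prems WhileTrue.hyps(1) obtain u\<^sub>1 u\<^sub>2 v where
    "exec w c s u\<^sub>1 v" "exec w (While e c) v u\<^sub>2 s''" "u = 1 + expr_cost e + u\<^sub>1 + u\<^sub>2"
    by - (erule exec_WhileE; simp)
  with WhileTrue.IH(1)[of u\<^sub>1 v] WhileTrue.IH(2)[of u\<^sub>2 s''] show ?case by simp
qed

text \<open>Registers are scratch: a call sets them to its arguments (and zero elsewhere), whereas the
  memory survives from one call to the next.\<close>

definition args :: "nat list \<Rightarrow> nat \<Rightarrow> nat" where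
  "args xs r = (if r < length xs then xs ! r else 0)"

definition blank :: mem where
  "blank = (\<lambda>_. 0)"

text \<open>With \<open>c\<close> constant, the word size below is of order \<open>log (max n m)\<close>; \<open>floorlog 2 k\<close> is the
  number of binary digits of \<open>k\<close>.\<close>

definition word_size :: "nat \<Rightarrow> nat \<Rightarrow> nat \<Rightarrow> nat" where
  "word_size c n m = c * floorlog 2 (max n m)"


section \<open>Data structure problems\<close>

text \<open>
  A problem is parametrised by the size \<open>n\<close>. A state is a list of words describing the stored
  data. Updates and queries, including their operands, are coded by numbers and are total on the
  states; \<open>updates n\<close> and \<open>queries n\<close> are the codes that are meaningful for size \<open>n\<close>. The constant
  \<open>width\<close> says how many units of \<open>log (max n m)\<close> bits are enough for one such code.
\<close>

record problem =
  width :: nat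
  empty_state :: "nat \<Rightarrow> nat list"
  updates :: "nat \<Rightarrow> nat set"
  queries :: "nat \<Rightarrow> nat set"
  update :: "nat \<Rightarrow> nat \<Rightarrow> nat list \<Rightarrow> nat list"
  answer :: "nat \<Rightarrow> nat \<Rightarrow> nat list \<Rightarrow> nat"

definition operands :: "problem \<Rightarrow> nat \<Rightarrow> nat \<Rightarrow> nat set" where
  "operands D n m = {..< 2 ^ word_size (width D) n m}"

definition legal_updates :: "problem \<Rightarrow> nat \<Rightarrow> nat \<Rightarrow> nat set" where
  "legal_updates D n m = updates D n \<inter> operands D n m"

definition legal_queries :: "problem \<Rightarrow> nat \<Rightarrow> nat \<Rightarrow> nat set" where
  "legal_queries D n m = queries D n \<inter> operands D n m"

definition result_state :: "problem \<Rightarrow> nat \<Rightarrow> nat list \<Rightarrow> nat list" where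
  "result_state D n us = fold (update D n) us (empty_state D n)"

definition states :: "problem \<Rightarrow> nat \<Rightarrow> nat \<Rightarrow> nat list set" where
  "states D n m = {result_state D n us | us. set us \<subseteq> legal_updates D n m}"

text \<open>States of size \<open>n\<close> consist of \<open>O(n)\<close> words, and answers are single words.\<close>

definition data_structure :: "problem \<Rightarrow> bool" where
  "data_structure D \<longleftrightarrow> width D \<ge> 1 \<and>
    (\<forall>n\<ge>1. \<forall>m\<ge>2. \<forall>S\<in>states D n m.
       length S \<le> width D * n \<and> set S \<subseteq> operands D n m \<and>
       (\<forall>q\<in>legal_queries D n m. answer D n q S \<in> operands D n m))"


section \<open>Extracting and constructing states\<close>

text \<open>
  \<open>extraction w n X ans M a qs t S\<close>: the program \<open>X\<close>, with memory \<open>M\<close> and the answer \<open>a\<close> to its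
  last query (initially 0), asks the queries \<open>qs\<close> one after the other, each of which is
  answered by \<open>ans\<close>, spends \<open>t\<close> steps in total, and leaves \<open>S\<close> at the beginning of the memory.
  After each call, register 0 tells whether there is a further query; register 1 holds that query,
  or the length of \<open>S\<close>.
\<close>

inductive extraction :: "nat \<Rightarrow> nat \<Rightarrow> com \<Rightarrow> (nat \<Rightarrow> nat) \<Rightarrow>
    mem \<Rightarrow> nat \<Rightarrow> nat list \<Rightarrow> nat \<Rightarrow> nat list \<Rightarrow> bool"
  for w n X ans where
  Done: "exec w X (args [n, a], M) t (R, M') \<Longrightarrow> R 0 = 0
      \<Longrightarrow> extraction w n X ans M a [] t (map M' [0..<R 1])"
| Ask: "exec w X (args [n, a], M) t (R, M') \<Longrightarrow> R 0 \<noteq> 0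
      \<Longrightarrow> extraction w n X ans M' (ans (R 1)) qs t' S
      \<Longrightarrow> extraction w n X ans M a (R 1 # qs) (t + t') S"

text \<open>There is a uniform sequence of \<open>O(n)\<close> queries that extracts the whole state. Choosing the
  queries and decoding the answers takes no more time than \<open>O(n)\<close> operations.\<close>

definition extractable :: "problem \<Rightarrow> (nat \<Rightarrow> nat \<Rightarrow> real) \<Rightarrow> bool" where
  "extractable D T \<longleftrightarrow> (\<exists>c\<ge>width D. \<exists>K X. \<forall>n\<ge>1. \<forall>m\<ge>2. \<forall>S\<in>states D n m. \<exists>qs t.
     extraction (word_size c n m) n X (\<lambda>q. answer D n q S) blank 0 qs t S \<and>
     set qs \<subseteq> legal_queries D n m \<and> length qs \<le> K * n \<and> real t \<le> real (K * n) * T n m)"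

text \<open>Given the description of a state, a program writes \<open>O(n)\<close> updates leading from the empty
  state to that state to the beginning of the memory, their number to register 0.\<close>

definition constructible :: "problem \<Rightarrow> (nat \<Rightarrow> nat \<Rightarrow> real) \<Rightarrow> bool" where
  "constructible D T \<longleftrightarrow> (\<exists>c\<ge>width D. \<exists>K Y. \<forall>n\<ge>1. \<forall>m\<ge>2. \<forall>S\<in>states D n m. \<exists>t R M us.
     exec (word_size c n m) Y (args [n, length S], args S) t (R, M) \<and>
     us = map M [0..<R 0] \<and> set us \<subseteq> legal_updates D n m \<and> result_state D n us = S \<and>
     length us \<le> K * n \<and> real t \<le> real (K * n) * T n m)"


section \<open>Retroactive data structures\<close>

text \<open>
  The timeline is a list of updates. \<open>Insert i u\<close> inserts \<open>u\<close> right after the first \<open>i\<close> updates,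
  \<open>Delete i\<close> removes the update with (zero-based) position \<open>i\<close>, and \<open>Query i q\<close> asks \<open>q\<close>
  about the state after the first \<open>i\<close> updates.
\<close>

datatype request = Insert nat nat | Delete nat | Query nat nat

datatype mode = Partially | Fully

fun queryable :: "mode \<Rightarrow> nat list \<Rightarrow> nat \<Rightarrow> bool" where
  "queryable Partially us i \<longleftrightarrow> i = length us"
| "queryable Fully us i \<longleftrightarrow> i \<le> length us"

fun apply_request :: "request \<Rightarrow> nat list \<Rightarrow> nat list" where
  "apply_request (Insert i u) us = take i us @ u # drop i us"
| "apply_request (Delete i) us = take i us @ drop (Suc i) us"
| "apply_request (Query i q) us = us"

text \<open>A legal request keeps the length of the timeline at most \<open>m\<close>.\<close>

fun legal_request :: "problem \<Rightarrow> mode \<Rightarrow> nat \<Rightarrow> nat \<Rightarrow> nat list \<Rightarrow> request \<Rightarrow> bool" where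
  "legal_request D md n m us (Insert i u) \<longleftrightarrow>
     i \<le> length us \<and> length us < m \<and> u \<in> legal_updates D n m"
| "legal_request D md n m us (Delete i) \<longleftrightarrow> i < length us"
| "legal_request D md n m us (Query i q) \<longleftrightarrow> queryable md us i \<and> q \<in> legal_queries D n m"

fun legal_requests :: "problem \<Rightarrow> mode \<Rightarrow> nat \<Rightarrow> nat \<Rightarrow> nat list \<Rightarrow> request list \<Rightarrow> bool" where
  "legal_requests D md n m us [] \<longleftrightarrow> True"
| "legal_requests D md n m us (r # rs) \<longleftrightarrow>
     legal_request D md n m us r \<and> legal_requests D md n m (apply_request r us) rs"

record implementation =
  insert_prog :: com
  delete_prog :: com
  query_prog :: com

fun call :: "nat \<Rightarrow> implementation \<Rightarrow> nat \<Rightarrow> request \<Rightarrow> mem \<Rightarrow> nat \<Rightarrow> config \<Rightarrow> bool" where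
  "call w P n (Insert i u) M = exec w (insert_prog P) (args [n, i, u], M)"
| "call w P n (Delete i) M = exec w (delete_prog P) (args [n, i], M)"
| "call w P n (Query i q) M = exec w (query_prog P) (args [n, i, q], M)"

fun correct_reply :: "problem \<Rightarrow> nat \<Rightarrow> nat list \<Rightarrow> request \<Rightarrow> (nat \<Rightarrow> nat) \<Rightarrow> bool" where
  "correct_reply D n us (Query i q) R \<longleftrightarrow> R 0 = answer D n q (result_state D n (take i us))"
| "correct_reply D n us _ R \<longleftrightarrow> True"

text \<open>\<open>serves D P w n us M rs ts\<close>: with timeline \<open>us\<close> represented by memory \<open>M\<close>, the implementation
  processes the requests \<open>rs\<close> correctly and on-line, in \<open>ts ! k\<close> steps for the request \<open>rs ! k\<close>.
  By \<open>exec_deterministic\<close>, the list \<open>ts\<close> is determined by the other arguments.\<close>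

fun serves :: "problem \<Rightarrow> implementation \<Rightarrow> nat \<Rightarrow> nat \<Rightarrow> nat list \<Rightarrow> mem \<Rightarrow>
    request list \<Rightarrow> nat list \<Rightarrow> bool" where
  "serves D P w n us M [] ts \<longleftrightarrow> ts = []"
| "serves D P w n us M (r # rs) ts \<longleftrightarrow>
     (\<exists>t ts' R M'. ts = t # ts' \<and> call w P n r M t (R, M') \<and> correct_reply D n us r R \<and>
        serves D P w n (apply_request r us) M' rs ts')"

text \<open>Worst-case time per operation. The programs know \<open>n\<close> (and the word size), but not the bound
  \<open>m\<close> on the length of the timeline.\<close>

definition partially_retroactive :: "problem \<Rightarrow> (nat \<Rightarrow> nat \<Rightarrow> real) \<Rightarrow> bool" where
  "partially_retroactive D T \<longleftrightarrow> (\<exists>c\<ge>width D. \<exists>P. \<forall>n\<ge>1. \<forall>m\<ge>2. \<forall>rs.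
     legal_requests D Partially n m [] rs \<longrightarrow>
     (\<exists>ts. serves D P (word_size c n m) n [] blank rs ts \<and> (\<forall>t\<in>set ts. real t \<le> T n m)))"

definition amortized_fully_retroactive :: "problem \<Rightarrow> (nat \<Rightarrow> nat \<Rightarrow> real) \<Rightarrow> bool" where
  "amortized_fully_retroactive D T \<longleftrightarrow> (\<exists>c\<ge>width D. \<exists>P. \<forall>n\<ge>1. \<forall>m\<ge>2. \<forall>rs.
     legal_requests D Fully n m [] rs \<longrightarrow>
     (\<exists>ts. serves D P (word_size c n m) n [] blank rs ts \<and>
        real (sum_list ts) \<le> real (length rs) * T n m))"

end

theory Submission
  imports Defs
begin

text \<open>Let \<open>L\<close> be the length of \<open>max n m\<close> in binary. Memory is divided into regions of \<open>2 ^ (cB * L)\<close> words, in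
 each of which one copy of the partially retroactive structure can be simulated.

 If \<open>2 ^ L = O((n * L)\<^sup>2)\<close>, then \<open>sqrt m = O(n * log m)\<close>. For each \<open>k\<close> with \<open>(k - 1)\<^sup>2\<close> at most the length of the
 timeline, keep a copy holding the first \<open>k\<^sup>2\<close> updates. An insertion or deletion changes one update at the start and
 one at the end of \<open>O(sqrt m)\<close> copies; a query inserts the \<open>O(sqrt m)\<close> missing updates into one copy and deletes them
 afterwards.

 Otherwise keep a weight-balanced skip list on the timeline whose blocks each carry a copy holding the updates of
 the block, so that an insertion or deletion affects \<open>O(log m)\<close> copies. A prefix of the timeline is a concatenation of
 \<open>O(log m)\<close> blocks. A query processes them in order: it puts \<open>O(n)\<close> updates that construct the current state in
 front of the next block, extracts the resulting state from that copy, deletes the updates again, and constructs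
 \<open>O(n)\<close> updates leading to the new state. Deleted elements stay in the list until it is rebuilt; splits and rebuilds
 are paid for by a potential.\<close>

section \<open>Weakest preconditions\<close>

text \<open>The programs see \<open>n\<close> and the word size but never \<open>m\<close>.
  Everything is therefore scaled by \<open>L\<close>, which the word size reveals, and by
  \<open>U = 2 ^ L\<close>, and the choice between the two schemes can depend on \<open>n\<close>
  and \<open>L\<close> only. It has to be right although \<open>max n m\<close> may be
  \<open>n\<close>; a small \<open>n * L\<close> forces \<open>U \<le> 2 * m\<close>. The given
  programs expect a smaller word size, their own registers and, for extraction and construction,
  blank memory at every start. Blanking a whole region would be far too expensive, so stores are
  recorded and undone one by one. Nothing is known about how the given structure represents a
  timeline. A copy is characterised by serving every legal continuation, and it can be changed by
  legal requests only. So a copy never holds more than \<open>m\<close> updates, which limits the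
  top level of the skip list, and a copy can be recycled only by deleting its updates one by one.
  Because deleted elements stay, weights only grow between rebuilds, and blocks are split but never
  merged.\<close>

definition wp :: "nat => com => (nat => (nat => nat) => mem => bool) => (nat => nat) => mem => bool" where
 "wp w c Q R M \<longleftrightarrow> (\<exists>t R' M'. exec w c (R, M) t (R', M') \<and> Q t R' M')"

lemma wp_mono:
 assumes "wp w c Q R M" "\<And>t R' M'. Q t R' M' ==> Q' t R' M'"
 shows "wp w c Q' R M"
proof -
 from assms(1) obtain t R' M' where "exec w c (R, M) t (R', M')" "Q t R' M'" unfolding wp_def by blast
 with assms(2)[of t R' M'] show ?thesis unfolding wp_def by blast
qed

lemma wp_Skip [simp]: "wp w Skip Q R M \<longleftrightarrow> Q 1 R M"
 unfolding wp_def by (rule iffI, fastforce elim!: exec_SkipE, intro exI conjI, rule exec.Skip, simp)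

lemma wp_Seq [simp]: "wp w (Seq c d) Q R M \<longleftrightarrow> wp w c (\<lambda>t. wp w d (\<lambda>t'. Q (t + t'))) R M"
proof
 assume "wp w (Seq c d) Q R M"
 then show "wp w c (\<lambda>t. wp w d (\<lambda>t'. Q (t + t'))) R M"
  unfolding wp_def by (auto elim!: exec_SeqE) blast
next
 assume "wp w c (\<lambda>t. wp w d (\<lambda>t'. Q (t + t'))) R M"
 then show "wp w (Seq c d) Q R M"
  unfolding wp_def by (blast intro: exec.Seq)
qed

lemma wp_Assign_eq: "wp w (Assign r e) Q R M \<longleftrightarrow> Q (1 + expr_cost e) (R(r := eval_expr w (R, M) e)) M"
 unfolding wp_def by (rule iffI, fastforce elim!: exec_AssignE, intro exI conjI, rule exec.Assign)

lemma wp_Store_eq: "wp w (Store a e) Q R M \<longleftrightarrow>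
  Q (1 + expr_cost a + expr_cost e) R (M(eval_expr w (R, M) a := eval_expr w (R, M) e))"
 unfolding wp_def by (rule iffI, fastforce elim!: exec_StoreE, intro exI conjI, rule exec.Store)

lemma wp_If_eq: "wp w (If e c d) Q R M \<longleftrightarrow>
  (if eval_expr w (R, M) e ~= 0 then wp w c (\<lambda>t. Q (1 + expr_cost e + t)) R M
   else wp w d (\<lambda>t. Q (1 + expr_cost e + t)) R M)"
proof (cases "eval_expr w (R, M) e = 0")
 case True
 then have "exec w (If e c d) s t s' \<longleftrightarrow> (\<exists>v. t = 1 + expr_cost e + v \<and> exec w d s v s')" if "s = (R, M)" for s t s'
  using that by (auto elim!: exec_IfE intro: exec.IfFalse[simplified])
 with True show ?thesis unfolding wp_def by auto
next
 case False
 then have "exec w (If e c d) s t s' \<longleftrightarrow> (\<exists>v. t = 1 + expr_cost e + v \<and> exec w c s v s')" if "s = (R, M)" for s t s'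
  using that by (auto elim!: exec_IfE intro: exec.IfTrue[simplified])
 with False show ?thesis unfolding wp_def by auto
qed

text \<open>One unrolling, as an equivalence. It is applied by substitution, since as a rewrite rule
  it would unfold a loop forever.\<close>

lemma wp_While_eq: "wp w (While e c) Q R M \<longleftrightarrow>
  (if eval_expr w (R, M) e ~= 0 then wp w (Seq c (While e c)) (\<lambda>t. Q (1 + expr_cost e + t)) R M
   else Q (1 + expr_cost e) R M)"
proof
 assume "wp w (While e c) Q R M"
 then obtain t R' M' where *: "exec w (While e c) (R, M) t (R', M')" "Q t R' M'"
  by (auto simp: wp_def)
 from *(1) have "(eval_expr w (R, M) e = 0 \<and> t = 1 + expr_cost e \<and> (R', M') = (R, M)) \<or>
  (\<exists>t1 s t2. eval_expr w (R, M) e ~= 0 \<and> t = 1 + expr_cost e + t1 + t2 \<and>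
   exec w c (R, M) t1 s \<and> exec w (While e c) s t2 (R', M'))"
  by (rule exec_WhileE) auto
 then show "(if eval_expr w (R, M) e ~= 0 then wp w (Seq c (While e c)) (\<lambda>t. Q (1 + expr_cost e + t)) R M
   else Q (1 + expr_cost e) R M)"
 proof (elim disjE exE conjE)
  fix t1 s t2
  assume a: "eval_expr w (R, M) e ~= 0" "t = 1 + expr_cost e + t1 + t2"
   "exec w c (R, M) t1 s" "exec w (While e c) s t2 (R', M')"
  then have "exec w (Seq c (While e c)) (R, M) (t1 + t2) (R', M')" by (blast intro: exec.Seq)
  with a *(2) show ?thesis unfolding wp_def by (fastforce simp: algebra_simps)
 qed (use *(2) in auto)
next
 assume *: "(if eval_expr w (R, M) e ~= 0 then wp w (Seq c (While e c)) (\<lambda>t. Q (1 + expr_cost e + t)) R M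
   else Q (1 + expr_cost e) R M)"
 show "wp w (While e c) Q R M"
 proof (cases "eval_expr w (R, M) e = 0")
  case True
  then show ?thesis using * exec.WhileFalse[OF True] by (auto simp: wp_def)
 next
  case False
  with * have "wp w c (\<lambda>t. wp w (While e c) (\<lambda>t'. Q (1 + expr_cost e + (t + t')))) R M" by simp
  then obtain t R' M' t' R'' M'' where "exec w c (R, M) t (R', M')"
   "exec w (While e c) (R', M') t' (R'', M'')" "Q (1 + expr_cost e + (t + t')) R'' M''"
   unfolding wp_def by blast
  with False show ?thesis
   using exec.WhileTrue[OF False] unfolding wp_def by (metis add.assoc)
 qed
qed

text \<open>The unreduced value of an expression over operands below \<open>Z\<close> is below
  \<open>Z\<close> to the number of its leaves. A \<open>Load\<close> inherits the leaves of its
  address: the loaded cell is again below \<open>Z\<close>, but the address must not wrap around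
  either.\<close>

fun leaves :: "expr => nat" where
 "leaves (Load a) = leaves a"
| "leaves (Bin b x y) = leaves x + leaves y"
| "leaves _ = 1"

lemma leaves_pos: "leaves e \<ge> 1"
 by (induction e) auto

text \<open>\<open>Sub\<close> is the only operation whose unreduced value depends on the word size;
  it becomes truncated subtraction, and a dummy size 0 serves for the others.\<close>

fun nat_op :: "binop => nat => nat => nat" where
 "nat_op Sub x y = x - y"
| "nat_op b x y = binop_val 0 b x y"

text \<open>All quantities handled by the retroactive structures are below \<open>Z\<close>, whereas words can hold
 products of ten of them; hence expressions with at most ten leaves never wrap around.\<close>

locale words =
 fixes cB L :: nat
 assumes cB: "cB \<ge> 8" and L: "L \<ge> 2"
begin

definition B :: nat where "B = 2 ^ (cB * L)"
text \<open>An address consists of a region number and an offset, both below \<open>B\<close>, read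
  as a two-digit number in base \<open>B\<close>.\<close>

definition Z :: nat where "Z = B * B"
definition U :: nat where "U = 2 ^ L"
definition w :: nat where "w = 20 * cB * L"

lemma Z_pow: "Z ^ 10 = 2 ^ w"
proof -
 have "w = (cB * L + cB * L) * 10" by (simp add: w_def)
 then show ?thesis by (simp only: Z_def B_def flip: power_mult power_add)
qed

lemma U_ge: "U \<ge> 4"
proof -
 have "(2::nat) ^ 2 <= 2 ^ L" using L by (intro power_increasing) auto
 then show ?thesis by (simp add: U_def)
qed

lemma B_U8: "B \<ge> U ^ 8"
 unfolding B_def U_def power_mult[symmetric] using cB by (intro power_increasing) (auto simp: algebra_simps)

text \<open>Of the eight factors \<open>U\<close> granted by \<open>cB \<ge> 8\<close>, four are
  traded for the constant 64 by means of \<open>U \<ge> 4\<close>. Region numbers and offsets of the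
  two schemes are of degree at most two in \<open>U\<close>, so \<open>B\<close> has ample room for
  them.\<close>

lemma U_lt_B: "U * U * U * U * 64 <= B"
proof -
 have "(4::nat) ^ 4 <= U ^ 4" using U_ge by (intro power_mono) auto
 then have "U ^ 4 * 64 <= U ^ 4 * U ^ 4" by (intro mult_le_mono2) simp
 also have "\<dots> = U ^ 8" by (simp flip: power_add)
 also have "\<dots> <= B" by (rule B_U8)
 finally show ?thesis by (simp add: power4_eq_xxxx)
qed

lemma B_big: "B \<ge> 16384" "U * 4096 <= B" "U * U * 1024 <= B"
proof -
 have 1: "4 * U <= U * U" using U_ge by (intro mult_right_mono) auto
 have "(U * U) * (4 * 4) <= (U * U) * (U * U)" using U_ge by (intro mult_left_mono mult_mono) auto
 then show "U * U * 1024 <= B" using U_lt_B by linarith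
 with 1 show "U * 4096 <= B" by linarith
 with U_ge show "B \<ge> 16384" by simp
qed

lemma B_lt_Z: "B < Z"
 using B_big by (simp add: Z_def)

text \<open>The word size is itself a readable value, so it has to count among the small
  ones.\<close>

lemma w_lt_Z: "w < Z"
proof -
 have *: "20 * x < 2 ^ (2 * x)" if "x \<ge> 8" for x :: nat
  using that by (induction x rule: nat_induct_at_least) auto
 have "8 * 1 <= cB * L" using cB L by (intro mult_mono) auto
 from *[of "cB * L"] this show ?thesis
  by (simp add: w_def Z_def B_def mult.assoc mult_2 flip: power_add)
qed

text \<open>This bound and \<open>bM\<close> accompany every specification below, because machine
  arithmetic agrees with arithmetic in the natural numbers only while they hold.\<close>

definition bR :: "(nat => nat) => bool" where "bR R \<longleftrightarrow> (\<forall>r. R r < Z)"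
definition bM :: "mem => bool" where "bM M \<longleftrightarrow> (\<forall>a. M a < Z)"

lemma bR_reg [simp]: "bR R ==> R r < Z" by (simp add: bR_def)
lemma bM_cell [simp]: "bM M ==> M r < Z" by (simp add: bM_def)
lemma bR_upd [simp]: "bR R ==> v < Z ==> bR (R(r := v))" by (simp add: bR_def)
lemma bM_upd [simp]: "bM M ==> v < Z ==> bM (M(r := v))" by (simp add: bM_def)
lemma num_lt_Z [simp]: "numeral k <= (16384 :: nat) ==> numeral k < Z"
 using B_big(1) B_lt_Z by linarith
lemma Z_pos [simp]: "0 < Z" "Suc 0 < Z" using B_big(1) B_lt_Z by linarith+

fun ev :: "(nat => nat) => mem => expr => nat" where
 "ev R M (Lit k) = k"
| "ev R M WordSize = w"
| "ev R M (Reg r) = R r"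
| "ev R M (Load a) = M (ev R M a)"
| "ev R M (Bin b x y) = nat_op b (ev R M x) (ev R M y)"

text \<open>Side conditions under which the unreduced value \<open>ev\<close> is the machine value.
  A shift is not controlled by the number of leaves, so its result is bounded directly. Bitwise
  operations and right shifts are rejected outright: the host code does not use them, and translated
  code is evaluated by \<open>comp_expr_eval\<close> instead.\<close>

fun ok :: "(nat => nat) => mem => expr => bool" where
 "ok R M (Lit k) \<longleftrightarrow> k < Z"
| "ok R M WordSize \<longleftrightarrow> True"
| "ok R M (Reg r) \<longleftrightarrow> True"
| "ok R M (Load a) \<longleftrightarrow> ok R M a"
| "ok R M (Bin b x y) \<longleftrightarrow> ok R M x \<and> ok R M y \<and>
  (case b of Sub => ev R M y <= ev R M x | Shl => push_bit (ev R M y) (ev R M x) < Z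
   | And => False | Or => False | Xor => False | Shr => False | _ => True)"

text \<open>The size bound is part of the induction claim: an operation is exact as long as its
  result is below \<open>Z ^ leaves e\<close>, and ten leaves keep this power within
  \<open>2 ^ w\<close>.\<close>

lemma eval_ev_aux:
 assumes "bR R" "bM M"
 shows "ok R M e ==> leaves e <= 10 ==> eval_expr w (R, M) e = ev R M e \<and> ev R M e < Z ^ leaves e"
proof (induction e)
 case (Lit k)
 have "Z ^ 1 <= Z ^ 10" by (intro power_increasing) (auto simp: Suc_le_eq)
 with Lit show ?case using Z_pow by simp
next
 case WordSize
 have "Z ^ 1 <= Z ^ 10" by (intro power_increasing) (auto simp: Suc_le_eq)
 with w_lt_Z show ?case using Z_pow by simp
next
 case (Reg x)
 then show ?case using assms by simp
next
 case (Load e)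
 have "Z ^ 1 <= Z ^ leaves e" using leaves_pos by (intro power_increasing) (auto simp: Suc_le_eq)
 moreover have "M (ev R M e) < Z" using assms by simp
 ultimately show ?case using Load by simp
next
 case (Bin b x y)
 let ?x = "ev R M x" and ?y = "ev R M y"
 have IH: "eval_expr w (R, M) x = ?x" "eval_expr w (R, M) y = ?y" "?x < Z ^ leaves x" "?y < Z ^ leaves y"
  using Bin by auto
 have Z2: "2 <= Z ^ leaves x" "2 <= Z ^ leaves y"
  using leaves_pos[of x] leaves_pos[of y] Z_pos(2) self_le_power[of Z "leaves x"] self_le_power[of Z "leaves y"]
  by linarith+
 \<comment> \<open>For numbers that are at least 2, a sum does not exceed the product.\<close>
 have sum: "Z ^ leaves x + Z ^ leaves y <= Z ^ leaves x * Z ^ leaves y"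
  using Z2 by (auto simp: le_iff_add algebra_simps)
 have le: "Z ^ leaves x <= Z ^ leaves x * Z ^ leaves y" "Z ^ leaves y <= Z ^ leaves x * Z ^ leaves y"
  using Z2 by auto
 have top: "Z ^ (leaves x + leaves y) <= 2 ^ w"
  unfolding Z_pow[symmetric] using Bin.prems by (intro power_increasing) (auto simp: Suc_le_eq)
 have ZZ: "Z <= Z ^ leaves x" using leaves_pos[of x] by (intro self_le_power) (auto simp: Suc_le_eq)
 have two: "2 <= Z ^ (leaves x + leaves y)" unfolding power_add using le Z2 by linarith
 have small: "v < Z ^ (leaves x + leaves y)" if "v <= ?x" for v
  using that IH(3) le(1) unfolding power_add by linarith
 have val: "nat_op b ?x ?y < Z ^ (leaves x + leaves y)"
 proof (cases b)
  case Add
  then show ?thesis using IH sum by (simp add: power_add)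
 next
  case Sub
  then show ?thesis using small[of "?x - ?y"] by simp
 next
  case Mul
  then show ?thesis using IH by (simp add: power_add mult_strict_mono)
 next
  case Div
  then show ?thesis using small[of "?x div ?y"] by simp
 next
  case Mod
  then show ?thesis using small[of "?x mod ?y"] by simp
 next
  case Shl
  then have "push_bit ?y ?x < Z" using Bin.prems by simp
  with ZZ le(1) have "push_bit ?y ?x < Z ^ leaves x * Z ^ leaves y" by linarith
  with Shl show ?thesis by (simp add: power_add)
 next
  case Less
  then show ?thesis using two by (simp add: of_bool_def)
 next
  case Eq
  then show ?thesis using two by (simp add: of_bool_def)
 qed (use Bin.prems in auto)
 have "binop_val w b ?x ?y mod 2 ^ w = nat_op b ?x ?y"
 proof (cases b)
  case Sub
  then have "?x + 2 ^ w - ?y = (?x - ?y) + 2 ^ w" using Bin.prems by simp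
  then have "(?x + 2 ^ w - ?y) mod 2 ^ w = (?x - ?y) mod 2 ^ w" by simp
  then show ?thesis using Sub val top by simp
 qed (use val top Bin.prems in auto)
 then show ?case using IH val by simp
qed

lemma eval_ev:
 assumes "bR R" "bM M" "ok R M e" "leaves e <= 10"
 shows "eval_expr w (R, M) e = ev R M e"
 using eval_ev_aux assms by blast

lemma wp_Assign [simp]:
 "bR R ==> bM M ==> ok R M e ==> leaves e <= 10 ==>
  wp w (Assign r e) Q R M \<longleftrightarrow> Q (1 + expr_cost e) (R(r := ev R M e)) M"
 by (simp add: wp_Assign_eq eval_ev)

lemma wp_If [simp]:
 "bR R ==> bM M ==> ok R M e ==> leaves e <= 10 ==>
  wp w (If e c d) Q R M \<longleftrightarrow>
   (if ev R M e ~= 0 then wp w c (\<lambda>t. Q (1 + expr_cost e + t)) R M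
    else wp w d (\<lambda>t. Q (1 + expr_cost e + t)) R M)"
 by (simp add: wp_If_eq eval_ev)

text \<open>The invariant sees both the variant \<open>k\<close> and the time \<open>\<tau>\<close>
  elapsed so far, so that one induction yields termination, correctness and time bounds, including
  amortised ones.\<close>

lemma wp_While:
 fixes k :: nat
 assumes "I k \<tau> R M" "bR R" "bM M"
  and step: "\<And>k \<tau> R M. I k \<tau> R M ==> bR R ==> bM M ==> ok R M e \<and> leaves e <= 10 \<and>
   (if ev R M e = 0 then Q (\<tau> + 1 + expr_cost e) R M
    else wp w c (\<lambda>t R' M'. bR R' \<and> bM M' \<and> (\<exists>k'<k. I k' (\<tau> + 1 + expr_cost e + t) R' M')) R M)"
 shows "wp w (While e c) (\<lambda>t. Q (\<tau> + t)) R M"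
 using assms(1-3)
proof (induction k arbitrary: \<tau> R M rule: less_induct)
 case (less k)
 note s = step[OF less.prems]
 show ?case
 proof (cases "ev R M e = 0")
  case True
  then show ?thesis using s less.prems by (subst wp_While_eq) (simp add: eval_ev)
 next
  case False
  from s False have "wp w c (\<lambda>t R' M'. bR R' \<and> bM M' \<and> (\<exists>k'<k. I k' (\<tau> + 1 + expr_cost e + t) R' M')) R M"
   by simp
  then have "wp w c (\<lambda>t. wp w (While e c) (\<lambda>t'. Q (\<tau> + 1 + expr_cost e + t + t'))) R M"
   by (rule wp_mono) (use less.IH in blast)
  then show ?thesis using False s less.prems
   by (subst wp_While_eq) (simp add: eval_ev algebra_simps)
 qed
qed

end

definition For :: "nat => nat => com => com" where
 "For r lm c = While (Bin Less (Reg r) (Reg lm)) (Seq c (Assign r (Bin Add (Reg r) (Lit 1))))"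

context words
begin

text \<open>Elapsed time is an argument of the invariant, as amortised bounds need. A round adds 4
  steps for the test and 4 for the increment; the failing test at the end adds 4 more.\<close>

lemma wp_For_acc:
 assumes "I a \<tau> R M" "R r = a" "R lm = z" "a <= z" "z < Z" "bR R" "bM M" "r ~= lm"
  and step: "\<And>i \<tau> R M. a <= i ==> i < z ==> I i \<tau> R M ==> R r = i ==> R lm = z ==> bR R ==> bM M ==>
   wp w c (\<lambda>t R' M'. R' r = i \<and> R' lm = z \<and> bR R' \<and> bM M' \<and>
    I (Suc i) (\<tau> + t + 8) (R'(r := Suc i)) M') R M"
  and final: "\<And>\<tau> R M. I z \<tau> R M ==> R r = z ==> R lm = z ==> bR R ==> bM M ==> Q (\<tau> + 4) R M"
 shows "wp w (For r lm c) (\<lambda>t. Q (\<tau> + t)) R M"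
proof -
 define J where "J k \<tau> R M \<longleftrightarrow> (\<exists>i. a <= i \<and> i <= z \<and> k = z - i \<and> I i \<tau> R M \<and> R r = i \<and> R lm = z)"
  for k \<tau> R M
 show ?thesis unfolding For_def
 proof (rule wp_While[where I = J and k = "z - a"])
  show "J (z - a) \<tau> R M" using assms by (auto simp: J_def)
 next
  fix k \<tau> R M assume "J k \<tau> R M" and b: "bR R" "bM M"
  then obtain i where i: "a <= i" "i <= z" "k = z - i" "I i \<tau> R M" "R r = i" "R lm = z"
   by (auto simp: J_def)
  show "ok R M (Bin Less (Reg r) (Reg lm)) \<and> leaves (Bin Less (Reg r) (Reg lm)) <= 10 \<and>
   (if ev R M (Bin Less (Reg r) (Reg lm)) = 0 then Q (\<tau> + 1 + expr_cost (Bin Less (Reg r) (Reg lm))) R M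
    else wp w (Seq c (Assign r (Bin Add (Reg r) (Lit 1)))) (\<lambda>t R' M'. bR R' \<and> bM M' \<and>
     (\<exists>k'<k. J k' (\<tau> + 1 + expr_cost (Bin Less (Reg r) (Reg lm)) + t) R' M')) R M)"
  proof (cases "i < z")
   case True
   have "wp w (Seq c (Assign r (Bin Add (Reg r) (Lit 1)))) (\<lambda>t R' M'. bR R' \<and> bM M' \<and>
     (\<exists>k'<k. J k' (\<tau> + 4 + t) R' M')) R M"
    unfolding wp_Seq
   proof (rule wp_mono[OF step[OF i(1) True i(4-6) b]], elim conjE)
    fix t R' M' assume *: "R' r = i" "R' lm = z" "bR R'" "bM M'" "I (Suc i) (\<tau> + t + 8) (R'(r := Suc i)) M'"
    have "J (z - Suc i) (\<tau> + 4 + (t + 4)) (R'(r := Suc i)) M'"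
     using * True i \<open>r ~= lm\<close> by (auto simp: J_def algebra_simps numeral_eq_Suc)
    moreover have "z - Suc i < k" using i True by simp
    moreover have "Suc i < Z" using True \<open>z < Z\<close> by simp
    ultimately show "wp w (Assign r (Bin Add (Reg r) (Lit 1)))
       (\<lambda>t' R' M'. bR R' \<and> bM M' \<and> (\<exists>k'<k. J k' (\<tau> + 4 + (t + t')) R' M')) R' M'"
     using * by (auto simp: algebra_simps numeral_eq_Suc)
   qed
   with True i show ?thesis by (simp add: algebra_simps numeral_eq_Suc)
  next
   case False
   then have "i = z" using i by simp
   with final[of \<tau> R M] i b show ?thesis by (simp add: algebra_simps numeral_eq_Suc)
  qed
 qed (use assms in auto)
qed

text \<open>The version for bodies with a worst-case bound \<open>b\<close>, which keeps time out of
  the invariant.\<close>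

lemma wp_For:
 assumes "I a R M" "R r = a" "R lm = z" "a <= z" "z < Z" "bR R" "bM M" "r ~= lm"
  and step: "\<And>i R M. a <= i ==> i < z ==> I i R M ==> R r = i ==> R lm = z ==> bR R ==> bM M ==>
   wp w c (\<lambda>t R' M'. t <= b \<and> R' r = i \<and> R' lm = z \<and> bR R' \<and> bM M' \<and> I (Suc i) (R'(r := Suc i)) M') R M"
  and final: "\<And>t R M. t <= 4 + (z - a) * (b + 8) ==> I z R M ==> R r = z ==> R lm = z ==>
   bR R ==> bM M ==> Q t R M"
 shows "wp w (For r lm c) Q R M"
proof -
 have "wp w (For r lm c) (\<lambda>t. Q (0 + t)) R M"
 proof (rule wp_For_acc[where I = "\<lambda>i \<tau> R M. \<tau> <= (i - a) * (b + 8) \<and> I i R M"])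
  fix i \<tau> R M assume *: "a <= i" "i < z" "\<tau> <= (i - a) * (b + 8) \<and> I i R M" "R r = i" "R lm = z" "bR R" "bM M"
  show "wp w c (\<lambda>t R' M'. R' r = i \<and> R' lm = z \<and> bR R' \<and> bM M' \<and>
    \<tau> + t + 8 <= (Suc i - a) * (b + 8) \<and> I (Suc i) (R'(r := Suc i)) M') R M"
   by (rule wp_mono[OF step[of i R M]]) (use * in \<open>auto simp: Suc_diff_le\<close>)
 qed (use assms in auto)
 then show ?thesis by simp
qed

section \<open>Memory regions and their addressing\<close>

definition adr :: "nat => nat => nat" where "adr h l = h * B + l"

lemma adr_eq [simp]: "l < B ==> l' < B ==> adr h l = adr h' l' \<longleftrightarrow> h = h' \<and> l = l'"
proof -
 have "(h * B + l) div B = h" "(h * B + l) mod B = l" if "l < B" for h l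
  using that by auto
 then show "l < B ==> l' < B ==> adr h l = adr h' l' \<longleftrightarrow> h = h' \<and> l = l'"
  unfolding adr_def by metis
qed

lemma adr_lt_Z: "h < B ==> l < B ==> adr h l < Z"
proof -
 assume "h < B" "l < B"
 then have "adr h l < Suc h * B" by (simp add: adr_def)
 also have "\<dots> <= B * B" using \<open>h < B\<close> by (intro mult_right_mono) auto
 finally show ?thesis by (simp add: Z_def)
qed

end

text \<open>Register 6 holds the region size \<open>B\<close>.\<close>

definition Ld :: "expr => expr => expr" where
 "Ld h l = Load (Bin Add (Bin Mul h (Reg 6)) l)"

definition St :: "expr => expr => expr => com" where
 "St h l e = Store (Bin Add (Bin Mul h (Reg 6)) l) e"

lemma Ld_simps [simp]: "leaves (Ld h l) = 1 + leaves h + leaves l"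
 "expr_cost (Ld h l) = 4 + expr_cost h + expr_cost l"
 by (auto simp: Ld_def)

context words
begin

lemma ok_Ld [simp]: "ok R M (Ld h l) \<longleftrightarrow> ok R M h \<and> ok R M l"
 by (auto simp: Ld_def)

lemma ev_Ld [simp]: "R 6 = B ==> ev R M (Ld h l) = M (adr (ev R M h) (ev R M l))"
 by (simp add: Ld_def adr_def)

lemma wp_St [simp]:
 "bR R ==> bM M ==> R 6 = B ==> ok R M h ==> ok R M l ==> ok R M e ==>
  leaves h + leaves l <= 9 ==> leaves e <= 10 ==>
  wp w (St h l e) Q R M \<longleftrightarrow> Q (4 + expr_cost h + expr_cost l + expr_cost e) R
   (M(adr (ev R M h) (ev R M l) := ev R M e))"
 unfolding St_def wp_Store_eq by (subst (1 2) eval_ev) (auto simp: adr_def numeral_eq_Suc)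

end

text \<open>One more than the largest register index that occurs, so that finitely many host
  registers suffice for a simulation.\<close>

fun expr_regs :: "expr => nat" where
 "expr_regs (Reg r) = Suc r"
| "expr_regs (Load a) = expr_regs a"
| "expr_regs (Bin b x y) = max (expr_regs x) (expr_regs y)"
| "expr_regs _ = 0"

fun com_regs :: "com => nat" where
 "com_regs Skip = 0"
| "com_regs (Assign r e) = max (Suc r) (expr_regs e)"
| "com_regs (Store a e) = max (expr_regs a) (expr_regs e)"
| "com_regs (Seq c d) = max (com_regs c) (com_regs d)"
| "com_regs (If e c d) = max (expr_regs e) (max (com_regs c) (com_regs d))"
| "com_regs (While e c) = max (expr_regs e) (com_regs c)"

section \<open>Simulation of programs for smaller words\<close>

text \<open>Simulation of a program for word size \<open>c * L\<close>: register 103 holds the base address of the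
 region that serves as its memory, register 106 the modulus \<open>2 ^ (c * L)\<close>, and its registers are
 shifted by 110. If \<open>tr\<close> is set, the addresses of modified cells are recorded without repetition in
 the region based at register 105, with membership marks in the region based at register 104 and
 their number in register 102; this makes it possible to blank the memory afterwards in time
 proportional to that of the simulation.\<close>

fun comp_expr :: "nat => nat => expr => expr" where
 "comp_expr cB c (Lit k) = Bin Mod (Lit k) (Reg 106)"
| "comp_expr cB c WordSize = Bin Mul (Lit c) (Bin Div WordSize (Lit (20 * cB)))"
| "comp_expr cB c (Reg r) = Reg (110 + r)"
| "comp_expr cB c (Load a) = Load (Bin Add (Reg 103) (comp_expr cB c a))"
| "comp_expr cB c (Bin b x y) = Bin Mod (Bin b (comp_expr cB c x) (comp_expr cB c y)) (Reg 106)"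

definition tracked_store :: "bool => com" where
 "tracked_store tr = Seq (Store (Bin Add (Reg 103) (Reg 100)) (Reg 101))
  (if tr then If (Load (Bin Add (Reg 104) (Reg 100))) Skip
    (Seq (Store (Bin Add (Reg 104) (Reg 100)) (Lit 1))
    (Seq (Store (Bin Add (Reg 105) (Reg 102)) (Reg 100))
     (Assign 102 (Bin Add (Reg 102) (Lit 1)))))
   else Skip)"

fun comp :: "nat => nat => bool => com => com" where
 "comp cB c tr Skip = Skip"
| "comp cB c tr (Assign r e) = Assign (110 + r) (comp_expr cB c e)"
| "comp cB c tr (Store a e) = Seq (Assign 100 (comp_expr cB c a))
   (Seq (Assign 101 (comp_expr cB c e)) (tracked_store tr))"
| "comp cB c tr (Seq d e) = Seq (comp cB c tr d) (comp cB c tr e)"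
| "comp cB c tr (If x d e) = If (comp_expr cB c x) (comp cB c tr d) (comp cB c tr e)"
| "comp cB c tr (While x d) = While (comp_expr cB c x) (comp cB c tr d)"

text \<open>The extreme case is \<open>WordSize\<close>, whose translation has five unit-cost
  nodes.\<close>

lemma comp_expr_cost: "expr_cost (comp_expr cB c e) <= 5 * expr_cost e"
 by (induction e) auto

context words
begin

text \<open>The decisive clause is the last one: every nonzero cell of the simulated memory is on
  the list, so zeroing the listed cells blanks the region. The marks in \<open>hm\<close> keep the
  list free of repetitions; this bounds its length by \<open>2 ^ W\<close> and makes it fit into the
  region \<open>ht\<close>.\<close>

definition trail :: "nat => nat => nat => nat => mem => nat => bool" where
 "trail W hb hm ht M k \<longleftrightarrow> (\<exists>xs. length xs = k \<and> distinct xs \<and> set xs \<subseteq> {..<2 ^ W} \<and>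
   (\<forall>i<k. M (adr ht i) = xs ! i) \<and>
   (\<forall>a<B. M (adr hm a) ~= 0 \<longleftrightarrow> a \<in> set xs) \<and>
   (\<forall>a<B. M (adr hb a) ~= 0 --> a \<in> set xs))"

lemma trail_le: "trail W hb hm ht M k ==> k <= 2 ^ W"
 unfolding trail_def by (metis card_lessThan card_mono distinct_card finite_lessThan)

text \<open>\<open>R\<close> and \<open>M\<close> form the simulated configuration,
  \<open>R1\<close> and \<open>M1\<close> that of the host, and \<open>R0\<close> and
  \<open>M0\<close> that of the host before the call, recorded for framing. Host registers below 100
  belong to the caller, those from 100 to 106 to the simulation, and those from 110 on are the
  simulated ones.\<close>

definition simulates :: "bool => nat => nat => nat => nat => nat => (nat => nat) => mem =>
  (nat => nat) => mem => (nat => nat) => mem => bool" where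
 "simulates tr hb hm ht W rb R0 M0 R M R1 M1 \<longleftrightarrow>
   bR R1 \<and> bM M1 \<and> (\<forall>r. R r < 2 ^ W) \<and> (\<forall>a. M a < 2 ^ W) \<and>
   (\<forall>r<rb. R1 (110 + r) = R r) \<and> (\<forall>a<2 ^ W. M1 (adr hb a) = M a) \<and>
   R1 103 = adr hb 0 \<and> R1 104 = adr hm 0 \<and> R1 105 = adr ht 0 \<and> R1 106 = 2 ^ W \<and>
   (\<forall>r<100. R1 r = R0 r) \<and>
   (\<forall>h l. l < B --> h ~= hb --> (tr --> h ~= hm \<and> h ~= ht) --> M1 (adr h l) = M0 (adr h l)) \<and>
   (tr --> trail W hb hm ht M1 (R1 102))"

text \<open>At most one entry is added per store. The trail thus grows by no more than the simulated
  time, so that blanking is paid for by the simulation itself.\<close>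

lemma tracked_store:
 assumes "bR R" "bM M" "R 103 = adr hb 0" "R 104 = adr hm 0" "R 105 = adr ht 0"
  "hb < B" "hm < B" "ht < B" "tr ==> distinct [hb, hm, ht]" "R 100 < 2 ^ W" "R 101 < Z" "2 ^ W < B"
  "tr ==> trail W hb hm ht M (R 102)"
 shows "wp w (tracked_store tr) (\<lambda>t R' M'. t <= 24 \<and> bR R' \<and> bM M' \<and> (\<forall>r. r ~= 102 --> R' r = R r) \<and>
  (\<forall>a<B. M' (adr hb a) = (if a = R 100 then R 101 else M (adr hb a))) \<and>
  (\<forall>h l. l < B --> h ~= hb --> (tr --> h ~= hm \<and> h ~= ht) --> M' (adr h l) = M (adr h l)) \<and>
  (tr --> trail W hb hm ht M' (R' 102)) \<and> R' 102 <= R 102 + 1) R M"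
proof -
 have ad: "adr h 0 + l = adr h l" for h l by (simp add: adr_def)
 have st: "wp w (Store (Bin Add (Reg r) (Reg r')) e) Q R M \<longleftrightarrow> Q (4 + expr_cost e) R (M(R r + R r' := ev R M e))"
  if "bR R" "bM M" "ok R M e" "leaves e <= 10" for r r' e Q R M
  unfolding wp_Store_eq using that by (subst (1 2) eval_ev) (auto simp: numeral_eq_Suc)
 have a: "R 100 < B" using assms by linarith
 show ?thesis
 proof (cases tr)
  case False
  then show ?thesis using assms a by (simp add: tracked_store_def st ad)
 next
  case True
  obtain xs where xs: "length xs = R 102" "distinct xs" "set xs \<subseteq> {..<2 ^ W}"
   "\<And>i. i < R 102 ==> M (adr ht i) = xs ! i"
   "\<And>a. a < B ==> M (adr hm a) ~= 0 \<longleftrightarrow> a \<in> set xs"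
   "\<And>a. a < B ==> M (adr hb a) ~= 0 ==> a \<in> set xs"
   using assms(13)[OF True] unfolding trail_def by blast
  have c: "R 102 < B" using trail_le[OF assms(13)[OF True]] assms(12) by linarith
  have dis: "hb ~= hm" "hb ~= ht" "hm ~= ht" using assms(9)[OF True] by auto
  have lB: "i < 2 ^ W ==> i < B" for i using assms(12) by linarith
  show ?thesis
  proof (cases "M (adr hm (R 100)) = 0")
   case False
   then have mem: "R 100 \<in> set xs" using xs(5) a by simp
   have "trail W hb hm ht (M(adr hb (R 100) := R 101)) (R 102)"
    unfolding trail_def using xs c mem dis lB a by (intro exI[of _ xs]) auto
   with False \<open>tr\<close> assms a dis show ?thesis
    by (simp add: tracked_store_def st ad)
  next
   case m0: True
   then have mem: "R 100 \<notin> set xs" using xs(5) a by blast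
   let ?M = "M(adr hb (R 100) := R 101, adr hm (R 100) := Suc 0, adr ht (R 102) := R 100)"
   have "trail W hb hm ht ?M (Suc (R 102))"
    unfolding trail_def using xs c mem dis lB a assms(10)
    by (intro exI[of _ "xs @ [R 100]"]) (auto simp: nth_append less_Suc_eq)
   with m0 \<open>tr\<close> assms a dis c B_lt_Z show ?thesis
    by (simp add: tracked_store_def st ad)
  qed
 qed
qed

text \<open>Reducing modulo \<open>2 ^ w\<close> first does no harm, because \<open>2 ^ W\<close>
  divides \<open>2 ^ w\<close>. The simulated word size is recovered as
  \<open>c * (w div (20 * cB))\<close>.\<close>

lemma comp_expr_eval:
 assumes "c <= cB" "c \<ge> 1" and W: "W = c * L" and "R1 103 = adr hb 0" "R1 106 = 2 ^ W" "hb < B" "2 ^ W < B"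
  "\<forall>r<rb. R1 (110 + r) = R r" "\<forall>r. R r < 2 ^ W" "\<forall>a<2 ^ W. M1 (adr hb a) = M a" "\<forall>a. M a < 2 ^ W"
 shows "expr_regs e <= rb ==> eval_expr w (R1, M1) (comp_expr cB c e) = eval_expr W (R, M) e
   \<and> eval_expr W (R, M) e < 2 ^ W"
proof (induction e)
 have BZw: "2 ^ W < B" "B < Z" "Z <= 2 ^ w"
  using assms(7) B_lt_Z Z_pow self_le_power[of Z 10] by (auto simp: Suc_le_eq)
 have Ww: "W <= w" using assms(1) unfolding W w_def by (intro mult_right_mono) auto
 then have dvd: "(2::nat) ^ W dvd 2 ^ w" by (rule le_imp_power_dvd)
 {
  case (Lit k)
  have "k mod 2 ^ w mod 2 ^ W mod 2 ^ w = k mod 2 ^ W"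
   using mod_less_divisor[of "2 ^ W" k] BZw by (simp add: mod_mod_cancel[OF dvd] del: mod_less_divisor)
  then show ?case using assms BZw by simp
 next
  case WordSize
  have "w < 2 ^ w" "W < 2 ^ W" by auto
  moreover have "20 * cB < 2 ^ w"
  proof -
   have "20 * cB * 1 <= w" unfolding w_def using L by (intro mult_left_mono) auto
   with \<open>w < 2 ^ w\<close> show ?thesis by linarith
  qed
  moreover have "c < 2 ^ w" using \<open>20 * cB < 2 ^ w\<close> assms(1) by linarith
  moreover have "w div (20 * cB) = L" unfolding w_def using cB by simp
  moreover have "L < 2 ^ w"
  proof -
   have "L * 1 <= L * (20 * cB)" using cB by (intro mult_left_mono) auto
   then have "L <= w" by (simp add: w_def algebra_simps)
   with \<open>w < 2 ^ w\<close> show ?thesis by linarith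
  qed
  moreover have "W < 2 ^ w" using Ww \<open>w < 2 ^ w\<close> by linarith
  ultimately show ?case by (simp add: W)
 next
  case (Reg r)
  then show ?case using assms by simp
 next
  case (Load a)
  let ?v = "eval_expr W (R, M) a"
  have v: "?v < 2 ^ W" "eval_expr w (R1, M1) (comp_expr cB c a) = ?v" using Load by auto
  have "adr hb ?v < Z" by (rule adr_lt_Z) (use v assms in auto)
  then have "(adr hb 0 + ?v) mod 2 ^ w = adr hb ?v" using BZw by (simp add: adr_def)
  then show ?case using assms v by simp
 next
  case (Bin b x y)
  let ?x = "eval_expr W (R, M) x" and ?y = "eval_expr W (R, M) y"
  have IH: "eval_expr w (R1, M1) (comp_expr cB c x) = ?x" "eval_expr w (R1, M1) (comp_expr cB c y) = ?y"
   "?x < 2 ^ W" "?y < 2 ^ W" using Bin by auto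
  have "binop_val w b ?x ?y mod 2 ^ w mod 2 ^ W = binop_val W b ?x ?y mod 2 ^ W"
  proof (cases "b = Sub")
   case True
   obtain k where k: "(2::nat) ^ w = 2 ^ W * k" using dvd by (auto simp: dvd_def)
   then have "k \<ge> 1" by (cases k) auto
   then obtain k' where k': "k = Suc k'" by (cases k) auto
   \<comment> \<open>The constants added before the two subtractions differ by a multiple of
     \<open>2 ^ W\<close>; no other operation depends on the word size.\<close>
   then have "?x + 2 ^ w - ?y = (?x + 2 ^ W - ?y) + 2 ^ W * (k - 1)"
    using IH(4) k k' by (simp add: algebra_simps)
   then show ?thesis using True by (simp add: mod_mod_cancel[OF dvd])
  next
   case False
   then have "binop_val w b ?x ?y = binop_val W b ?x ?y" by (cases b) auto
   then show ?thesis by (simp add: mod_mod_cancel[OF dvd])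
  qed
  moreover have "binop_val W b ?x ?y mod 2 ^ W < 2 ^ w"
   using mod_less_divisor[of "2 ^ W" "binop_val W b ?x ?y"] BZw by (simp del: mod_less_divisor)
  ultimately show ?case using IH assms by simp
 }
qed

text \<open>Induction on the execution. The factor 30 leaves room for \<open>Store\<close>: two
  evaluations at factor 5, two assignments, and up to 24 steps of tracking.\<close>

lemma comp_simulates:
 assumes "exec W d s t s'"
  and c: "c <= cB" "c \<ge> 1" "W = c * L" "2 ^ W < B" "hb < B" "hm < B" "ht < B" "tr ==> distinct [hb, hm, ht]"
  and "simulates tr hb hm ht W rb R0 M0 (fst s) (snd s) R1 M1" "com_regs d <= rb"
 shows "wp w (comp cB c tr d) (\<lambda>t' R2 M2. t' <= 30 * t \<and>
  simulates tr hb hm ht W rb R0 M0 (fst s') (snd s') R2 M2 \<and> (tr --> R2 102 <= R1 102 + t)) R1 M1"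
 using assms(1,10,11)
proof (induction arbitrary: R1 M1 rule: exec.induct)
 case (Skip s)
 then show ?case by simp
next
 case (Assign r e R M)
 have e: "eval_expr w (R1, M1) (comp_expr cB c e) = eval_expr W (R, M) e \<and> eval_expr W (R, M) e < 2 ^ W"
  by (rule comp_expr_eval[where rb = rb and hb = hb])
   (use Assign c in \<open>auto simp: simulates_def\<close>)
 have "2 ^ W < Z" using c(4) B_lt_Z by linarith
 then show ?case using Assign e comp_expr_cost[of cB c e] unfolding comp.simps wp_Assign_eq
  by (auto simp: simulates_def)
next
 case (Store a e R M)
 have ea: "eval_expr w (R1, M1) (comp_expr cB c a) = eval_expr W (R, M) a \<and> eval_expr W (R, M) a < 2 ^ W"
  by (rule comp_expr_eval[where rb = rb and hb = hb])
   (use Store c in \<open>auto simp: simulates_def\<close>)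
 have ee: "eval_expr w (R1(100 := v), M1) (comp_expr cB c e) = eval_expr W (R, M) e \<and> eval_expr W (R, M) e < 2 ^ W" for v
  by (rule comp_expr_eval[where rb = rb and hb = hb])
   (use Store c in \<open>auto simp: simulates_def\<close>)
 have Z: "2 ^ W < Z" using c(4) B_lt_Z by linarith
 let ?R = "R1(100 := eval_expr W (R, M) a, 101 := eval_expr W (R, M) e)"
 have "wp w (tracked_store tr) (\<lambda>t R' M'. t <= 24 \<and> bR R' \<and> bM M' \<and> (\<forall>r. r ~= 102 --> R' r = ?R r) \<and>
  (\<forall>a<B. M' (adr hb a) = (if a = ?R 100 then ?R 101 else M1 (adr hb a))) \<and>
  (\<forall>h l. l < B --> h ~= hb --> (tr --> h ~= hm \<and> h ~= ht) --> M' (adr h l) = M1 (adr h l)) \<and>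
  (tr --> trail W hb hm ht M' (R' 102)) \<and> R' 102 <= ?R 102 + 1) ?R M1"
 proof -
  have lt: "eval_expr W (R, M) a < Z" "eval_expr W (R, M) e < Z" using ea ee Z by (meson less_trans)+
  have bR: "bR ?R" using lt Store.prems by (intro bR_upd) (auto simp: simulates_def)
  show ?thesis
   by (rule tracked_store[OF bR]) (use Store.prems c ea lt in \<open>simp_all add: simulates_def\<close>)
 qed
 then have "wp w (tracked_store tr) (\<lambda>t' R' M'.
   1 + expr_cost (comp_expr cB c a) + (1 + expr_cost (comp_expr cB c e) + t') <= 30 * (1 + expr_cost a + expr_cost e) \<and>
   simulates tr hb hm ht W rb R0 M0 R (M(eval_expr W (R, M) a := eval_expr W (R, M) e)) R' M' \<and>
   (tr --> R' 102 <= R1 102 + (1 + expr_cost a + expr_cost e))) ?R M1"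
 proof (rule wp_mono, goal_cases)
  case (1 t' R' M')
  then show ?case
   using Store c(4) ee comp_expr_cost[of cB c a] comp_expr_cost[of cB c e]
   by (auto simp: simulates_def)
 qed
 then show ?case unfolding comp.simps wp_Seq wp_Assign_eq using ea ee by simp
next
 case (Seq c1 s t1 s' c2 t2 s'')
 have 1: "com_regs c1 <= rb" "com_regs c2 <= rb" using Seq.prems by auto
 show ?case unfolding comp.simps wp_Seq
  by (rule wp_mono[OF Seq.IH(1)[OF Seq.prems(1) 1(1)]], elim conjE, rule wp_mono[OF Seq.IH(2)[OF _ 1(2)]])
   auto
next
 case (IfTrue s e c1 t s' c2)
 obtain R M where s: "s = (R, M)" by fastforce
 have e: "eval_expr w (R1, M1) (comp_expr cB c e) = eval_expr W (R, M) e \<and> eval_expr W (R, M) e < 2 ^ W"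
  by (rule comp_expr_eval[where rb = rb and hb = hb])
   (use IfTrue s c in \<open>auto simp: simulates_def\<close>)
 have "wp w (comp cB c tr c1) (\<lambda>t'. \<lambda>R2 M2. t' <= 30 * t \<and>
  simulates tr hb hm ht W rb R0 M0 (fst s') (snd s') R2 M2 \<and> (tr --> R2 102 <= R1 102 + t)) R1 M1"
  by (rule IfTrue.IH) (use IfTrue.prems in auto)
 then show ?case using e s IfTrue.hyps comp_expr_cost[of cB c e]
  by (simp add: wp_If_eq) (erule wp_mono, auto)
next
 case (IfFalse s e c2 t s' c1)
 obtain R M where s: "s = (R, M)" by fastforce
 have e: "eval_expr w (R1, M1) (comp_expr cB c e) = eval_expr W (R, M) e \<and> eval_expr W (R, M) e < 2 ^ W"
  by (rule comp_expr_eval[where rb = rb and hb = hb])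
   (use IfFalse s c in \<open>auto simp: simulates_def\<close>)
 have "wp w (comp cB c tr c2) (\<lambda>t'. \<lambda>R2 M2. t' <= 30 * t \<and>
  simulates tr hb hm ht W rb R0 M0 (fst s') (snd s') R2 M2 \<and> (tr --> R2 102 <= R1 102 + t)) R1 M1"
  by (rule IfFalse.IH) (use IfFalse.prems in auto)
 then show ?case using e s IfFalse.hyps comp_expr_cost[of cB c e]
  by (simp add: wp_If_eq) (erule wp_mono, auto)
next
 case (WhileFalse s e d)
 obtain R M where s: "s = (R, M)" by fastforce
 have e: "eval_expr w (R1, M1) (comp_expr cB c e) = eval_expr W (R, M) e \<and> eval_expr W (R, M) e < 2 ^ W"
  by (rule comp_expr_eval[where rb = rb and hb = hb])
   (use WhileFalse s c in \<open>auto simp: simulates_def\<close>)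
 show ?case unfolding comp.simps
  by (subst wp_While_eq) (use e s WhileFalse comp_expr_cost[of cB c e] in auto)
next
 case (WhileTrue s e d t1 s' t2 s'')
 obtain R M where s: "s = (R, M)" by fastforce
 have e: "eval_expr w (R1, M1) (comp_expr cB c e) = eval_expr W (R, M) e \<and> eval_expr W (R, M) e < 2 ^ W"
  by (rule comp_expr_eval[where rb = rb and hb = hb])
   (use WhileTrue s c in \<open>auto simp: simulates_def\<close>)
 have 1: "com_regs d <= rb" "com_regs (While e d) <= rb" using WhileTrue.prems by auto
 have "wp w (Seq (comp cB c tr d) (comp cB c tr (While e d))) (\<lambda>t'. \<lambda>R2 M2. t' <= 30 * (t1 + t2) \<and>
  simulates tr hb hm ht W rb R0 M0 (fst s'') (snd s'') R2 M2 \<and> (tr --> R2 102 <= R1 102 + t1 + t2)) R1 M1"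
  unfolding wp_Seq
  by (rule wp_mono[OF WhileTrue.IH(1)[OF WhileTrue.prems(1) 1(1)]], elim conjE,
    rule wp_mono[OF WhileTrue.IH(2)[OF _ 1(2)]]) auto
 then show ?case using e s WhileTrue.hyps comp_expr_cost[of cB c e] unfolding comp.simps
  by (subst wp_While_eq) (simp del: wp_Seq, erule wp_mono, auto)
qed

end

text \<open>Used to charge the constant overhead of a call to its running time, and in the end to
  infer that the given operation time is at least 1.\<close>

lemma exec_pos: "exec w c s t s' ==> t \<ge> 1"
 by (induction rule: exec.induct) auto

lemma call_deterministic:
 "call w P n r M t s ==> call w P n r M u s' ==> t = u \<and> s = s'"
 by (cases r) (auto dest: exec_deterministic)

fun zero_regs :: "nat => com" where
 "zero_regs 0 = Skip"
| "zero_regs (Suc k) = Seq (zero_regs k) (Assign (110 + k) (Lit 0))"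

text \<open>At least three, because arguments occupy the registers 0 to 2 and results are read from
  0 and 1, whether or not the program mentions these registers.\<close>

definition regs_bound :: "com => nat" where
 "regs_bound d = max 3 (com_regs d)"

text \<open>Registers 3 to 6 hold \<open>n\<close>, \<open>L\<close>, \<open>U\<close> and \<open>B\<close>. A simulated program works on the region given
 by register 10, with the arguments \<open>n\<close> and those in the registers 11 and 12.\<close>

definition run_sim :: "nat => nat => bool => com => com" where
 "run_sim cB c tr d = Seq (zero_regs (regs_bound d))
  (Seq (Assign 103 (Bin Mul (Reg 10) (Reg 6)))
  (Seq (Assign 104 (Bin Mul (Lit 11) (Reg 6)))
  (Seq (Assign 105 (Bin Mul (Lit 12) (Reg 6)))
  (Seq (Assign 106 (Bin Shl (Lit 1) (Bin Mul (Lit c) (Reg 4))))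
  (Seq (Assign 110 (Reg 3)) (Seq (Assign 111 (Reg 11)) (Seq (Assign 112 (Reg 12))
  (comp cB c tr d))))))))"

text \<open>Registers from 100 on are scratch for the simulations, so their preservation is never
  claimed.\<close>

definition keep :: "nat set => (nat => nat) => (nat => nat) => bool" where
 "keep rs R R' \<longleftrightarrow> (\<forall>r<100. r \<notin> rs --> R' r = R r)"

lemma keep_refl: "keep rs R R" by (simp add: keep_def)

locale progs =
 fixes cB cP cX cY :: nat and P :: implementation and X Y :: com
begin

text \<open>A single overhead factor for all five simulated programs. It covers clearing their
  registers and the translation; the slack in the constant 200 pays for register moves around a
  call.\<close>

definition gam :: nat where
 "gam = 2 * (regs_bound (insert_prog P) + regs_bound (delete_prog P) + regs_bound (query_prog P)
  + regs_bound X + regs_bound Y) + 200"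

definition pIns :: com where "pIns = run_sim cB cP False (insert_prog P)"
text \<open>\<open>Delete\<close> passes only two arguments besides the missing third one, whose
  register therefore has to be cleared.\<close>

definition pDel :: com where "pDel = Seq (Assign 12 (Lit 0)) (run_sim cB cP False (delete_prog P))"
definition pQry :: com where "pQry = Seq (run_sim cB cP False (query_prog P)) (Assign 13 (Reg 110))"

end

context words
begin

text \<open>The restriction \<open>l < B\<close> makes the region number meaningful: a larger offset
  would name a cell of a later region.\<close>

definition same :: "nat set => mem => mem => bool" where
 "same H M M' \<longleftrightarrow> (\<forall>h l. l < B --> h \<notin> H --> M' (adr h l) = M (adr h l))"

lemma same_refl [simp]: "same H M M" by (simp add: same_def)
lemma sameD: "same H M M' ==> l < B ==> h \<notin> H ==> M' (adr h l) = M (adr h l)" by (simp add: same_def)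
lemma same_trans: "same H M M' ==> same H' M' M'' ==> H \<union> H' \<subseteq> H'' ==> same H'' M M''"
 by (force simp: same_def)
lemma same_upd: "l < B ==> h \<in> H ==> same H M M' ==> same H M (M'(adr h l := v))"
 by (auto simp: same_def)

lemma zero_regs:
 assumes "bR R" "bM M"
 shows "wp w (zero_regs k) (\<lambda>t R' M'. t = 1 + 2 * k \<and> M' = M \<and> bR R' \<and>
  (\<forall>r. R' r = (if 110 <= r \<and> r < 110 + k then 0 else R r))) R M"
 using assms
proof (induction k)
 case (Suc k)
 show ?case unfolding zero_regs.simps wp_Seq
  by (rule wp_mono[OF Suc.IH]) (use Suc.prems in auto)
qed simp

text \<open>A run takes at least one step, so the set-up time, which is linear in the number of
  registers, is absorbed into the factor of \<open>t\<close>.\<close>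

lemma run_sim:
 assumes "exec W d (args [n, x, y], Ma) t (Ra, Ma')" "W = c * L" "c < cB" "c \<ge> 1"
  and R: "bR R" "bM M" "R 3 = n" "R 4 = L" "R 6 = B" "R 10 = h" "R 11 = x" "R 12 = y"
  and h: "h < B" "h ~= 11" "h ~= 12"
  and small: "n < 2 ^ W" "x < 2 ^ W" "y < 2 ^ W" "\<forall>a. Ma a < 2 ^ W"
  and M: "\<forall>a<2 ^ W. M (adr h a) = Ma a"
  and tr: "tr ==> trail W h 11 12 M (R 102)"
 shows "wp w (run_sim cB c tr d) (\<lambda>t' R' M'. t' <= (2 * regs_bound d + 80) * t \<and> bR R' \<and> bM M' \<and>
  keep {} R R' \<and> (\<forall>a. Ma' a < 2 ^ W) \<and> (\<forall>a<2 ^ W. M' (adr h a) = Ma' a) \<and>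
  R' 110 = Ra 0 \<and> R' 111 = Ra 1 \<and> Ra 0 < 2 ^ W \<and> Ra 1 < 2 ^ W \<and>
  same (if tr then {h, 11, 12} else {h}) M M' \<and>
  (tr --> trail W h 11 12 M' (R' 102) \<and> R' 102 <= R 102 + t)) R M"
 unfolding run_sim_def wp_Seq
proof (rule wp_mono[OF zero_regs[OF R(1,2)]], goal_cases)
 case (1 t0 R0 M0)
 then have 0: "t0 = 1 + 2 * regs_bound d" "M0 = M" "bR R0"
  "\<forall>r. R0 r = (if 110 <= r \<and> r < 110 + regs_bound d then 0 else R r)"
  by blast+
 have WB: "2 ^ W < B" unfolding B_def assms(2) using assms(3) L by (intro power_strict_increasing) auto
 have "c * L < Z" "c < Z"
 proof -
  have "c * L <= w" using assms(3) unfolding w_def by (intro mult_right_mono) auto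
  then show "c * L < Z" using w_lt_Z by linarith
  moreover have "c * 1 <= c * L" using L by (intro mult_left_mono) auto
  ultimately show "c < Z" by linarith
 qed
 moreover have WZ: "2 ^ W < Z" using WB B_lt_Z by linarith
 moreover have "h * B < Z" "11 * B < Z" "12 * B < Z"
  using adr_lt_Z[of h 0] adr_lt_Z[of 11 0] adr_lt_Z[of 12 0] h(1) B_big by (auto simp: adr_def)
 moreover have "3 <= regs_bound d" by (simp add: regs_bound_def)
 ultimately have vals: "c * L < Z" "c < Z" "2 ^ W < Z" "h * B < Z" "11 * B < Z" "12 * B < Z" "3 <= regs_bound d"
  by auto
 let ?R = "R0(103 := h * B, 104 := 11 * B, 105 := 12 * B, 106 := 2 ^ W, 110 := n, 111 := x, 112 := y)"
 have xyz: "n < Z" "x < Z" "y < Z" using small(1-3) WZ by linarith+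
 have bR': "bR ?R" using 0(3) vals xyz by (auto simp del: One_nat_def)
 have sim: "simulates tr h 11 12 W (regs_bound d) R M (args [n, x, y]) Ma ?R M"
  unfolding simulates_def
 proof (intro conjI allI impI)
  fix r show "args [n, x, y] r < 2 ^ W" using small by (auto simp: args_def nth_Cons split: nat.split)
  assume r: "r < regs_bound d"
  show "?R (110 + r) = args [n, x, y] r"
   using r 0(4) by (auto simp: args_def nth_Cons split: nat.split)
 next
  fix r :: nat assume "r < 100"
  then show "?R r = R r" using 0(4) by auto
 next
  assume tr
  show "trail W h 11 12 M (?R 102)" using tr[OF \<open>tr\<close>] 0(4) by simp
 qed (use bR' R M small in \<open>auto simp: adr_def\<close>)
 then have sim': "simulates tr h 11 12 W (regs_bound d) R M (fst (args [n, x, y], Ma)) (snd (args [n, x, y], Ma)) ?R M"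
  by simp
 have "wp w (comp cB c tr d) (\<lambda>t' R2 M2. t' <= 30 * t \<and>
  simulates tr h 11 12 W (regs_bound d) R M (fst (Ra, Ma')) (snd (Ra, Ma')) R2 M2 \<and> (tr --> R2 102 <= ?R 102 + t)) ?R M"
  by (rule comp_simulates[OF assms(1) _ _ _ _ _ _ _ _ sim'])
   (use assms(2,3,4) h WB B_big in \<open>auto simp: regs_bound_def\<close>)
 then have main: "wp w (comp cB c tr d) (\<lambda>t' R' M'. t0 + (4 + (4 + (4 + (6 + (2 + (2 + (2 + t')))))))
    <= (2 * regs_bound d + 80) * t \<and> bR R' \<and> bM M' \<and>
  keep {} R R' \<and> (\<forall>a. Ma' a < 2 ^ W) \<and> (\<forall>a<2 ^ W. M' (adr h a) = Ma' a) \<and>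
  R' 110 = Ra 0 \<and> R' 111 = Ra 1 \<and> Ra 0 < 2 ^ W \<and> Ra 1 < 2 ^ W \<and>
  same (if tr then {h, 11, 12} else {h}) M M' \<and>
  (tr --> trail W h 11 12 M' (R' 102) \<and> R' 102 <= R 102 + t)) ?R M"
 proof (rule wp_mono, elim conjE)
  fix t' R2 M2
  assume t': "t' <= 30 * t" and s: "simulates tr h 11 12 W (regs_bound d) R M (fst (Ra, Ma')) (snd (Ra, Ma')) R2 M2"
   and t102: "tr --> R2 102 <= ?R 102 + t"
  have r: "R2 (110 + r) = Ra r" if "r < 3" for r
   using s that vals(7) by (auto simp: simulates_def)
  have r01: "R2 110 = Ra 0" "R2 111 = Ra 1" using r[of 0] r[of 1] by auto
  have "t \<ge> 1" using exec_pos[OF assms(1)] .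
  then have "2 * regs_bound d + 50 <= (2 * regs_bound d + 50) * t" by simp
  then have "t0 + (4 + (4 + (4 + (6 + (2 + (2 + (2 + t'))))))) <= (2 * regs_bound d + 80) * t"
   using 0(1) t' by (simp add: algebra_simps)
  with s t102 r01 0(4) show "t0 + (4 + (4 + (4 + (6 + (2 + (2 + (2 + t'))))))) <= (2 * regs_bound d + 80) * t \<and> bR R2 \<and> bM M2 \<and>
   keep {} R R2 \<and> (\<forall>a. Ma' a < 2 ^ W) \<and> (\<forall>a<2 ^ W. M2 (adr h a) = Ma' a) \<and>
   R2 110 = Ra 0 \<and> R2 111 = Ra 1 \<and> Ra 0 < 2 ^ W \<and> Ra 1 < 2 ^ W \<and>
   same (if tr then {h, 11, 12} else {h}) M M2 \<and>
   (tr --> trail W h 11 12 M2 (R2 102) \<and> R2 102 <= R 102 + t)"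
   by (simp add: simulates_def keep_def same_def)
 qed
 have "R0 10 = h" "R0 6 = B" "R0 4 = L" "R0 3 = n" "R0 11 = x" "R0 12 = y" using 0(4) R by auto
 then show ?case
  using 0(2,3) R(2) vals xyz
  by (simp add: push_bit_nat_def assms(2)[symmetric] split del: if_split)
   (rule wp_mono[OF main], simp split del: if_split)
qed

end

text \<open>One pair \<open>n\<close>, \<open>m\<close> is fixed, and time is counted by a natural
  number \<open>T\<close>; the constant \<open>K\<close>, common to extraction and construction,
  absorbs the rounding. The strict inequalities with \<open>cB\<close> make each simulated memory
  fit into a region.\<close>

locale machine = words cB L + progs cB cP cX cY P X Y
 for cB L cP cX cY :: nat and P :: implementation and X Y :: com +
 fixes D :: problem and n m T K :: nat
 assumes L_def: "L = floorlog 2 (max n m)"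
  and n: "n \<ge> 1" and m: "m \<ge> 2" and T: "T \<ge> 1"
  and wd: "width D \<ge> 1" "width D <= cP" "width D <= cX" "width D <= cY"
  and cs: "cP < cB" "cX < cB" "cY < cB" and K: "K < cB"
  and D: "\<And>S. S \<in> states D n m ==> length S <= width D * n \<and> set S \<subseteq> operands D n m \<and>
    (\<forall>q\<in>legal_queries D n m. answer D n q S \<in> operands D n m)"
  and P_ok: "\<And>rs. legal_requests D Partially n m [] rs ==>
    \<exists>ts. serves D P (cP * L) n [] blank rs ts \<and> (\<forall>t\<in>set ts. t <= T)"
  and X_ok: "\<And>S. S \<in> states D n m ==> \<exists>qs t.
    extraction (cX * L) n X (\<lambda>q. answer D n q S) blank 0 qs t S \<and>
    set qs \<subseteq> legal_queries D n m \<and> length qs <= K * n \<and> t <= K * n * T"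
  and Y_ok: "\<And>S. S \<in> states D n m ==> \<exists>t R M us.
    exec (cY * L) Y (args [n, length S], args S) t (R, M) \<and>
    us = map M [0..<R 0] \<and> set us \<subseteq> legal_updates D n m \<and> result_state D n us = S \<and>
    length us <= K * n \<and> t <= K * n * T"
begin

section \<open>Copies of the given structure, each in one region\<close>

abbreviation "WP \<equiv> cP * L"

lemma nm_U: "n < U" "m < U"
proof -
 have "max n m < 2 ^ floorlog 2 (max n m)" by (rule floorlog_bounds[of "max n m" 2, THEN conjunct2]) (use n in auto)
 then show "n < U" "m < U" by (auto simp: U_def simp flip: L_def)
qed

lemma two_pow: "c \<ge> 1 ==> U <= 2 ^ (c * L)"
 unfolding U_def by (intro power_increasing) auto

lemma operand_lt: "x \<in> operands D n m ==> width D <= c ==> x < 2 ^ (c * L)"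
proof -
 assume x: "x \<in> operands D n m" and c: "width D <= c"
 have "(2::nat) ^ (width D * L) <= 2 ^ (c * L)" using c by (intro power_increasing mult_right_mono) auto
 moreover have "x < 2 ^ (width D * L)" using x by (simp add: operands_def word_size_def flip: L_def)
 ultimately show ?thesis by linarith
qed

lemma pow_lt_B: "c < cB ==> 2 ^ (c * L) < B"
 unfolding B_def using L by (intro power_strict_increasing) auto

lemma operand_lt_Z: "x \<in> operands D n m ==> x < Z"
 using operand_lt[of x cP] pow_lt_B[of cP] wd cs B_lt_Z by fastforce

text \<open>The representation chosen by the given structure is unknown, so a memory is said to
  represent \<open>us\<close> on account of its future behaviour alone.\<close>

definition good :: "nat list => mem => bool" where
 "good us Ma \<longleftrightarrow> (\<forall>rs. legal_requests D Partially n m us rs -->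
   (\<exists>ts. serves D P WP n us Ma rs ts \<and> (\<forall>t\<in>set ts. t <= T)))"

lemma good_blank: "good [] blank"
 unfolding good_def using P_ok by blast

text \<open>The hypothesis speaks about each sequence of requests separately. Determinism makes the
  memory reached after \<open>r\<close> the same in all of them, so this memory is good in
  turn.\<close>

lemma good_step:
 assumes "good us Ma" "legal_request D Partially n m us r"
 shows "\<exists>t R Ma'. call WP P n r Ma t (R, Ma') \<and> correct_reply D n us r R \<and> t <= T \<and>
  good (apply_request r us) Ma'"
proof -
 from assms have "legal_requests D Partially n m us [r]" by simp
 with assms(1) obtain ts where "serves D P WP n us Ma [r] ts" "\<forall>t\<in>set ts. t <= T"
  unfolding good_def by blast
 then obtain t R Ma' where *: "call WP P n r Ma t (R, Ma')" "correct_reply D n us r R" "t <= T"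
  by auto
 have "good (apply_request r us) Ma'" unfolding good_def
 proof (intro allI impI)
  fix rs assume "legal_requests D Partially n m (apply_request r us) rs"
  with assms have "legal_requests D Partially n m us (r # rs)" by simp
  with assms(1) obtain ts where ts: "serves D P WP n us Ma (r # rs) ts" "\<forall>t\<in>set ts. t <= T"
   unfolding good_def by blast
  then obtain t' ts' R'' Ma'' where "ts = t' # ts'" "call WP P n r Ma t' (R'', Ma'')"
   "serves D P WP n (apply_request r us) Ma'' rs ts'" by auto
  moreover from this have "Ma'' = Ma'" using call_deterministic[OF *(1)] by blast
  ultimately show "\<exists>ts. serves D P WP n (apply_request r us) Ma' rs ts \<and> (\<forall>t\<in>set ts. t <= T)"
   using ts(2) by auto
 qed
 with * show ?thesis by blast
qed

text \<open>Only cells below \<open>2 ^ WP\<close> are compared: words of the simulated program are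
  too short to address any other cell.\<close>

definition inst :: "mem => nat => nat list => bool" where
 "inst M h us \<longleftrightarrow> (\<exists>Ma. good us Ma \<and> (\<forall>a. Ma a < 2 ^ WP) \<and> (\<forall>a<2 ^ WP. M (adr h a) = Ma a))"

lemma inst_cong: "(\<And>a. a < B ==> M' (adr h a) = M (adr h a)) ==> inst M' h us \<longleftrightarrow> inst M h us"
proof -
 assume *: "\<And>a. a < B ==> M' (adr h a) = M (adr h a)"
 have "M' (adr h a) = M (adr h a)" if "a < 2 ^ WP" for a
  using that pow_lt_B[OF cs(1)] by (intro *) linarith
 then show ?thesis unfolding inst_def by auto
qed

lemma inst_same: "same H M M' ==> h \<notin> H ==> inst M h us ==> inst M' h us"
 using inst_cong[of M' h M us] by (auto simp: same_def)

lemma inst_upd [simp]: "l < B ==> h ~= h' ==> inst (M(adr h l := v)) h' us \<longleftrightarrow> inst M h' us"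
 by (rule inst_cong) simp

text \<open>Zeroed regions are copies for the empty timeline; hence copies need no
  initialisation.\<close>

lemma inst_blank: "inst blank h []"
 unfolding inst_def using good_blank by (intro exI[of _ blank]) (auto simp: blank_def)

definition std :: "(nat => nat) => bool" where
 "std R \<longleftrightarrow> R 3 = n \<and> R 4 = L \<and> R 5 = U \<and> R 6 = B"

lemma stdD [simp]: "std R ==> R 3 = n" "std R ==> R 4 = L" "std R ==> R 5 = U" "std R ==> R 6 = B"
 by (auto simp: std_def)

lemma std_upd [simp]: "r > 6 ==> std (R(r := v)) = std R"
 unfolding std_def by simp

lemma std_keep: "keep rs R R' ==> rs \<inter> {3,4,5,6} = {} ==> std R ==> std R'"
 unfolding std_def keep_def by simp

abbreviation legal :: "nat => bool" where "legal u \<equiv> u \<in> legal_updates D n m"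

lemma legal_lt: "legal u ==> u < 2 ^ WP" "legal u ==> u < Z"
 using operand_lt[of u cP] operand_lt_Z[of u] wd by (auto simp: legal_updates_def)

text \<open>The 20 spare steps are for the register moves that \<open>pDel\<close> and
  \<open>pQry\<close> add to the simulation.\<close>

lemma sim_request:
 assumes "bR R" "bM M" "std R" "R 10 = h" "h < B" "h ~= 11" "h ~= 12"
  and inst: "inst M h us" and r: "legal_request D Partially n m us r"
  and c: "call WP P n r = (\<lambda>M. exec WP d (args [n, R 11, R 12], M))" and xy: "R 11 < 2 ^ WP" "R 12 < 2 ^ WP"
  and d: "d \<in> {insert_prog P, delete_prog P, query_prog P}"
 shows "wp w (run_sim cB cP False d) (\<lambda>t R' M'. t + 20 <= gam * T \<and> bR R' \<and> bM M' \<and> keep {} R R' \<and>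
  inst M' h (apply_request r us) \<and> same {h} M M' \<and> (\<exists>Ra. correct_reply D n us r Ra \<and> R' 110 = Ra 0)) R M"
proof -
 from inst obtain Ma where Ma: "good us Ma" "\<forall>a. Ma a < 2 ^ WP" "\<forall>a<2 ^ WP. M (adr h a) = Ma a"
  unfolding inst_def by blast
 from good_step[OF Ma(1) r] obtain t Ra Ma' where
  t: "call WP P n r Ma t (Ra, Ma')" "correct_reply D n us r Ra" "t <= T" "good (apply_request r us) Ma'"
  by blast
 have "n < 2 ^ WP" using nm_U two_pow[of cP] wd by linarith
 have "(2 * regs_bound d + 80) * t + 20 <= gam * T"
 proof -
  have "(2 * regs_bound d + 80) * t <= (2 * regs_bound d + 80) * T" using t(3) by (rule mult_left_mono) simp
  moreover have "20 <= 20 * T" using T by simp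
  moreover have "(2 * regs_bound d + 80) * T + 20 * T <= gam * T"
   unfolding gam_def add_mult_distrib[symmetric] using d by (intro mult_right_mono) auto
  ultimately show ?thesis by linarith
 qed
 note time = this
 have ex: "exec WP d (args [n, R 11, R 12], Ma) t (Ra, Ma')" using t(1) c by simp
 have *: "wp w (run_sim cB cP False d) (\<lambda>t' R' M'. t' <= (2 * regs_bound d + 80) * t \<and> bR R' \<and> bM M' \<and>
  keep {} R R' \<and> (\<forall>a. Ma' a < 2 ^ WP) \<and> (\<forall>a<2 ^ WP. M' (adr h a) = Ma' a) \<and>
  R' 110 = Ra 0 \<and> R' 111 = Ra 1 \<and> Ra 0 < 2 ^ WP \<and> Ra 1 < 2 ^ WP \<and>
  same (if False then {h, 11, 12} else {h}) M M' \<and>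
  (False --> trail WP h 11 12 M' (R' 102) \<and> R' 102 <= R 102 + t)) R M"
  by (rule run_sim[OF ex refl cs(1)]) (use assms(1-7) xy Ma \<open>n < 2 ^ WP\<close> wd in simp_all)
 show ?thesis
 proof (rule wp_mono[OF *], elim conjE, intro conjI)
  fix t' R' M'
  assume a: "t' <= (2 * regs_bound d + 80) * t" "\<forall>a. Ma' a < 2 ^ WP" "\<forall>a<2 ^ WP. M' (adr h a) = Ma' a"
   "R' 110 = Ra 0" "same (if False then {h, 11, 12} else {h}) M M'"
  show "t' + 20 <= gam * T" using a(1) time by linarith
  show "inst M' h (apply_request r us)" unfolding inst_def using a t(4) by blast
  show "same {h} M M'" using a by simp
  show "\<exists>Ra. correct_reply D n us r Ra \<and> R' 110 = Ra 0" using a t(2) by blast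
 qed
qed

lemma pIns:
 assumes "bR R" "bM M" "std R" "R 10 = h" "h < B" "h ~= 11" "h ~= 12"
  and "inst M h us" "R 11 = i" "R 12 = u" "i <= length us" "length us < m" "legal u"
 shows "wp w pIns (\<lambda>t R' M'. t <= gam * T \<and> bR R' \<and> bM M' \<and> keep {12, 13} R R' \<and> std R' \<and>
  inst M' h (take i us @ u # drop i us) \<and> same {h} M M') R M"
proof -
 have "i < 2 ^ WP" using assms nm_U two_pow[of cP] wd by linarith
 then show ?thesis unfolding pIns_def
  by (intro wp_mono[OF sim_request[where r = "Insert i u" and us = us and h = h]])
   (use assms legal_lt std_keep[of "{}" R] in \<open>simp_all add: keep_def fun_eq_iff\<close>)
qed

lemma pDel:
 assumes "bR R" "bM M" "std R" "R 10 = h" "h < B" "h ~= 11" "h ~= 12"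
  and "inst M h us" "R 11 = i" "i < length us" "length us <= m"
 shows "wp w pDel (\<lambda>t R' M'. t <= gam * T \<and> bR R' \<and> bM M' \<and> keep {12, 13} R R' \<and> std R' \<and>
  inst M' h (take i us @ drop (Suc i) us) \<and> same {h} M M') R M"
proof -
 have "i < 2 ^ WP" using assms nm_U two_pow[of cP] wd by linarith
 moreover have "args [n, i] = args [n, i, 0]"
  by (auto simp: args_def nth_Cons fun_eq_iff split: nat.split)
 then have "call WP P n (Delete i) = (\<lambda>M. exec WP (delete_prog P) (args [n, i, 0], M))"
  by (intro ext) (simp only: call.simps)
 ultimately have "wp w (run_sim cB cP False (delete_prog P)) (\<lambda>t R' M'. t + 20 <= gam * T \<and> bR R' \<and> bM M' \<and>
   keep {} (R(12 := 0)) R' \<and>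
  inst M' h (apply_request (Delete i) us) \<and> same {h} M M' \<and>
  (\<exists>Ra. correct_reply D n us (Delete i) Ra \<and> R' 110 = Ra 0)) (R(12 := 0)) M"
  by (intro sim_request) (use assms in simp_all)
 then have "wp w (run_sim cB cP False (delete_prog P)) (\<lambda>t R' M'. 2 + t <= gam * T \<and> bR R' \<and> bM M' \<and> keep {12, 13} R R' \<and> std R' \<and>
  inst M' h (take i us @ drop (Suc i) us) \<and> same {h} M M') (R(12 := 0)) M"
  by (rule wp_mono) (use assms std_keep[of "{}" "R(12 := 0)"] in \<open>simp_all add: keep_def\<close>)
 then show ?thesis unfolding pDel_def using assms by simp
qed

lemma pQry:
 assumes "bR R" "bM M" "std R" "R 10 = h" "h < B" "h ~= 11" "h ~= 12"
  and "inst M h us" "R 11 = length us" "R 12 = q" "length us <= m" "q \<in> legal_queries D n m"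
 shows "wp w pQry (\<lambda>t R' M'. t <= gam * T \<and> bR R' \<and> bM M' \<and> keep {12, 13} R R' \<and> std R' \<and>
  inst M' h us \<and> same {h} M M' \<and> R' 13 = answer D n q (result_state D n us)) R M"
proof -
 have "length us < 2 ^ WP" "q < 2 ^ WP"
  using assms nm_U two_pow[of cP] wd operand_lt[of q cP] by (auto simp: legal_queries_def)
 then show ?thesis unfolding pQry_def wp_Seq
  by (intro wp_mono[OF sim_request[where r = "Query (length us) q" and us = us and h = h]])
   (use assms std_keep[of "{}" R] in \<open>auto simp: keep_def\<close>)
qed

end

section \<open>Copying, blanking and preloading the work regions\<close>

definition copy :: "nat => nat => nat => com" where
 "copy src dst lm = Seq (Assign 11 (Lit 0)) (For 11 lm (St (Lit dst) (Reg 11) (Ld (Lit src) (Reg 11))))"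

definition cleanup_body :: com where
 "cleanup_body = Seq (Assign 17 (Bin Sub (Reg 17) (Lit 1)))
  (Seq (Assign 11 (Ld (Lit 12) (Reg 17)))
  (Seq (St (Lit 10) (Reg 11) (Lit 0)) (St (Lit 11) (Reg 11) (Lit 0))))"

definition cleanup :: com where
 "cleanup = While (Reg 17) cleanup_body"

text \<open>The input of the construction program is written by tracked stores too, since its cells
  have to be blanked afterwards even where the program leaves them alone.\<close>

definition preload :: com where
 "preload = Seq (Assign 103 (Bin Mul (Lit 10) (Reg 6))) (Seq (Assign 104 (Bin Mul (Lit 11) (Reg 6)))
  (Seq (Assign 105 (Bin Mul (Lit 12) (Reg 6))) (Seq (Assign 102 (Lit 0)) (Seq (Assign 11 (Lit 0))
  (For 11 19 (Seq (Assign 100 (Reg 11)) (Seq (Assign 101 (Ld (Lit 9) (Reg 11))) (tracked_store True))))))))"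

context progs
begin

text \<open>Inserting at the positions 0, 1, 2, ... puts the list in region 8 in front of the
  timeline in its own order; \<open>delUS\<close> reverts this by deleting at position 0
  throughout.\<close>

definition insUS :: com where
 "insUS = Seq (Assign 20 (Lit 0))
  (For 20 16 (Seq (Assign 11 (Reg 20)) (Seq (Assign 12 (Ld (Lit 8) (Reg 20))) pIns)))"

definition delUS :: "nat => com" where
 "delUS lm = Seq (Assign 20 (Lit 0)) (For 20 lm (Seq (Assign 11 (Lit 0)) pDel))"

text \<open>Register 13 carries the last answer and register 17 the length of the trail from call to
  call; 18 and 19 receive the two results of \<open>X\<close>.\<close>

definition extract_call :: com where
 "extract_call = Seq (Assign 10 (Lit 10)) (Seq (Assign 11 (Reg 13)) (Seq (Assign 12 (Lit 0))
  (Seq (Assign 102 (Reg 17)) (Seq (run_sim cB cX True X)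
  (Seq (Assign 17 (Reg 102)) (Seq (Assign 18 (Reg 110)) (Assign 19 (Reg 111))))))))"

definition extract_step :: com where
 "extract_step = Seq extract_call
  (If (Reg 18) (Seq (Assign 10 (Reg 14)) (Seq (Assign 11 (Reg 15)) (Seq (Assign 12 (Reg 19)) pQry))) Skip)"

definition extract_prog :: com where
 "extract_prog = Seq (Assign 13 (Lit 0)) (Seq (Assign 17 (Lit 0)) (Seq (Assign 18 (Lit 1))
  (While (Reg 18) extract_step)))"

definition construct :: com where
 "construct = Seq (Assign 10 (Lit 10)) (Seq (Assign 11 (Reg 19)) (Seq (Assign 12 (Lit 0))
  (Seq (run_sim cB cY True Y) (Seq (Assign 17 (Reg 102)) (Assign 16 (Reg 110))))))"

text \<open>The extracted state is saved in region 9 and the constructed updates in region 8,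
  because the work memory in region 10 is blanked after each of the two programs.\<close>

definition transfer :: com where
 "transfer = Seq extract_prog (Seq (copy 10 9 19) (Seq cleanup (Seq preload (Seq construct
  (Seq (copy 10 8 16) cleanup)))))"

text \<open>Register 22 remembers the number of prepended updates, as \<open>transfer\<close>
  overwrites register 16 with the length of the new list.\<close>

definition process :: com where
 "process = Seq (Assign 10 (Reg 14)) (Seq insUS (Seq (Assign 15 (Bin Add (Reg 21) (Reg 16)))
  (Seq (Assign 22 (Reg 16)) (Seq transfer (Seq (Assign 10 (Reg 14)) (delUS 22))))))"

end

context words
begin

text \<open>Stale entries in region 12 are harmless, because they lie beyond the end of an empty
  trail.\<close>

definition clean :: "mem => bool" where
 "clean M \<longleftrightarrow> (\<forall>l<B. M (adr 10 l) = 0 \<and> M (adr 11 l) = 0)"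

lemma clean_same: "same H M M' ==> 10 \<notin> H ==> 11 \<notin> H ==> clean M ==> clean M'"
 by (simp add: clean_def same_def)

lemma clean_upd [simp]: "l < B ==> h ~= 10 ==> h ~= 11 ==> clean (M(adr h l := v)) = clean M"
 by (simp add: clean_def)

lemma trail_empty: "clean M ==> trail W 10 11 12 M 0"
 unfolding trail_def clean_def by (intro exI[of _ "[]"]) auto

lemma trail_cong:
 "same H M M' ==> {10, 11, 12} \<inter> H = {} ==> 2 ^ W < B ==> trail W 10 11 12 M k ==> trail W 10 11 12 M' k"
proof -
 assume s: "same H M M'" "{10, 11, 12} \<inter> H = {}" "2 ^ W < B" and t: "trail W 10 11 12 M k"
 have "M' (adr 12 i) = M (adr 12 i)" if "i < k" for i
  using s that trail_le[OF t] by (intro sameD[OF s(1)]) auto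
 moreover have "M' (adr 10 l) = M (adr 10 l)" "M' (adr 11 l) = M (adr 11 l)" if "l < B" for l
  using s that by (auto simp: same_def)
 ultimately show ?thesis using t unfolding trail_def by auto
qed

lemma wp_While_step:
 "bR R ==> bM M ==> ok R M e ==> leaves e <= 10 ==> wp w (While e c) Q R M \<longleftrightarrow>
  (if ev R M e ~= 0 then wp w (Seq c (While e c)) (\<lambda>t. Q (1 + expr_cost e + t)) R M
   else Q (1 + expr_cost e) R M)"
 by (subst wp_While_eq) (simp add: eval_ev)

lemma copy:
 assumes "bR R" "bM M" "R 6 = B" "R lm < B" "lm ~= 11" "src ~= dst" "src < 1000" "dst < 1000"
 shows "wp w (copy src dst lm) (\<lambda>t R' M'. t <= 10 + 30 * R lm \<and> bR R' \<and> bM M' \<and> (\<forall>r. r ~= 11 --> R' r = R r) \<and>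
  same {dst} M M' \<and> (\<forall>k<R lm. M' (adr dst k) = M (adr src k))) R M"
proof -
 have Z: "R lm < Z" "src < Z" "dst < Z" using assms B_lt_Z B_big by linarith+
 have "wp w (For 11 lm (St (Lit dst) (Reg 11) (Ld (Lit src) (Reg 11))))
  (\<lambda>t R' M'. Suc (Suc t) <= 10 + 30 * R lm \<and> bR R' \<and> bM M' \<and> (\<forall>r. r ~= 11 --> R' r = R r) \<and>
  same {dst} M M' \<and> (\<forall>k<R lm. M' (adr dst k) = M (adr src k))) (R(11 := 0)) M"
 proof (rule wp_For[where a = 0 and z = "R lm" and b = 20 and I = "\<lambda>i R' M'. (\<forall>r. r ~= 11 --> R' r = R r) \<and>
  same {dst} M M' \<and> (\<forall>k<i. M' (adr dst k) = M (adr src k))"])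
  fix i R' M'
  assume i: "i < R lm" and I: "(\<forall>r. r ~= 11 --> R' r = R r) \<and> same {dst} M M' \<and> (\<forall>k<i. M' (adr dst k) = M (adr src k))"
   and R': "R' 11 = i" "bR R'" "bM M'" "R' lm = R lm"
  have "i < B" "R' 6 = B" using i assms I by auto
  moreover have "M' (adr src i) = M (adr src i)" using I \<open>i < B\<close> assms by (auto simp: same_def)
  ultimately show "wp w (St (Lit dst) (Reg 11) (Ld (Lit src) (Reg 11)))
   (\<lambda>t R'' M''. t <= 20 \<and> R'' 11 = i \<and> R'' lm = R lm \<and> bR R'' \<and> bM M'' \<and>
    (\<forall>r. r ~= 11 --> (R''(11 := Suc i)) r = R r) \<and> same {dst} M M'' \<and>
    (\<forall>k<Suc i. M'' (adr dst k) = M (adr src k))) R' M'"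
   using R' I i assms Z by (auto simp: same_upd less_Suc_eq)
 qed (use assms Z in auto)
 then show ?thesis unfolding copy_def using assms by simp
qed

lemma wp_cleanup_step:
 "bR R ==> bM M ==> wp w cleanup Q R M \<longleftrightarrow>
  (if R 17 ~= 0 then wp w cleanup_body (\<lambda>t. wp w cleanup (\<lambda>t'. Q (2 + (t + t')))) R M else Q 2 R M)"
 unfolding cleanup_def by (subst wp_While_step) (auto simp: numeral_eq_Suc)

text \<open>Popping the last entry leaves a valid trail: the entry occurs nowhere else in it, and
  its cell and its mark have both become zero.\<close>

lemma cleanup:
 assumes "bR R" "bM M" "R 6 = B" "trail W 10 11 12 M (R 17)" "2 ^ W < B"
 shows "wp w cleanup (\<lambda>t R' M'. t <= 2 + 50 * R 17 \<and> bR R' \<and> bM M' \<and> (\<forall>r. r \<notin> {11, 17} --> R' r = R r) \<and>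
  same {10, 11} M M' \<and> clean M') R M"
 using assms
proof (induction "R 17" arbitrary: R M)
 case 0
 then have "clean M" unfolding trail_def clean_def by auto
 with 0 show ?case by (subst wp_cleanup_step) auto
next
 case (Suc k)
 obtain xs where xs: "length xs = Suc k" "distinct xs" "set xs \<subseteq> {..<2 ^ W}"
  "\<And>i. i < Suc k ==> M (adr 12 i) = xs ! i"
  "\<And>a. a < B ==> M (adr 11 a) ~= 0 \<longleftrightarrow> a \<in> set xs"
  "\<And>a. a < B ==> M (adr 10 a) ~= 0 ==> a \<in> set xs"
  using Suc.prems(4) Suc.hyps(2) unfolding trail_def by metis
 from xs(1) obtain ys x where ys: "xs = ys @ [x]" "length ys = k"
  by (metis length_append_singleton length_Suc_conv_rev)
 have x: "x < B" "M (adr 12 k) = x" using xs ys Suc.prems(5) by (auto simp: nth_append)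
 have kB: "k < B" using trail_le[OF Suc.prems(4)] Suc.hyps(2) Suc.prems(5) by linarith
 have kZ: "k < Z" "x < Z" using kB x B_lt_Z by linarith+
 let ?R = "R(17 := k, 11 := x)" and ?M = "M(adr 10 x := 0, adr 11 x := 0)"
 have yB: "y < B" if "y \<in> set ys" for y using xs(3) ys that Suc.prems(5) by (auto intro: less_trans)
 have tr: "trail W 10 11 12 ?M k" unfolding trail_def
 proof (intro exI[of _ ys] conjI allI impI)
  fix i assume "i < k"
  then show "?M (adr 12 i) = ys ! i" using xs(4)[of i] ys kB x by (simp add: nth_append)
 qed (use xs ys x kB in \<open>auto split: if_splits\<close>)
 have "wp w cleanup (\<lambda>t R' M'. t <= 2 + 50 * ?R 17 \<and> bR R' \<and> bM M' \<and> (\<forall>r. r \<notin> {11, 17} --> R' r = ?R r) \<and>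
  same {10, 11} ?M M' \<and> clean M') ?R ?M"
  by (rule Suc.hyps(1)[of ?R ?M]) (use Suc.prems tr kZ in auto)
 then have main: "wp w cleanup (\<lambda>t R' M'. t <= 2 + 50 * k \<and> bR R' \<and> bM M' \<and> (\<forall>r. r \<notin> {11, 17} --> R' r = R r) \<and>
  same {10, 11} M M' \<and> clean M') ?R ?M"
  by (rule wp_mono) (use x in \<open>auto simp: same_def\<close>)
 have Sk: "R 17 - Suc 0 = k" "0 < R 17" "R 17 = Suc k" using Suc.hyps(2) by auto
 show ?case
  by (subst wp_cleanup_step)
   (use Suc.prems x kB kZ Sk in \<open>simp_all add: cleanup_body_def\<close>, rule wp_mono[OF main], auto)
qed

lemma preload:
 assumes "bR R" "bM M" "R 6 = B" "R 19 = length S" "length S < 2 ^ W" "2 ^ W < B"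
  "\<And>k. k < length S ==> M (adr 9 k) = S ! k" "clean M"
 shows "wp w preload (\<lambda>t R' M'. t <= 40 + 60 * length S \<and> bR R' \<and> bM M' \<and> keep {11} R R' \<and>
  same {10, 11, 12} M M' \<and> trail W 10 11 12 M' (R' 102) \<and> R' 102 <= length S \<and>
  (\<forall>l<B. M' (adr 10 l) = args S l)) R M"
proof -
 have h: "10 < B" "11 < B" "12 < B" "9 < B" using B_big by auto
 have hZ: "10 * B < Z" "11 * B < Z" "12 * B < Z"
  using adr_lt_Z[of 10 0] adr_lt_Z[of 11 0] adr_lt_Z[of 12 0] h by (auto simp: adr_def)
 have lS: "length S < B" "length S < Z" using assms B_lt_Z by linarith+
 let ?R = "R(103 := 10 * B, 104 := 11 * B, 105 := 12 * B, 102 := 0, 11 := 0)"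
 define I where "I i R' M' \<longleftrightarrow> keep {11} R R' \<and> R' 103 = 10 * B \<and> R' 104 = 11 * B \<and> R' 105 = 12 * B \<and>
  same {10, 11, 12} M M' \<and> trail W 10 11 12 M' (R' 102) \<and> R' 102 <= i \<and>
  (\<forall>l<B. M' (adr 10 l) = (if l < i then S ! l else 0))" for i R' M'
 have "wp w (For 11 19 (Seq (Assign 100 (Reg 11)) (Seq (Assign 101 (Ld (Lit 9) (Reg 11))) (tracked_store True))))
  (\<lambda>t R' M'. t <= 4 + 48 * length S \<and> bR R' \<and> bM M' \<and> I (length S) R' M') ?R M"
 proof (rule wp_For[where a = 0 and z = "length S" and b = 40 and I = I])
  show "I 0 ?R M" unfolding I_def using assms(8) trail_empty[of M W] by (auto simp: keep_def clean_def)
 next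
  fix i R' M'
  assume i: "i < length S" and I: "I i R' M'" and R': "R' 11 = i" "bR R'" "bM M'" "R' 19 = length S"
  have iB: "i < B" "i < Z" "R' 6 = B" "i < 2 ^ W" using i assms I lS by (auto simp: I_def keep_def)
  have Si: "M' (adr 9 i) = S ! i" using I assms(7)[OF i] iB by (auto simp: I_def same_def)
  then have SZ: "S ! i < Z" using R'(3) by (metis bM_cell)
  let ?R' = "R'(100 := i, 101 := S ! i)"
  have "wp w (tracked_store True) (\<lambda>t R'' M''. t <= 24 \<and> bR R'' \<and> bM M'' \<and> (\<forall>r. r ~= 102 --> R'' r = ?R' r) \<and>
   (\<forall>a<B. M'' (adr 10 a) = (if a = ?R' 100 then ?R' 101 else M' (adr 10 a))) \<and>
   (\<forall>h l. l < B --> h ~= 10 --> (True --> h ~= 11 \<and> h ~= 12) --> M'' (adr h l) = M' (adr h l)) \<and>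
   (True --> trail W 10 11 12 M'' (R'' 102)) \<and> R'' 102 <= ?R' 102 + 1) ?R' M'"
  proof -
   have bR: "bR ?R'" using R' iB SZ by simp
   show ?thesis
    by (rule tracked_store[OF bR]) (use R' I iB SZ h assms in \<open>simp_all add: I_def adr_def\<close>)
  qed
  then have ts: "wp w (tracked_store True) (\<lambda>t R'' M''. t <= 24 \<and> R'' 11 = i \<and> R'' 19 = length S \<and> bR R'' \<and> bM M'' \<and>
   I (Suc i) (R''(11 := Suc i)) M'') ?R' M'"
   by (rule wp_mono) (use I R' in \<open>auto simp: I_def keep_def same_def less_Suc_eq\<close>)
  show "wp w (Seq (Assign 100 (Reg 11)) (Seq (Assign 101 (Ld (Lit 9) (Reg 11))) (tracked_store True)))
   (\<lambda>t R'' M''. t <= 40 \<and> R'' 11 = i \<and> R'' 19 = length S \<and> bR R'' \<and> bM M'' \<and> I (Suc i) (R''(11 := Suc i)) M'') R' M'"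
   using R' iB Si by simp (rule wp_mono[OF ts], auto)
 qed (use assms lS hZ in auto)
 then have main: "wp w (For 11 19 (Seq (Assign 100 (Reg 11)) (Seq (Assign 101 (Ld (Lit 9) (Reg 11))) (tracked_store True))))
  (\<lambda>t R' M'. t <= 4 + 48 * length S \<and> bR R' \<and> bM M' \<and> keep {11} R R' \<and>
  same {10, 11, 12} M M' \<and> trail W 10 11 12 M' (R' 102) \<and> R' 102 <= length S \<and>
  (\<forall>l<B. M' (adr 10 l) = args S l)) ?R M"
  by (rule wp_mono) (auto simp: I_def args_def)
 show ?thesis unfolding preload_def
  using assms hZ by simp (rule wp_mono[OF main], auto)
qed

end

section \<open>Transferring a state from one copy to the next\<close>

context machine
begin

lemma insUS:
 assumes "bR R" "bM M" "std R" "R 10 = h" "h < B" "h \<notin> {8, 11, 12}"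
  and "inst M h us" "R 16 = length ul" "\<And>k. k < length ul ==> M (adr 8 k) = ul ! k"
  and "\<And>u. u \<in> set ul ==> legal u" "length us + length ul <= m"
 shows "wp w insUS (\<lambda>t R' M'. t <= 10 + length ul * (gam * T + 30) \<and> bR R' \<and> bM M' \<and>
  keep {11, 12, 13, 20} R R' \<and> std R' \<and> inst M' h (ul @ us) \<and> same {h} M M') R M"
proof -
 have mB: "m < B" "m < Z" using nm_U B_big B_lt_Z U_ge by linarith+
 define I where "I i R' M' \<longleftrightarrow> keep {11, 12, 13, 20} R R' \<and> std R' \<and> inst M' h (take i ul @ us) \<and> same {h} M M'"
  for i R' M'
 have main: "wp w (For 20 16 (Seq (Assign 11 (Reg 20)) (Seq (Assign 12 (Ld (Lit 8) (Reg 20))) pIns)))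
  (\<lambda>t R' M'. t <= 4 + (length ul - 0) * ((gam * T + 20) + 8) \<and> bR R' \<and> bM M' \<and> I (length ul) R' M') (R(20 := 0)) M"
 proof (rule wp_For[where a = 0 and z = "length ul" and b = "gam * T + 20" and I = I])
  show "I 0 (R(20 := 0)) M" using assms by (simp add: I_def keep_def)
 next
  fix i R' M'
  assume i: "i < length ul" and I: "I i R' M'" and R': "R' 20 = i" "bR R'" "bM M'" "R' 16 = length ul"
  have iB: "i < B" "i < Z" "i <= m" using i assms mB by linarith+
  have s: "std R'" "R' 10 = h" using I assms by (auto simp: I_def keep_def)
  have ui: "M' (adr 8 i) = ul ! i" using I assms(6) assms(9)[OF i] iB by (auto simp: I_def same_def)
  have leg: "legal (ul ! i)" using assms(10) i by simp
  let ?R = "R'(11 := i, 12 := ul ! i)"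
  have "wp w pIns (\<lambda>t R'' M''. t <= gam * T \<and> bR R'' \<and> bM M'' \<and> keep {12, 13} ?R R'' \<and> std R'' \<and>
   inst M'' h (take i (take i ul @ us) @ (ul ! i) # drop i (take i ul @ us)) \<and> same {h} M' M'') ?R M'"
   by (rule pIns) (use R' s assms iB i I leg legal_lt in \<open>auto simp: I_def\<close>)
  then have "wp w pIns (\<lambda>t R'' M''. t <= gam * T \<and> R'' 20 = i \<and> R'' 16 = length ul \<and> bR R'' \<and> bM M'' \<and>
   I (Suc i) (R''(20 := Suc i)) M'') ?R M'"
   by (rule wp_mono) (use I R' i in \<open>auto simp: I_def keep_def same_def take_Suc_conv_app_nth\<close>)
  note ts = this
  show "wp w (Seq (Assign 11 (Reg 20)) (Seq (Assign 12 (Ld (Lit 8) (Reg 20))) pIns))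
   (\<lambda>t R'' M''. t <= gam * T + 20 \<and> R'' 20 = i \<and> R'' 16 = length ul \<and> bR R'' \<and> bM M'' \<and> I (Suc i) (R''(20 := Suc i)) M'') R' M'"
   using R' iB ui s by simp (rule wp_mono[OF ts], auto)
 qed (use assms mB in auto)
 show ?thesis unfolding insUS_def
  using assms by simp (rule wp_mono[OF main], auto simp: I_def algebra_simps)
qed

lemma delUS:
 assumes "bR R" "bM M" "std R" "R 10 = h" "h < B" "h \<notin> {11, 12}" "lm < 100" "lm \<notin> {11, 12, 13, 20}"
  and "inst M h (ul @ us)" "R lm = length ul" "length us + length ul <= m"
 shows "wp w (delUS lm) (\<lambda>t R' M'. t <= 10 + length ul * (gam * T + 30) \<and> bR R' \<and> bM M' \<and>
  keep {11, 12, 13, 20} R R' \<and> std R' \<and> inst M' h us \<and> same {h} M M') R M"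
proof -
 have mB: "m < B" "m < Z" using nm_U B_big B_lt_Z U_ge by linarith+
 define I where "I i R' M' \<longleftrightarrow> keep {11, 12, 13, 20} R R' \<and> std R' \<and> inst M' h (drop i ul @ us) \<and> same {h} M M'"
  for i R' M'
 have main: "wp w (For 20 lm (Seq (Assign 11 (Lit 0)) pDel))
  (\<lambda>t R' M'. t <= 4 + (length ul - 0) * ((gam * T + 20) + 8) \<and> bR R' \<and> bM M' \<and> I (length ul) R' M') (R(20 := 0)) M"
 proof (rule wp_For[where a = 0 and z = "length ul" and b = "gam * T + 20" and I = I])
  show "I 0 (R(20 := 0)) M" using assms by (simp add: I_def keep_def)
 next
  fix i R' M'
  assume i: "i < length ul" and I: "I i R' M'" and R': "R' 20 = i" "bR R'" "bM M'" "R' lm = length ul"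
  have s: "std R'" "R' 10 = h" using I assms by (auto simp: I_def keep_def)
  let ?R = "R'(11 := 0)"
  have "wp w pDel (\<lambda>t R'' M''. t <= gam * T \<and> bR R'' \<and> bM M'' \<and> keep {12, 13} ?R R'' \<and> std R'' \<and>
   inst M'' h (take 0 (drop i ul @ us) @ drop (Suc 0) (drop i ul @ us)) \<and> same {h} M' M'') ?R M'"
   by (rule pDel) (use R' s assms i I in \<open>auto simp: I_def\<close>)
  then have "wp w pDel (\<lambda>t R'' M''. t <= gam * T \<and> R'' 20 = i \<and> R'' lm = length ul \<and> bR R'' \<and> bM M'' \<and>
   I (Suc i) (R''(20 := Suc i)) M'') ?R M'"
   by (rule wp_mono) (use I R' i assms(7,8) in \<open>auto simp: I_def keep_def same_def\<close>)
  note ts = this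
  show "wp w (Seq (Assign 11 (Lit 0)) pDel)
   (\<lambda>t R'' M''. t <= gam * T + 20 \<and> R'' 20 = i \<and> R'' lm = length ul \<and> bR R'' \<and> bM M'' \<and> I (Suc i) (R''(20 := Suc i)) M'') R' M'"
   using R' s by simp (rule wp_mono[OF ts], auto)
 qed (use assms mB in auto)
 show ?thesis unfolding delUS_def
  using assms by simp (rule wp_mono[OF main], auto simp: I_def algebra_simps)
qed

lemma args3: "args [x, y] = args [x, y, 0]"
 by (auto simp: args_def nth_Cons fun_eq_iff split: nat.split)

lemma extract_call:
 assumes "exec WX X (args [n, a], Ma) t (Ra, Ma')" "WX = cX * L"
  and "bR R" "bM M" "std R" "R 13 = a" "a < 2 ^ WX" "\<forall>b. Ma b < 2 ^ WX" "\<forall>b<2 ^ WX. M (adr 10 b) = Ma b"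
  and "trail WX 10 11 12 M (R 17)"
 shows "wp w extract_call (\<lambda>t' R' M'. t' <= gam * t + 30 \<and>
  bR R' \<and> bM M' \<and> std R' \<and> keep {10, 11, 12, 17, 18, 19} R R' \<and> same {10, 11, 12} M M' \<and>
  trail WX 10 11 12 M' (R' 17) \<and> R' 17 <= R 17 + t \<and> R' 18 = Ra 0 \<and> R' 19 = Ra 1 \<and> Ra 1 < 2 ^ WX \<and>
  (\<forall>a. Ma' a < 2 ^ WX) \<and> (\<forall>a<2 ^ WX. M' (adr 10 a) = Ma' a)) R M"
proof -
 have c: "cX < cB" "cX \<ge> 1" using cs wd by auto
 have nX: "n < 2 ^ WX" "2 ^ WX < B" unfolding assms(2) using nm_U two_pow[of cX] c pow_lt_B by (auto intro: less_le_trans)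
 have ex: "exec WX X (args [n, a, 0], Ma) t (Ra, Ma')" using assms(1) args3 by simp
 let ?R = "R(10 := 10, 11 := a, 12 := 0, 102 := R 17)"
 have aZ: "a < Z" using assms(7) nX B_lt_Z by linarith
 have bR: "bR ?R" using assms aZ by simp
 have sim: "wp w (run_sim cB cX True X) (\<lambda>t' R' M'. t' <= (2 * regs_bound X + 80) * t \<and> bR R' \<and> bM M' \<and>
  keep {} ?R R' \<and> (\<forall>a. Ma' a < 2 ^ WX) \<and> (\<forall>a<2 ^ WX. M' (adr 10 a) = Ma' a) \<and>
  R' 110 = Ra 0 \<and> R' 111 = Ra 1 \<and> Ra 0 < 2 ^ WX \<and> Ra 1 < 2 ^ WX \<and>
  same (if True then {10, 11, 12} else {10}) M M' \<and>
  (True --> trail WX 10 11 12 M' (R' 102) \<and> R' 102 <= ?R 102 + t)) ?R M"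
  by (rule run_sim[OF ex assms(2) c bR]) (use assms nX aZ B_big in simp_all)
 have time: "(2 * regs_bound X + 80) * t <= gam * t" unfolding gam_def by (intro mult_right_mono) auto
 show ?thesis unfolding extract_call_def
 proof (simp add: assms(3-) aZ, rule wp_mono[OF sim], elim conjE, goal_cases)
  case (1 t' R' M')
  have "Ra 0 < Z" "Ra 1 < Z" using 1 nX B_lt_Z by linarith+
  moreover have "std R'" using std_keep[OF 1(4)] assms(5) by simp
  moreover have "keep {10, 11, 12, 17, 18, 19} R (R'(17 := R' 102, 18 := R' 110, 19 := R' 111))"
   using 1(4) by (auto simp: keep_def)
  moreover have "t' <= gam * t" using 1(1) time by linarith
  ultimately show ?case using 1 by auto
 qed
qed

lemma wp_extract_loop:
 "bR R ==> bM M ==> R 18 ~= 0 ==> wp w (While (Reg 18) extract_step) Q R M \<longleftrightarrow>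
  wp w extract_call (\<lambda>t. wp w (If (Reg 18) (Seq (Assign 10 (Reg 14)) (Seq (Assign 11 (Reg 15)) (Seq (Assign 12 (Reg 19)) pQry))) Skip)
   (\<lambda>t'. wp w (While (Reg 18) extract_step) (\<lambda>t''. Q (2 + (t + t' + t''))))) R M"
 by (subst wp_While_step) (auto simp: wp_Seq extract_step_def[THEN arg_cong[where f = "\<lambda>c. wp w c Q' R' M'" for Q' R' M']])

text \<open>Induction over the extraction. Between two calls of \<open>X\<close> the copy in region
  \<open>h\<close> answers a query; it changes only its own region, so the memory of
  \<open>X\<close> and its trail survive.\<close>

lemma extract_loop:
 assumes "extraction WX n X ans Ma a qs t S" "WX = cX * L"
  and "ans = (\<lambda>q. answer D n q (result_state D n us))" "set qs \<subseteq> legal_queries D n m" "set us \<subseteq> legal_updates D n m"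
  and "bR R" "bM M" "std R" "R 14 = h" "h < B" "h \<notin> {10, 11, 12}" "R 15 = length us" "length us <= m"
  and "inst M h us" "R 13 = a" "a < 2 ^ WX" "\<forall>b. Ma b < 2 ^ WX" "\<forall>b<2 ^ WX. M (adr 10 b) = Ma b"
  and "trail WX 10 11 12 M (R 17)" "R 18 ~= 0"
 shows "wp w (While (Reg 18) extract_step) (\<lambda>t' R' M'. t' <= gam * t + (length qs + 1) * (gam * T + 60) \<and>
  bR R' \<and> bM M' \<and> std R' \<and> keep {10, 11, 12, 13, 17, 18, 19} R R' \<and> same {h, 10, 11, 12} M M' \<and> inst M' h us \<and>
  trail WX 10 11 12 M' (R' 17) \<and> R' 17 <= R 17 + t \<and> R' 19 = length S \<and> length S < 2 ^ WX \<and>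
  (\<forall>k<length S. M' (adr 10 k) = S ! k)) R M"
 using assms
proof (induction arbitrary: R M rule: extraction.induct)
 case (Done a Ma t Ra Ma')
 note p = Done.prems
 note call = extract_call[OF Done.hyps(1) p(1) p(5,6,7) p(14,15,16,17,18)]
 show ?case
 proof (simp only: wp_extract_loop[OF p(5,6,19)], rule wp_mono[OF call], elim conjE, goal_cases)
  case (1 t' R' M')
  have "inst M' h us" using inst_same[OF 1(6)] p by auto
  moreover have "keep {10, 11, 12, 13, 17, 18, 19} R R'" "same {h, 10, 11, 12} M M'"
   using 1(5,6) by (auto simp: keep_def same_def)
  ultimately show ?case using 1 Done.hyps(2) by (simp add: wp_While_step)
 qed
next
 case (Ask a Ma t Ra Ma' qs t' S)
 note p = Ask.prems
 have mB: "m < B" "m < Z" using nm_U B_big B_lt_Z U_ge by linarith+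
 have sub: "Ra 1 \<in> legal_queries D n m" "set qs \<subseteq> legal_queries D n m" using p by auto
 let ?S = "result_state D n us"
 have S: "?S \<in> states D n m" using p(4) unfolding states_def by blast
 \<comment> \<open>The answer becomes an argument of \<open>X\<close> and must fit into its smaller
   words, which holds because answers are operands.\<close>
 have ans: "ans (Ra 1) < 2 ^ WX" using D[OF S] sub operand_lt[of _ cX] wd p by auto
 have qZ: "Ra 1 < Z" using sub operand_lt_Z by (auto simp: legal_queries_def)
 note call = extract_call[OF Ask.hyps(1) p(1) p(5,6,7) p(14,15,16,17,18)]
 show ?case
 proof (simp only: wp_extract_loop[OF p(5,6,19)], rule wp_mono[OF call], elim conjE, goal_cases)
  case (1 t1 R1 M1)
  have i1: "inst M1 h us" using inst_same[OF 1(6)] p by auto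
  have k1: "R1 14 = h" "R1 15 = length us" using 1(5) p by (auto simp: keep_def)
  have hZ: "h < Z" using p(9) B_lt_Z by linarith
  let ?R = "R1(10 := h, 11 := length us, 12 := Ra 1)"
  have bR: "bR ?R" using 1 hZ qZ mB p(12) by simp
  have q: "wp w pQry (\<lambda>t R' M'. t <= gam * T \<and> bR R' \<and> bM M' \<and> keep {12, 13} ?R R' \<and> std R' \<and>
   inst M' h us \<and> same {h} M1 M' \<and> R' 13 = answer D n (Ra 1) (result_state D n us)) ?R M1"
   by (rule pQry[OF bR]) (use 1 i1 k1 p sub in simp_all)
  have "wp w pQry (\<lambda>t2. wp w (While (Reg 18) extract_step) (\<lambda>t3 R' M'. t1 + t2 + t3 + 10 \<le>
    gam * (t + t') + (length (Ra 1 # qs) + 1) * (gam * T + 60) \<and>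
   bR R' \<and> bM M' \<and> std R' \<and> keep {10, 11, 12, 13, 17, 18, 19} R R' \<and> same {h, 10, 11, 12} M M' \<and> inst M' h us \<and>
   trail WX 10 11 12 M' (R' 17) \<and> R' 17 <= R 17 + (t + t') \<and> R' 19 = length S \<and> length S < 2 ^ WX \<and>
   (\<forall>k<length S. M' (adr 10 k) = S ! k))) ?R M1"
  proof (rule wp_mono[OF q], elim conjE)
   fix t2 R2 M2
   assume 2: "t2 <= gam * T" "bR R2" "bM M2" "keep {12, 13} ?R R2" "std R2"
    "inst M2 h us" "same {h} M1 M2" "R2 13 = answer D n (Ra 1) (result_state D n us)"
   have k2: "R2 14 = h" "R2 15 = length us" "R2 17 = R1 17" "R2 18 = Ra 0"
    using 2(4) k1 1 by (auto simp: keep_def)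
   have t2: "trail WX 10 11 12 M2 (R2 17)"
    using trail_cong[OF 2(7) _ _ 1(7)] k2 p(1,10) pow_lt_B[of cX] cs by auto
   have m2: "\<forall>b<2 ^ WX. M2 (adr 10 b) = Ma' b"
    using 2(7) 1(13) p(1,10) pow_lt_B[of cX] cs by (auto simp: same_def)
   have ih: "wp w (While (Reg 18) extract_step) (\<lambda>t3 R' M'. t3 <= gam * t' + (length qs + 1) * (gam * T + 60) \<and>
    bR R' \<and> bM M' \<and> std R' \<and> keep {10, 11, 12, 13, 17, 18, 19} R2 R' \<and> same {h, 10, 11, 12} M2 M' \<and> inst M' h us \<and>
    trail WX 10 11 12 M' (R' 17) \<and> R' 17 <= R2 17 + t' \<and> R' 19 = length S \<and> length S < 2 ^ WX \<and>
    (\<forall>k<length S. M' (adr 10 k) = S ! k)) R2 M2"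
    by (rule Ask.IH[OF p(1,2) sub(2) p(4) 2(2,3,5) k2(1) p(9,10) k2(2) p(12) 2(6)])
     (use 2 p 1 m2 t2 k2 ans Ask.hyps(2) in auto)
   have kk: "keep {10, 11, 12, 13, 17, 18, 19} R R'" if "keep {10, 11, 12, 13, 17, 18, 19} R2 R'" for R'
    using that 1(5) 2(4) by (auto simp: keep_def)
   have ss: "same {h, 10, 11, 12} M M'" if "same {h, 10, 11, 12} M2 M'" for M'
    using that 1(6) 2(7) by (auto simp: same_def)
   show "wp w (While (Reg 18) extract_step) (\<lambda>t3 R' M'. t1 + t2 + t3 + 10 \<le>
    gam * (t + t') + (length (Ra 1 # qs) + 1) * (gam * T + 60) \<and>
   bR R' \<and> bM M' \<and> std R' \<and> keep {10, 11, 12, 13, 17, 18, 19} R R' \<and> same {h, 10, 11, 12} M M' \<and> inst M' h us \<and>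
   trail WX 10 11 12 M' (R' 17) \<and> R' 17 <= R 17 + (t + t') \<and> R' 19 = length S \<and> length S < 2 ^ WX \<and>
   (\<forall>k<length S. M' (adr 10 k) = S ! k)) R2 M2"
    by (rule wp_mono[OF ih], elim conjE, intro conjI)
     (use 1 2(1) k2 kk ss in \<open>simp_all add: algebra_simps\<close>)
  qed
  note main = this
  have "length us < Z" "Ra (Suc 0) < Z" using p(12) mB qZ by auto
  then show ?case using 1 Ask.hyps(2) k1 p(9) hZ
   by simp (rule wp_mono[OF main[unfolded One_nat_def]], erule wp_mono, simp add: algebra_simps)
 qed
qed

end

context machine
begin

lemma std_cong: "std R ==> R' 3 = R 3 ==> R' 4 = R 4 ==> R' 5 = R 5 ==> R' 6 = R 6 ==> std R'"
 unfolding std_def by simp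

text \<open>States have at most \<open>width D * n\<close> entries, so this makes their lengths fit
  into the words of \<open>Y\<close>, and lists of \<open>K * n\<close> updates into a
  region.\<close>

lemma cn_lt: "c \<ge> 1 ==> c * n < 2 ^ (c * L)"
proof -
 assume c: "c \<ge> 1"
 then obtain d where d: "c = Suc d" by (cases c) auto
 have "d < 2 ^ d" by simp
 also have "(2::nat) ^ d <= 2 ^ (d * L)" using L by (intro power_increasing) auto
 finally have "Suc d <= 2 ^ (d * L)" by simp
 moreover have "n < 2 ^ L" using nm_U by (simp add: U_def)
 ultimately have "c * n < 2 ^ (d * L) * 2 ^ L" unfolding d by (intro mult_le_less_imp_less) auto
 also have "\<dots> = 2 ^ (c * L)" by (simp add: d power_add)
 finally show ?thesis .
qed

text \<open>The trail passed in already lists the preloaded cells, so that one later cleanup removes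
  input and output alike.\<close>

lemma construct:
 assumes "S \<in> states D n m" "bR R" "bM M" "std R" "R 19 = length S" "\<forall>l<B. M (adr 10 l) = args S l"
  and "trail (cY * L) 10 11 12 M (R 102)"
 shows "wp w construct (\<lambda>t R' M'. t <= gam * (K * n * T) + 30 \<and> bR R' \<and> bM M' \<and> std R' \<and>
  keep {10, 11, 12, 16, 17} R R' \<and> same {10, 11, 12} M M' \<and> trail (cY * L) 10 11 12 M' (R' 17) \<and>
  R' 17 <= R 102 + K * n * T \<and> (\<exists>us. set us \<subseteq> legal_updates D n m \<and> result_state D n us = S \<and>
   length us <= K * n \<and> R' 16 = length us \<and> length us < B \<and> (\<forall>k<length us. M' (adr 10 k) = us ! k))) R M"
proof -
 obtain t Ra Ma' us where Y: "exec (cY * L) Y (args [n, length S], args S) t (Ra, Ma')"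
  "us = map Ma' [0..<Ra 0]" "set us \<subseteq> legal_updates D n m" "result_state D n us = S"
  "length us <= K * n" "t <= K * n * T" using Y_ok[OF assms(1)] by blast
 have c: "cY < cB" "cY \<ge> 1" using cs wd by auto
 have nY: "n < 2 ^ (cY * L)" "2 ^ (cY * L) < B" using nm_U two_pow[of cY] c pow_lt_B by (auto intro: less_le_trans)
 have S: "length S <= width D * n" "set S \<subseteq> operands D n m" using D[OF assms(1)] by auto
 have lS: "length S < 2 ^ (cY * L)"
 proof -
  have "length S <= cY * n" using S(1) wd(4) by (meson le_trans mult_le_mono1)
  then show ?thesis using cn_lt[OF c(2)] by linarith
 qed
 have aS: "args S a < 2 ^ (cY * L)" for a
  using S(2) operand_lt[of "S ! a" cY] wd by (auto simp: args_def subset_iff)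
 have lZ: "length S < Z" using lS nY B_lt_Z by linarith
 let ?R = "R(10 := 10, 11 := length S, 12 := 0)"
 have bR: "bR ?R" using assms lZ by simp
 have ex: "exec (cY * L) Y (args [n, length S, 0], args S) t (Ra, Ma')" using Y(1) args3 by simp
 have sim: "wp w (run_sim cB cY True Y) (\<lambda>t' R' M'. t' <= (2 * regs_bound Y + 80) * t \<and> bR R' \<and> bM M' \<and>
  keep {} ?R R' \<and> (\<forall>a. Ma' a < 2 ^ (cY * L)) \<and> (\<forall>a<2 ^ (cY * L). M' (adr 10 a) = Ma' a) \<and>
  R' 110 = Ra 0 \<and> R' 111 = Ra 1 \<and> Ra 0 < 2 ^ (cY * L) \<and> Ra 1 < 2 ^ (cY * L) \<and>
  same (if True then {10, 11, 12} else {10}) M M' \<and>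
  (True --> trail (cY * L) 10 11 12 M' (R' 102) \<and> R' 102 <= ?R 102 + t)) ?R M"
  by (rule run_sim[OF ex refl c bR]) (use assms nY aS lS B_big in simp_all)
 have time: "(2 * regs_bound Y + 80) * t <= gam * (K * n * T)" unfolding gam_def
  by (intro mult_mono Y(6)) auto
 show ?thesis unfolding construct_def
 proof (simp add: assms(2-6) lZ, rule wp_mono[OF sim], elim conjE, goal_cases)
  case (1 t' R' M')
  have lt: "Ra 0 < B" "Ra 0 < Z" using 1 nY B_lt_Z by linarith+
  have "std R'" using std_keep[OF 1(4)] assms by simp
  moreover have "keep {10, 11, 12, 16, 17} R (R'(17 := R' 102, 16 := R' 110))"
   using 1(4) by (auto simp: keep_def)
  moreover have "t' <= gam * (K * n * T)" using 1(1) time by linarith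
  moreover have "R' 102 <= R 102 + K * n * T" using 1 Y(6) by simp
  moreover have "\<exists>us. set us \<subseteq> legal_updates D n m \<and> result_state D n us = S \<and>
   length us <= K * n \<and> Ra 0 = length us \<and> length us < B \<and> (\<forall>k<length us. M' (adr 10 k) = us ! k)"
   using Y(2-5) 1(6,9) lt by (intro exI[of _ us]) auto
  ultimately show ?case using 1 lt by auto
 qed
qed

definition transfer_cost :: nat where "transfer_cost = 3 * gam * K + gam + 300 * K + 300 * cP + 400"

text \<open>The point is that the new list is short: \<open>us\<close> may have up to
  \<open>m\<close> updates, while its replacement with the same resulting state has at most
  \<open>K * n\<close>.\<close>

lemma transfer:
 assumes us: "set us \<subseteq> legal_updates D n m"
  and "bR R" "bM M" "std R" "R 14 = h" "h < B" "h \<notin> {8, 9, 10, 11, 12}" "R 15 = length us" "length us <= m"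
  and "inst M h us" "clean M"
 shows "wp w transfer (\<lambda>t R' M'. t <= transfer_cost * (n * T) \<and>
  bR R' \<and> bM M' \<and> std R' \<and> keep {10, 11, 12, 13, 16, 17, 18, 19} R R' \<and> same {h, 8, 9, 10, 11, 12} M M' \<and>
  inst M' h us \<and> clean M' \<and> (\<exists>us'. set us' \<subseteq> legal_updates D n m \<and> result_state D n us' = result_state D n us \<and>
   length us' <= K * n \<and> R' 16 = length us' \<and> (\<forall>k<length us'. M' (adr 8 k) = us' ! k))) R M"
proof -
 let ?S = "result_state D n us"
 have S: "?S \<in> states D n m" using us unfolding states_def by blast
 have lS: "length ?S <= cP * n" using D[OF S] wd(2) by (meson le_trans mult_le_mono1)
 have lSY: "length ?S < 2 ^ (cY * L)"
 proof -
  have "length ?S <= cY * n" using D[OF S] wd(4) by (meson le_trans mult_le_mono1)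
  then show ?thesis using cn_lt[of cY] wd by linarith
 qed
 obtain qs t where X: "extraction (cX * L) n X (\<lambda>q. answer D n q ?S) blank 0 qs t ?S"
  "set qs \<subseteq> legal_queries D n m" "length qs <= K * n" "t <= K * n * T" using X_ok[OF S] by blast
 have WB: "2 ^ (cX * L) < B" "2 ^ (cY * L) < B" using pow_lt_B cs by auto
 let ?R = "R(13 := 0, 17 := 0, 18 := Suc 0)"
 have e1: "wp w (While (Reg 18) extract_step) (\<lambda>t' R' M'. t' <= gam * t + (length qs + 1) * (gam * T + 60) \<and>
  bR R' \<and> bM M' \<and> std R' \<and> keep {10, 11, 12, 13, 17, 18, 19} ?R R' \<and> same {h, 10, 11, 12} M M' \<and> inst M' h us \<and>
  trail (cX * L) 10 11 12 M' (R' 17) \<and> R' 17 <= ?R 17 + t \<and> R' 19 = length ?S \<and> length ?S < 2 ^ (cX * L) \<and>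
  (\<forall>k<length ?S. M' (adr 10 k) = ?S ! k)) ?R M"
  by (rule extract_loop[OF X(1) refl refl X(2) us])
   (use assms WB trail_empty[of M] in \<open>auto simp: clean_def blank_def\<close>)
 have tX: "gam * t + (length qs + 1) * (gam * T + 60) <= 2 * (gam * (K * n * T)) + gam * T + 60 * (K * n) + 60"
 proof -
  have "gam * t <= gam * (K * n * T)" using X(4) by simp
  moreover have "(length qs + 1) * (gam * T + 60) <= (K * n + 1) * (gam * T + 60)" using X(3) by (intro mult_right_mono) auto
  moreover have "(K * n + 1) * (gam * T + 60) = gam * (K * n * T) + 60 * (K * n) + gam * T + 60" by (simp add: algebra_simps)
  ultimately show ?thesis by linarith
 qed
 show ?thesis unfolding transfer_def extract_prog_def wp_Seq
 proof (use assms in \<open>simp\<close>, rule wp_mono[OF e1], elim conjE, goal_cases)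
  case (1 t1 R1 M1)
  have cpy: "wp w (copy 10 9 19) (\<lambda>t R' M'. t <= 10 + 30 * R1 19 \<and> bR R' \<and> bM M' \<and> (\<forall>r. r ~= 11 --> R' r = R1 r) \<and>
   same {9} M1 M' \<and> (\<forall>k<R1 19. M' (adr 9 k) = M1 (adr 10 k))) R1 M1"
   by (rule copy) (use 1 WB in auto)
  show ?case
  proof (rule wp_mono[OF cpy], elim conjE, goal_cases)
   case (1 t2 R2 M2)
   note 2 = this
   note 1 = \<open>t1 <= gam * t + (length qs + 1) * (gam * T + 60)\<close> \<open>std R1\<close> \<open>keep {10, 11, 12, 13, 17, 18, 19} ?R R1\<close>
    \<open>same {h, 10, 11, 12} M M1\<close> \<open>inst M1 h us\<close> \<open>trail (cX * L) 10 11 12 M1 (R1 17)\<close> \<open>R1 17 <= ?R 17 + t\<close>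
    \<open>R1 19 = length ?S\<close> \<open>\<forall>k<length ?S. M1 (adr 10 k) = ?S ! k\<close>
   have i2: "inst M2 h us" using inst_same[OF 2(5)] 1 assms by auto
   have tr2: "trail (cX * L) 10 11 12 M2 (R2 17)" using trail_cong[OF 2(5) _ WB(1) 1(6)] 2(4) by auto
   have cln: "wp w cleanup (\<lambda>t R' M'. t <= 2 + 50 * R2 17 \<and> bR R' \<and> bM M' \<and> (\<forall>r. r \<notin> {11, 17} --> R' r = R2 r) \<and>
    same {10, 11} M2 M' \<and> clean M') R2 M2"
    by (rule cleanup[where W = "cX * L"]) (use 1 2 tr2 WB in auto)
   show ?case
   proof (rule wp_mono[OF cln], elim conjE, goal_cases)
    case (1 t3 R3 M3)
    note 3 = this
    have i3: "inst M3 h us" using inst_same[OF 3(5)] i2 assms by auto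
    have R3: "std R3" by (rule std_cong[OF \<open>std R1\<close>]) (use 3(4) 2(4) in auto)
    have R3': "R3 19 = length ?S" "R3 6 = B" using 3(4) 2(4) stdD(4)[OF \<open>std R1\<close>] \<open>R1 19 = length ?S\<close> by auto
    have m3: "M3 (adr 9 k) = ?S ! k" if "k < length ?S" for k
     using 3(5) 2(6) \<open>R1 19 = length ?S\<close> \<open>\<forall>k<length ?S. M1 (adr 10 k) = ?S ! k\<close> that lSY WB by (auto simp: same_def)
    have pre: "wp w preload (\<lambda>t R' M'. t <= 40 + 60 * length ?S \<and> bR R' \<and> bM M' \<and> keep {11} R3 R' \<and>
     same {10, 11, 12} M3 M' \<and> trail (cY * L) 10 11 12 M' (R' 102) \<and> R' 102 <= length ?S \<and>
     (\<forall>l<B. M' (adr 10 l) = args ?S l)) R3 M3"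
     by (rule preload) (use 3 R3' lSY WB m3 in auto)
    show ?case
    proof (rule wp_mono[OF pre], elim conjE, goal_cases)
     case (1 t4 R4 M4)
     note 4 = this
     have i4: "inst M4 h us" using inst_same[OF 4(5)] i3 assms by auto
     have R4: "std R4" by (rule std_keep[OF 4(4) _ R3]) simp
     have R4': "R4 19 = length ?S" using 4(4) R3' by (auto simp: keep_def)
     note con = construct[OF S 4(2,3) R4 R4' 4(8,6)]
     show ?case
     proof (rule wp_mono[OF con], elim conjE exE, goal_cases)
      case (1 t5 R5 M5 us')
      note 5 = this
      have i5: "inst M5 h us" using inst_same[OF 5(6)] i4 assms by auto
      have cpy2: "wp w (copy 10 8 16) (\<lambda>t R' M'. t <= 10 + 30 * R5 16 \<and> bR R' \<and> bM M' \<and> (\<forall>r. r ~= 11 --> R' r = R5 r) \<and>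
       same {8} M5 M' \<and> (\<forall>k<R5 16. M' (adr 8 k) = M5 (adr 10 k))) R5 M5"
       by (rule copy) (use 5 in auto)
      show ?case
      proof (rule wp_mono[OF cpy2], elim conjE, goal_cases)
       case (1 t6 R6 M6)
       note 6 = this
       have i6: "inst M6 h us" using inst_same[OF 6(5)] i5 assms by auto
       have tr6: "trail (cY * L) 10 11 12 M6 (R6 17)" using trail_cong[OF 6(5) _ WB(2) 5(7)] 6(4) by auto
       have cln2: "wp w cleanup (\<lambda>t R' M'. t <= 2 + 50 * R6 17 \<and> bR R' \<and> bM M' \<and> (\<forall>r. r \<notin> {11, 17} --> R' r = R6 r) \<and>
        same {10, 11} M6 M' \<and> clean M') R6 M6"
        by (rule cleanup[where W = "cY * L"]) (use 5 6 tr6 WB in auto)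
       show ?case
       proof (rule wp_mono[OF cln2], elim conjE, goal_cases)
        case (1 t7 R7 M7)
        note 7 = this
        have i7: "inst M7 h us" using inst_same[OF 7(5)] i6 assms by auto
        have s7: "std R7" by (rule std_cong[OF \<open>std R5\<close>]) (use 7(4) 6(4) in auto)
        have k7: "keep {10, 11, 12, 13, 16, 17, 18, 19} R R7"
         using 7(4) 6(4) 5(5) 4(4) 3(4) 2(4) \<open>keep {10, 11, 12, 13, 17, 18, 19} ?R R1\<close> by (auto simp: keep_def)
        have sm7: "same {h, 8, 9, 10, 11, 12} M M7"
         using 7(5) 6(5) 5(6) 4(5) 3(5) 2(5) \<open>same {h, 10, 11, 12} M M1\<close> by (auto simp: same_def)
        have e7: "R7 16 = length us'" "\<forall>k<length us'. M7 (adr 8 k) = us' ! k"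
         using 7(4,5) 6(4,6) 5 by (auto simp: same_def)
        \<comment> \<open>All seven terms are estimated by multiples of \<open>q\<close>, which
          dominates \<open>n\<close>, \<open>T\<close> and 1.\<close>
        define q where "q = n * T"
        have q: "K * n * T = K * q" "n <= q" "T <= q" "1 <= q" using n T by (auto simp: q_def)
        have b: "R2 17 <= K * q" using 2(4) \<open>R1 17 <= ?R 17 + t\<close> X(4) q by auto
        have b6: "R6 17 <= length ?S + K * q" using 6(4) 5(8) 4(7) q by auto
        have kn: "K * n <= K * q" "cP * n <= cP * q" "gam * T <= gam * q" using q by auto
        have b7: "R6 17 <= cP * q + K * q" using b6 lS kn(2) by linarith
        have "t1 <= 2 * (gam * (K * q)) + gam * q + 60 * (K * q) + 60"
         using \<open>t1 <= gam * t + (length qs + 1) * (gam * T + 60)\<close> tX kn unfolding q(1) by linarith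
        moreover have "t2 <= 10 + 30 * (cP * q)" using 2(1) lS kn unfolding \<open>R1 19 = length ?S\<close> by linarith
        moreover have "t3 <= 2 + 50 * (K * q)" using 3(1) b by linarith
        moreover have "t4 <= 40 + 60 * (cP * q)" using 4(1) lS kn by linarith
        moreover have "t5 <= gam * (K * q) + 30" using 5(1) unfolding q(1) .
        moreover have "t6 <= 10 + 30 * (K * q)" using 6(1) \<open>length us' <= K * n\<close> kn unfolding \<open>R5 16 = length us'\<close> by linarith
        moreover have "t7 <= 2 + (50 * (cP * q) + 50 * (K * q))"
         by (rule order_trans[OF 7(1)]) (use b7 in linarith)
        moreover have "400 <= 400 * q" using q by simp
        moreover have "transfer_cost * q = 3 * (gam * (K * q)) + gam * q + 300 * (K * q) + 300 * (cP * q) + 400 * q"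
         by (simp add: transfer_cost_def algebra_simps)
        moreover have "t1 + t2 + t3 + t4 + t5 + t6 + t7 + 10 <= tc"
         if "t1 <= 2 * a + b + 60 * k + 60" "t2 <= 10 + 30 * c" "t3 <= 2 + 50 * k" "t4 <= 40 + 60 * c"
          "t5 <= a + 30" "t6 <= 10 + 30 * k" "t7 <= 2 + (50 * c + 50 * k)" "400 <= 400 * q"
          "tc = 3 * a + b + 300 * k + 300 * c + 400 * q" for a b c k tc
         using that by linarith
        ultimately have "t1 + t2 + t3 + t4 + t5 + t6 + t7 + 10 <= transfer_cost * q" by blast
        then show ?case using 7 i7 s7 k7 sm7 e7 5 by (auto simp: q_def)
       qed
      qed
     qed
    qed
   qed
  qed
 qed
qed

end

context machine
begin

definition process_cost :: nat where "process_cost = transfer_cost + 2 * (gam * K) + 60 * K + 60"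

lemma result_state_append: "result_state D n (us @ vs) = fold (update D n) vs (result_state D n us)"
 by (simp add: result_state_def)

lemma bounds: "m < B" "m < Z" "n < Z" "U < B" "U < Z" "L < Z" "cB * L < Z"
proof -
 show "m < B" "m < Z" "U < B" "U < Z" "n < Z" using nm_U B_big B_lt_Z U_ge by linarith+
 have "cB * L <= w" unfolding w_def by (intro mult_right_mono) auto
 then show "cB * L < Z" using w_lt_Z by linarith
 moreover have "1 * L <= cB * L" using cB by (intro mult_right_mono) auto
 ultimately show "L < Z" by linarith
qed

lemma KB: "K * n < B"
proof (cases "K = 0")
 case False
 then show ?thesis using cn_lt[of K] pow_lt_B[OF K] by linarith
qed (use B_big in simp)

text \<open>Prepending \<open>ul\<close> replays the state reached before the block, so the copy,
  which by itself knows only the updates \<open>us\<close> of the block, arrives at the state after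
  it. Insertions are legal only while the timeline stays within \<open>m\<close>, whence the bound
  on the total length.\<close>

lemma process:
 assumes us: "set us \<subseteq> legal_updates D n m" "set ul \<subseteq> legal_updates D n m" "length ul <= K * n"
  and "bR R" "bM M" "std R" "R 14 = h" "h < B" "h \<notin> {8, 9, 10, 11, 12}" "R 21 = length us"
  and "length us + length ul <= m" "inst M h us" "clean M" "R 16 = length ul" "\<forall>k<length ul. M (adr 8 k) = ul ! k"
 shows "wp w process (\<lambda>t R' M'. t <= process_cost * (n * T) \<and>
  bR R' \<and> bM M' \<and> std R' \<and> keep {10, 11, 12, 13, 15, 16, 17, 18, 19, 20, 22} R R' \<and> same {h, 8, 9, 10, 11, 12} M M' \<and>
  inst M' h us \<and> clean M' \<and> (\<exists>us'. set us' \<subseteq> legal_updates D n m \<and> result_state D n us' = result_state D n (ul @ us) \<and>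
   length us' <= K * n \<and> R' 16 = length us' \<and> (\<forall>k<length us'. M' (adr 8 k) = us' ! k))) R M"
proof -
 have hZ: "h < Z" using assms B_lt_Z by linarith
 have i1: "wp w insUS (\<lambda>t R' M'. t <= 10 + length ul * (gam * T + 30) \<and> bR R' \<and> bM M' \<and>
  keep {11, 12, 13, 20} (R(10 := h)) R' \<and> std R' \<and> inst M' h (ul @ us) \<and> same {h} M M') (R(10 := h)) M"
  by (rule insUS) (use assms hZ in auto)
 show ?thesis unfolding process_def wp_Seq
 proof (simp add: assms(4-7) hZ, rule wp_mono[OF i1], elim conjE, goal_cases)
  case (1 t1 R1 M1)
  note 1 = this
  have k1: "R1 14 = h" "R1 16 = length ul" "R1 21 = length us" using 1(4) assms by (auto simp: keep_def)
  have lm: "length us + length ul < Z" "length ul < Z" using assms(11) bounds by linarith+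
  let ?R = "R1(15 := length us + length ul, 22 := length ul)"
  have c1: "clean M1" using clean_same[OF 1(7)] assms by auto
  have b1: "bR ?R" "std ?R" using 1 lm by auto
  have "wp w transfer (\<lambda>t R' M'. t <= transfer_cost * (n * T) \<and>
   bR R' \<and> bM M' \<and> std R' \<and> keep {10, 11, 12, 13, 16, 17, 18, 19} ?R R' \<and> same {h, 8, 9, 10, 11, 12} M1 M' \<and>
   inst M' h (ul @ us) \<and> clean M' \<and> (\<exists>us'. set us' \<subseteq> legal_updates D n m \<and> result_state D n us' = result_state D n (ul @ us) \<and>
   length us' <= K * n \<and> R' 16 = length us' \<and> (\<forall>k<length us'. M' (adr 8 k) = us' ! k))) ?R M1"
   by (rule transfer[OF _ b1(1) 1(3) b1(2)]) (use assms 1 c1 k1 in auto)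
  note tr = this
  show ?case
  proof (simp add: 1(2,3,5) k1 lm, rule wp_mono[OF tr], elim conjE exE, goal_cases)
   case (1 t2 R2 M2 us')
   note 2 = this
   have k2: "R2 14 = h" "R2 22 = length ul" using 2(5) k1 by (auto simp: keep_def)
   let ?R2 = "R2(10 := h)"
   have b2: "bR ?R2" "std ?R2" using 2 hZ by auto
   have "wp w (delUS 22) (\<lambda>t R' M'. t <= 10 + length ul * (gam * T + 30) \<and> bR R' \<and> bM M' \<and>
    keep {11, 12, 13, 20} ?R2 R' \<and> std R' \<and> inst M' h us \<and> same {h} M2 M') ?R2 M2"
    by (rule delUS[OF b2(1) 2(3) b2(2)]) (use 2 k2 assms in auto)
   note dl = this
   show ?case
   proof (simp add: 2(2-4) k2 hZ, rule wp_mono[OF dl], elim conjE, goal_cases)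
    case (1 t3 R3 M3)
    note 3 = this
    have kp: "keep {10, 11, 12, 13, 15, 16, 17, 18, 19, 20, 22} R R3"
     using \<open>keep {11, 12, 13, 20} (R(10 := h)) R1\<close> 2(5) 3(4) by (auto simp: keep_def)
    have sm: "same {h, 8, 9, 10, 11, 12} M M3" using \<open>same {h} M M1\<close> 2(6) 3(7) by (auto simp: same_def)
    have c3: "clean M3" using clean_same[OF 3(7)] 2 assms by auto
    have "length us' < B" using 2(11) KB by linarith
    then have e: "R3 16 = length us'" "\<forall>k<length us'. M3 (adr 8 k) = us' ! k"
     using 3(4,7) 2 assms by (auto simp: keep_def same_def)
    define q where "q = n * T"
    have q: "n <= q" "T <= q" "1 <= q" using n T by (auto simp: q_def)
    have "length ul * (gam * T + 30) <= K * n * (gam * T + 30)" by (rule mult_right_mono[OF us(3)]) simp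
    also have "\<dots> = gam * K * q + 30 * (K * n)" by (simp add: q_def algebra_simps)
    also have "30 * (K * n) <= 30 * (K * q)" using q by simp
    finally have "length ul * (gam * T + 30) <= gam * K * q + 30 * (K * q)" by simp
    moreover have "process_cost * q = transfer_cost * q + 2 * (gam * K * q) + 60 * (K * q) + 60 * q"
     by (simp add: process_cost_def algebra_simps)
    ultimately have "t1 + t2 + t3 + 20 <= process_cost * q"
     using \<open>t1 <= 10 + length ul * (gam * T + 30)\<close> 2(1) 3(1) q unfolding q_def[symmetric] by linarith
    then show ?case using 3 kp sm c3 e 2 by (auto simp: q_def)
   qed
  qed
 qed
qed

end

text \<open>The ring of block \<open>j\<close> owns the \<open>U\<close> slots from
  \<open>j * U\<close> on, and region 1 stores the offset of its first entry. Shifting a whole block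
  by one place then amounts to changing this offset.\<close>

definition buf_index :: "expr => expr => expr" where
 "buf_index j k = Bin Add (Bin Mul j (Reg 5)) (Bin Mod (Bin Add (Ld (Lit 1) j) k) (Reg 5))"

section \<open>Copies of the prefixes of square length\<close>

abbreviation find_cond :: expr where
 "find_cond \<equiv> Bin Less (Bin Mul (Bin Add (Reg 32) (Lit 1)) (Bin Add (Reg 32) (Lit 1))) (Bin Add (Reg 1) (Lit 1))"

text \<open>A linear search for the integer square root is affordable, since touching the copies
  takes \<open>sqrt m\<close> operations anyway.\<close>

definition find_block :: com where
 "find_block = Seq (Assign 32 (Lit 0))
  (While find_cond
   (Assign 32 (Bin Add (Reg 32) (Lit 1))))"

text \<open>Register 35 carries the update displaced from the previous slot; in the end it holds the
  one that leaves the block.\<close>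

definition shift_in :: com where
 "shift_in = Seq (Assign 35 (Reg 2)) (Seq (Assign 33 (Bin Sub (Reg 1) (Bin Mul (Reg 32) (Reg 32))))
  (Seq (Assign 37 (Bin Add (Bin Add (Reg 32) (Reg 32)) (Lit 1)))
  (For 33 37 (Seq (Assign 36 (Ld (Lit 2) (buf_index (Reg 32) (Reg 33))))
   (Seq (St (Lit 2) (buf_index (Reg 32) (Reg 33)) (Reg 35)) (Assign 35 (Reg 36)))))))"

text \<open>Every later block gains an entry in front and loses its last one, which is read before
  the rotation. Adding \<open>U - 1\<close> modulo \<open>U\<close> moves the origin of the ring
  back by one.\<close>

definition cascade_in :: com where
 "cascade_in = Seq (Assign 33 (Bin Add (Reg 32) (Lit 1)))
  (For 33 31 (Seq (Assign 36 (Ld (Lit 2) (buf_index (Reg 33) (Bin Add (Reg 33) (Reg 33)))))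
   (Seq (St (Lit 1) (Reg 33) (Bin Mod (Bin Add (Ld (Lit 1) (Reg 33)) (Bin Sub (Reg 5) (Lit 1))) (Reg 5)))
   (Seq (St (Lit 2) (buf_index (Reg 33) (Lit 0)) (Reg 35)) (Assign 35 (Reg 36))))))"

definition shift_out :: com where
 "shift_out = Seq (Assign 33 (Bin Sub (Reg 1) (Bin Mul (Reg 32) (Reg 32))))
  (Seq (Assign 37 (Bin Add (Reg 32) (Reg 32)))
  (For 33 37 (St (Lit 2) (buf_index (Reg 32) (Reg 33)) (Ld (Lit 2) (buf_index (Reg 32) (Bin Add (Reg 33) (Lit 1)))))))"

text \<open>The first entry of block \<open>k\<close> fills the gap at the end of block
  \<open>k - 1\<close>; then the origin of block \<open>k\<close> advances.\<close>

definition cascade_out :: com where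
 "cascade_out = Seq (Assign 33 (Bin Add (Reg 32) (Lit 1)))
  (For 33 31 (Seq (Assign 34 (Bin Sub (Reg 33) (Lit 1)))
   (Seq (St (Lit 2) (buf_index (Reg 34) (Bin Add (Reg 34) (Reg 34))) (Ld (Lit 2) (buf_index (Reg 33) (Lit 0))))
   (St (Lit 1) (Reg 33) (Bin Mod (Bin Add (Ld (Lit 1) (Reg 33)) (Lit 1)) (Reg 5))))))"

context progs
begin

text \<open>Copies up to the number in register 32 end at or before the insertion point and stay as
  they are. A later copy that is already full drops its last update first.\<close>

definition structs_in :: com where
 "structs_in = Seq (Assign 33 (Bin Add (Reg 32) (Lit 1))) (Seq (Assign 37 (Bin Add (Reg 31) (Lit 1)))
  (For 33 37 (Seq (Assign 10 (Bin Add (Lit 16) (Reg 33)))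
   (Seq (If (Bin Less (Bin Mul (Reg 33) (Reg 33)) (Bin Add (Reg 30) (Lit 1)))
     (Seq (Assign 11 (Bin Sub (Bin Mul (Reg 33) (Reg 33)) (Lit 1))) pDel) Skip)
   (Seq (Assign 11 (Reg 1)) (Seq (Assign 12 (Reg 2)) pIns))))))"

text \<open>The update that moves up into copy \<open>k\<close> has position \<open>k * k\<close>,
  so it is the first entry of block \<open>k\<close>. It is read from the blocks of the old
  timeline; hence the copies are updated before the blocks.\<close>

definition structs_out :: com where
 "structs_out = Seq (Assign 33 (Bin Add (Reg 32) (Lit 1))) (Seq (Assign 37 (Bin Add (Reg 31) (Lit 1)))
  (For 33 37 (Seq (Assign 10 (Bin Add (Lit 16) (Reg 33)))
   (Seq (Assign 11 (Reg 1)) (Seq pDel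
   (If (Bin Less (Bin Mul (Reg 33) (Reg 33)) (Reg 30))
     (Seq (Assign 11 (Bin Sub (Bin Mul (Reg 33) (Reg 33)) (Lit 1)))
     (Seq (Assign 12 (Ld (Lit 2) (buf_index (Reg 33) (Lit 0)))) pIns)) Skip))))))"

text \<open>Called when the timeline has exactly \<open>J * J\<close> updates, so that one more
  would not be covered by copy \<open>J\<close>. The new copy starts with the whole timeline, read
  off block by block.\<close>

definition create :: com where
 "create = Seq (Assign 31 (Bin Add (Reg 31) (Lit 1))) (Seq (St (Lit 0) (Lit 1) (Reg 31))
  (Seq (Assign 10 (Bin Add (Lit 16) (Reg 31))) (Seq (Assign 32 (Lit 0)) (Seq (Assign 33 (Lit 0)) (Seq (Assign 34 (Lit 0))
  (For 34 30 (Seq (Assign 11 (Reg 34)) (Seq (Assign 12 (Ld (Lit 2) (buf_index (Reg 32) (Reg 33)))) (Seq pIns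
   (If (Bin Less (Reg 33) (Bin Add (Reg 32) (Reg 32))) (Assign 33 (Bin Add (Reg 33) (Lit 1)))
    (Seq (Assign 33 (Lit 0)) (Assign 32 (Bin Add (Reg 32) (Lit 1))))))))))))))"

definition sqrt_insert_rest :: com where
 "sqrt_insert_rest = Seq find_block (Seq structs_in (Seq shift_in (Seq cascade_in
   (St (Lit 0) (Lit 0) (Bin Add (Reg 30) (Lit 1))))))"

definition sqrt_insert :: com where
 "sqrt_insert = Seq (Assign 30 (Ld (Lit 0) (Lit 0))) (Seq (Assign 31 (Ld (Lit 0) (Lit 1)))
  (Seq (If (Bin Eq (Reg 30) (Bin Mul (Reg 31) (Reg 31))) create Skip) sqrt_insert_rest))"

definition sqrt_delete :: com where
 "sqrt_delete = Seq (Assign 30 (Ld (Lit 0) (Lit 0))) (Seq (Assign 31 (Ld (Lit 0) (Lit 1)))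
  (Seq find_block (Seq structs_out (Seq shift_out (Seq cascade_out
   (St (Lit 0) (Lit 0) (Bin Sub (Reg 30) (Lit 1))))))))"

text \<open>The added updates all sit behind position \<open>j * j\<close>, so repeated deletion at
  this fixed position restores the copy.\<close>

definition sqrt_query :: com where
 "sqrt_query = Seq find_block (Seq (Assign 10 (Bin Add (Lit 16) (Reg 32)))
  (Seq (Assign 16 (Bin Sub (Reg 1) (Bin Mul (Reg 32) (Reg 32)))) (Seq (Assign 33 (Lit 0))
  (Seq (For 33 16 (Seq (Assign 11 (Bin Add (Bin Mul (Reg 32) (Reg 32)) (Reg 33)))
    (Seq (Assign 12 (Ld (Lit 2) (buf_index (Reg 32) (Reg 33)))) pIns)))
  (Seq (Assign 11 (Reg 1)) (Seq (Assign 12 (Reg 2)) (Seq pQry (Seq (Assign 38 (Reg 13))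
  (Seq (Assign 33 (Lit 0))
  (Seq (For 33 16 (Seq (Assign 11 (Bin Mul (Reg 32) (Reg 32))) pDel))
  (Assign 0 (Reg 38))))))))))))"

end

context words
begin

lemma bR_upd_eta [simp]: "bR R ==> v < Z ==> bR (\<lambda>a. if a = r then v else R a)"
 by (simp add: bR_def)

definition bidx :: "mem => nat => nat => nat" where
 "bidx M j k = j * U + (M (adr 1 j) + k) mod U"

lemma bidx_lt: "j < U ==> bidx M j k < U * U"
proof -
 assume "j < U"
 have "(M (adr 1 j) + k) mod U < U" using U_ge by simp
 then have "bidx M j k < Suc j * U" by (simp add: bidx_def)
 also have "\<dots> <= U * U" using \<open>j < U\<close> by (intro mult_right_mono) auto
 finally show ?thesis .
qed

lemma bidx_B [simp]: "j < U ==> bidx M j k < B"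
 using bidx_lt[of j M k] B_big(3) by linarith

lemma bidx_upd [simp]:
 "l < B ==> j < B ==> h ~= 1 ==> bidx (M(adr h l := v)) j k = bidx M j k"
 by (simp add: bidx_def)

lemma bidx_eq: "bidx M j k = bidx M j' k' \<longleftrightarrow> j = j' \<and> (M (adr 1 j) + k) mod U = (M (adr 1 j) + k') mod U"
proof
 assume *: "bidx M j k = bidx M j' k'"
 have U: "U > 0" using U_ge by simp
 have 1: "bidx M j k div U = j" for j k using U by (simp add: bidx_def)
 have "j = j'" using 1[of j k] 1[of j' k'] * by simp
 with * show "j = j' \<and> (M (adr 1 j) + k) mod U = (M (adr 1 j) + k') mod U" by (auto simp: bidx_def)
qed (auto simp: bidx_def)

lemma mod_add_eq_iff: "k < U ==> k' < U ==> (h + k) mod U = (h + k') mod U \<longleftrightarrow> k = k'"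
proof
 assume k: "k < U" "k' < U" and "(h + k) mod U = (h + k') mod U"
 then have "(int h + int k) mod int U = (int h + int k') mod int U" by (metis of_nat_add of_nat_mod)
 then have "(int h + int k - int h) mod int U = (int h + int k' - int h) mod int U" by (metis mod_diff_left_eq)
 then have "int k mod int U = int k' mod int U" by simp
 then show "k = k'" using k by simp
qed simp

lemma ev_buf_index [simp]: "R 5 = U ==> R 6 = B ==> ev R M (buf_index j k) = bidx M (ev R M j) (ev R M k)"
 by (simp add: buf_index_def bidx_def)

lemma ok_buf_index [simp]: "ok R M (buf_index j k) \<longleftrightarrow> ok R M j \<and> ok R M k"
 by (auto simp: buf_index_def)

definition buf :: "mem => nat => nat => nat" where
 "buf M j k = M (adr 2 (bidx M j k))"

text \<open>Block \<open>j\<close> is a ring buffer for the positions from \<open>j\<^sup>2\<close> to \<open>j\<^sup>2 + 2 j\<close> of the timeline.\<close>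

definition block_ok :: "mem => nat list => nat => bool" where
 "block_ok M us j \<longleftrightarrow> (\<forall>k\<le>2 * j. j * j + k < length us --> buf M j k = us ! (j * j + k))"

end

lemma buf_index_simps [simp]: "leaves (buf_index j k) = 4 + 2 * leaves j + leaves k"
 "expr_cost (buf_index j k) = 11 + 2 * expr_cost j + expr_cost k"
 by (auto simp: buf_index_def)

abbreviation squares :: "nat => 'a list => nat => 'a list" where
 "squares J us \<equiv> \<lambda>k. if k <= J then take (k * k) us else []"

definition ins_at :: "nat => 'a => 'a list => 'a list" where "ins_at i u us = take i us @ u # drop i us"
definition del_at :: "nat => 'a list => 'a list" where "del_at i us = take i us @ drop (Suc i) us"

lemma length_ins_at [simp]: "length (ins_at i u us) = Suc (length us)"
 by (simp add: ins_at_def)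
lemma length_del_at [simp]: "i < length us ==> length (del_at i us) = length us - 1"
 by (simp add: del_at_def)

lemma nth_ins_at: "i <= length us ==> p <= length us ==>
  ins_at i u us ! p = (if p < i then us ! p else if p = i then u else us ! (p - 1))"
 by (auto simp: ins_at_def nth_append nth_Cons' intro!: arg_cong[where f = "(!) us"])

lemma nth_del_at: "i < length us ==> p < length us - 1 ==>
  del_at i us ! p = (if p < i then us ! p else us ! Suc p)"
 by (auto simp: del_at_def nth_append)

text \<open>A prefix reaching beyond the insertion point loses its last update and gains the new
  one; this is why one deletion and one insertion per copy are enough.\<close>

lemma take_ins_at: "i <= length us ==> i < q ==> take q (ins_at i u us) = ins_at i u (take (q - 1) us)"
 by (auto simp: ins_at_def min_def take_Cons' drop_take)

lemma take_ins_at_le: "i <= length us ==> q <= i ==> take q (ins_at i u us) = take q us"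
 by (auto simp: ins_at_def min_def)

lemma take_del_at_le: "i < length us ==> q <= i ==> take q (del_at i us) = take q us"
 by (auto simp: del_at_def min_def)

text \<open>Conversely, the prefix gains the update that followed it, provided there is one.\<close>

lemma take_del_at: "i < length us ==> i < q ==>
  take q (del_at i us) = del_at i (take q us) @ (if q < length us then [us ! q] else [])"
 by (auto simp: del_at_def min_def drop_take take_Suc_conv_app_nth simp flip: take_add)
  (auto simp: list_eq_iff_nth_eq nth_append intro!: arg_cong[where f = "(!) us"])

context machine
begin

section \<open>Maintaining the copies and the ring buffers\<close>

definition s :: nat where "s = nat \<lfloor>sqrt (real m)\<rfloor>"

lemma le_s: "x * x <= m ==> x <= s"
proof -
 assume "x * x <= m"
 then have "real x * real x <= real m" by (metis of_nat_le_iff of_nat_mult)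
 then have "real x <= sqrt (real m)" by (intro real_le_rsqrt) (simp add: power2_eq_square)
 then show ?thesis unfolding s_def by linarith
qed

lemma s_ge: "s \<ge> 1" using le_s[of 1] m by simp

lemma s_sqrt: "real s <= sqrt (real m)" unfolding s_def by simp

lemma s_lt_U: "s < U"
proof -
 have "real s * real s <= sqrt (real m) * sqrt (real m)" using s_sqrt by (intro mult_mono) auto
 then have "real (s * s) <= real m" by simp
 then have "s * s <= m" by (simp only: of_nat_le_iff)
 moreover have "s * 1 <= s * s" using s_ge by (intro mult_left_mono) auto
 ultimately show ?thesis using nm_U by linarith
qed

lemma small_sum: "a <= U ==> b <= U ==> c <= U ==> a * b + c + c + 20 < B"
proof -
 assume "a <= U" "b <= U" "c <= U"
 then have "a * b <= U * U" by (intro mult_mono) auto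
 moreover have "U * 1 <= U * U" using U_ge by (intro mult_left_mono) auto
 moreover have "4 * 4 <= U * U" using U_ge by (intro mult_mono) auto
 ultimately show ?thesis using \<open>c <= U\<close> B_big(3) by linarith
qed

lemma find_block:
 assumes "bR R" "bM M" "R 1 = i" "i <= m"
 shows "wp w find_block (\<lambda>t R' M'. t <= 20 + 20 * s \<and> M' = M \<and>
  (\<exists>j. R' = R(32 := j) \<and> j * j <= i \<and> i < (j + 1) * (j + 1) \<and> j <= s)) R M"
proof -
 have sm: "j < Z" "(j + 1) * (j + 1) < Z" "i + 1 < Z" if "j <= s" for j
 proof -
  have "j <= U" using that s_lt_U by linarith
  then show "j < Z" "(j + 1) * (j + 1) < Z" "i + 1 < Z"
   using small_sum[of j j j] assms(4) bounds B_lt_Z by (auto simp: algebra_simps)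
 qed
 have main: "wp w (While find_cond
   (Assign 32 (Bin Add (Reg 32) (Lit 1)))) (\<lambda>t. (\<lambda>t R' M'. t <= 18 + 20 * s \<and> M' = M \<and>
  (\<exists>j. R' = R(32 := j) \<and> j * j <= i \<and> i < (j + 1) * (j + 1) \<and> j <= s)) (0 + t)) (R(32 := 0)) M"
 proof (rule wp_While[where k = s and I = "\<lambda>k \<tau> R' M'. M' = M \<and> (\<exists>j. R' = R(32 := j) \<and> j * j <= i \<and> j + k = s \<and> \<tau> <= 18 * j)"])
  fix k \<tau> R' M'
  assume I: "M' = M \<and> (\<exists>j. R' = R(32 := j) \<and> j * j <= i \<and> j + k = s \<and> \<tau> <= 18 * j)" and b: "bR R'" "bM M'"
  then obtain j where j: "M' = M" "R' = R(32 := j)" "j * j <= i" "j + k = s" "\<tau> <= 18 * j" by blast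
  have k: "0 < k" if "(j + 1) * (j + 1) <= i"
  proof -
   have "j + 1 <= s" using that assms(4) by (intro le_s) auto
   then show ?thesis using j by linarith
  qed
  show "ok R' M' find_cond \<and>
   leaves find_cond <= 10 \<and>
   (if ev R' M' find_cond = 0
    then (\<lambda>t R' M'. t <= 18 + 20 * s \<and> M' = M \<and>
  (\<exists>j. R' = R(32 := j) \<and> j * j <= i \<and> i < (j + 1) * (j + 1) \<and> j <= s)) (\<tau> + 1 + expr_cost find_cond) R' M'
    else wp w (Assign 32 (Bin Add (Reg 32) (Lit 1))) (\<lambda>t R'' M''. bR R'' \<and> bM M'' \<and> (\<exists>k'<k. M'' = M \<and>
     (\<exists>j. R'' = R(32 := j) \<and> j * j <= i \<and> j + k' = s \<and> \<tau> + 1 + expr_cost find_cond + t <= 18 * j))) R' M')"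
  proof (cases "(j + 1) * (j + 1) <= i")
   case True
   with k have "0 < k" by simp
   then obtain k' where k': "k = Suc k'" by (cases k) auto
   have "Suc j < Z" using sm(1)[of "Suc j"] j k' by simp
   moreover have "bR (R(32 := Suc j))" using assms(1) \<open>Suc j < Z\<close> by simp
   ultimately show ?thesis using True j b assms(3) sm[of j] k'
    by simp (rule exI[of _ k'], simp, rule exI[of _ "Suc j"], simp)
  next
   case False
   then show ?thesis using j b assms(3) by auto
  qed
 qed (use assms in auto)
 show ?thesis unfolding find_block_def using assms by simp (rule wp_mono[OF main[unfolded One_nat_def]], auto)
qed

text \<open>All further regions are included, not only those in use: \<open>create\<close> relies on
  its new region representing the empty timeline.\<close>

definition structs :: "mem => (nat => nat list) => bool" where
 "structs M f \<longleftrightarrow> (\<forall>k. 16 + k < B --> inst M (16 + k) (f k))"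

lemma structs_upd [simp]: "l < B ==> h < 16 ==> structs (M(adr h l := v)) f = structs M f"
 by (simp add: structs_def)

lemma structs_step:
 assumes "structs M f" "same {16 + k} M M'" "inst M' (16 + k) us" "\<And>k'. k' ~= k ==> g k' = f k'" "g k = us"
 shows "structs M' g"
 unfolding structs_def
proof (intro allI impI)
 fix k' assume "16 + k' < B"
 then show "inst M' (16 + k') (g k')"
  using assms inst_same[OF assms(2), of "16 + k'" "f k'"] by (cases "k' = k") (auto simp: structs_def)
qed

lemma structs_in:
 assumes b: "bR R" "bM M" "std R" and r: "R 1 = i" "R 2 = u" "R 30 = length us" "R 31 = J" "R 32 = j"
  and i: "i <= length us" "length us < m" "legal u" "j * j <= i" "i < (j + 1) * (j + 1)" "j < J" "J <= s + 1" "length us <= J * J"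
  and st: "structs M (squares J us)"
 shows "wp w structs_in (\<lambda>t R' M'. t <= 20 + (s + 1) * (2 * (gam * T) + 80) \<and> bR R' \<and> bM M' \<and> std R' \<and>
  keep {10, 11, 12, 13, 33, 37} R R' \<and> same {16..} M M' \<and>
  structs M' (\<lambda>k. if k <= J then take (k * k) (ins_at i u us) else [])) R M"
proof -
 define vs where "vs = ins_at i u us"
 define I where "I k R' M' \<longleftrightarrow> keep {10, 11, 12, 13, 33} (R(37 := J + 1)) R' \<and> same {16..} M M' \<and>
  structs M' (\<lambda>k'. if k' <= J then take (k' * k') (if k' < k then vs else us) else [])" for k R' M'
 have JU: "J <= U" "s + 1 <= U" using i(7) s_lt_U by linarith+
 have sm: "k < Z" "k * k < Z" "16 + k < B" "16 + k < Z" "Suc k < Z" if "k <= J" for k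
  using small_sum[of k k k] that JU B_lt_Z by auto
 have jJ: "j < Z" "Suc j < Z" "J < Z" "Suc J < Z" using sm[of J] sm[of j] i(6) by auto
 have iB: "i < Z" "u < Z" "length us < Z" "Suc (length us) < Z" using i bounds legal_lt by auto
 \<comment> \<open>For \<open>k \<le> j\<close> the prefix ends at \<open>k * k \<le> i\<close> and
   is not affected, so the invariant can claim the new prefixes up to \<open>j\<close> before the
   first round.\<close>
 have "(if k <= J then take (k * k) (if k < j + 1 then vs else us) else []) = (if k <= J then take (k * k) us else [])" for k
 proof (cases "k < j + 1")
  case True
  then have "k * k <= j * j" by (intro mult_mono) auto
  then show ?thesis using i by (simp add: vs_def take_ins_at_le)
 qed auto
 then have init: "(\<lambda>k. if k <= J then take (k * k) (if k < j + 1 then vs else us) else []) =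
  (squares J us)" by (rule ext)
 have main: "wp w (For 33 37 (Seq (Assign 10 (Bin Add (Lit 16) (Reg 33)))
   (Seq (If (Bin Less (Bin Mul (Reg 33) (Reg 33)) (Bin Add (Reg 30) (Lit 1)))
     (Seq (Assign 11 (Bin Sub (Bin Mul (Reg 33) (Reg 33)) (Lit 1))) pDel) Skip)
   (Seq (Assign 11 (Reg 1)) (Seq (Assign 12 (Reg 2)) pIns)))))
   (\<lambda>t R' M'. t <= 4 + (J + 1 - (j + 1)) * (2 * (gam * T) + 60 + 8) \<and> bR R' \<and> bM M' \<and> I (J + 1) R' M')
   (R(33 := j + 1, 37 := J + 1)) M"
 proof (rule wp_For[where a = "j + 1" and z = "J + 1" and I = I])
  show "I (j + 1) (R(33 := j + 1, 37 := J + 1)) M"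
   unfolding I_def init using st by (simp add: keep_def)
 next
  fix k R' M'
  assume k: "j + 1 <= k" "k < J + 1" and I: "I k R' M'" and R': "R' 33 = k" "R' 37 = J + 1" "bR R'" "bM M'"
  have kJ: "k <= J" using k by simp
  note smk = sm[OF kJ]
  have stR: "std R'"
   by (rule std_keep[of "{10, 11, 12, 13, 33}" "R(37 := J + 1)"]) (use I b in \<open>simp_all add: I_def\<close>)
  have rr: "R' 1 = i" "R' 2 = u" "R' 30 = length us"
   using I r by (auto simp: I_def keep_def)
  have instk: "inst M' (16 + k) (take (k * k) us)" using I smk kJ unfolding I_def structs_def by auto
  have ik: "i < k * k"
  proof -
   have "(j + 1) * (j + 1) <= k * k" using k by (intro mult_mono) auto
   then show ?thesis using i by linarith
  qed
  have tk: "take (k * k) vs = ins_at i u (take (k * k - 1) us)" using i ik by (simp add: vs_def take_ins_at)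
  let ?R = "R'(10 := 16 + k)"
  have ins: "wp w pIns (\<lambda>t R'' M''. t <= gam * T \<and> R'' 33 = k \<and> R'' 37 = J + 1 \<and> bR R'' \<and> bM M'' \<and>
    I (Suc k) (R''(33 := Suc k)) M'') (R1(11 := i, 12 := u)) M1"
   if "bR R1" "bM M1" "keep {11, 12, 13} ?R R1" "same {16 + k} M' M1" "inst M1 (16 + k) (take (k * k - 1) us)" for R1 M1
  proof -
   have s1: "std R1" using std_keep[OF that(3)] stR by simp
   have r1: "R1 1 = i" "R1 2 = u" "R1 10 = 16 + k" using that(3) rr by (auto simp: keep_def)
   let ?R1 = "R1(11 := i, 12 := u)"
   have b1: "bR ?R1" "std ?R1" using that s1 iB by auto
   have "wp w pIns (\<lambda>t R' M'. t <= gam * T \<and> bR R' \<and> bM M' \<and> keep {12, 13} ?R1 R' \<and> std R' \<and>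
    inst M' (16 + k) (take i (take (k * k - 1) us) @ u # drop i (take (k * k - 1) us)) \<and> same {16 + k} M1 M') ?R1 M1"
    by (rule pIns[OF b1(1) that(2) b1(2)]) (use that r1 smk i ik in auto)
   then show ?thesis
   proof (rule wp_mono, elim conjE)
    fix t R'' M''
    assume 2: "t <= gam * T" "bR R''" "bM M''" "keep {12, 13} ?R1 R''"
     "inst M'' (16 + k) (take i (take (k * k - 1) us) @ u # drop i (take (k * k - 1) us))" "same {16 + k} M1 M''"
    have e: "inst M'' (16 + k) (take (k * k) vs)" using 2(5) tk by (simp add: ins_at_def)
    have s2: "same {16 + k} M' M''" using same_trans[OF that(4) 2(6)] by simp
    have "structs M'' (\<lambda>k'. if k' <= J then take (k' * k') (if k' < Suc k then vs else us) else [])"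
     by (rule structs_step[OF _ s2 e, where f = "\<lambda>k'. if k' <= J then take (k' * k') (if k' < k then vs else us) else []"])
      (use I kJ in \<open>auto simp: I_def less_Suc_eq\<close>)
    moreover have "keep {10, 11, 12, 13, 33} (R(37 := J + 1)) (R''(33 := Suc k))"
     using 2(4) that(3) I by (auto simp: I_def keep_def)
    moreover have "same {16..} M M''" using I s2 by (auto simp: I_def same_def)
    moreover have "R'' 33 = k" "R'' 37 = J + 1" using 2(4) that(3) R' by (auto simp: keep_def)
    ultimately show "t <= gam * T \<and> R'' 33 = k \<and> R'' 37 = J + 1 \<and> bR R'' \<and> bM M'' \<and> I (Suc k) (R''(33 := Suc k)) M''"
     using 2 by (simp add: I_def)
   qed
  qed
  have br: "bR ?R" using R' smk by simp
  show "wp w (Seq (Assign 10 (Bin Add (Lit 16) (Reg 33)))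
   (Seq (If (Bin Less (Bin Mul (Reg 33) (Reg 33)) (Bin Add (Reg 30) (Lit 1)))
     (Seq (Assign 11 (Bin Sub (Bin Mul (Reg 33) (Reg 33)) (Lit 1))) pDel) Skip)
   (Seq (Assign 11 (Reg 1)) (Seq (Assign 12 (Reg 2)) pIns))))
   (\<lambda>t R'' M''. t <= 2 * (gam * T) + 60 \<and> R'' 33 = k \<and> R'' 37 = J + 1 \<and> bR R'' \<and> bM M'' \<and> I (Suc k) (R''(33 := Suc k)) M'') R' M'"
  proof (cases "k * k <= length us")
   case False
   \<comment> \<open>This copy holds the whole timeline with room to spare, so nothing has to leave
     it.\<close>
   then have "take (k * k) us = us" "take (k * k - 1) us = us" by auto
   then have A: "inst M' (16 + k) (take (k * k - 1) us)" using instk by simp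
   note ins1 = ins[OF br R'(4) keep_refl same_refl A]
   have "\<not> k * k < Suc (length us)" using False by simp
   then show ?thesis using R' stR rr smk iB by simp (rule wp_mono[OF ins1], simp)
  next
   case True
   have kk: "k * k - Suc 0 < Z" "Suc 0 <= k * k" using smk ik by linarith+
   let ?R1 = "?R(11 := k * k - Suc 0)"
   have b1: "bR ?R1" "std ?R1" using br stR kk by auto
   have del: "wp w pDel (\<lambda>t R2 M2. t <= gam * T \<and> bR R2 \<and> bM M2 \<and> keep {12, 13} ?R1 R2 \<and> std R2 \<and>
    inst M2 (16 + k) (take (k * k - 1) (take (k * k) us) @ drop (Suc (k * k - 1)) (take (k * k) us)) \<and> same {16 + k} M' M2) ?R1 M'"
    by (rule pDel[OF b1(1) R'(4) b1(2)]) (use instk smk True kk i in auto)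
   have "k * k < Suc (length us)" using True by simp
   then show ?thesis using R' stR rr smk iB kk
   proof (simp, intro wp_mono[OF del], elim conjE, goal_cases)
    case (1 t R2 M2)
    note 2 = 1
    have tt: "take (k * k - 1) (take (k * k) us) @ drop (Suc (k * k - 1)) (take (k * k) us) = take (k * k - 1) us"
     using kk by (simp add: min_def)
    have kp: "keep {11, 12, 13} ?R R2" using 2 by (auto simp: keep_def)
    have r2: "R2 1 = i" "R2 2 = u" using kp rr by (auto simp: keep_def)
    have i2: "inst M2 (16 + k) (take (k * k - 1) us)" using 2 tt by simp
    have b2: "bR R2" "bM M2" "same {16 + k} M' M2" "std R2" using 2 by auto
    show ?case using b2 r2 iB \<open>t <= gam * T\<close> by simp (rule wp_mono[OF ins[OF b2(1,2) kp b2(3) i2]], simp)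
   qed
  qed
 qed (use i jJ b r in auto)
 have "(J + 1 - (j + 1)) * (2 * (gam * T) + 60 + 8) <= (s + 1) * (2 * (gam * T) + 68)"
  using i(7) by (intro mult_mono) auto
 also have "\<dots> <= (s + 1) * (2 * (gam * T) + 80)" by (intro mult_left_mono) auto
 finally have time: "(J + 1 - (j + 1)) * (2 * (gam * T) + 60 + 8) <= (s + 1) * (2 * (gam * T) + 80)" .
 have fin: "structs M' (\<lambda>k. if k <= J then take (k * k) vs else [])" if "I (J + 1) R' M'" for R' M'
 proof -
  have "(\<lambda>k'. if k' <= J then take (k' * k') (if k' < J + 1 then vs else us) else []) = (\<lambda>k. if k <= J then take (k * k) vs else [])"
   by auto
  with that show ?thesis unfolding I_def by (simp only:)
 qed
 show ?thesis unfolding structs_in_def using b r jJ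
 proof (simp, intro wp_mono[OF main[unfolded One_nat_def add_Suc_right add_0_right]], elim conjE, goal_cases)
  case (1 t R' M')
  have I: "I (J + 1) R' M'" using 1 by simp
  have "keep {10, 11, 12, 13, 33, 37} R R'" using I by (auto simp: I_def keep_def)
  moreover have "std R'"
   by (rule std_keep[of "{10, 11, 12, 13, 33}" "R(37 := J + 1)"]) (use I b in \<open>simp_all add: I_def\<close>)
  ultimately show ?case using 1 time fin[OF I, unfolded vs_def] I by (simp add: I_def)
 qed
qed

end

declare One_nat_def [simp del]

context words
begin

lemma one_lt [simp]: "1 < Z" "1 < B" "0 < B"
 using B_big B_lt_Z by linarith+

lemma buf_upd [simp]: "j < U ==> j' < U ==> k < U ==> k' < U ==>
  buf (M(adr 2 (bidx M j k) := v)) j' k' = (if j = j' \<and> k = k' then v else buf M j' k')"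
 using U_lt_B B_big by (auto simp: buf_def bidx_eq mod_add_eq_iff)

lemma buf_upd_other [simp]: "l < B ==> j < U ==> h \<notin> {1, 2} ==> buf (M(adr h l := v)) j k = buf M j k"
 using B_big by (auto simp: buf_def)

lemma buf_same: "same H M M' ==> 1 \<notin> H ==> 2 \<notin> H ==> j < U ==> buf M' j k = buf M j k"
proof -
 assume *: "same H M M'" "1 \<notin> H" "2 \<notin> H" "j < U"
 have "M' (adr 1 j) = M (adr 1 j)" by (rule sameD[OF *(1)]) (use * B_big in auto)
 then have "bidx M' j k = bidx M j k" by (simp add: bidx_def)
 then show ?thesis using * by (simp add: buf_def sameD[OF *(1)])
qed

lemma block_ok_same: "same H M M' ==> 1 \<notin> H ==> 2 \<notin> H ==> j < U ==> block_ok M' us j = block_ok M us j"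
 by (simp add: block_ok_def buf_same)

lemma block_ok_upd: "l < B ==> j < U ==> h \<notin> {1, 2} ==> block_ok (M(adr h l := v)) us j = block_ok M us j"
 by (simp add: block_ok_def)

text \<open>Index 0 now names what was slot \<open>U - 1\<close>; \<open>cascade_in\<close>
  overwrites it at once with the incoming update.\<close>

lemma buf_rotate_right:
 assumes "b < U" "b' < U" "k < U"
 shows "buf (M(adr 1 b := (M (adr 1 b) + (U - 1)) mod U)) b' k =
  (if b' = b then (if k = 0 then buf M b (U - 1) else buf M b (k - 1)) else buf M b' k)"
proof -
 have U: "U > 0" "U < B" using U_ge B_big by linarith+
 let ?h = "M (adr 1 b)"
 have "((?h + (U - 1)) mod U + k) mod U = (?h + (if k = 0 then U - 1 else k - 1)) mod U"
 proof (cases k)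
  case (Suc k')
  have "((?h + (U - 1)) mod U + k) mod U = (?h + (U - 1) + k) mod U" by (simp add: mod_add_left_eq)
  also have "?h + (U - 1) + k = ?h + k' + U" using U Suc by simp
  finally show ?thesis using Suc by simp
 qed simp
 then have "bidx (M(adr 1 b := (?h + (U - 1)) mod U)) b' k = bidx M b' (if b' = b then if k = 0 then U - 1 else k - 1 else k)"
  using assms U by (auto simp: bidx_def simp del: diff_add_assoc diff_add_assoc2)
 then show ?thesis unfolding buf_def using assms U by simp
qed

lemma buf_rotate_left:
 assumes "b < U" "b' < U"
 shows "buf (M(adr 1 b := (M (adr 1 b) + 1) mod U)) b' k = (if b' = b then buf M b (k + 1) else buf M b' k)"
proof -
 have U: "U > 0" "U < B" using U_ge B_big by linarith+
 have "((M (adr 1 b) + 1) mod U + k) mod U = (M (adr 1 b) + (k + 1)) mod U"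
  by (simp only: mod_add_left_eq add.assoc add.commute[of 1 k])
 then have "bidx (M(adr 1 b := (M (adr 1 b) + 1) mod U)) b' k = bidx M b' (if b' = b then k + 1 else k)"
  using assms U by (simp add: bidx_def)
 then show ?thesis unfolding buf_def using assms U by simp
qed

text \<open>Like \<open>block_ok\<close> but without the last slot \<open>2 * j\<close>: the
  condition of a block that has lost an entry and not yet received the first one of its
  successor.\<close>

definition partial_ok :: "mem => nat list => nat => bool" where
 "partial_ok M us j \<longleftrightarrow> (\<forall>k<2 * j. j * j + k < length us --> buf M j k = us ! (j * j + k))"

end

context machine
begin

lemma std_upd_eta [simp]: "r > 6 ==> std (\<lambda>a. if a = r then v else R a) = std R"
 unfolding std_def by simp

text \<open>\<open>j * j \<le> m < U\<close> forces \<open>2 * j < U\<close>, so the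
  \<open>2 * j + 1\<close> entries of a block fit into a ring of \<open>U\<close> slots.\<close>

lemma block_bounds: "j <= s ==> j < U \<and> 2 * j < U \<and> 2 * j + 1 <= U \<and> j * j + 2 * j + 1 < B \<and> j < Z \<and> j + j + 1 < Z \<and> j * j < Z \<and> j < B"
proof -
 assume j: "j <= s"
 have "real s * real s <= sqrt (real m) * sqrt (real m)" using s_sqrt by (intro mult_mono) auto
 then have "real (s * s) <= real m" by simp
 then have "s * s <= m" by (simp only: of_nat_le_iff)
 moreover have "j * j <= s * s" using j by (intro mult_mono) auto
 ultimately have jj: "j * j < U" using nm_U by linarith
 have 1: "2 * j < U"
 proof (cases "j <= 1")
  case False
  then have "2 * j <= j * j" by (intro mult_right_mono) auto
  with jj show ?thesis by linarith
 qed (use U_ge in linarith)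
 then have "j < U" by linarith
 moreover have "j * j + 2 * j + 1 < B" using jj 1 B_big by linarith
 moreover have "j < B" "j + j + 1 < B" "j * j < B" using jj 1 \<open>j < U\<close> B_big by linarith+
 ultimately show ?thesis using 1 B_lt_Z by linarith
qed

lemma shift_in:
 assumes b: "bR R" "bM M" "std R" and r: "R 1 = i" "R 2 = u" "R 32 = j"
  and i: "i <= length us" "length us < m" "u < Z" "j * j <= i" "i < (j + 1) * (j + 1)" "j <= s" and ok: "block_ok M us j"
 shows "wp w shift_in (\<lambda>t R' M'. t <= 30 + (2 * s + 1) * 80 \<and> bR R' \<and> bM M' \<and> std R' \<and>
  keep {33, 35, 36, 37} R R' \<and> same {2} M M' \<and> (\<forall>j'<U. j' ~= j --> block_ok M us j' --> block_ok M' us j') \<and>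
  block_ok M' (ins_at i u us) j \<and> ((j + 1) * (j + 1) <= length us --> R' 35 = ins_at i u us ! ((j + 1) * (j + 1)))) R M"
proof -
 define vs where "vs = ins_at i u us"
 note bb = block_bounds[OF i(6)]
 have iB: "i < Z" using i bounds by linarith
 have vs: "vs ! p = (if p < i then us ! p else if p = i then u else us ! (p - 1))" if "p <= length us" for p
  using nth_ins_at[OF i(1) that] by (simp add: vs_def)
 \<comment> \<open>Slots before \<open>k\<close> already show the new timeline, the others still the
   old one; register 35 is the update that belongs into slot \<open>k\<close>.\<close>
 define I where "I k R' M' \<longleftrightarrow> keep {33, 35, 36} (R(37 := j + j + 1)) R' \<and> same {2} M M' \<and>
  (\<forall>j'<U. j' ~= j --> block_ok M us j' --> block_ok M' us j') \<and>
  (\<forall>q<k. q <= 2 * j --> j * j + q <= length us --> buf M' j q = vs ! (j * j + q)) \<and>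
  (\<forall>q. k <= q --> q <= 2 * j --> j * j + q < length us --> buf M' j q = us ! (j * j + q)) \<and>
  (j * j + k <= length us --> R' 35 = vs ! (j * j + k))" for k R' M'
 have main: "wp w (For 33 37 (Seq (Assign 36 (Ld (Lit 2) (buf_index (Reg 32) (Reg 33))))
   (Seq (St (Lit 2) (buf_index (Reg 32) (Reg 33)) (Reg 35)) (Assign 35 (Reg 36)))))
   (\<lambda>t R' M'. t <= 4 + (j + j + 1 - (i - j * j)) * (60 + 8) \<and> bR R' \<and> bM M' \<and> I (j + j + 1) R' M')
   (R(35 := u, 33 := i - j * j, 37 := j + j + 1)) M"
 proof (rule wp_For[where a = "i - j * j" and z = "j + j + 1" and I = I])
  show "I (i - j * j) (R(35 := u, 33 := i - j * j, 37 := j + j + 1)) M"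
   unfolding I_def using i ok by (auto simp: keep_def vs block_ok_def)
 next
  fix k R' M'
  assume k: "i - j * j <= k" "k < j + j + 1" and I: "I k R' M'" and R': "R' 33 = k" "R' 37 = j + j + 1" "bR R'" "bM M'"
  have st: "std R'" by (rule std_keep[of "{33, 35, 36}" "R(37 := j + j + 1)"]) (use I b in \<open>simp_all add: I_def\<close>)
  have r2: "R' 32 = j" using I r by (auto simp: I_def keep_def)
  have kU: "k < U" using k bb by linarith
  have next_carry: "buf M' j k = vs ! Suc (j * j + k)" if "Suc (j * j + k) <= length us"
  proof -
   have "buf M' j k = us ! (j * j + k)" using I that k by (auto simp: I_def)
   moreover have "vs ! Suc (j * j + k) = us ! (j * j + k)" using vs[OF that] k i by auto
   ultimately show ?thesis by simp
  qed
  let ?M = "M'(adr 2 (bidx M' j k) := R' 35)"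
  have "I (Suc k) (R'(36 := buf M' j k, 35 := buf M' j k, 33 := Suc k)) ?M"
   unfolding I_def
  proof (intro conjI allI impI)
   show "keep {33, 35, 36} (R(37 := j + j + 1)) (R'(36 := buf M' j k, 35 := buf M' j k, 33 := Suc k))"
    using I by (auto simp: I_def keep_def)
   show "same {2} M ?M" using I bb by (auto simp: I_def intro!: same_upd)
   fix j' assume j': "j' < U" "j' ~= j" "block_ok M us j'"
   have "j' < B" using j' U_lt_B B_big by linarith
   then have "buf ?M j' q = buf M' j' q" for q using j' bb by (simp add: buf_def bidx_eq)
   moreover have "block_ok M' us j'" using I j' by (simp add: I_def)
   ultimately show "block_ok ?M us j'" by (simp add: block_ok_def)
  next
   fix q assume "q < Suc k" "q <= 2 * j" "j * j + q <= length us"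
   then show "buf ?M j q = vs ! (j * j + q)" using I kU bb by (auto simp: I_def less_Suc_eq)
  next
   fix q assume "Suc k <= q" "q <= 2 * j" "j * j + q < length us"
   then show "buf ?M j q = us ! (j * j + q)" using I kU bb by (auto simp: I_def)
  next
   assume "j * j + Suc k <= length us"
   then show "(R'(36 := buf M' j k, 35 := buf M' j k, 33 := Suc k)) 35 = vs ! (j * j + Suc k)" using next_carry by simp
  qed
  note In = this
  have bz: "buf M' j k < Z" using R' by (simp add: buf_def)
  show "wp w (Seq (Assign 36 (Ld (Lit 2) (buf_index (Reg 32) (Reg 33))))
   (Seq (St (Lit 2) (buf_index (Reg 32) (Reg 33)) (Reg 35)) (Assign 35 (Reg 36))))
   (\<lambda>t R'' M''. t <= 60 \<and> R'' 33 = k \<and> R'' 37 = j + j + 1 \<and> bR R'' \<and> bM M'' \<and> I (Suc k) (R''(33 := Suc k)) M'') R' M'"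
   using R' st r2 bz In by (simp flip: buf_def)
 qed (use i bb b in \<open>auto simp: algebra_simps\<close>)
 have "(j + j + 1 - (i - j * j)) * (60 + 8) <= (2 * s + 1) * 80" using i(6) by (intro mult_mono) auto
 note time = this
 show ?thesis unfolding shift_in_def using b r iB i bb
 proof (simp, intro wp_mono[OF main], elim conjE, goal_cases)
  case (1 t R' M')
  have I: "I (j + j + 1) R' M'" using 1 by simp
  have "block_ok M' vs j" using I i(1) by (auto simp: I_def block_ok_def vs_def)
  moreover have "R' 35 = vs ! ((j + 1) * (j + 1))" if "(j + 1) * (j + 1) <= length us"
  proof -
   have "(j + 1) * (j + 1) = j * j + (j + j + 1)" by (simp add: algebra_simps)
   then show ?thesis using I that unfolding I_def by metis
  qed
  moreover have "keep {33, 35, 36, 37} R R'" using I by (auto simp: I_def keep_def)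
  moreover have "std R'" by (rule std_keep[of "{33, 35, 36}" "R(37 := j + j + 1)"]) (use I b in \<open>simp_all add: I_def\<close>)
  ultimately show ?case using 1 time I by (simp add: vs_def I_def)
 qed
qed

lemma cascade_in:
 assumes b: "bR R" "bM M" "std R" and r: "R 31 = J" "R 32 = j"
  and i: "i <= length us" "length us < m" "j * j <= i" "i < (j + 1) * (j + 1)" "j < J" "J <= s + 1"
  and ok: "\<forall>b<J. block_ok M (if b < j + 1 then ins_at i u us else us) b"
  and carry: "(j + 1) * (j + 1) <= length us --> R 35 = ins_at i u us ! ((j + 1) * (j + 1))"
 shows "wp w cascade_in (\<lambda>t R' M'. t <= 30 + (s + 1) * 120 \<and> bR R' \<and> bM M' \<and> std R' \<and>
  keep {33, 35, 36} R R' \<and> same {1, 2} M M' \<and> (\<forall>b<J. block_ok M' (ins_at i u us) b)) R M"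
proof -
 define vs where "vs = ins_at i u us"
 have vs: "vs ! p = (if p < i then us ! p else if p = i then u else us ! (p - 1))" if "p <= length us" for p
  using nth_ins_at[OF i(1) that] by (simp add: vs_def)
 define I where "I k R' M' \<longleftrightarrow> keep {33, 35, 36} R R' \<and> same {1, 2} M M' \<and>
  (\<forall>b<J. block_ok M' (if b < k then vs else us) b) \<and> (k * k <= length us --> R' 35 = vs ! (k * k))" for k R' M'
 have jJ: "J < Z" "j + 1 < Z" using block_bounds[of "J - 1"] block_bounds[of j] i bounds s_lt_U by linarith+
 have main: "wp w (For 33 31 (Seq (Assign 36 (Ld (Lit 2) (buf_index (Reg 33) (Bin Add (Reg 33) (Reg 33)))))
   (Seq (St (Lit 1) (Reg 33) (Bin Mod (Bin Add (Ld (Lit 1) (Reg 33)) (Bin Sub (Reg 5) (Lit 1))) (Reg 5)))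
   (Seq (St (Lit 2) (buf_index (Reg 33) (Lit 0)) (Reg 35)) (Assign 35 (Reg 36))))))
   (\<lambda>t R' M'. t <= 4 + (J - (j + 1)) * (90 + 8) \<and> bR R' \<and> bM M' \<and> I J R' M') (R(33 := j + 1)) M"
 proof (rule wp_For[where a = "j + 1" and z = J and I = I])
  show "I (j + 1) (R(33 := j + 1)) M" unfolding I_def using ok carry by (auto simp: keep_def vs_def)
 next
  fix k R' M'
  assume k: "j + 1 <= k" "k < J" and I: "I k R' M'" and R': "R' 33 = k" "R' 31 = J" "bR R'" "bM M'"
  have st: "std R'" by (rule std_keep[of "{33, 35, 36}" R]) (use I b in \<open>simp_all add: I_def\<close>)
  have "k <= s" using k i by linarith
  note kb = block_bounds[OF this]
  have bU: "b < U" if "b < J" for b using block_bounds[of b] that i(6) by linarith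
  have U1: "U \<ge> 1" "U - 1 < U" using U_ge by linarith+
  have ik: "i < k * k"
  proof -
   have "(j + 1) * (j + 1) <= k * k" using k by (intro mult_mono) auto
   then show ?thesis using i by linarith
  qed
  define M1 where "M1 = M'(adr 1 k := (M' (adr 1 k) + (U - 1)) mod U)"
  have rot: "buf M1 b q = (if b = k then if q = 0 then buf M' k (U - 1) else buf M' k (q - 1) else buf M' b q)"
   if "b < U" "q < U" for b q unfolding M1_def using that kb by (intro buf_rotate_right) auto
  have sm1: "same {1, 2} M M1" unfolding M1_def using I kb by (auto simp: I_def intro!: same_upd)
  let ?M1 = M1
  let ?M = "?M1(adr 2 (bidx ?M1 k 0) := R' 35)"
  have buf2: "buf ?M b q = (if b = k then if q = 0 then R' 35 else buf M' k (q - 1) else buf M' b q)" if "b < U" "q < U" for b q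
   using that kb U1 by (simp add: rot)
  have okus: "block_ok M' us k" using I k by (auto simp: I_def)
  have "I (Suc k) (R'(36 := buf M' k (k + k), 35 := buf M' k (k + k), 33 := Suc k)) ?M"
   unfolding I_def
  proof (intro conjI allI impI)
   show "keep {33, 35, 36} R (R'(36 := buf M' k (k + k), 35 := buf M' k (k + k), 33 := Suc k))"
    using I by (auto simp: I_def keep_def)
   show "same {1, 2} M ?M" using sm1 kb by (intro same_upd) auto
  next
   fix b assume bJ: "b < J"
   have okb: "block_ok M' (if b < k then vs else us) b" using I bJ by (simp add: I_def)
   note bbb = block_bounds[of b]
   show "block_ok ?M (if b < Suc k then vs else us) b"
   proof (cases "b = k")
    case False
    then show ?thesis using okb bbb bJ i(6) by (auto simp: block_ok_def buf2 less_Suc_eq)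
   next
    case True
    have "buf ?M k q = vs ! (k * k + q)" if q: "q <= 2 * k" "k * k + q < length vs" for q
    proof (cases q)
     case 0
     then show ?thesis using buf2[of k 0] kb I q by (simp add: I_def vs_def)
    next
     case (Suc q')
     then have "buf M' k q' = us ! (k * k + q')" using okus q by (auto simp: block_ok_def vs_def)
     moreover have "vs ! (k * k + q) = us ! (k * k + q')" using vs[of "k * k + q"] q Suc ik by (auto simp: vs_def)
     ultimately show ?thesis using buf2[of k q] q kb Suc by simp
    qed
    with True show ?thesis by (simp add: block_ok_def)
   qed
  next
   assume le: "Suc k * Suc k <= length us"
   have "buf M' k (k + k) = us ! (k * k + (k + k))" using okus le by (auto simp: block_ok_def)
   moreover have e: "Suc k * Suc k = k * k + (k + k) + 1" by simp
   have "vs ! (k * k + (k + k) + 1) = us ! (k * k + (k + k))" using vs[of "k * k + (k + k) + 1"] le ik unfolding e by simp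
   then have "vs ! (Suc k * Suc k) = us ! (k * k + (k + k))" unfolding e .
   ultimately show "(R'(36 := buf M' k (k + k), 35 := buf M' k (k + k), 33 := Suc k)) 35 = vs ! (Suc k * Suc k)" by simp
  qed
  note In = this
  have bz: "buf M' k (k + k) < Z" using R' by (simp add: buf_def)
  have mz: "(M' (adr 1 k) + (U - 1)) mod U < Z" using U_ge bounds by (intro less_trans[OF mod_less_divisor]) auto
  show "wp w (Seq (Assign 36 (Ld (Lit 2) (buf_index (Reg 33) (Bin Add (Reg 33) (Reg 33)))))
   (Seq (St (Lit 1) (Reg 33) (Bin Mod (Bin Add (Ld (Lit 1) (Reg 33)) (Bin Sub (Reg 5) (Lit 1))) (Reg 5)))
   (Seq (St (Lit 2) (buf_index (Reg 33) (Lit 0)) (Reg 35)) (Assign 35 (Reg 36)))))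
   (\<lambda>t R'' M''. t <= 90 \<and> R'' 33 = k \<and> R'' 31 = J \<and> bR R'' \<and> bM M'' \<and> I (Suc k) (R''(33 := Suc k)) M'') R' M'"
   using R' st bz mz In[unfolded M1_def] U1 kb by (simp flip: buf_def)
 qed (use i jJ b r in auto)
 have "(J - (j + 1)) * (90 + 8) <= (s + 1) * 120" using i(6) by (intro mult_mono) auto
 note time = this
 show ?thesis unfolding cascade_in_def using b r jJ block_bounds[of j] i
 proof (simp, intro wp_mono[OF main], elim conjE, goal_cases)
  case (1 t R' M')
  have I: "I J R' M'" using 1 by simp
  have "std R'" by (rule std_keep[of "{33, 35, 36}" R]) (use I b in \<open>simp_all add: I_def\<close>)
  then show ?case using 1 time I by (simp add: vs_def I_def)
 qed
qed

lemma shift_out: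
 assumes b: "bR R" "bM M" "std R" and r: "R 1 = i" "R 32 = j"
  and i: "i < length us" "length us <= m" "j * j <= i" "i < (j + 1) * (j + 1)" "j <= s" and ok: "block_ok M us j"
 shows "wp w shift_out (\<lambda>t R' M'. t <= 30 + (2 * s + 1) * 80 \<and> bR R' \<and> bM M' \<and> std R' \<and>
  keep {33, 37} R R' \<and> same {2} M M' \<and> (\<forall>j'<U. j' ~= j --> block_ok M us j' --> block_ok M' us j') \<and>
  partial_ok M' (del_at i us) j) R M"
proof -
 define vs where "vs = del_at i us"
 note bb = block_bounds[OF i(5)]
 have iB: "i < Z" using i bounds by linarith
 have lv: "length vs = length us - 1" using i by (simp add: vs_def)
 have vs: "vs ! p = (if p < i then us ! p else us ! Suc p)" if "p < length us - 1" for p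
  using nth_del_at[OF i(1) that] by (simp add: vs_def)
 define I where "I k R' M' \<longleftrightarrow> keep {33} (R(37 := j + j)) R' \<and> same {2} M M' \<and>
  (\<forall>j'<U. j' ~= j --> block_ok M us j' --> block_ok M' us j') \<and>
  (\<forall>q<k. q < 2 * j --> j * j + q < length us - 1 --> buf M' j q = vs ! (j * j + q)) \<and>
  (\<forall>q. k <= q --> q <= 2 * j --> j * j + q < length us --> buf M' j q = us ! (j * j + q))" for k R' M'
 have le: "i - j * j <= j + j" using i(4) by (simp add: algebra_simps)
 have main: "wp w (For 33 37 (St (Lit 2) (buf_index (Reg 32) (Reg 33)) (Ld (Lit 2) (buf_index (Reg 32) (Bin Add (Reg 33) (Lit 1))))))
   (\<lambda>t R' M'. t <= 4 + (j + j - (i - j * j)) * (60 + 8) \<and> bR R' \<and> bM M' \<and> I (j + j) R' M')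
   (R(33 := i - j * j, 37 := j + j)) M"
 proof (rule wp_For[where a = "i - j * j" and z = "j + j" and I = I])
  show "I (i - j * j) (R(33 := i - j * j, 37 := j + j)) M"
   unfolding I_def using i ok by (auto simp: keep_def vs block_ok_def)
 next
  fix k R' M'
  assume k: "i - j * j <= k" "k < j + j" and I: "I k R' M'" and R': "R' 33 = k" "R' 37 = j + j" "bR R'" "bM M'"
  have st: "std R'" by (rule std_keep[of "{33}" "R(37 := j + j)"]) (use I b in \<open>simp_all add: I_def\<close>)
  have r2: "R' 32 = j" using I r by (auto simp: I_def keep_def)
  have kU: "k < U" "k + 1 < U" using k bb by linarith+
  let ?M = "M'(adr 2 (bidx M' j k) := buf M' j (k + 1))"
  have "I (Suc k) (R'(33 := Suc k)) ?M"
   unfolding I_def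
  proof (intro conjI allI impI)
   show "keep {33} (R(37 := j + j)) (R'(33 := Suc k))"
    using I by (auto simp: I_def keep_def)
   show "same {2} M ?M" using I bb by (auto simp: I_def intro!: same_upd)
   fix j' assume j': "j' < U" "j' ~= j" "block_ok M us j'"
   have "j' < B" using j' U_lt_B B_big by linarith
   then have "buf ?M j' q = buf M' j' q" for q using j' bb by (simp add: buf_def bidx_eq)
   moreover have "block_ok M' us j'" using I j' by (simp add: I_def)
   ultimately show "block_ok ?M us j'" by (simp add: block_ok_def)
  next
   fix q assume q: "q < Suc k" "q < 2 * j" "j * j + q < length us - 1"
   show "buf ?M j q = vs ! (j * j + q)"
   proof (cases "q = k")
    case False
    then show ?thesis using I q kU bb by (auto simp: I_def)
   next
    case True
    have e: "j * j + (k + 1) = Suc (j * j + k)" by simp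
    have "buf M' j (k + 1) = us ! Suc (j * j + k)" using I q True k by (auto simp: I_def e)
    moreover have "vs ! (j * j + k) = us ! Suc (j * j + k)" using vs[OF q(3)] k i True by auto
    ultimately show ?thesis using True kU bb by simp
   qed
  next
   fix q assume "Suc k <= q" "q <= 2 * j" "j * j + q < length us"
   then show "buf ?M j q = us ! (j * j + q)" using I kU bb by (auto simp: I_def)
  qed
  note In = this
  have bz: "buf M' j (k + 1) < Z" using R' by (simp add: buf_def)
  show "wp w (St (Lit 2) (buf_index (Reg 32) (Reg 33)) (Ld (Lit 2) (buf_index (Reg 32) (Bin Add (Reg 33) (Lit 1)))))
   (\<lambda>t R'' M''. t <= 60 \<and> R'' 33 = k \<and> R'' 37 = j + j \<and> bR R'' \<and> bM M'' \<and> I (Suc k) (R''(33 := Suc k)) M'') R' M'"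
   using R' st r2 bz In by (simp flip: buf_def)
 qed (use i bb b le in \<open>auto simp: algebra_simps\<close>)
 have "(j + j - (i - j * j)) * (60 + 8) <= (2 * s + 1) * 80" using i(5) by (intro mult_mono) auto
 note time = this
 show ?thesis unfolding shift_out_def using b r iB i bb
 proof (simp, intro wp_mono[OF main], elim conjE, goal_cases)
  case (1 t R' M')
  have I: "I (j + j) R' M'" using 1 by simp
  have "partial_ok M' vs j" using I by (auto simp: I_def partial_ok_def lv)
  moreover have "keep {33, 37} R R'" using I by (auto simp: I_def keep_def)
  moreover have "std R'" by (rule std_keep[of "{33}" "R(37 := j + j)"]) (use I b in \<open>simp_all add: I_def\<close>)
  ultimately show ?case using 1 time I by (simp add: vs_def I_def)
 qed
qed

lemma cascade_out:
 assumes b: "bR R" "bM M" "std R" and r: "R 31 = J" "R 32 = j"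
  and i: "i < length us" "length us <= m" "j * j <= i" "i < (j + 1) * (j + 1)" "j < J" "J <= s + 1" "length us <= J * J"
  and ok: "\<forall>b<J. b ~= j --> block_ok M (if b < j then del_at i us else us) b" "partial_ok M (del_at i us) j"
 shows "wp w cascade_out (\<lambda>t R' M'. t <= 30 + (s + 1) * 120 \<and> bR R' \<and> bM M' \<and> std R' \<and>
  keep {33, 34} R R' \<and> same {1, 2} M M' \<and> (\<forall>b<J. block_ok M' (del_at i us) b)) R M"
proof -
 define vs where "vs = del_at i us"
 have lv: "length vs = length us - 1" using i by (simp add: vs_def)
 have vs: "vs ! p = (if p < i then us ! p else us ! Suc p)" if "p < length us - 1" for p
  using nth_del_at[OF i(1) that] by (simp add: vs_def)
 \<comment> \<open>Only block \<open>k - 1\<close> is incomplete: its last slot stays open until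
   round \<open>k\<close> fills it.\<close>
 define I where "I k R' M' \<longleftrightarrow> keep {33, 34} R R' \<and> same {1, 2} M M' \<and>
  (\<forall>b<J. b + 1 ~= k --> block_ok M' (if b + 1 < k then vs else us) b) \<and> partial_ok M' vs (k - 1)" for k R' M'
 have jJ: "J < Z" "j + 1 < Z" using block_bounds[of "J - 1"] block_bounds[of j] i bounds s_lt_U by linarith+
 have main: "wp w (For 33 31 (Seq (Assign 34 (Bin Sub (Reg 33) (Lit 1)))
   (Seq (St (Lit 2) (buf_index (Reg 34) (Bin Add (Reg 34) (Reg 34))) (Ld (Lit 2) (buf_index (Reg 33) (Lit 0))))
   (St (Lit 1) (Reg 33) (Bin Mod (Bin Add (Ld (Lit 1) (Reg 33)) (Lit 1)) (Reg 5))))))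
   (\<lambda>t R' M'. t <= 4 + (J - (j + 1)) * (90 + 8) \<and> bR R' \<and> bM M' \<and> I J R' M') (R(33 := j + 1)) M"
 proof (rule wp_For[where a = "j + 1" and z = J and I = I])
  show "I (j + 1) (R(33 := j + 1)) M" unfolding I_def using ok by (auto simp: keep_def vs_def)
 next
  fix k R' M'
  assume k: "j + 1 <= k" "k < J" and I: "I k R' M'" and R': "R' 33 = k" "R' 31 = J" "bR R'" "bM M'"
  have st: "std R'" by (rule std_keep[of "{33, 34}" R]) (use I b in \<open>simp_all add: I_def\<close>)
  obtain k' where k': "k = Suc k'" using k by (cases k) auto
  have "k <= s" "k' <= s" using k k' i by linarith+
  note kb = block_bounds[OF this(1)] block_bounds[OF this(2)]
  have bU: "b < U" if "b < J" for b using block_bounds[of b] that i(6) by linarith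
  have U1: "U \<ge> 1" "0 < U" using U_ge by linarith+
  have ik: "i < k * k"
  proof -
   have "(j + 1) * (j + 1) <= k * k" using k by (intro mult_mono) auto
   then show ?thesis using i by linarith
  qed
  define M1 where "M1 = M'(adr 2 (bidx M' k' (k' + k')) := buf M' k 0)"
  have buf1: "buf M1 b q = (if b = k' \<and> q = k' + k' then buf M' k 0 else buf M' b q)" if "b < U" "q < U" for b q
   unfolding M1_def using that kb by simp
  have m1: "M1 (adr 1 k) = M' (adr 1 k)" unfolding M1_def using kb by simp
  define M2 where "M2 = M1(adr 1 k := (M1 (adr 1 k) + 1) mod U)"
  have buf2: "buf M2 b q = (if b = k then buf M1 k (q + 1) else buf M1 b q)" if "b < U" for b q
   unfolding M2_def using that kb by (intro buf_rotate_left) auto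
  have okus: "block_ok M' us k" using I k by (auto simp: I_def)
  have first: "buf M' k 0 = us ! (k * k)" if "k * k < length us" using okus that by (auto simp: block_ok_def)
  have "I (Suc k) (R'(34 := k', 33 := Suc k)) M2"
   unfolding I_def
  proof (intro conjI allI impI)
   show "keep {33, 34} R (R'(34 := k', 33 := Suc k))"
    using I by (auto simp: I_def keep_def)
   show "same {1, 2} M M2" unfolding M2_def M1_def using kb I by (auto simp: I_def intro!: same_upd)
  next
   fix b assume bJ: "b < J" "b + 1 ~= Suc k"
   then have bk: "b ~= k" by simp
   show "block_ok M2 (if b + 1 < Suc k then vs else us) b"
   proof (cases "b = k'")
    case False
    have "block_ok M' (if b + 1 < k then vs else us) b" using I bJ False k' by (simp add: I_def)
    moreover have "b + 1 < k \<longleftrightarrow> b + 1 < Suc k" using False bk k' by auto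
    ultimately have "block_ok M' (if b + 1 < Suc k then vs else us) b" by simp
    moreover have "buf M2 b q = buf M' b q" if "q <= 2 * b" for q
     using buf2[of b q] buf1[of b q] False bk bU[OF bJ(1)] that block_bounds[of b] bJ(1) i(6) by simp
    ultimately show ?thesis by (simp add: block_ok_def)
   next
    case True
    have "buf M2 k' q = vs ! (k' * k' + q)" if q: "q <= 2 * k'" "k' * k' + q < length vs" for q
    proof (cases "q = 2 * k'")
     case False
     then have "buf M' k' q = vs ! (k' * k' + q)" using I q k' by (auto simp: I_def partial_ok_def)
     then show ?thesis using buf2[of k' q] buf1[of k' q] k' kb q False by simp
    next
     case 2: True
     have e: "Suc (k' * k' + q) = k * k" using 2 k' by simp
     have "k * k < length us" using q(2) e lv by linarith
     moreover have "vs ! (k' * k' + q) = us ! (k * k)" using vs[of "k' * k' + q"] q(2) lv ik e by auto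
     ultimately show ?thesis using buf2[of k' q] buf1[of k' q] k' kb 2 first by simp
    qed
    with True k' show ?thesis by (simp add: block_ok_def)
   qed
  next
   show "partial_ok M2 vs (Suc k - 1)" unfolding partial_ok_def
   proof (intro allI impI)
    fix q assume q: "q < 2 * (Suc k - 1)" "(Suc k - 1) * (Suc k - 1) + q < length vs"
    have e: "k * k + (q + 1) = Suc (k * k + q)" by simp
    have "buf M' k (q + 1) = us ! Suc (k * k + q)" using okus q lv by (auto simp: block_ok_def e)
    moreover have "vs ! (k * k + q) = us ! Suc (k * k + q)" using vs[of "k * k + q"] q lv ik by auto
    ultimately show "buf M2 (Suc k - 1) q = vs ! ((Suc k - 1) * (Suc k - 1) + q)"
     using buf2[of k q] buf1[of k "q + 1"] kb k' q by simp
   qed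
  qed
  note In = this
  have bz: "buf M' k 0 < Z" using R' by (simp add: buf_def)
  have mz: "(M' (adr 1 k) + 1) mod U < Z" using U1 bounds by (intro less_trans[OF mod_less_divisor]) auto
  have kk: "k - 1 = k'" "1 <= k" using k' by auto
  show "wp w (Seq (Assign 34 (Bin Sub (Reg 33) (Lit 1)))
   (Seq (St (Lit 2) (buf_index (Reg 34) (Bin Add (Reg 34) (Reg 34))) (Ld (Lit 2) (buf_index (Reg 33) (Lit 0))))
   (St (Lit 1) (Reg 33) (Bin Mod (Bin Add (Ld (Lit 1) (Reg 33)) (Lit 1)) (Reg 5)))))
   (\<lambda>t R'' M''. t <= 90 \<and> R'' 33 = k \<and> R'' 31 = J \<and> bR R'' \<and> bM M'' \<and> I (Suc k) (R''(33 := Suc k)) M'') R' M'"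
   using R' st bz mz In[unfolded M2_def m1] U1 kb kk m1 unfolding M1_def by (simp flip: buf_def)
 qed (use i jJ b r in auto)
 have "(J - (j + 1)) * (90 + 8) <= (s + 1) * 120" using i(6) by (intro mult_mono) auto
 note time = this
 show ?thesis unfolding cascade_out_def using b r jJ block_bounds[of j] i
 proof (simp, intro wp_mono[OF main], elim conjE, goal_cases)
  case (1 t R' M')
  have I: "I J R' M'" using 1 by simp
  have "std R'" by (rule std_keep[of "{33, 34}" R]) (use I b in \<open>simp_all add: I_def\<close>)
  moreover have "block_ok M' vs b" if "b < J" for b
  proof (cases "b + 1 = J")
   case False
   then show ?thesis using I that by (auto simp: I_def dest!: spec[of _ b])
  next
   case True
   \<comment> \<open>The last block has no successor to fill its final slot. That slot is position
     \<open>J * J - 1\<close>, which lies beyond the end of the timeline after a deletion.\<close>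
   have "b * b + 2 * b + 1 = J * J" using True by (auto simp: algebra_simps)
   then have "q < 2 * b" if "q <= 2 * b" "b * b + q < length vs" for q
    using that lv i(1,7) by (cases "q = 2 * b") auto
   moreover have "partial_ok M' vs b" using I True by (auto simp: I_def)
   ultimately show ?thesis by (auto simp: block_ok_def partial_ok_def)
  qed
  ultimately show ?case using 1 time I by (simp add: vs_def I_def)
 qed
qed

lemma structs_out:
 assumes b: "bR R" "bM M" "std R" and r: "R 1 = i" "R 30 = length us" "R 31 = J" "R 32 = j"
  and i: "i < length us" "length us <= m" "set us \<subseteq> legal_updates D n m" "j * j <= i" "i < (j + 1) * (j + 1)" "j < J"
   "J <= s + 1" "length us <= J * J"
  and st: "structs M (squares J us)" and blk: "\<forall>b<J. block_ok M us b"
 shows "wp w structs_out (\<lambda>t R' M'. t <= 20 + (s + 1) * (2 * (gam * T) + 80) \<and> bR R' \<and> bM M' \<and> std R' \<and>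
  keep {10, 11, 12, 13, 33, 37} R R' \<and> same {16..} M M' \<and>
  structs M' (\<lambda>k. if k <= J then take (k * k) (del_at i us) else [])) R M"
proof -
 define vs where "vs = del_at i us"
 define I where "I k R' M' \<longleftrightarrow> keep {10, 11, 12, 13, 33} (R(37 := J + 1)) R' \<and> same {16..} M M' \<and>
  structs M' (\<lambda>k'. if k' <= J then take (k' * k') (if k' < k then vs else us) else [])" for k R' M'
 have JU: "J <= U" "s + 1 <= U" using i(7) s_lt_U by linarith+
 have sm: "k < Z" "k * k < Z" "16 + k < B" "16 + k < Z" "Suc k < Z" "k < B" if "k <= J" for k
  using small_sum[of k k k] that JU B_lt_Z by auto
 have jJ: "j < Z" "j + 1 < Z" "J < Z" "J + 1 < Z" using sm[of J] sm[of j] i(6) by auto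
 have iB: "i < Z" "length us < Z" using i bounds by auto
 have "(if k <= J then take (k * k) (if k < j + 1 then vs else us) else []) = (if k <= J then take (k * k) us else [])" for k
 proof (cases "k < j + 1")
  case True
  then have "k * k <= j * j" by (intro mult_mono) auto
  then show ?thesis using i by (simp add: vs_def take_del_at_le)
 qed auto
 then have init: "(\<lambda>k. if k <= J then take (k * k) (if k < j + 1 then vs else us) else []) =
  (squares J us)" by (rule ext)
 have main: "wp w (For 33 37 (Seq (Assign 10 (Bin Add (Lit 16) (Reg 33)))
   (Seq (Assign 11 (Reg 1)) (Seq pDel
   (If (Bin Less (Bin Mul (Reg 33) (Reg 33)) (Reg 30))
     (Seq (Assign 11 (Bin Sub (Bin Mul (Reg 33) (Reg 33)) (Lit 1)))
     (Seq (Assign 12 (Ld (Lit 2) (buf_index (Reg 33) (Lit 0)))) pIns)) Skip)))))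
   (\<lambda>t R' M'. t <= 4 + (J + 1 - (j + 1)) * (2 * (gam * T) + 60 + 8) \<and> bR R' \<and> bM M' \<and> I (J + 1) R' M')
   (R(33 := j + 1, 37 := J + 1)) M"
 proof (rule wp_For[where a = "j + 1" and z = "J + 1" and I = I])
  show "I (j + 1) (R(33 := j + 1, 37 := J + 1)) M"
   unfolding I_def init using st by (simp add: keep_def)
 next
  fix k R' M'
  assume k: "j + 1 <= k" "k < J + 1" and I: "I k R' M'" and R': "R' 33 = k" "R' 37 = J + 1" "bR R'" "bM M'"
  have kJ: "k <= J" using k by simp
  note smk = sm[OF kJ]
  have stR: "std R'"
   by (rule std_keep[of "{10, 11, 12, 13, 33}" "R(37 := J + 1)"]) (use I b in \<open>simp_all add: I_def\<close>)
  have rr: "R' 1 = i" "R' 30 = length us" using I r by (auto simp: I_def keep_def)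
  have instk: "inst M' (16 + k) (take (k * k) us)" using I smk kJ unfolding I_def structs_def by auto
  have ik: "i < k * k"
  proof -
   have "(j + 1) * (j + 1) <= k * k" using k by (intro mult_mono) auto
   then show ?thesis using i by linarith
  qed
  have tk: "take (k * k) vs = del_at i (take (k * k) us) @ (if k * k < length us then [us ! (k * k)] else [])"
   using i ik by (simp add: vs_def take_del_at)
  let ?R = "R'(10 := 16 + k, 11 := i)"
  have br: "bR ?R" "std ?R" using R' smk iB stR by auto
  have del: "wp w pDel (\<lambda>t R2 M2. t <= gam * T \<and> bR R2 \<and> bM M2 \<and> keep {12, 13} ?R R2 \<and> std R2 \<and>
    inst M2 (16 + k) (take i (take (k * k) us) @ drop (Suc i) (take (k * k) us)) \<and> same {16 + k} M' M2) ?R M'"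
   by (rule pDel[OF br(1) R'(4) br(2)]) (use instk smk i ik in auto)
  have close: "I (Suc k) (R3(33 := Suc k)) M3"
   if "keep {11, 12, 13} ?R R3" "same {16 + k} M' M3" "inst M3 (16 + k) (take (k * k) vs)" for R3 M3
  proof -
   have "structs M3 (\<lambda>k'. if k' <= J then take (k' * k') (if k' < Suc k then vs else us) else [])"
    by (rule structs_step[OF _ that(2,3), where f = "\<lambda>k'. if k' <= J then take (k' * k') (if k' < k then vs else us) else []"])
     (use I kJ in \<open>auto simp: I_def less_Suc_eq\<close>)
   moreover have "keep {10, 11, 12, 13, 33} (R(37 := J + 1)) (R3(33 := Suc k))"
    using that(1) I by (auto simp: I_def keep_def)
   moreover have "same {16..} M M3" using I that(2) by (auto simp: I_def same_def)
   ultimately show ?thesis by (simp add: I_def)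
  qed
  show "wp w (Seq (Assign 10 (Bin Add (Lit 16) (Reg 33)))
   (Seq (Assign 11 (Reg 1)) (Seq pDel
   (If (Bin Less (Bin Mul (Reg 33) (Reg 33)) (Reg 30))
     (Seq (Assign 11 (Bin Sub (Bin Mul (Reg 33) (Reg 33)) (Lit 1)))
     (Seq (Assign 12 (Ld (Lit 2) (buf_index (Reg 33) (Lit 0)))) pIns)) Skip))))
   (\<lambda>t R'' M''. t <= 2 * (gam * T) + 60 \<and> R'' 33 = k \<and> R'' 37 = J + 1 \<and> bR R'' \<and> bM M'' \<and> I (Suc k) (R''(33 := Suc k)) M'') R' M'"
  proof (simp add: R' stR rr smk iB, rule wp_mono[OF del], elim conjE, goal_cases)
   case (1 t R2 M2)
   note 2 = this
   have r2: "R2 33 = k" "R2 37 = J + 1" "R2 30 = length us" "R2 10 = 16 + k" using 2(4) R' rr by (auto simp: keep_def)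
   have kp2: "keep {11, 12, 13} ?R R2" using 2(4) by (auto simp: keep_def)
   have d2: "inst M2 (16 + k) (del_at i (take (k * k) us))" using 2(6) by (simp add: del_at_def)
   show ?case
   proof (cases "k * k < length us")
    case False
    then have "inst M2 (16 + k) (take (k * k) vs)" using d2 tk by simp
    from close[OF kp2 2(7) this] show ?thesis using 2 r2 smk iB False by simp
   next
    case True
    \<comment> \<open>There is an update at position \<open>k * k\<close>, while the timeline has at
      most \<open>J * J\<close> updates; so block \<open>k\<close> is one of those
      maintained.\<close>
    have kJ': "k < J"
    proof (rule ccontr)
     assume "\<not> k < J"
     then have "J * J <= k * k" using kJ by simp
     then show False using True i by linarith
    qed
    then have ks: "k <= s" using i by linarith
    note kb = block_bounds[OF ks]
    have "buf M' k 0 = us ! (k * k)"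
    proof -
     have "same {16..} M M'" using I by (simp add: I_def)
     then have "block_ok M' us k" using block_ok_same[of "{16..}" M M' k us] blk kJ' kb by auto
     then show ?thesis using True by (auto simp: block_ok_def)
    qed
    moreover have "buf M2 k 0 = buf M' k 0" by (rule buf_same[OF 2(7)]) (use kb in auto)
    ultimately have bv: "buf M2 k 0 = us ! (k * k)" by simp
    have leg: "legal (us ! (k * k))" using True i(3) by (auto simp: subset_iff)
    have kk: "k * k - 1 < Z" "1 <= k * k" using smk ik by linarith+
    let ?R2 = "R2(11 := k * k - 1, 12 := us ! (k * k))"
    have b2: "bR ?R2" "std ?R2" using 2 kk leg legal_lt by auto
    have len: "length (del_at i (take (k * k) us)) = k * k - 1" using True ik by (simp add: min_def)
    have ins: "wp w pIns (\<lambda>t R3 M3. t <= gam * T \<and> bR R3 \<and> bM M3 \<and> keep {12, 13} ?R2 R3 \<and> std R3 \<and>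
     inst M3 (16 + k) (take (k * k - 1) (del_at i (take (k * k) us)) @ us ! (k * k) # drop (k * k - 1) (del_at i (take (k * k) us)))
     \<and> same {16 + k} M2 M3) ?R2 M2"
     by (rule pIns[OF b2(1) 2(3) b2(2)]) (use d2 r2 smk len leg True i in auto)
    have e: "take (k * k - 1) (del_at i (take (k * k) us)) @ us ! (k * k) # drop (k * k - 1) (del_at i (take (k * k) us)) = take (k * k) vs"
     using len True tk by simp
    show ?thesis using 2 r2 smk iB True kk bv
    proof (simp flip: buf_def, intro wp_mono[OF ins], elim conjE, goal_cases)
     case (1 t3 R3 M3)
     have "keep {11, 12, 13} ?R R3" using \<open>keep {12, 13} ?R2 R3\<close> kp2 by (auto simp: keep_def)
     moreover have "same {16 + k} M' M3" using same_trans[OF \<open>same {16 + k} M' M2\<close> \<open>same {16 + k} M2 M3\<close>] by simp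
     moreover have "inst M3 (16 + k) (take (k * k) vs)" using 1 e by simp
     ultimately have "I (Suc k) (R3(33 := Suc k)) M3" by (rule close)
     moreover have "R3 33 = k" "R3 37 = J + 1" using \<open>keep {12, 13} ?R2 R3\<close> r2 by (auto simp: keep_def)
     ultimately show ?case using \<open>t <= gam * T\<close> \<open>t3 <= gam * T\<close> \<open>bR R3\<close> \<open>bM M3\<close> by simp
    qed
   qed
  qed
 qed (use i jJ b r in auto)
 have "(J + 1 - (j + 1)) * (2 * (gam * T) + 60 + 8) <= (s + 1) * (2 * (gam * T) + 68)"
  using i(7) by (intro mult_mono) auto
 also have "\<dots> <= (s + 1) * (2 * (gam * T) + 80)" by (intro mult_left_mono) auto
 finally have time: "(J + 1 - (j + 1)) * (2 * (gam * T) + 60 + 8) <= (s + 1) * (2 * (gam * T) + 80)" .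
 have fin: "structs M' (\<lambda>k. if k <= J then take (k * k) vs else [])" if "I (J + 1) R' M'" for R' M'
 proof -
  have "(\<lambda>k'. if k' <= J then take (k' * k') (if k' < J + 1 then vs else us) else []) = (\<lambda>k. if k <= J then take (k * k) vs else [])"
   by auto
  with that show ?thesis unfolding I_def by (simp only:)
 qed
 show ?thesis unfolding structs_out_def using b r jJ
 proof (simp, intro wp_mono[OF main], elim conjE, goal_cases)
  case (1 t R' M')
  have I: "I (J + 1) R' M'" using 1 by simp
  have "keep {10, 11, 12, 13, 33, 37} R R'" using I by (auto simp: I_def keep_def)
  moreover have "std R'"
   by (rule std_keep[of "{10, 11, 12, 13, 33}" "R(37 := J + 1)"]) (use I b in \<open>simp_all add: I_def\<close>)
  ultimately show ?case using 1 time fin[OF I, unfolded vs_def] I by (simp add: I_def)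
 qed
qed

lemma create:
 assumes b: "bR R" "bM M" "std R" and r: "R 30 = length us" "R 31 = J"
  and i: "length us <= m" "set us \<subseteq> legal_updates D n m" "length us < m" "length us = J * J"
  and st: "structs M (squares J us)" and blk: "\<forall>b<J. block_ok M us b"
 shows "wp w create (\<lambda>t R' M'. t <= 50 + (J * J) * (gam * T + 100) \<and> bR R' \<and> bM M' \<and> std R' \<and>
  keep {10, 11, 12, 13, 31, 32, 33, 34} R R' \<and> same ({0} \<union> {16..}) M M' \<and> R' 31 = J + 1 \<and>
  M' (adr 0 0) = M (adr 0 0) \<and> M' (adr 0 1) = J + 1 \<and>
  structs M' (\<lambda>k. if k <= J + 1 then take (k * k) us else [])) R M"
proof -
 \<comment> \<open>\<open>J * J\<close> is the present length, hence at most \<open>m\<close>, and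
   the new copy has a number of at most \<open>s + 1\<close>.\<close>
 have Js: "J <= s" by (rule le_s) (use i in simp)
 note Jb = block_bounds[OF Js]
 let ?h = "16 + (J + 1)"
 have hB: "?h < B" "?h < Z" "J + 1 < Z" "J + 1 < B" using Jb B_big B_lt_Z U_ge by linarith+
 have oB: "(0::nat) < B" "(1::nat) < B" "0 < Z" "1 < Z" using B_big B_lt_Z by linarith+
 let ?M = "M(adr 0 1 := J + 1)"
 let ?R = "R(31 := J + 1, 10 := ?h, 32 := 0, 33 := 0, 34 := 0)"
 have "inst M ?h []" using st[unfolded structs_def, rule_format, of "J + 1"] hB by simp
 then have inst0: "inst ?M ?h []" using oB by simp
 \<comment> \<open>The registers 32 and 33 keep the position decomposed as \<open>j * j + k\<close>
   with \<open>k \<le> 2 * j\<close>, which saves computing a square root in each round.\<close>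
 define I where "I p R' M' \<longleftrightarrow> keep {11, 12, 13, 32, 33, 34} (R(31 := J + 1, 10 := ?h)) R' \<and> same {?h} ?M M' \<and>
  inst M' ?h (take p us) \<and> R' 32 * R' 32 + R' 33 = p \<and> R' 33 <= 2 * R' 32" for p R' M'
 have main: "wp w (For 34 30 (Seq (Assign 11 (Reg 34)) (Seq (Assign 12 (Ld (Lit 2) (buf_index (Reg 32) (Reg 33)))) (Seq pIns
   (If (Bin Less (Reg 33) (Bin Add (Reg 32) (Reg 32))) (Assign 33 (Bin Add (Reg 33) (Lit 1)))
    (Seq (Assign 33 (Lit 0)) (Assign 32 (Bin Add (Reg 32) (Lit 1)))))))))
   (\<lambda>t R' M'. t <= 4 + (length us - 0) * (gam * T + 80 + 8) \<and> bR R' \<and> bM M' \<and> I (length us) R' M')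
   ?R ?M"
 proof (rule wp_For[where a = 0 and z = "length us" and I = I])
  show "I 0 ?R ?M" using inst0 by (simp add: I_def keep_def)
 next
  fix p R' M'
  assume p: "p < length us" and I: "I p R' M'" and R': "R' 34 = p" "R' 30 = length us" "bR R'" "bM M'"
  have stR: "std R'"
   by (rule std_keep[of "{11, 12, 13, 32, 33, 34}" "R(31 := J + 1, 10 := ?h)"]) (use I b in \<open>simp_all add: I_def\<close>)
  have r10: "R' 10 = ?h" using I by (auto simp: I_def keep_def)
  define j k where "j = R' 32" and "k = R' 33"
  have jk: "j * j + k = p" "k <= 2 * j" "R' 32 = j" "R' 33 = k" using I by (auto simp: I_def j_def k_def)
  have jJ: "j < J"
  proof (rule ccontr)
   assume "\<not> j < J"
   then have "J * J <= j * j" by (intro mult_mono) auto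
   then show False using jk p i by linarith
  qed
  have js: "j <= s" using jJ Js by simp
  note jb = block_bounds[OF js]
  have bv: "buf M' j k = us ! p"
  proof -
   have "same {0, ?h} M M'" using I oB by (auto simp: I_def same_def)
   then have "block_ok M' us j" using block_ok_same[of "{0, ?h}" M M' j us] blk jJ jb by auto
   then show ?thesis using p jk by (auto simp: block_ok_def)
  qed
  have leg: "legal (us ! p)" using p i(2) by (auto simp: subset_iff)
  have pZ: "p < Z" using p i bounds by linarith
  let ?R1 = "R'(11 := p, 12 := us ! p)"
  have b1: "bR ?R1" "std ?R1" using R' stR leg legal_lt pZ by auto
  have ins: "wp w pIns (\<lambda>t R3 M3. t <= gam * T \<and> bR R3 \<and> bM M3 \<and> keep {12, 13} ?R1 R3 \<and> std R3 \<and>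
     inst M3 ?h (take p (take p us) @ us ! p # drop p (take p us)) \<and> same {?h} M' M3) ?R1 M'"
   by (rule pIns[OF b1(1) R'(4) b1(2)]) (use I r10 hB p leg i in \<open>auto simp: I_def\<close>)
  have kU: "k + 1 < Z" "j + 1 < Z" "j + j < Z" using jk jb bounds by linarith+
  show "wp w (Seq (Assign 11 (Reg 34)) (Seq (Assign 12 (Ld (Lit 2) (buf_index (Reg 32) (Reg 33)))) (Seq pIns
   (If (Bin Less (Reg 33) (Bin Add (Reg 32) (Reg 32))) (Assign 33 (Bin Add (Reg 33) (Lit 1)))
    (Seq (Assign 33 (Lit 0)) (Assign 32 (Bin Add (Reg 32) (Lit 1))))))))
   (\<lambda>t R'' M''. t <= gam * T + 80 \<and> R'' 34 = p \<and> R'' 30 = length us \<and> bR R'' \<and> bM M'' \<and> I (Suc p) (R''(34 := Suc p)) M'') R' M'"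
  proof (simp add: R' stR jk pZ bv flip: buf_def, rule wp_mono[OF ins], elim conjE, goal_cases)
   case (1 t R3 M3)
   note 3 = this
   have r3: "R3 32 = j" "R3 33 = k" "R3 34 = p" "R3 30 = length us" using 3(4) jk R' by (auto simp: keep_def)
   have i3: "inst M3 ?h (take (Suc p) us)" using 3(6) p by (simp add: take_Suc_conv_app_nth)
   have kp: "keep {11, 12, 13, 32, 33, 34} (R(31 := J + 1, 10 := ?h)) R3" using 3(4) I by (auto simp: I_def keep_def)
   have sm: "same {?h} ?M M3" using I 3(7) by (auto simp: I_def same_def)
   show ?case
   proof (cases "k < j + j")
    case True
    then show ?thesis using 3 r3 kU i3 kp sm jk by (auto simp: I_def keep_def)
   next
    case False
    then have "k = j + j" using jk by simp
    then have "(j + 1) * (j + 1) = Suc p" using jk by (simp add: algebra_simps)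
    then show ?thesis using False 3 r3 kU i3 kp sm jk by (auto simp: I_def keep_def)
   qed
  qed
 qed (use b r hB oB i bounds in auto)
 have "(length us - 0) * (gam * T + 80 + 8) <= (J * J) * (gam * T + 100)" using i(4) by (intro mult_mono) auto
 note time = this
 have "16 + (J + 1) = 17 + J" by simp
 note main' = main[unfolded this]
 show ?thesis unfolding create_def using b r hB oB
 proof (simp, intro wp_mono[OF main'], elim conjE, goal_cases)
  case (1 t R' M')
  have I: "I (length us) R' M'" using 1 by simp
  have s1: "same {?h} ?M M'" using I by (simp add: I_def)
  have "structs M' (\<lambda>k. if k <= J + 1 then take (k * k) us else [])"
  proof (rule structs_step[OF _ s1, where us = us and f = "\<lambda>k. if k <= J then take (k * k) us else []"])
   show "structs ?M (squares J us)" using st oB by simp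
   show "inst M' ?h us" using I by (simp add: I_def)
   have "J * J <= (J + 1) * (J + 1)" by (intro mult_mono) auto
   then show "(if J + 1 <= J + 1 then take ((J + 1) * (J + 1)) us else []) = us" using i(4) by simp
  qed auto
  moreover have "keep {10, 11, 12, 13, 31, 32, 33, 34} R R'" using I by (auto simp: I_def keep_def)
  moreover have "std R'"
   by (rule std_keep[of "{11, 12, 13, 32, 33, 34}" "R(31 := J + 1, 10 := ?h)"]) (use I b in \<open>simp_all add: I_def\<close>)
  moreover have "same ({0} \<union> {16..}) M M'" using s1 oB by (auto simp: same_def)
  moreover have "M' (adr 0 0) = M (adr 0 0)" "M' (adr 0 1) = J + 1" using s1 oB by (auto simp: same_def)
  moreover have "R' 31 = J + 1" using I by (auto simp: I_def keep_def)
  ultimately show ?case using 1 time by simp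
 qed
qed

text \<open>The number \<open>p\<close> bounds the number of insertions so far; it pays for the creation of the
 structures, of which the \<open>J\<close>-th one costs \<open>(J - 1)\<^sup>2\<close> insertions.\<close>

definition sqrt_inv :: "nat list => mem => nat => bool" where
 "sqrt_inv us M p \<longleftrightarrow> bM M \<and> length us <= m \<and> set us \<subseteq> legal_updates D n m \<and> M (adr 0 0) = length us \<and>
  length us <= M (adr 0 1) * M (adr 0 1) \<and> (M (adr 0 1) - 1) * (M (adr 0 1) - 1) <= p \<and> length us <= p \<and> p <= m \<and>
  (\<forall>b<M (adr 0 1). block_ok M us b) \<and>
  structs M (\<lambda>k. if k <= M (adr 0 1) then take (k * k) us else [])"

text \<open>Each increment of \<open>p\<close> earns \<open>s\<close> units, one unit being worth an
  insertion into a copy. The subtracted cube accounts for what creations have consumed: raising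
  \<open>J\<close> by one uses \<open>J * J\<close> units, and \<open>(J - 1)^3\<close> grows by at
  least as much. The difference does not truncate, because \<open>(J - 1)^2 \<le> p\<close> and
  \<open>J - 1 \<le> s\<close>.\<close>

definition sqrt_pot :: "mem => nat => nat" where
 "sqrt_pot M p = (gam * T + 100) * (s * p - (M (adr 0 1) - 1) * (M (adr 0 1) - 1) * (M (adr 0 1) - 1))"

definition sqrt_cost :: nat where "sqrt_cost = 6 * gam + 3000"

lemma sqrt_inv_J: "sqrt_inv us M p ==> M (adr 0 1) <= s + 1"
proof -
 assume "sqrt_inv us M p"
 then have "(M (adr 0 1) - 1) * (M (adr 0 1) - 1) <= m" by (auto simp: sqrt_inv_def)
 then have "M (adr 0 1) - 1 <= s" by (rule le_s)
 then show ?thesis by simp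
qed

text \<open>Blank memory means \<open>J = 0\<close>. The very first insertion therefore finds
  \<open>length us = J * J\<close> and creates copy 1.\<close>

lemma sqrt_inv_blank: "sqrt_inv [] blank 0"
 using inst_blank by (auto simp: sqrt_inv_def blank_def bM_def structs_def)

text \<open>Collects the loops over copies and blocks together with the \<open>s\<close> units put
  aside for later creations.\<close>

lemma sqrt_time:
 assumes "t <= 200 + 20 * s + (s + 1) * (2 * (gam * T) + 80) + (2 * s + 1) * 80 + (s + 1) * 120"
 shows "t + s * (gam * T + 100) <= sqrt_cost * (s * T)"
proof -
 define g q where "g = gam * (s * T)" and "q = s * T"
 have 1: "s <= q" "1 <= q" "gam * T <= g" using s_ge T mult_le_mono[OF s_ge T] by (auto simp: g_def q_def)
 have "(s + 1) * (2 * (gam * T) + 80) = 2 * g + 2 * (gam * T) + 80 * s + 80" by (simp add: g_def algebra_simps)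
 moreover have "s * (gam * T + 100) = g + 100 * s" by (simp add: g_def algebra_simps)
 moreover have "sqrt_cost * (s * T) = 6 * g + 3000 * q" by (simp add: sqrt_cost_def g_def q_def algebra_simps)
 moreover have "(2 * s + 1) * 80 = 160 * s + 80" "(s + 1) * 120 = 120 * s + 120" by simp_all
 ultimately have "t <= 480 + 380 * s + 2 * g + 2 * (gam * T)" using assms by (simp only:)
 then show ?thesis using 1 \<open>s * (gam * T + 100) = g + 100 * s\<close> \<open>sqrt_cost * (s * T) = 6 * g + 3000 * q\<close> by linarith
qed

lemma sqrt_insert:
 assumes b: "bR R" "std R" and r: "R 1 = i" "R 2 = u" and inv: "sqrt_inv us M p"
  and i: "i <= length us" "length us < m" "legal u"
 shows "wp w sqrt_insert (\<lambda>t R' M'. \<exists>p'. sqrt_inv (ins_at i u us) M' p' \<and>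
  t + sqrt_pot M' p' <= sqrt_pot M p + sqrt_cost * (s * T)) R M"
proof -
 have M: "bM M" "set us \<subseteq> legal_updates D n m" "M (adr 0 0) = length us" using inv by (auto simp: sqrt_inv_def)
 define J where "J = M (adr 0 1)"
 have J: "J <= s + 1" "length us <= J * J" "(J - 1) * (J - 1) <= p" "\<forall>b<J. block_ok M us b"
  "structs M (squares J us)"
  using inv sqrt_inv_J[OF inv] by (auto simp: sqrt_inv_def J_def)
 have p: "length us <= p" "p <= m" using inv by (auto simp: sqrt_inv_def)
 \<comment> \<open>\<open>p\<close> grows only when the timeline reaches a new maximal length. This
   preserves \<open>p \<le> m\<close> although the number of insertions is unbounded.\<close>
 define p' where "p' = (if p = length us then p + 1 else p)"
 have p': "p <= p'" "p' <= p + 1" "length us + 1 <= p'" "p' <= m" using p i by (auto simp: p'_def)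
 let ?R = "R(30 := length us, 31 := J)"
 have oB: "(0::nat) < B" "(1::nat) < B" using B_big by linarith+
 have JZ: "J < Z" "length us < Z" "length us + 1 < Z" using J(1) s_lt_U bounds i by linarith+
 have bR: "bR ?R" "std ?R" using b JZ by auto
 \<comment> \<open>The part after a possible creation is treated once, for whatever number
   \<open>J1\<close> of copies there is by then.\<close>
 have rest: "wp w sqrt_insert_rest
  (\<lambda>t R' M'. t <= 120 + 20 * s + (s + 1) * (2 * (gam * T) + 80) + (2 * s + 1) * 80 + (s + 1) * 120 \<and>
   bM M' \<and> M' (adr 0 0) = length us + 1 \<and> M' (adr 0 1) = J1 \<and> (\<forall>b<J1. block_ok M' (ins_at i u us) b) \<and>
   structs M' (\<lambda>k. if k <= J1 then take (k * k) (ins_at i u us) else [])) R1 M1"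
  if 1: "bR R1" "bM M1" "std R1" "R1 1 = i" "R1 2 = u" "R1 30 = length us" "R1 31 = J1" "M1 (adr 0 1) = J1" "J1 <= s + 1"
   "length us < J1 * J1" "\<forall>b<J1. block_ok M1 us b" "structs M1 (\<lambda>k. if k <= J1 then take (k * k) us else [])"
  for R1 M1 J1
  unfolding sqrt_insert_rest_def wp_Seq
 proof (rule wp_mono[OF find_block[OF 1(1,2,4)]], use i in simp, elim conjE exE, goal_cases)
  case (1 t2 R2 M2 j)
  note 2 = this
  have jJ: "j < J1"
  proof (rule ccontr)
   assume "\<not> j < J1"
   then have "J1 * J1 <= j * j" by (intro mult_mono) auto
   then show False using 2 that(10) i by linarith
  qed
  have jZ: "j < Z" using block_bounds[of j] 2 by simp
  have b2: "bR R2" "std R2" using that 2 jZ by auto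
  have si: "wp w structs_in (\<lambda>t R' M'. t <= 20 + (s + 1) * (2 * (gam * T) + 80) \<and> bR R' \<and> bM M' \<and> std R' \<and>
   keep {10, 11, 12, 13, 33, 37} R2 R' \<and> same {16..} M1 M' \<and>
   structs M' (\<lambda>k. if k <= J1 then take (k * k) (ins_at i u us) else [])) R2 M2"
   using 2 by (intro wp_mono[OF structs_in[OF b2(1) _ b2(2)]]) (use that 2 jJ i in auto)
  show ?case
  proof (rule wp_mono[OF si], elim conjE, goal_cases)
   case (1 t3 R3 M3)
   note 3 = this
   have r3: "R3 1 = i" "R3 2 = u" "R3 30 = length us" "R3 31 = J1" "R3 32 = j" using 3(5) 2 that by (auto simp: keep_def)
   have blk3: "block_ok M3 us b" if "b < J1" for b
    using block_ok_same[OF 3(6), of b us] that block_bounds[of b] \<open>J1 <= s + 1\<close> \<open>\<forall>b<J1. block_ok M1 us b\<close> by auto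
   have uZ: "u < Z" using i legal_lt by simp
   have js: "j <= s" using 2 by simp
   note sh = shift_in[OF 3(2-4) r3(1,2,5) i(1,2) uZ _ _ js blk3[OF jJ]]
   show ?case
   proof (rule wp_mono[OF sh], (use 2 in simp_all)[2], elim conjE, goal_cases)
    case (1 t4 R4 M4)
    note 4 = this
    have r4: "R4 30 = length us" "R4 31 = J1" "R4 32 = j" using 4(5) r3 by (auto simp: keep_def)
    have ok4: "\<forall>b<J1. block_ok M4 (if b < j + 1 then ins_at i u us else us) b"
    proof (intro allI impI)
     fix b assume bJ: "b < J1"
     show "block_ok M4 (if b < j + 1 then ins_at i u us else us) b"
     proof (cases "b = j")
      case False
      then have blk4: "block_ok M4 us b" using 4(7) blk3[OF bJ] block_bounds[of b] bJ \<open>J1 <= s + 1\<close> by auto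
      show ?thesis
      proof (cases "b < j")
       case True
       have "block_ok M4 (ins_at i u us) b" unfolding block_ok_def
       proof (intro allI impI)
        fix k assume k: "k <= 2 * b" "b * b + k < length (ins_at i u us)"
        have "(b + 1) * (b + 1) <= j * j" using True by (intro mult_mono) auto
        then have lt: "b * b + k < i" using k 2 by (simp add: algebra_simps)
        then have "ins_at i u us ! (b * b + k) = us ! (b * b + k)" using i by (subst nth_ins_at) auto
        then show "buf M4 b k = ins_at i u us ! (b * b + k)" using blk4 k lt i by (auto simp: block_ok_def)
       qed
       then show ?thesis using True by simp
      qed (use blk4 False in auto)
     qed (use 4 in auto)
    qed
    note ca = cascade_in[OF 4(2-4) r4(2,3) i(1,2) _ _ jJ \<open>J1 <= s + 1\<close> ok4 4(9)]
    show ?case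
    proof (rule wp_mono[OF ca], (use 2 in simp_all)[2], elim conjE, goal_cases)
     case (1 t5 R5 M5)
     note 5 = this
     have r5: "R5 30 = length us" using 5(5) r4 by (auto simp: keep_def)
     have m5: "M5 (adr 0 1) = J1" using 5(6) 4(6) 3(6) that(8) oB by (auto simp: same_def)
     have s5: "structs M5 (\<lambda>k. if k <= J1 then take (k * k) (ins_at i u us) else [])"
      unfolding structs_def
     proof (intro allI impI)
      fix k assume "16 + k < B"
      then have "inst M3 (16 + k) (if k <= J1 then take (k * k) (ins_at i u us) else [])" using 3(7) by (simp add: structs_def)
      then show "inst M5 (16 + k) (if k <= J1 then take (k * k) (ins_at i u us) else [])"
       using inst_same[OF 5(6)] inst_same[OF 4(6)] by simp
     qed
     have blk5: "block_ok (M5(adr 0 0 := length us + 1)) (ins_at i u us) b" if "b < J1" for b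
      using 5(7) that block_bounds[of b] \<open>J1 <= s + 1\<close> oB by (subst block_ok_upd) auto
     show ?case using 5 r5 m5 s5 blk5 oB JZ 2(1) 3(1) 4(1) by simp
    qed
   qed
  qed
 qed
 \<comment> \<open>\<open>t0\<close> is the time spent before the common part. If a copy was
   created, the growth of the subtracted cube covers it.\<close>
 have finish: "sqrt_inv (ins_at i u us) M' p' \<and> t + t0 + sqrt_pot M' p' <= sqrt_pot M p + sqrt_cost * (s * T)"
  if "bM M'" "M' (adr 0 0) = length us + 1" "M' (adr 0 1) = J1" "\<forall>b<J1. block_ok M' (ins_at i u us) b"
   "structs M' (\<lambda>k. if k <= J1 then take (k * k) (ins_at i u us) else [])" "length us < J1 * J1"
   "J1 = J \<and> t0 <= 40 \<or> J1 = J + 1 \<and> length us = J * J \<and> t0 <= 80 + (J * J) * (gam * T + 100)"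
   "t <= 120 + 20 * s + (s + 1) * (2 * (gam * T) + 80) + (2 * s + 1) * 80 + (s + 1) * 120"
  for M' J1 t t0
 proof -
  have "set (ins_at i u us) \<subseteq> legal_updates D n m" using M(2) i(3) set_take_subset[of i us] set_drop_subset[of i us]
   by (auto simp: ins_at_def)
  moreover have J1p: "(J1 - 1) * (J1 - 1) <= p'" using that(7) J(3) p' p by auto
  ultimately have inv': "sqrt_inv (ins_at i u us) M' p'" using that p' i by (simp add: sqrt_inv_def)
  have cube: "(x - 1) * (x - 1) * (x - 1) <= s * q" if "(x - 1) * (x - 1) <= q" "q <= m" for x q
  proof -
   have "x - 1 <= s" by (rule le_s) (use that in linarith)
   then have "(x - 1) * ((x - 1) * (x - 1)) <= s * q" using that by (intro mult_mono) auto
   then show ?thesis by (simp add: mult.assoc)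
  qed
  define c where "c x = (x - 1) * (x - 1) * (x - 1)" for x :: nat
  have c: "c J <= s * p" "c J1 <= s * p'" using cube[OF J(3) p(2)] cube[OF J1p p'(4)] by (auto simp: c_def)
  have pot: "sqrt_pot M p = (gam * T + 100) * (s * p - c J)" "sqrt_pot M' p' = (gam * T + 100) * (s * p' - c J1)"
   using that by (auto simp: sqrt_pot_def c_def J_def)
  have sp: "s * p' <= s * p + s"
  proof -
   have "s * p' <= s * (p + 1)" using p'(2) by (rule mult_le_mono2)
   then show ?thesis by (simp add: algebra_simps)
  qed
  define G where "G = gam * T + 100"
  from that(7) have "t + t0 + G * (s * p' - c J1) <= G * (s * p - c J) + sqrt_cost * (s * T)"
  proof (elim disjE conjE)
   assume a: "J1 = J" "t0 <= 40"
   have "s * p' - c J1 <= (s * p - c J) + s" using sp a c by simp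
   then have "G * (s * p' - c J1) <= G * (s * p - c J) + s * G"
    using mult_le_mono2[of "s * p' - c J1" "(s * p - c J) + s" G] by (simp add: algebra_simps)
   moreover have "t + t0 + s * G <= sqrt_cost * (s * T)" unfolding G_def
    by (rule sqrt_time) (use that(8) a in linarith)
   ultimately show ?thesis by linarith
  next
   assume a: "J1 = J + 1" "length us = J * J" "t0 <= 80 + (J * J) * (gam * T + 100)"
   have "c (J + 1) \<ge> c J + J * J"
   proof (cases J)
    case (Suc x)
    have "x * x * x + Suc x * Suc x <= Suc x * Suc x * Suc x" by (simp add: algebra_simps)
    then show ?thesis using Suc by (simp add: c_def algebra_simps)
   qed (simp add: c_def)
   then have "s * p' - c J1 + J * J <= (s * p - c J) + s" using sp a c by simp
   then have "G * (s * p' - c J1) + (J * J) * G <= G * (s * p - c J) + s * G"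
    using mult_le_mono2[of "s * p' - c J1 + J * J" "(s * p - c J) + s" G] by (simp add: algebra_simps)
   moreover have "(t + 80) + s * G <= sqrt_cost * (s * T)" unfolding G_def
    by (rule sqrt_time) (use that(8) in linarith)
   moreover have "t0 <= 80 + (J * J) * G" using a by (simp add: G_def)
   ultimately show ?thesis by linarith
  qed
  then show ?thesis using inv' by (simp add: pot G_def)
 qed
 show ?thesis
 proof (cases "length us = J * J")
  case False
  then have lt: "length us < J * J" using J by simp
  have rs: "wp w sqrt_insert_rest
   (\<lambda>t R' M'. t <= 120 + 20 * s + (s + 1) * (2 * (gam * T) + 80) + (2 * s + 1) * 80 + (s + 1) * 120 \<and>
   bM M' \<and> M' (adr 0 0) = length us + 1 \<and> M' (adr 0 1) = J \<and> (\<forall>b<J. block_ok M' (ins_at i u us) b) \<and>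
   structs M' (\<lambda>k. if k <= J then take (k * k) (ins_at i u us) else [])) ?R M"
   by (rule rest[OF bR(1) M(1) bR(2)]) (use r J lt in \<open>simp_all add: J_def\<close>)
  show ?thesis unfolding sqrt_insert_def
  proof (simp add: b M J_def[symmetric] oB JZ False, rule wp_mono[OF rs], elim conjE, goal_cases)
   case (1 t R' M')
   then show ?case using finish[of M' J 21 t] lt by (intro exI[of _ p']) simp
  qed
 next
  case True
  note cr = create[OF bR(1) M(1) bR(2) _ _ _ M(2) i(2) True J(5,4)]
  have sZ: "J * J < Z" using True JZ by simp
  show ?thesis unfolding sqrt_insert_def
  proof (simp add: b M J_def[symmetric] oB JZ True[symmetric], rule wp_mono[OF cr], (use i in simp_all)[3], elim conjE, goal_cases)
   case (1 t1 R1 M1)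
   note 1 = this
   have lt: "length us < (J + 1) * (J + 1)" using True by (simp add: algebra_simps)
   have Js: "J <= s" by (rule le_s) (use True i in simp)
   have blk1: "\<forall>b<J + 1. block_ok M1 us b"
   proof (intro allI impI)
    fix b assume bJ: "b < J + 1"
    show "block_ok M1 us b"
    proof (cases "b = J")
     case False
     then show ?thesis using block_ok_same[OF 1(6), of b us] J(4) bJ block_bounds[of b] Js by auto
    qed (use True in \<open>simp add: block_ok_def\<close>)
   qed
   have r1: "R1 1 = i" "R1 2 = u" "R1 30 = length us" using 1(5) r by (auto simp: keep_def)
   have rs: "wp w sqrt_insert_rest
    (\<lambda>t R' M'. t <= 120 + 20 * s + (s + 1) * (2 * (gam * T) + 80) + (2 * s + 1) * 80 + (s + 1) * 120 \<and>
    bM M' \<and> M' (adr 0 0) = length us + 1 \<and> M' (adr 0 1) = J + 1 \<and> (\<forall>b<J + 1. block_ok M' (ins_at i u us) b) \<and>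
    structs M' (\<lambda>k. if k <= J + 1 then take (k * k) (ins_at i u us) else [])) R1 M1"
    by (rule rest[OF 1(2-4)]) (use r1 1 Js lt blk1 in simp_all)
   show ?case
   proof (rule wp_mono[OF rs], elim conjE, goal_cases)
    case (1 t R' M')
    then show ?case using finish[of M' "J + 1" "20 + t1" t] lt True \<open>t1 <= 50 + J * J * (gam * T + 100)\<close>
     by (intro exI[of _ p']) simp
   qed
  qed
 qed
qed

lemma sqrt_delete:
 assumes b: "bR R" "std R" and r: "R 1 = i" and inv: "sqrt_inv us M p" and i: "i < length us"
 shows "wp w sqrt_delete (\<lambda>t R' M'. sqrt_inv (del_at i us) M' p \<and>
  t + sqrt_pot M' p <= sqrt_pot M p + sqrt_cost * (s * T)) R M"
proof -
 have M: "bM M" "set us \<subseteq> legal_updates D n m" "M (adr 0 0) = length us" "length us <= m" using inv by (auto simp: sqrt_inv_def)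
 define J where "J = M (adr 0 1)"
 have J: "J <= s + 1" "length us <= J * J" "(J - 1) * (J - 1) <= p" "\<forall>b<J. block_ok M us b"
  "structs M (squares J us)"
  using inv sqrt_inv_J[OF inv] by (auto simp: sqrt_inv_def J_def)
 have p: "length us <= p" "p <= m" using inv by (auto simp: sqrt_inv_def)
 let ?R = "R(30 := length us, 31 := J)"
 have JZ: "J < Z" "length us < Z" using J(1) s_lt_U bounds M(4) by linarith+
 have bR: "bR ?R" "std ?R" "?R 1 = i" using b JZ r by auto
 have im: "i <= m" using i M(4) by simp
 show ?thesis unfolding sqrt_delete_def
 proof (simp add: b M J_def[symmetric] JZ, rule wp_mono[OF find_block[OF bR(1) M(1) bR(3) im]], elim conjE exE, goal_cases)
  case (1 t2 R2 M2 j)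
  note 2 = this
  have jJ: "j < J"
  proof (rule ccontr)
   assume "\<not> j < J"
   then have "J * J <= j * j" by (intro mult_mono) auto
   then show False using 2 J(2) i by linarith
  qed
  have js: "j <= s" and jZ: "j < Z" using block_bounds[of j] 2 by simp_all
  have b2: "bR R2" "std R2" "bM M2" using M b 2 jZ JZ by auto
  have r2: "R2 1 = i" "R2 30 = length us" "R2 31 = J" "R2 32 = j" using 2 r by auto
  have si: "wp w structs_out (\<lambda>t R' M'. t <= 20 + (s + 1) * (2 * (gam * T) + 80) \<and> bR R' \<and> bM M' \<and> std R' \<and>
   keep {10, 11, 12, 13, 33, 37} R2 R' \<and> same {16..} M2 M' \<and>
   structs M' (\<lambda>k. if k <= J then take (k * k) (del_at i us) else [])) R2 M2"
   by (rule structs_out[OF b2(1,3,2) r2]) (use M J 2 jJ i in simp_all)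
  show ?case unfolding wp_Seq
  proof (rule wp_mono[OF si], elim conjE, goal_cases)
   case (1 t3 R3 M3)
   note 3 = this
   have r3: "R3 1 = i" "R3 30 = length us" "R3 31 = J" "R3 32 = j" using 3(5) r2 by (auto simp: keep_def)
   have blk3: "block_ok M3 us b" if "b < J" for b
    using block_ok_same[OF 3(6), of b us] that block_bounds[of b] J(1,4) 2 by auto
   note sh = shift_out[OF 3(2-4) r3(1,4) i M(4) _ _ js blk3[OF jJ]]
   show ?case
   proof (rule wp_mono[OF sh], (use 2 in simp_all)[2], elim conjE, goal_cases)
    case (1 t4 R4 M4)
    note 4 = this
    have r4: "R4 30 = length us" "R4 31 = J" "R4 32 = j" using 4(5) r3 by (auto simp: keep_def)
    have ok4: "\<forall>b<J. b ~= j --> block_ok M4 (if b < j then del_at i us else us) b"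
    proof (intro allI impI)
     fix b assume bJ: "b < J" "b ~= j"
     then have blk4: "block_ok M4 us b" using 4(7) blk3[OF bJ(1)] block_bounds[of b] J(1) by auto
     show "block_ok M4 (if b < j then del_at i us else us) b"
     proof (cases "b < j")
      case True
      have "block_ok M4 (del_at i us) b" unfolding block_ok_def
      proof (intro allI impI)
       fix k assume k: "k <= 2 * b" "b * b + k < length (del_at i us)"
       have "(b + 1) * (b + 1) <= j * j" using True by (intro mult_mono) auto
       then have lt: "b * b + k < i" using k 2 by (simp add: algebra_simps)
       then have "del_at i us ! (b * b + k) = us ! (b * b + k)" using i by (subst nth_del_at) auto
       then show "buf M4 b k = del_at i us ! (b * b + k)" using blk4 k lt i by (auto simp: block_ok_def)
      qed
      then show ?thesis using True by simp
     qed (use blk4 in auto)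
    qed
    note ca = cascade_out[OF 4(2-4) r4(2,3) i M(4) _ _ jJ J(1,2) ok4 4(8)]
    show ?case
    proof (rule wp_mono[OF ca], (use 2 in simp_all)[2], elim conjE, goal_cases)
     case (1 t5 R5 M5)
     note 5 = this
     have r5: "R5 30 = length us" using 5(5) r4 by (auto simp: keep_def)
     have m5: "M5 (adr 0 1) = J" using 5(6) 4(6) 3(6) 2 J_def by (auto simp: same_def)
     have s5: "structs M5 (\<lambda>k. if k <= J then take (k * k) (del_at i us) else [])"
      unfolding structs_def
     proof (intro allI impI)
      fix k assume "16 + k < B"
      then have "inst M3 (16 + k) (if k <= J then take (k * k) (del_at i us) else [])" using 3(7) by (simp add: structs_def)
      then show "inst M5 (16 + k) (if k <= J then take (k * k) (del_at i us) else [])"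
       using inst_same[OF 5(6)] inst_same[OF 4(6)] by simp
     qed
     have blk5: "block_ok (M5(adr 0 0 := length us - 1)) (del_at i us) b" if "b < J" for b
      using 5(7) that block_bounds[of b] J(1) by (subst block_ok_upd) auto
     have lZ: "length us - 1 < Z" "1 <= length us" using JZ i by linarith+
     have set: "set (del_at i us) \<subseteq> legal_updates D n m" using M(2) set_take_subset[of i us] set_drop_subset[of "Suc i" us]
      by (auto simp: del_at_def)
     have "length us - 1 <= m" "length us - 1 <= J * J" "length us - 1 <= p" using M(4) J(2) p by linarith+
     then have inv': "sqrt_inv (del_at i us) (M5(adr 0 0 := length us - 1)) p"
      unfolding sqrt_inv_def using 5 m5 s5 blk5 lZ set i J p M by simp
     have pot: "sqrt_pot (M5(adr 0 0 := length us - 1)) p = sqrt_pot M p"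
      by (simp add: sqrt_pot_def m5 J_def[symmetric])
     have "(t2 + t3 + t4 + t5 + 50) + s * (gam * T + 100) <= sqrt_cost * (s * T)"
      by (rule sqrt_time) (use 2(1) 3(1) 4(1) 5(1) in linarith)
     then show ?case using 5 r5 lZ inv' pot by simp
    qed
   qed
  qed
 qed
qed

lemma sqrt_query:
 assumes b: "bR R" "std R" and r: "R 1 = i" "R 2 = q" and inv: "sqrt_inv us M p"
  and i: "i <= length us" "q \<in> legal_queries D n m"
 shows "wp w sqrt_query (\<lambda>t R' M'. sqrt_inv us M' p \<and> R' 0 = answer D n q (result_state D n (take i us)) \<and>
  t + sqrt_pot M' p <= sqrt_pot M p + sqrt_cost * (s * T)) R M"
proof -
 have M: "bM M" "set us \<subseteq> legal_updates D n m" "length us <= m" using inv by (auto simp: sqrt_inv_def)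
 define J where "J = M (adr 0 1)"
 have J: "J <= s + 1" "length us <= J * J" "\<forall>b<J. block_ok M us b"
  "structs M (squares J us)"
  using inv sqrt_inv_J[OF inv] by (auto simp: sqrt_inv_def J_def)
 have im: "i <= m" using i M(3) by simp
 have qZ: "q < Z" using i(2) operand_lt_Z by (auto simp: legal_queries_def)
 show ?thesis unfolding sqrt_query_def wp_Seq
 proof (rule wp_mono[OF find_block[OF b(1) M(1) r(1) im]], elim conjE exE, goal_cases)
  case (1 t1 R1 M1 j)
  have js: "j <= s" using 1 by simp
  note jb = block_bounds[OF js]
  have jj: "j * j <= i" "i < (j + 1) * (j + 1)" using 1 by auto
  have jJ: "j <= J"
  proof (rule ccontr)
   assume "\<not> j <= J"
   then have "(J + 1) * (J + 1) <= j * j" by (intro mult_mono) auto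
   then show False using jj i J(2) by (simp add: algebra_simps)
  qed
  let ?h = "16 + j"
  have hB: "?h < B" "?h < Z" using jb B_big B_lt_Z U_ge by linarith+
  have iZ: "i < Z" "i - j * j < Z" "j * j < Z" using im bounds jb by linarith+
  have inst0: "inst M ?h (take (j * j) us)" using J(4)[unfolded structs_def, rule_format, of j] hB jJ by simp
  define c where "c = i - j * j"
  have c: "j * j + c = i" "c < Z" "c <= 2 * j" using jj iZ by (auto simp: c_def algebra_simps)
  have bv: "buf M' j k = us ! (j * j + k)" if "k < c" "same {?h} M M'" for k M'
  proof -
   have "j < J"
   proof (rule ccontr)
    assume "\<not> j < J"
    then have "J * J <= j * j" by (intro mult_mono) auto
    then show False using that c i J(2) by linarith
   qed
   then have "block_ok M' us j" using block_ok_same[OF that(2), of j us] jb J(3) by auto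
   then show ?thesis using that c i by (auto simp: block_ok_def)
  qed
  let ?R = "R(32 := j, 10 := ?h, 16 := c, 33 := 0)"
  have bR: "bR ?R" "std ?R" using b jb hB c by auto
  define I where "I k R' M' \<longleftrightarrow> keep {11, 12, 13, 33} ?R R' \<and> same {?h} M M' \<and> inst M' ?h (take (j * j + k) us)"
   for k R' M'
  have loop1: "wp w (For 33 16 (Seq (Assign 11 (Bin Add (Bin Mul (Reg 32) (Reg 32)) (Reg 33)))
    (Seq (Assign 12 (Ld (Lit 2) (buf_index (Reg 32) (Reg 33)))) pIns)))
   (\<lambda>t R' M'. t <= 4 + (c - 0) * (gam * T + 40 + 8) \<and> bR R' \<and> bM M' \<and> I c R' M') ?R M"
  proof (rule wp_For[where a = 0 and z = c and I = I])
   show "I 0 ?R M" using inst0 by (simp add: I_def keep_def)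
  next
   fix k R' M'
   assume k: "k < c" and I: "I k R' M'" and R': "R' 33 = k" "R' 16 = c" "bR R'" "bM M'"
   have stR: "std R'" by (rule std_keep[of "{11, 12, 13, 33}" ?R]) (use I bR in \<open>simp_all add: I_def\<close>)
   have r': "R' 10 = ?h" "R' 32 = j" using I by (auto simp: I_def keep_def)
   have bk: "buf M' j k = us ! (j * j + k)" using bv[OF k] I by (simp add: I_def)
   have leg: "legal (us ! (j * j + k))" using k c i M(2) by (auto simp: subset_iff)
   have kZ: "j * j + k < Z" using k c iZ by linarith
   let ?R1 = "R'(11 := j * j + k, 12 := us ! (j * j + k))"
   have b1: "bR ?R1" "std ?R1" using R' stR leg legal_lt kZ by auto
   have ins: "wp w pIns (\<lambda>t R3 M3. t <= gam * T \<and> bR R3 \<and> bM M3 \<and> keep {12, 13} ?R1 R3 \<and> std R3 \<and>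
     inst M3 ?h (take (j * j + k) (take (j * j + k) us) @ us ! (j * j + k) # drop (j * j + k) (take (j * j + k) us)) \<and> same {?h} M' M3) ?R1 M'"
    by (rule pIns[OF b1(1) R'(4) b1(2)]) (use I r' hB leg k c i M(3) in \<open>auto simp: I_def\<close>)
   show "wp w (Seq (Assign 11 (Bin Add (Bin Mul (Reg 32) (Reg 32)) (Reg 33)))
    (Seq (Assign 12 (Ld (Lit 2) (buf_index (Reg 32) (Reg 33)))) pIns))
    (\<lambda>t R'' M''. t <= gam * T + 40 \<and> R'' 33 = k \<and> R'' 16 = c \<and> bR R'' \<and> bM M'' \<and> I (Suc k) (R''(33 := Suc k)) M'') R' M'"
   proof (simp add: R' stR r' kZ bk flip: buf_def, rule wp_mono[OF ins], elim conjE, goal_cases)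
    case (1 t R3 M3)
    have "inst M3 ?h (take (j * j + Suc k) us)" using 1(6) k c i by (simp add: take_Suc_conv_app_nth)
    moreover have "keep {11, 12, 13, 33} ?R (R3(33 := Suc k))" using 1(4) I by (auto simp: I_def keep_def)
    moreover have "same {?h} M M3" using I 1(7) by (auto simp: I_def same_def)
    moreover have "R3 33 = k" "R3 16 = c" using 1(4) R' by (auto simp: keep_def)
    ultimately show ?case using 1 by (simp add: I_def)
   qed
  qed (use bR M c in auto)
  define I2 where "I2 k R' M' \<longleftrightarrow> keep {11, 12, 13, 33, 38} ?R R' \<and> same {?h} M M' \<and>
   inst M' ?h (take (j * j) us @ drop (j * j + k) (take i us)) \<and> R' 38 = answer D n q (result_state D n (take i us))" for k R' M'
  have loop2: "wp w (For 33 16 (Seq (Assign 11 (Bin Mul (Reg 32) (Reg 32))) pDel))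
   (\<lambda>t R' M'. t <= 4 + (c - 0) * (gam * T + 40 + 8) \<and> bR R' \<and> bM M' \<and> I2 c R' M') R2 M2"
   if "I2 0 R2 M2" "bR R2" "bM M2" "R2 33 = 0" for R2 M2
  proof (rule wp_For[where a = 0 and z = c and I = I2])
   show "I2 0 R2 M2" by fact
  next
   fix k R' M'
   assume k: "k < c" and I: "I2 k R' M'" and R': "R' 33 = k" "R' 16 = c" "bR R'" "bM M'"
   have stR: "std R'" by (rule std_keep[of "{11, 12, 13, 33, 38}" ?R]) (use I bR in \<open>simp_all add: I2_def\<close>)
   have r': "R' 10 = ?h" "R' 32 = j" using I by (auto simp: I2_def keep_def)
   show "wp w (Seq (Assign 11 (Bin Mul (Reg 32) (Reg 32))) pDel)
    (\<lambda>t R'' M''. t <= gam * T + 40 \<and> R'' 33 = k \<and> R'' 16 = c \<and> bR R'' \<and> bM M'' \<and> I2 (Suc k) (R''(33 := Suc k)) M'') R' M'"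
   proof -
    let ?X = "take (j * j) us @ drop (j * j + k) (take i us)"
    have "i - (j * j + k) = c - k" "\<not> length us <= i --> i < length us" using c(1) by linarith+
    then have lX: "length ?X = j * j + (c - k)" using c i jj by (simp add: min_def)
    let ?R1 = "R'(11 := j * j)"
    have b1: "bR ?R1" "std ?R1" using R' stR iZ by auto
    have del: "wp w pDel (\<lambda>t R3 M3. t <= gam * T \<and> bR R3 \<and> bM M3 \<and> keep {12, 13} ?R1 R3 \<and> std R3 \<and>
     inst M3 ?h (take (j * j) ?X @ drop (Suc (j * j)) ?X) \<and> same {?h} M' M3) ?R1 M'"
     by (rule pDel[OF b1(1) R'(4) b1(2)]) (use I r' hB lX k c i M(3) in \<open>auto simp: I2_def\<close>)
    have e: "take (j * j) ?X @ drop (Suc (j * j)) ?X = take (j * j) us @ drop (j * j + Suc k) (take i us)"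
     using c i jj by (simp add: min_def)
    show ?thesis
    proof (simp add: R' stR r' iZ, rule wp_mono[OF del], elim conjE, goal_cases)
     case (1 t R3 M3)
     have "inst M3 ?h (take (j * j) us @ drop (j * j + Suc k) (take i us))" using 1(6) e by simp
     moreover have "keep {11, 12, 13, 33, 38} ?R (R3(33 := Suc k))" using 1(4) I by (auto simp: I2_def keep_def)
     moreover have "same {?h} M M3" using I 1(7) by (auto simp: I2_def same_def)
     moreover have "R3 33 = k" "R3 16 = c" "R3 38 = R' 38" using 1(4) R' by (auto simp: keep_def)
     ultimately show ?case using 1 I by (simp add: I2_def)
    qed
   qed
  qed (use that c in \<open>auto simp: I2_def keep_def\<close>)
  show ?case
  proof (use 1 r bR hB jb iZ in \<open>simp add: c_def[symmetric] b M\<close>, rule wp_mono[OF loop1], elim conjE, goal_cases)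
   case prems: (1 t2 R2 M2)
   have I: "I c R2 M2" using prems by simp
   have stR: "std R2" by (rule std_keep[of "{11, 12, 13, 33}" ?R]) (use I bR in \<open>simp_all add: I_def\<close>)
   have r2: "R2 1 = i" "R2 2 = q" "R2 10 = ?h" using I r by (auto simp: I_def keep_def)
   let ?R2 = "R2(11 := i, 12 := q)"
   have b2: "bR ?R2" "std ?R2" using prems stR iZ qZ by auto
   have qry: "wp w pQry (\<lambda>t R' M'. t <= gam * T \<and> bR R' \<and> bM M' \<and> keep {12, 13} ?R2 R' \<and> std R' \<and>
    inst M' ?h (take i us) \<and> same {?h} M2 M' \<and> R' 13 = answer D n q (result_state D n (take i us))) ?R2 M2"
    by (rule pQry[OF b2(1) _ b2(2)]) (use prems I r2 hB i c im in \<open>auto simp: I_def\<close>)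
   show ?case
   proof (use prems r2 iZ qZ in \<open>simp\<close>, rule wp_mono[OF qry], elim conjE, goal_cases)
    case prems3: (1 t3 R3 M3)
    have k3: "keep {11, 12, 13, 33, 38} ?R (R3(38 := R3 13, 33 := 0))" using prems3 I by (auto simp: I_def keep_def)
    have sm3: "same {?h} M M3" using I \<open>same {?h} M2 M3\<close> by (auto simp: I_def same_def)
    have X: "take (j * j) us @ drop (j * j + 0) (take i us) = take i us"
     using jj append_take_drop_id[of "j * j" "take i us"] by (simp add: min_def)
    have "I2 0 (R3(38 := R3 13, 33 := 0)) M3" unfolding I2_def X using k3 sm3 prems3 by simp
    note lp = loop2[OF this]
    show ?case
    proof (use \<open>bR R3\<close> \<open>bM M3\<close> in \<open>simp\<close>, rule wp_mono[OF lp], (use \<open>bR R3\<close> \<open>bM M3\<close> in simp_all)[3], elim conjE, goal_cases)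
     case prems4: (1 t4 R4 M4)
     have I4: "I2 c R4 M4" using prems4 by simp
     have s4: "same {?h} M M4" using I4 by (simp add: I2_def)
     have i4: "inst M4 ?h (take (j * j) us)" using I4 c i by (simp add: I2_def)
     have m4: "M4 (adr 0 0) = M (adr 0 0)" "M4 (adr 0 1) = J" using s4 by (auto simp: same_def J_def)
     have st4: "structs M4 (squares J us)"
      by (rule structs_step[OF J(4) s4 i4]) (use jJ in auto)
     have blk4: "block_ok M4 us b" if "b < J" for b
      using block_ok_same[OF s4, of b us] that block_bounds[of b] J(1,3) by auto
     have inv4: "sqrt_inv us M4 p" using inv st4 blk4 m4 prems4 by (simp add: sqrt_inv_def J_def[symmetric])
     have pot: "sqrt_pot M4 p = sqrt_pot M p" by (simp add: sqrt_pot_def m4 J_def[symmetric])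
     have sum4: "t1 + t2 + t3 + t4 + 60 <= 100 + 20 * s + g + 2 * x"
      if "t1 <= 20 + 20 * s" "t2 <= 4 + x" "t3 <= g" "t4 <= 4 + x" for x g using that by linarith
     have "(c - 0) * (gam * T + 40 + 8) = c * (gam * T + 48)" by simp
     then have t5: "t1 + t2 + t3 + t4 + 60 <= 100 + 20 * s + gam * T + 2 * (c * (gam * T + 48))"
      using 1 prems prems3 prems4 by (intro sum4) (simp_all only: )
     define g q x where "g = gam * (s * T)" and "q = s * T" and "x = c * (gam * T + 48)"
     have 1: "s <= q" "1 <= q" "gam * T <= g" using s_ge T mult_le_mono[OF s_ge T] by (auto simp: g_def q_def)
     \<comment> \<open>At most \<open>2 * j\<close> updates are missing between consecutive squares,
       and \<open>j \<le> s\<close>.\<close>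
     have "c * (gam * T + 48) <= 2 * s * (gam * T + 48)" using c js by (intro mult_le_mono1) linarith
     then have x: "x <= 2 * g + 96 * s" by (simp add: x_def g_def algebra_simps)
     have pc: "sqrt_cost * (s * T) = 6 * g + 3000 * q" by (simp add: g_def q_def sqrt_cost_def algebra_simps)
     have "t1 + t2 + t3 + t4 + 60 <= 100 + 20 * s + gam * T + 2 * x" using t5 by (simp only: x_def)
     with 1 x have "t1 + t2 + t3 + t4 + 60 <= 6 * g + 3000 * q" by linarith
     then have "t1 + t2 + t3 + t4 + 60 <= sqrt_cost * (s * T)" by (simp only: pc)
     then show ?case using prems4 inv4 pot I4 by (simp add: I2_def)
    qed
   qed
  qed
 qed
qed

end

section \<open>Weight-balanced skip lists\<close>

text \<open>In a list without repetitions an element determines its position; this allows blocks to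
  be identified by their first elements.\<close>

lemma distinct_split_unique:
 "distinct (A @ h # C) ==> A @ h # C = A' @ h # C' ==> A = A' \<and> C = C'"
proof -
 assume d: "distinct (A @ h # C)" and e: "A @ h # C = A' @ h # C'"
 then have "distinct (A' @ h # C')" by simp
 with d have "h \<notin> set A" "h \<notin> set A'" "h \<notin> set C" "h \<notin> set C'" by auto
 with e show ?thesis by (simp add: append_Cons_eq_iff)
qed

lemma split_at_head:
 assumes "concat Q = A @ h # C" "distinct (A @ h # C)" "[] \<notin> set Q" "h \<in> hd ` set Q"
 shows "\<exists>Q1 b Q2. Q = Q1 @ b # Q2 \<and> concat Q1 = A \<and> b @ concat Q2 = h # C \<and> hd b = h"
proof -
 obtain b where b: "b \<in> set Q" "hd b = h" using assms(4) by auto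
 then obtain Q1 Q2 where Q: "Q = Q1 @ b # Q2" by (meson split_list)
 have "b ~= []" using b assms(3) by auto
 then obtain t where t: "b = h # t" using b by (cases b) auto
 have "A @ h # C = concat Q1 @ h # (t @ concat Q2)" using assms(1) Q t by simp
 from distinct_split_unique[OF assms(2) this] have "A = concat Q1" "C = t @ concat Q2" by auto
 then show ?thesis using Q t by (intro exI[of _ Q1] exI[of _ b] exI[of _ Q2]) simp
qed

text \<open>The cutting points of a partition are the first elements of its blocks. If those of
  \<open>bs\<close> are among those of \<open>Q\<close>, both ends of \<open>b\<close> are cutting
  points of \<open>Q\<close> too, so \<open>b\<close> is a concatenation of consecutive blocks of
  \<open>Q\<close>.\<close>

lemma refine_block:
 assumes "concat Q = es" "concat bs = es" "distinct es" "[] \<notin> set Q" "[] \<notin> set bs" "hd ` set bs \<subseteq> hd ` set Q"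
  and bs: "bs = X @ b # Y"
 shows "\<exists>Q1 Qb Q2. Q = Q1 @ Qb @ Q2 \<and> concat Q1 = concat X \<and> concat Qb = b \<and> concat Q2 = concat Y"
proof -
 have bne: "b ~= []" using assms(5) bs by auto
 have bh: "b = hd b # tl b" using bne by simp
 have es: "es = concat X @ hd b # (tl b @ concat Y)" using assms(2) bs bh by (metis append.assoc append_Cons concat.simps(2) concat_append)
 have "hd b \<in> hd ` set Q" using assms(6) bs by auto
 from split_at_head[of Q "concat X" "hd b" "tl b @ concat Y"] this assms es
 obtain Q1 c Q2 where Q: "Q = Q1 @ c # Q2" "concat Q1 = concat X" "c @ concat Q2 = hd b # (tl b @ concat Y)"
  by auto
 have Qc: "concat (c # Q2) = b @ concat Y" using Q(3) bh by (metis append_Cons concat.simps(2))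
 show ?thesis
 proof (cases Y)
  case Nil
  then show ?thesis using Q Qc by (intro exI[of _ Q1] exI[of _ "c # Q2"] exI[of _ "[]"]) auto
 next
  case (Cons y Y')
  have yne: "y ~= []" using assms(5) bs Cons by auto
  have yh: "concat Y = hd y # (tl y @ concat Y')" using Cons yne by simp
  have "hd y \<in> hd ` set Q" using assms(6) bs Cons by auto
  moreover have d: "distinct (concat Q1 @ b @ concat Y)" using assms(2,3) bs Q(2) by simp
  moreover have "hd y \<notin> hd ` set Q1"
  proof
   assume "hd y \<in> hd ` set Q1"
   then obtain z where "z \<in> set Q1" "hd z = hd y" by auto
   moreover from this have "z ~= []" using assms(4) Q(1) by auto
   ultimately have "hd y \<in> set (concat Q1)" by (metis UN_I hd_in_set set_concat)
   with d yh show False by auto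
  qed
  ultimately have "hd y \<in> hd ` set (c # Q2)" using Q(1) by auto
  moreover have "distinct (b @ hd y # (tl y @ concat Y'))" using d yh by simp
  moreover have "concat (c # Q2) = b @ hd y # (tl y @ concat Y')" using Qc yh by simp
  moreover have "[] \<notin> set (c # Q2)" using assms(4) Q(1) by auto
  ultimately obtain Q3 e Q4 where "c # Q2 = Q3 @ e # Q4" "concat Q3 = b" "e @ concat Q4 = hd y # (tl y @ concat Y')"
   using split_at_head[of "c # Q2" b "hd y" "tl y @ concat Y'"] by blast
  then show ?thesis using Q yh by (intro exI[of _ Q1] exI[of _ Q3] exI[of _ "e # Q4"]) auto
 qed
qed

text \<open>The list \<open>es\<close> of all elements, including deleted ones, is cut into blocks on each level. The
 element 0 is a sentinel in front of the timeline; it does not count for the weight.\<close>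

definition weight :: "nat list => nat" where "weight b = length (filter (\<lambda>e. e ~= 0) b)"
definition live :: "nat set => nat list => nat" where "live A b = length (filter (\<lambda>e. e \<in> A) b)"
definition vals :: "nat set => (nat => nat) => nat list => nat list" where "vals A vl b = map vl (filter (\<lambda>e. e \<in> A) b)"

lemma weight_simps [simp]: "weight [] = 0" "weight (e # b) = (if e = 0 then 0 else 1) + weight b"
 "weight (b @ c) = weight b + weight c"
 by (auto simp: weight_def)
lemma live_simps [simp]: "live A [] = 0" "live A (e # b) = (if e \<in> A then 1 else 0) + live A b"
 "live A (b @ c) = live A b + live A c"
 by (auto simp: live_def)
lemma vals_simps [simp]: "vals A vl [] = []" "vals A vl (e # b) = (if e \<in> A then [vl e] else []) @ vals A vl b"
 "vals A vl (b @ c) = vals A vl b @ vals A vl c"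
 by (auto simp: vals_def)
lemma length_vals [simp]: "length (vals A vl b) = live A b" by (simp add: vals_def live_def)
lemma live_le_weight: "0 \<notin> A ==> live A b <= weight b"
 by (induction b) auto
lemma weight_eq_length: "0 \<notin> set b ==> weight b = length b"
 by (induction b) auto
lemma vals_cong: "(\<And>e. e \<in> set b ==> (e \<in> A \<longleftrightarrow> e \<in> A') \<and> (e \<in> A --> vl e = vl' e)) ==> vals A vl b = vals A' vl' b"
 by (induction b) auto
lemma live_cong: "(\<And>e. e \<in> set b ==> (e \<in> A \<longleftrightarrow> e \<in> A')) ==> live A b = live A' b"
 by (induction b) auto

lemma weight_concat_ge:
 "(\<And>b. b \<in> set bs ==> q <= weight b) ==> length bs * q <= weight (concat bs)"
proof (induction bs)
 case (Cons a bs)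
 have "length bs * q <= weight (concat bs)" by (rule Cons.IH) (use Cons.prems in auto)
 moreover have "q <= weight a" using Cons.prems by auto
 ultimately show ?case by simp
qed simp

text \<open>What the test between the schemes yields in its second alternative: \<open>m\<close> is
  at least half of \<open>U\<close>, and lists of \<open>K * n\<close> updates are at most a quarter
  of it.\<close>

locale tree = machine +
 assumes Lb: "L \<ge> 5" and mU: "U <= 2 * m" and KU: "4 * (K * n) <= U"
begin

text \<open>The top level. Blocks on it weigh less than \<open>2 ^ (L - 2)\<close>, a quarter of
  \<open>U\<close>. With at most another quarter of prepended updates, a copy holds at most
  \<open>U / 2\<close> updates, which is within the legal length \<open>m\<close>.\<close>

definition tp :: nat where "tp = L - 3"
text \<open>The block of level \<open>l\<close> that begins with element \<open>e\<close> is stored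
  under this number, both in the tables and, shifted by 16, as the region of its copy.\<close>

definition nd :: "nat => nat => nat" where "nd e l = e * U + l"

lemma L_U: "L < U" unfolding U_def by simp
lemma tp_U: "l <= tp ==> l < U" using L_U unfolding tp_def by linarith

lemma nd_inj: "l < U ==> l' < U ==> nd e l = nd e' l' \<longleftrightarrow> e = e' \<and> l = l'"
proof -
 assume l: "l < U" "l' < U"
 have "nd e l div U = e" "nd e l mod U = l" if "l < U" for e l using that by (auto simp: nd_def)
 then show ?thesis using l by metis
qed

lemma nd_B: "e <= 2 * U ==> l < U ==> nd e l < B" "e <= 2 * U ==> l < U ==> 16 + nd e l < B"
proof -
 assume e: "e <= 2 * U" "l < U"
 have "e * U <= 2 * U * U" using e by (intro mult_right_mono) auto
 moreover have "U * 1 <= U * U" "16 <= U * U" using U_ge mult_mono[of 4 U 4 U] by (intro mult_left_mono, auto)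
 ultimately show "nd e l < B" "16 + nd e l < B" using e B_big(3) unfolding nd_def by linarith+
qed

lemma nd_Z: "e <= 2 * U ==> l < U ==> nd e l < Z" "e <= 2 * U ==> l < U ==> 16 + nd e l < Z"
 "e <= 2 * U ==> e < Z" "e <= 2 * U ==> e < B" "e <= 2 * U + 1 ==> e + e < Z"
 using nd_B[of e l] B_lt_Z B_big U_ge by linarith+

text \<open>Tables indexed by nodes: first element of the next block, number of live elements, and
  weight. Of the other regions, 4 holds the updates of the elements, 5 and 6 the search path, 7 the
  log of skipped blocks, 13 the updates during a rebuild, and 15 a spare copy.\<close>

abbreviation NX :: "mem => nat => nat => nat" where "NX M e l \<equiv> M (adr 1 (nd e l))"
abbreviation LV :: "mem => nat => nat => nat" where "LV M e l \<equiv> M (adr 2 (nd e l))"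
abbreviation WT :: "mem => nat => nat => nat" where "WT M e l \<equiv> M (adr 3 (nd e l))"

fun linked :: "mem => nat => nat list => bool" where
 "linked M l (e # f # hs) \<longleftrightarrow> NX M e l = f \<and> linked M l (f # hs)"
| "linked M l _ \<longleftrightarrow> True"

lemma linked_append: "linked M l (xs @ e # ys) \<longleftrightarrow> linked M l (xs @ [e]) \<and> linked M l (e # ys)"
proof (induction xs)
 case (Cons x xs)
 then show ?case by (cases xs) auto
qed simp

lemma linked_next: "linked M l (xs @ e # f # ys) ==> NX M e l = f"
 by (subst (asm) linked_append) simp

lemma linked_cong: "(\<And>e. e \<in> set hs ==> NX M' e l = NX M e l) ==> linked M' l hs = linked M l hs"
 by (induction M l hs rule: linked.induct) auto

definition block_at :: "mem => nat => nat set => (nat => nat) => nat list => bool" where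
 "block_at M l A vl b \<longleftrightarrow> WT M (hd b) l = weight b \<and> LV M (hd b) l = live A b \<and>
   inst M (16 + nd (hd b) l) (vals A vl b)"

text \<open>The block of the sentinel may be light, since an empty list has no other. Nodes that
  head no block must have empty copies, because a later split starts from them.\<close>

definition level :: "mem => nat => nat list list => nat list => nat set => (nat => nat) => bool" where
 "level M l bs es A vl \<longleftrightarrow> concat bs = es \<and> [] \<notin> set bs \<and>
   (\<forall>b\<in>set bs. block_at M l A vl b \<and> (hd b ~= 0 --> 2 ^ (l - 1) <= weight b)) \<and> linked M l (map hd bs) \<and>
   (\<forall>e\<le>2 * U. e \<notin> hd ` set bs --> inst M (16 + nd e l) [])"

text \<open>Kept apart from \<open>level\<close>, because an insertion may violate it until the
  overweight block has been split.\<close>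

definition bounded :: "nat => nat list list => bool" where
 "bounded l bs \<longleftrightarrow> (\<forall>b\<in>set bs. weight b < 2 ^ (l + 1))"

text \<open>A frame condition for a single level. It is finer than \<open>same\<close>, as the
  tables of all levels share the regions 1 to 3.\<close>

definition lev_same :: "nat => mem => mem => bool" where
 "lev_same l M M' \<longleftrightarrow> (\<forall>e\<le>2 * U. NX M' e l = NX M e l \<and> LV M' e l = LV M e l \<and> WT M' e l = WT M e l \<and>
   (\<forall>x<B. M' (adr (16 + nd e l) x) = M (adr (16 + nd e l) x)))"

lemma lev_same_refl [simp]: "lev_same l M M" by (simp add: lev_same_def)
lemma lev_same_trans: "lev_same l M M' ==> lev_same l M' M'' ==> lev_same l M M''"
 by (simp add: lev_same_def)

lemma lev_same_same: "same H M M' ==> l < U ==> {1, 2, 3} \<inter> H = {} ==>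
  (\<And>e. e <= 2 * U ==> 16 + nd e l \<notin> H) ==> lev_same l M M'"
 unfolding lev_same_def same_def using nd_B(1)[of _ l] by auto

lemma lev_same_low: "same H M M' ==> l < U ==> H \<subseteq> {h. h < 16} ==> {1, 2, 3} \<inter> H = {} ==> lev_same l M M'"
 by (rule lev_same_same) auto

lemma lev_same_node: "same {16 + nd e l'} M M' ==> l < U ==> l' < U ==> l ~= l' ==> lev_same l M M'"
 by (rule lev_same_same) (auto simp: nd_inj)

lemma lev_same_upd: "lev_same l M M' ==> l < U ==> l' < U ==> e <= 2 * U ==> h < 16 ==> l ~= l' ==>
  lev_same l M (M'(adr h (nd e l') := v))"
 unfolding lev_same_def using nd_B(1) by (auto simp: nd_inj)

lemma lev_same_upd_other: "lev_same l M M' ==> l < U ==> x < B ==> h < 16 ==> h \<notin> {1, 2, 3} ==>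
  lev_same l M (M'(adr h x := v))"
 unfolding lev_same_def using nd_B(1)[of _ l] by auto

lemma level_heads: "level M l bs es A vl ==> b \<in> set bs ==> hd b \<in> set es"
 unfolding level_def by (metis UN_I hd_in_set set_concat)

lemma level_frame:
 assumes "lev_same l M M'" "level M l bs es A vl" "set es \<subseteq> {..2 * U}"
 shows "level M' l bs es A vl"
proof -
 have h: "hd b <= 2 * U" if "b \<in> set bs" for b using level_heads[OF assms(2) that] assms(3) by auto
 have i: "inst M' (16 + nd e l) us \<longleftrightarrow> inst M (16 + nd e l) us" if "e <= 2 * U" for e us
  by (rule inst_cong) (use assms(1) that in \<open>auto simp: lev_same_def\<close>)
 have "block_at M' l A vl b = block_at M l A vl b" if "b \<in> set bs" for b
  using h[OF that] i assms(1) by (simp add: block_at_def lev_same_def)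
 moreover have "linked M' l (map hd bs) = linked M l (map hd bs)"
  by (rule linked_cong) (use h assms(1) in \<open>auto simp: lev_same_def\<close>)
 ultimately show ?thesis using assms(2) i by (auto simp: level_def)
qed

lemma hd_inj:
 assumes "level M l bs es A vl" "distinct es" "bs = Xs @ b # Ys" "c \<in> set (Xs @ Ys)"
 shows "hd c ~= hd b"
proof -
 have "c \<in> set bs" using assms by auto
 then have "c ~= []" "b ~= []" using assms by (auto simp: level_def)
 then have "hd c \<in> set (concat (Xs @ Ys))" "hd b \<in> set b" using assms(4) by (auto intro!: bexI[of _ c])
 moreover have "distinct (concat Xs @ b @ concat Ys)" using assms by (auto simp: level_def)
 then have "set b \<inter> set (concat (Xs @ Ys)) = {}" by auto
 ultimately show ?thesis by (metis IntI empty_iff)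
qed

lemma hd_replace: "b' ~= [] ==> hd b' = hd b ==> hd ` set (Xs @ b' # Ys) = hd ` set (Xs @ b # Ys)"
 by auto

text \<open>Covers all changes within one block that keep its first element: links and the other
  blocks are then unaffected.\<close>

lemma level_replace:
 assumes lev: "level M l (Xs @ b # Ys) es A vl" and d: "distinct es" "set es \<subseteq> {..2 * U}" and l: "l < U"
  and b': "b' ~= []" "hd b' = hd b" "hd b ~= 0 --> 2 ^ (l - 1) <= weight b'" "block_at M' l A' vl' b'"
  and es': "es' = concat Xs @ b' @ concat Ys"
  and AV: "\<And>e. e \<in> set es ==> e \<notin> set b ==> (e \<in> A \<longleftrightarrow> e \<in> A') \<and> (e \<in> A --> vl e = vl' e)"
  and M': "\<And>e. e <= 2 * U ==> NX M' e l = NX M e l"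
   "\<And>e. e <= 2 * U ==> e ~= hd b ==> LV M' e l = LV M e l \<and> WT M' e l = WT M e l"
   "\<And>e us. e <= 2 * U ==> e ~= hd b ==> inst M (16 + nd e l) us ==> inst M' (16 + nd e l) us"
 shows "level M' l (Xs @ b' # Ys) es' A' vl'"
proof -
 let ?bs = "Xs @ b # Ys"
 have h: "hd c <= 2 * U" if "c \<in> set ?bs" for c using level_heads[OF lev that] d by auto
 have bl: "block_at M' l A' vl' c" if c: "c \<in> set (Xs @ Ys)" for c
 proof -
  have c': "c \<in> set ?bs" using c by auto
  have ne: "hd c ~= hd b" by (rule hd_inj[OF lev d(1) refl c])
  have sub: "set c \<subseteq> set es" using lev c' by (auto simp: level_def)
  have "distinct (concat Xs @ b @ concat Ys)" using lev d by (auto simp: level_def)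
  then have "set c \<inter> set b = {}" using c by auto
  then have "vals A vl c = vals A' vl' c" "live A c = live A' c"
   using AV sub by (auto intro!: vals_cong live_cong)
  moreover have "block_at M l A vl c" using lev c' by (auto simp: level_def)
  ultimately show ?thesis using M'(2)[OF h[OF c'] ne] M'(3)[OF h[OF c'] ne] by (simp add: block_at_def)
 qed
 have "linked M' l (map hd ?bs) = linked M l (map hd ?bs)"
  by (rule linked_cong) (use h M'(1) in auto)
 then have ch: "linked M' l (map hd (Xs @ b' # Ys))" using lev b'(2) by (simp add: level_def)
 have "inst M' (16 + nd e l) []" if "e <= 2 * U" "e \<notin> hd ` set (Xs @ b' # Ys)" for e
  using that lev M'(3)[of e "[]"] b'(2) by (auto simp: level_def)
 moreover have "[] \<notin> set (Xs @ b' # Ys)" using lev b'(1) by (auto simp: level_def)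
 ultimately show ?thesis using lev bl b' es' ch by (auto simp: level_def)
qed

end

section \<open>Searching a position from the top level down\<close>

definition node :: "expr => expr => expr" where "node e l = Bin Add (Bin Mul e (Reg 5)) l"

lemma node_simps [simp]: "leaves (node e l) = leaves e + leaves l + 1" "expr_cost (node e l) = 3 + expr_cost e + expr_cost l"
 by (auto simp: node_def)

text \<open>Besides moving on, it appends the skipped block to the log in region 7, from which a
  query later reads the prefix.\<close>

definition walk_step :: com where
 "walk_step = Seq (Assign 48 (node (Reg 42) (Reg 47))) (Seq (St (Lit 7) (Reg 44) (Reg 48))
  (Seq (Assign 44 (Bin Add (Reg 44) (Lit 1))) (Seq (Assign 43 (Bin Add (Reg 43) (Ld (Lit 2) (Reg 48))))
  (Assign 42 (Ld (Lit 1) (Reg 48))))))"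

abbreviation walk_cond :: expr where
 "walk_cond \<equiv> Bin Less (Bin Add (Reg 43) (Ld (Lit 2) (node (Reg 42) (Reg 47)))) (Reg 41)"

definition walk_level :: com where
 "walk_level = While walk_cond walk_step"

definition walk :: com where
 "walk = Seq (Assign 42 (Lit 0)) (Seq (Assign 43 (Lit 0)) (Seq (Assign 44 (Lit 0)) (Seq (Assign 45 (Lit 0))
  (Seq (Assign 46 (Bin Sub (Reg 4) (Lit 2)))
  (For 45 46 (Seq (Assign 47 (Bin Sub (Bin Sub (Reg 46) (Lit 1)) (Reg 45)))
   (Seq walk_level (Seq (St (Lit 5) (Reg 47) (Reg 42)) (St (Lit 6) (Reg 47) (Reg 43))))))))))"

context words
begin
lemma ok_node [simp]: "ok R M (node e l) \<longleftrightarrow> ok R M e \<and> ok R M l" by (auto simp: node_def)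
end

context tree
begin

lemma ev_node [simp]: "R 5 = U ==> ev R M (node e l) = nd (ev R M e) (ev R M l)"
 by (simp add: node_def nd_def)

lemma hd_nonzero:
 assumes "level M l bs es A vl" "distinct es" "hd es = 0" "bs = Xs @ b # Ys" "Xs ~= []"
 shows "0 \<notin> set b" "hd b ~= 0"
proof -
 obtain x Xs' where Xs: "Xs = x # Xs'" using assms(5) by (cases Xs) auto
 have ne: "x ~= []" "b ~= []" using assms Xs by (auto simp: level_def)
 have "es = x @ concat Xs' @ b @ concat Ys" using assms(1,4) Xs by (auto simp: level_def)
 then have "hd x = 0" "distinct (x @ concat Xs' @ b @ concat Ys)" using assms(2,3) ne by (auto simp: hd_append)
 then have "0 \<in> set x" "distinct (x @ concat Xs' @ b @ concat Ys)" using hd_in_set[OF ne(1)] by simp_all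
 then show "0 \<notin> set b" by auto
 then show "hd b ~= 0" using ne(2) hd_in_set by metis
qed

text \<open>Position 0 is represented by the sentinel, so that an insertion always takes place
  behind some \<open>p\<close>.\<close>

definition target :: "nat list => nat set => nat => nat list => nat => bool" where
 "target es A t E1 p \<longleftrightarrow> (\<exists>E2. es = E1 @ p # E2) \<and> (p \<in> A \<and> t = live A E1 + 1 \<or> E1 = [] \<and> t = 0)"

text \<open>Justifies the loop condition of the walk. As \<open>p\<close> is live, or the sentinel
  when \<open>t = 0\<close>, the running count of live elements reaches \<open>t\<close> exactly in
  the block of \<open>p\<close>.\<close>

lemma target_block:
 assumes "target es A t E1 p" "distinct es" "es = C @ b @ Dd" "b ~= []" "p \<in> set (b @ Dd)"
 shows "p \<in> set b \<longleftrightarrow> \<not> live A C + live A b < t"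
  "p \<in> set b ==> \<exists>b1 b2. b = b1 @ p # b2 \<and> E1 = C @ b1"
  "p \<notin> set b ==> \<exists>D1. E1 = C @ b @ D1"
proof -
 obtain E2 where E2: "es = E1 @ p # E2" using assms(1) by (auto simp: target_def)
 have d: "distinct (E1 @ p # E2)" using assms(2) E2 by simp
 have in_b: "\<exists>b1 b2. b = b1 @ p # b2 \<and> E1 = C @ b1" if pb: "p \<in> set b"
 proof -
  obtain b1 b2 where b: "b = b1 @ p # b2" using pb by (meson split_list)
  have "E1 @ p # E2 = (C @ b1) @ p # (b2 @ Dd)" using E2 assms(3) b by simp
  from distinct_split_unique[OF d this] b show ?thesis by blast
 qed
 have out_b: "\<exists>D1. E1 = C @ b @ D1" if pb: "p \<notin> set b"
 proof -
  have "p \<in> set Dd" using pb assms(5) by auto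
  then obtain D1 D2 where Dd: "Dd = D1 @ p # D2" by (meson split_list)
  have "E1 @ p # E2 = (C @ b @ D1) @ p # D2" using E2 assms(3) Dd by simp
  from distinct_split_unique[OF d this] show ?thesis by blast
 qed
 show "p \<in> set b \<longleftrightarrow> \<not> live A C + live A b < t"
 proof (cases "p \<in> set b")
  case True
  then obtain b1 b2 where "b = b1 @ p # b2" "E1 = C @ b1" using in_b by blast
  then show ?thesis using True assms(1) by (auto simp: target_def)
 next
  case False
  then obtain D1 where D1: "E1 = C @ b @ D1" using out_b by blast
  then have "E1 ~= []" using assms(4) by auto
  then show ?thesis using False assms(1) D1 by (auto simp: target_def)
 qed
 show "p \<in> set b ==> \<exists>b1 b2. b = b1 @ p # b2 \<and> E1 = C @ b1" by (rule in_b)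
 show "p \<notin> set b ==> \<exists>D1. E1 = C @ b @ D1" by (rule out_b)
qed

text \<open>All the blocks except perhaps the first, which may be that of the sentinel, weigh at
  least \<open>2 ^ (l - 1)\<close>; this gives 32 + 1.\<close>

lemma few_blocks:
 assumes lev: "level M l bs es A vl" "distinct es" "hd es = 0" and bs: "bs = Xs @ mv @ Ys"
  and wt: "weight (concat mv) <= 32 * 2 ^ (l - 1)"
 shows "length mv <= 33"
proof (cases mv)
 case (Cons x mv')
 have ge: "2 ^ (l - 1) <= weight b" if b: "b \<in> set mv'" for b
 proof -
  obtain B1 B2 where "mv' = B1 @ b # B2" using split_list[OF b] by blast
  then have e: "bs = (Xs @ x # B1) @ b # (B2 @ Ys)" using bs Cons by simp
  have "hd b ~= 0" by (rule hd_nonzero(2)[OF lev e]) simp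
  then show ?thesis using lev(1) e by (auto simp: level_def)
 qed
 have "length mv' * 2 ^ (l - 1) <= weight (concat mv')" using ge by (rule weight_concat_ge)
 also have "\<dots> <= 32 * 2 ^ (l - 1)" using wt Cons by simp
 finally have "length mv' <= 32" by simp
 then show ?thesis using Cons by simp
qed simp

lemma walk_level:
 assumes b: "bR R" "bM M" "std R" and r: "R 41 = t" "R 42 = hd b0" "R 43 = live A (concat X0)" "R 44 = lc" "R 47 = l"
  and lev: "level M l bs es A vl" "distinct es" "hd es = 0" "set es \<subseteq> {..2 * U}" "0 \<notin> A" and l: "l < U"
  and bs: "bs = X0 @ b0 # Y0" and p: "target es A t E1 p" "p \<in> set (b0 @ concat Y0)"
  and Z: "E1 = concat X0 @ Zs" "weight Zs <= 32 * 2 ^ (l - 1)" and lc: "lc + 40 <= 40 * U"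
 shows "wp w walk_level (\<lambda>\<tau> R' M'. \<tau> <= 2000 \<and> bR R' \<and> bM M' \<and> std R' \<and> keep {42, 43, 44, 48} R R' \<and> same {7} M M' \<and>
  (\<exists>mv b Ys. bs = X0 @ mv @ b # Ys \<and> p \<in> set b \<and> R' 42 = hd b \<and> R' 43 = live A (concat (X0 @ mv)) \<and>
   R' 44 = lc + length mv \<and> length mv <= 33 \<and> (\<forall>k<lc. M' (adr 7 k) = M (adr 7 k)) \<and>
   (\<forall>k<length mv. M' (adr 7 (lc + k)) = nd (hd (mv ! k)) l))) R M"
proof -
 define I where "I k \<tau> R' M' \<longleftrightarrow> keep {42, 43, 44, 48} R R' \<and> same {7} M M' \<and>
  (\<exists>mv b Ys. k = length Ys \<and> \<tau> <= 55 * length mv \<and> bs = X0 @ mv @ b # Ys \<and> p \<in> set (b @ concat Ys) \<and> R' 42 = hd b \<and>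
   R' 43 = live A (concat (X0 @ mv)) \<and> R' 44 = lc + length mv \<and> length mv <= 33 \<and> (\<forall>k<lc. M' (adr 7 k) = M (adr 7 k)) \<and>
   (\<forall>k<length mv. M' (adr 7 (lc + k)) = nd (hd (mv ! k)) l))" for k \<tau> R' M'
 define Q where "Q \<tau> R' M' \<longleftrightarrow> \<tau> <= 2000 \<and> bR R' \<and> bM M' \<and> std R' \<and> keep {42, 43, 44, 48} R R' \<and> same {7} M M' \<and>
  (\<exists>mv b Ys. bs = X0 @ mv @ b # Ys \<and> p \<in> set b \<and> R' 42 = hd b \<and> R' 43 = live A (concat (X0 @ mv)) \<and>
   R' 44 = lc + length mv \<and> length mv <= 33 \<and> (\<forall>k<lc. M' (adr 7 k) = M (adr 7 k)) \<and>
   (\<forall>k<length mv. M' (adr 7 (lc + k)) = nd (hd (mv ! k)) l))" for \<tau> :: nat and R' M'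
 have dist: "es = concat bs" using lev(1) by (auto simp: level_def)
 have hB: "hd c <= 2 * U" if "c \<in> set bs" for c using level_heads[OF lev(1) that] lev(4) by auto
 have wte: "weight es <= 2 * U"
 proof -
  have "weight es = card (set (filter (\<lambda>e. e ~= 0) es))" unfolding weight_def by (rule distinct_card[symmetric]) (use lev(2) in simp)
  also have "\<dots> <= card {1..2 * U}" using lev(4) by (intro card_mono) auto
  finally show ?thesis by simp
 qed
 have liveB: "live A (concat C) <= 2 * U" if "bs = C @ D" for C D
 proof -
  have "live A (concat C) <= weight (concat C)" by (rule live_le_weight[OF lev(5)])
  also have "\<dots> <= weight es" using dist that by simp
  finally show ?thesis using wte by simp
 qed
 have "wp w (While walk_cond walk_step) (\<lambda>\<tau>. Q (0 + \<tau>)) R M"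
 proof (rule wp_While[where I = I and k = "length Y0"])
  show "I (length Y0) 0 R M"
   unfolding I_def
   by (rule conjI[rotated], rule conjI[rotated], rule exI[of _ "[]"], rule exI[of _ b0], rule exI[of _ Y0])
    (use bs p r in \<open>auto simp: keep_def\<close>)
 next
  fix k \<tau> R' M' assume I: "I k \<tau> R' M'" and b': "bR R'" "bM M'"
  then obtain mv c Ys where mv: "k = length Ys" "\<tau> <= 55 * length mv" "bs = X0 @ mv @ c # Ys" "p \<in> set (c @ concat Ys)" "R' 42 = hd c"
   "R' 43 = live A (concat (X0 @ mv))" "R' 44 = lc + length mv" "length mv <= 33" "\<forall>k<lc. M' (adr 7 k) = M (adr 7 k)"
   "\<forall>k<length mv. M' (adr 7 (lc + k)) = nd (hd (mv ! k)) l" by (auto simp: I_def)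
  have kp: "keep {42, 43, 44, 48} R R'" and sm: "same {7} M M'" using I by (auto simp: I_def)
  have st: "std R'" by (rule std_keep[OF kp]) (use b in simp_all)
  have r': "R' 41 = t" "R' 47 = l" using kp r by (auto simp: keep_def)
  have cin: "c \<in> set bs" using mv(3) by simp
  have c2: "hd c <= 2 * U" by (rule hB[OF cin])
  have levc: "level M' l bs es A vl" by (rule level_frame[OF lev_same_same[OF sm l] lev(1,4)]) auto
  have bc: "LV M' (hd c) l = live A c" and cne: "c ~= []" using levc cin by (auto simp: level_def block_at_def)
  have es: "es = concat (X0 @ mv) @ c @ concat Ys" using dist mv(3) by simp
  note tb = target_block[OF p(1) lev(2) es cne mv(4)]
  have l': "l < Z" "nd (hd c) l < B" "nd (hd c) l < Z" using nd_B nd_Z c2 l bounds by auto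
  have cond: "ev R' M' walk_cond =
   (if p \<in> set c then 0 else 1)"
   using st mv(5,6) r' bc tb(1) by simp
  have okc: "ok R' M' walk_cond \<and>
   leaves walk_cond <= 10 \<and>
   expr_cost walk_cond = 14" by simp
  have "if p \<in> set c then Q (\<tau> + 15) R' M' else wp w walk_step (\<lambda>t R'' M''. bR R'' \<and> bM M'' \<and> (\<exists>k'<k. I k' (\<tau> + 15 + t) R'' M'')) R' M'"
  proof (cases "p \<in> set c")
   case True
   have "Q (\<tau> + 15) R' M'" unfolding Q_def
    by (intro conjI, (use mv b' st kp sm in auto)[6], rule exI[of _ mv], rule exI[of _ c], rule exI[of _ Ys])
     (use True mv in auto)
   with True show ?thesis by simp
  next
   case False
   then obtain d Ys' where Ys: "Ys = d # Ys'" using mv(4) by (cases Ys) auto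
   have nx: "NX M' (hd c) l = hd d"
   proof -
    have "linked M' l (map hd (X0 @ mv) @ hd c # hd d # map hd Ys')" using mv(3) Ys levc by (simp add: level_def)
    then show ?thesis by (rule linked_next)
   qed
   obtain D1 where D1: "E1 = concat (X0 @ mv) @ c @ D1" using tb(3)[OF False] by blast
   then have "concat X0 @ Zs = concat X0 @ concat mv @ c @ D1" using Z(1) by simp
   then have "Zs = concat (mv @ [c]) @ D1" by simp
   then have "weight (concat (mv @ [c])) <= 32 * 2 ^ (l - 1)" using Z(2) by simp
   then have len: "length (mv @ [c]) <= 33" by (intro few_blocks[OF lev(1-3), of X0 _ Ys]) (use mv(3) in auto)
   have lB: "lc + length mv < B" "lc + length mv + 1 < Z" using len lc B_big B_lt_Z by auto
   have LB: "live A (concat (X0 @ mv)) + live A c < Z" using liveB[of "X0 @ mv @ [c]" Ys] mv(3) nd_Z(3)[of "live A (concat (X0 @ mv)) + live A c"] by simp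
   have dB: "hd d < Z" using hB[of d] mv(3) Ys nd_Z by simp
   let ?R = "R'(48 := nd (hd c) l, 44 := lc + length mv + 1, 43 := live A (concat (X0 @ mv)) + live A c, 42 := hd d)"
   let ?M = "M'(adr 7 (lc + length mv) := nd (hd c) l)"
   have "I (length Ys') (\<tau> + 48) ?R ?M" unfolding I_def
   proof (rule conjI[rotated], rule conjI[rotated], rule exI[of _ "mv @ [c]"], rule exI[of _ d], rule exI[of _ Ys'], intro conjI)
    show "keep {42, 43, 44, 48} R ?R" using kp by (auto simp: keep_def)
    show "same {7} M ?M" using sm lB by (intro same_upd) auto
    show "p \<in> set (d @ concat Ys')" using mv(4) False Ys by auto
    show "\<forall>k<lc. ?M (adr 7 k) = M (adr 7 k)" using mv(9) lB by auto
    show "\<forall>k<length (mv @ [c]). ?M (adr 7 (lc + k)) = nd (hd ((mv @ [c]) ! k)) l"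
     using mv(10) lB by (auto simp: nth_append less_Suc_eq)
   qed (use mv Ys len in auto)
   moreover have "length Ys' < k" using mv Ys by simp
   ultimately show ?thesis using False b' st mv(5-7) r' l' lB LB dB bc nx
    unfolding walk_step_def by (auto simp: add.commute)
  qed
  then show "ok R' M' walk_cond \<and>
   leaves walk_cond <= 10 \<and>
   (if ev R' M' walk_cond = 0
    then Q (\<tau> + 1 + expr_cost walk_cond) R' M'
    else wp w walk_step (\<lambda>t R'' M''. bR R'' \<and> bM M'' \<and>
     (\<exists>k'<k. I k' (\<tau> + 1 + expr_cost walk_cond + t) R'' M'')) R' M')"
   unfolding cond using okc by (auto simp: add.assoc)
 qed (use b in auto)
 then show ?thesis unfolding walk_level_def by (rule wp_mono) (simp add: Q_def)
qed

text \<open>Between adjacent levels only an inclusion of first elements is required. By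
  \<open>refine_block\<close> it makes every block a concatenation of blocks one level down.\<close>

definition wf_tree :: "mem => (nat => nat list list) => nat list => nat set => (nat => nat) => bool" where
 "wf_tree M Ps es A vl \<longleftrightarrow> distinct es \<and> set es \<subseteq> {..2 * U} \<and> es ~= [] \<and> hd es = 0 \<and> 0 \<notin> A \<and> A \<subseteq> set es \<and>
   Ps 0 = map (\<lambda>e. [e]) es \<and> (\<forall>l\<le>tp. level M l (Ps l) es A vl \<and> bounded l (Ps l)) \<and>
   (\<forall>l<tp. hd ` set (Ps (l + 1)) \<subseteq> hd ` set (Ps l))"

lemma weight_es: "distinct es ==> set es \<subseteq> {..2 * U} ==> weight es <= 2 * U"
proof -
 assume d: "distinct es" "set es \<subseteq> {..2 * U}"
 have "weight es = card (set (filter (\<lambda>e. e ~= 0) es))" unfolding weight_def by (rule distinct_card[symmetric]) (use d in simp)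
 also have "\<dots> <= card {1..2 * U}" using d by (intro card_mono) auto
 finally show ?thesis by simp
qed

definition path_at :: "mem => nat list list => nat set => nat => nat => bool" where
 "path_at M bs A p l \<longleftrightarrow> (\<exists>Xs b Ys. bs = Xs @ b # Ys \<and> p \<in> set b \<and> M (adr 5 l) = hd b \<and> M (adr 6 l) = live A (concat Xs))"

definition logged :: "mem => (nat => nat list list) => (nat \<times> nat list) list => bool" where
 "logged M Ps lg \<longleftrightarrow> (\<forall>k<length lg. fst (lg ! k) <= tp \<and> snd (lg ! k) \<in> set (Ps (fst (lg ! k))) \<and>
   M (adr 7 k) = nd (hd (snd (lg ! k))) (fst (lg ! k)))"

text \<open>On each level the search stays inside the block found above, of weight below
  \<open>2 ^ (l + 2)\<close>, or on the top level inside the whole list, of weight at most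
  \<open>2 * U\<close>. In both cases at most 33 blocks are skipped per level, and the skipped
  blocks of all levels, in order, spell the elements before \<open>p\<close>.\<close>

lemma walk:
 assumes b: "bR R" "bM M" "std R" and r: "R 41 = t" and wf: "wf_tree M Ps es A vl" and p: "target es A t E1 p"
 shows "wp w walk (\<lambda>\<tau> R' M'. \<tau> <= 2100 * L \<and> bR R' \<and> bM M' \<and> std R' \<and> keep {42, 43, 44, 45, 46, 47, 48} R R' \<and>
  same {5, 6, 7} M M' \<and> R' 42 = p \<and> R' 46 = L - 2 \<and> (\<forall>l\<le>tp. path_at M' (Ps l) A p l) \<and>
  (\<exists>lg. R' 44 = length lg \<and> length lg <= 33 * L \<and> concat (map snd lg) = E1 \<and> logged M' Ps lg)) R M"
proof -
 note W = wf[unfolded wf_tree_def]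
 have W1: "distinct es" "set es \<subseteq> {..2 * U}" "es ~= []" "hd es = 0" "0 \<notin> A" "A \<subseteq> set es" "Ps 0 = map (\<lambda>e. [e]) es" using W by auto
 have lev: "level M l (Ps l) es A vl" "bounded l (Ps l)" if "l <= tp" for l using W that by auto
 obtain E2 where E2: "es = E1 @ p # E2" using p by (auto simp: target_def)
 have cc: "concat (Ps l) = es" "[] \<notin> set (Ps l)" if "l <= tp" for l using lev(1)[OF that] by (auto simp: level_def)
 define top where "top d l \<longleftrightarrow> l + d = tp" for d l :: nat
 \<comment> \<open>\<open>d\<close> counts the finished levels. The log spells \<open>C\<close>, the
   elements before the current block, and \<open>Zs\<close> are those between its start and
   \<open>p\<close>.\<close>
 define I where "I d R' M' \<longleftrightarrow> keep {42, 43, 44, 45, 47, 48} (R(46 := L - 2)) R' \<and> same {5, 6, 7} M M' \<and>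
  (\<forall>l\<le>tp. tp < l + d --> path_at M' (Ps l) A p l) \<and>
  (\<exists>lg C Zs. R' 44 = length lg \<and> length lg <= 33 * d \<and> concat (map snd lg) = C \<and> logged M' Ps lg \<and> E1 = C @ Zs \<and>
   R' 43 = live A C \<and>
   (if d = 0 then C = [] \<and> R' 42 = 0
    else (\<exists>Xs b Ys. Ps (tp + 1 - d) = Xs @ b # Ys \<and> concat Xs = C \<and> p \<in> set b \<and> R' 42 = hd b)))" for d R' M'
 have L3: "tp + 1 = L - 2" "tp + 3 = L" unfolding tp_def using Lb by auto
 have LZ: "L - 2 < Z" "L < Z" using bounds by linarith+
 let ?body = "Seq (Assign 47 (Bin Sub (Bin Sub (Reg 46) (Lit 1)) (Reg 45)))
   (Seq walk_level (Seq (St (Lit 5) (Reg 47) (Reg 42)) (St (Lit 6) (Reg 47) (Reg 43))))"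
 let ?R = "R(42 := 0, 43 := 0, 44 := 0, 45 := 0, 46 := L - 2)"
 have main: "wp w (For 45 46 ?body) (\<lambda>\<tau> R' M'. \<tau> <= 4 + (L - 2 - 0) * (2050 + 8) \<and> bR R' \<and> bM M' \<and> I (L - 2) R' M') ?R M"
 proof (rule wp_For[where a = 0 and z = "L - 2" and I = I])
  show "I 0 ?R M" unfolding I_def
   by (auto simp: keep_def logged_def)
 next
  fix d R' M' assume d: "d < L - 2" and I: "I d R' M'" and R': "R' 45 = d" "R' 46 = L - 2" "bR R'" "bM M'"
  define l where "l = tp - d"
  have l: "l <= tp" "l < U" "L - 2 - 1 - d = l" "tp + 1 - Suc d = l" using d L3 tp_U[of l] by (auto simp: l_def)
  have st: "std R'" by (rule std_keep[of "{42, 43, 44, 45, 47, 48}" "R(46 := L - 2)"]) (use I b in \<open>simp_all add: I_def\<close>)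
  have r41: "R' 41 = t" using I r by (auto simp: I_def keep_def)
  have sm: "same {5, 6, 7} M M'" using I by (simp add: I_def)
  have lev': "level M' k (Ps k) es A vl" if "k <= tp" for k
   by (rule level_frame[OF lev_same_low[OF sm tp_U[OF that]] lev(1)[OF that] W1(2)]) auto
  obtain lg C Zs where lg: "R' 44 = length lg" "length lg <= 33 * d" "concat (map snd lg) = C" "logged M' Ps lg" "E1 = C @ Zs"
   "R' 43 = live A C" "if d = 0 then C = [] \<and> R' 42 = 0
    else (\<exists>Xs b Ys. Ps (tp + 1 - d) = Xs @ b # Ys \<and> concat Xs = C \<and> p \<in> set b \<and> R' 42 = hd b)"
   using I unfolding I_def by blast
  have start: "\<exists>X0 b0 Y0 Zs'. Ps l = X0 @ b0 # Y0 \<and> concat X0 = C \<and> hd b0 = R' 42 \<and> p \<in> set (b0 @ concat Y0) \<and>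
   E1 = C @ Zs' \<and> weight Zs' <= 32 * 2 ^ (l - 1)"
  proof (cases "d = 0")
   case True
   then have C: "C = []" "R' 42 = 0" "l = tp" using lg(7) by (auto simp: l_def)
   obtain b0 Y0 where P: "Ps l = b0 # Y0" using cc[OF l(1)] W1(3) by (cases "Ps l") auto
   have "b0 ~= []" using cc(2)[OF l(1)] P by auto
   then have "hd b0 = 0" using cc(1)[OF l(1)] W1(4) P by (metis concat.simps(2) hd_append2)
   moreover have "p \<in> set (b0 @ concat Y0)" using cc(1)[OF l(1)] P E2 by auto
   moreover have "weight E1 <= 32 * 2 ^ (l - 1)"
   proof -
    have "weight E1 <= weight es" using E2 by simp
    also have "\<dots> <= 2 * U" by (rule weight_es[OF W1(1,2)])
    \<comment> \<open>The origin of the factor 32: the top level is \<open>L - 3\<close>, and the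
      list has at most \<open>2 * U\<close> elements besides the sentinel.\<close>
    also have "2 * U = 32 * 2 ^ (tp - 1)"
    proof -
     have "L = 4 + (tp - 1)" unfolding tp_def using Lb by simp
     then have "U = 2 ^ 4 * 2 ^ (tp - 1)" unfolding U_def by (metis power_add)
     then show ?thesis by simp
    qed
    finally show ?thesis using C by simp
   qed
   ultimately show ?thesis using P C
    by - (rule exI[of _ "[]"], rule exI[of _ b0], rule exI[of _ Y0], rule exI[of _ E1], auto)
  next
   case False
   then obtain Xs c Ys where c: "Ps (tp + 1 - d) = Xs @ c # Ys" "concat Xs = C" "p \<in> set c" "R' 42 = hd c" using lg(7) by auto
   have l1: "tp + 1 - d = l + 1" "l + 1 <= tp" "l < tp" using False d L3 by (auto simp: l_def)
   have sub: "hd ` set (Ps (l + 1)) \<subseteq> hd ` set (Ps l)" using W l1(3) by blast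
   \<comment> \<open>The block found on level \<open>l + 1\<close> consists of blocks of level
     \<open>l\<close>, and the first of these has the same first element; so register 42 already
     names the node to start from.\<close>
   obtain Q1 Qb Q2 where Q: "Ps l = Q1 @ Qb @ Q2" "concat Q1 = concat Xs" "concat Qb = c" "concat Q2 = concat Ys"
    using refine_block[OF cc(1)[OF l(1)] cc(1)[OF l1(2)] W1(1) cc(2)[OF l(1)] cc(2)[OF l1(2)] sub c(1)[unfolded l1(1)]] by blast
   have cne: "c ~= []" using c(3) by auto
   then obtain b0 Qr where b0: "Qb = b0 # Qr" using Q(3) by (cases Qb) auto
   have "b0 ~= []" using cc(2)[OF l(1)] Q(1) b0 by auto
   then have hb: "hd b0 = hd c" using Q(3) b0 by auto
   have es: "es = C @ c @ concat Ys" using cc(1)[OF l1(2)] c(1,2) l1(1) by simp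
   have "p \<in> set (c @ concat Ys)" using c(3) by simp
   from target_block(2)[OF p W1(1) es cne this c(3)] obtain b1 b2 where bb: "c = b1 @ p # b2" "E1 = C @ b1" by blast
   have "weight b1 <= weight c" using bb by simp
   moreover have "weight c < 2 ^ (l + 1 + 1)" using lev(2)[OF l1(2)] c(1) l1(1) by (auto simp: bounded_def)
   moreover have "(2::nat) ^ (l + 1 + 1) <= 32 * 2 ^ (l - 1)"
   proof (cases l)
    case (Suc k)
    then show ?thesis by (simp add: power_add)
   qed simp
   ultimately have "weight b1 <= 32 * 2 ^ (l - 1)" by linarith
   moreover have "p \<in> set (b0 @ concat (Qr @ Q2))" using c(3) Q(3) b0 by auto
   ultimately show ?thesis using Q b0 hb bb c
    by - (rule exI[of _ Q1], rule exI[of _ b0], rule exI[of _ "Qr @ Q2"], rule exI[of _ b1], auto)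
  qed
  then obtain X0 b0 Y0 Zs' where S: "Ps l = X0 @ b0 # Y0" "concat X0 = C" "hd b0 = R' 42" "p \<in> set (b0 @ concat Y0)"
   "E1 = C @ Zs'" "weight Zs' <= 32 * 2 ^ (l - 1)" by blast
  have dU: "33 * d + 40 <= 40 * U" using d L_U U_ge by linarith
  let ?R1 = "R'(47 := l)"
  have lZ: "l < Z" "d < Z" "L - 2 - 1 < Z" using l(2) bounds d LZ by linarith+
  have b1: "bR ?R1" "std ?R1" using R' st lZ by auto
  have wl: "wp w walk_level (\<lambda>\<tau> R'' M''. \<tau> <= 2000 \<and> bR R'' \<and> bM M'' \<and> std R'' \<and> keep {42, 43, 44, 48} ?R1 R'' \<and> same {7} M' M'' \<and>
   (\<exists>mv b Y. Ps l = X0 @ mv @ b # Y \<and> p \<in> set b \<and> R'' 42 = hd b \<and> R'' 43 = live A (concat (X0 @ mv)) \<and>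
    R'' 44 = length lg + length mv \<and> length mv <= 33 \<and> (\<forall>k<length lg. M'' (adr 7 k) = M' (adr 7 k)) \<and>
    (\<forall>k<length mv. M'' (adr 7 (length lg + k)) = nd (hd (mv ! k)) l))) ?R1 M'"
   by (rule walk_level[OF b1(1) R'(4) b1(2) _ _ _ _ _ lev'[OF l(1)] W1(1,4,2,5) l(2) S(1) p S(4)])
    (use r41 S lg dU in auto)
  have sub: "1 <= L - 2" "d <= L - 2 - 1" using d by linarith+
  show "wp w ?body (\<lambda>\<tau> R'' M''. \<tau> <= 2050 \<and> R'' 45 = d \<and> R'' 46 = L - 2 \<and> bR R'' \<and> bM M'' \<and> I (Suc d) (R''(45 := Suc d)) M'') R' M'"
   unfolding wp_Seq
  proof (use R' l(3) sub lZ in \<open>simp del: diff_diff_left\<close>, rule wp_mono[OF wl], elim conjE exE, goal_cases)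
   case prems: (1 \<tau> R2 M2 mv c Y)
   have r2: "R2 47 = l" "R2 45 = d" "R2 46 = L - 2" using \<open>keep {42, 43, 44, 48} ?R1 R2\<close> R' by (auto simp: keep_def)
   have Psl: "Ps l = (X0 @ mv) @ c # Y" using prems by simp
   have cB: "hd c <= 2 * U" using level_heads[OF lev'[OF l(1)], of c] Psl W1(2) by auto
   have lB: "l < B" using l(2) bounds by linarith
   let ?M = "M2(adr 5 l := hd c, adr 6 l := live A (concat (X0 @ mv)))"
   have s2: "same {7} M' M2" by fact
   have smM: "same {5, 6, 7} M ?M"
    using sm s2 lB by (auto simp: same_def)
   have pathl: "path_at ?M (Ps l) A p l" unfolding path_at_def
    using Psl \<open>p \<in> set c\<close> lB by - (rule exI[of _ "X0 @ mv"], rule exI[of _ c], rule exI[of _ Y], simp)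
   have paths: "path_at ?M (Ps k) A p k" if "k <= tp" "tp < k + Suc d" for k
   proof (cases "k = l")
    case False
    then have k: "tp < k + d" using that by (auto simp: l_def)
    have kB: "k < B" using tp_U[OF that(1)] bounds by linarith
    have "path_at M' (Ps k) A p k" using I that k by (simp add: I_def)
    moreover have "?M (adr 5 k) = M' (adr 5 k)" "?M (adr 6 k) = M' (adr 6 k)"
     using s2 False kB lB by (auto simp: same_def)
    ultimately show ?thesis by (simp add: path_at_def)
   qed (use pathl in simp)
   let ?lg = "lg @ map (Pair l) mv"
   have mvs: "mv ! k \<in> set (Ps l)" if "k < length mv" for k using Psl that by auto
   have "length ?lg <= 33 * Suc d" using lg(2) \<open>length mv <= 33\<close> by simp
   then have lgB: "k < B" if "k < length ?lg" for k using that dU B_big by (simp del: length_append)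
   have log': "logged ?M Ps ?lg" unfolding logged_def
   proof (intro allI impI)
    fix k assume k: "k < length ?lg"
    have e: "?M (adr 7 k) = M2 (adr 7 k)" using lgB[OF k] lB by simp
    show "fst (?lg ! k) <= tp \<and> snd (?lg ! k) \<in> set (Ps (fst (?lg ! k))) \<and>
     ?M (adr 7 k) = nd (hd (snd (?lg ! k))) (fst (?lg ! k))"
    proof (cases "k < length lg")
     case True
     then have "M2 (adr 7 k) = M' (adr 7 k)" using prems by blast
     then show ?thesis using e True lg(4) by (simp add: logged_def nth_append)
    next
     case False
     then obtain k' where k': "k = length lg + k'" "k' < length mv" using k by (metis add_diff_inverse_nat length_append length_map nat_add_left_cancel_less)
     then have "M2 (adr 7 k) = nd (hd (mv ! k')) l" using prems by blast
     then show ?thesis using e k' mvs l(1) by (simp add: nth_append)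
    qed
   qed
   have ccl: "concat (map snd ?lg) = concat (X0 @ mv)" using lg(3) S(2) by (simp add: comp_def)
   have "es = concat (X0 @ mv) @ c @ concat Y" using cc(1)[OF l(1)] Psl by simp
   moreover have c: "c ~= []" "p \<in> set (c @ concat Y)" "p \<in> set c" using \<open>p \<in> set c\<close> by auto
   ultimately obtain c1 where "E1 = concat (X0 @ mv) @ c1" using target_block(2)[OF p W1(1) _ c] by blast
   moreover have "\<exists>Xs b Ys. Ps l = Xs @ b # Ys \<and> concat Xs = concat (X0 @ mv) \<and> p \<in> set b \<and> (R2(45 := Suc d)) 42 = hd b"
    by (rule exI[of _ "X0 @ mv"], rule exI[of _ c], rule exI[of _ Y]) (use Psl c prems in simp)
   ultimately have ex: "\<exists>lg C Zs. (R2(45 := Suc d)) 44 = length lg \<and> length lg <= 33 * Suc d \<and> concat (map snd lg) = C \<and> logged ?M Ps lg \<and>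
    E1 = C @ Zs \<and> (R2(45 := Suc d)) 43 = live A C \<and> (\<exists>Xs b Ys. Ps l = Xs @ b # Ys \<and> concat Xs = C \<and> p \<in> set b \<and> (R2(45 := Suc d)) 42 = hd b)"
    by - (rule exI[of _ ?lg], rule exI[of _ "concat (X0 @ mv)"], rule exI[of _ c1],
     intro conjI, use ccl log' \<open>length ?lg <= 33 * Suc d\<close> prems in simp_all)
   have "keep {42, 43, 44, 45, 47, 48} (R(46 := L - 2)) (R2(45 := Suc d))"
    using \<open>keep {42, 43, 44, 48} ?R1 R2\<close> I by (auto simp: I_def keep_def)
   then have "I (Suc d) (R2(45 := Suc d)) ?M" unfolding I_def using smM paths ex l(4) by simp
   moreover have "live A (concat (X0 @ mv)) < Z" "hd c < Z" using prems bR_reg[of R2 43] bR_reg[of R2 42] by simp_all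
   ultimately show ?case using prems r2 lB lZ R' by simp
  qed
 qed (use b LZ Lb in auto)
 have L2: "2 <= L" "4 + (L - 2 - 0) * (2050 + 8) + 30 <= 2100 * L" using Lb by auto
 show ?thesis unfolding walk_def using b r LZ L2
 proof (simp, intro wp_mono[OF main], elim conjE, goal_cases)
  case (1 \<tau> R' M')
  have I: "I (L - 2) R' M'" using 1 by simp
  then obtain lg C Zs where lg: "R' 44 = length lg" "length lg <= 33 * (L - 2)" "concat (map snd lg) = C" "logged M' Ps lg" "E1 = C @ Zs"
   and "if L - 2 = 0 then C = [] \<and> R' 42 = 0
    else (\<exists>Xs b Ys. Ps (tp + 1 - (L - 2)) = Xs @ b # Ys \<and> concat Xs = C \<and> p \<in> set b \<and> R' 42 = hd b)"
   unfolding I_def by blast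
  then obtain Xs c Ys where c: "Ps 0 = Xs @ c # Ys" "concat Xs = C" "p \<in> set c" "R' 42 = hd c" using Lb L3 by auto
  have "c \<in> set (map (\<lambda>e. [e]) es)" using c(1) W1(7) by simp
  then have cp: "c = [p]" using c(3) by auto
  have "es = C @ c @ concat Ys" using cc(1)[of 0] c by simp
  from target_block(2)[OF p W1(1) this] cp have "E1 = C" by (auto simp: Cons_eq_append_conv)
  moreover have "std R'" by (rule std_keep[of "{42, 43, 44, 45, 47, 48}" "R(46 := L - 2)"]) (use I b in \<open>simp_all add: I_def\<close>)
  moreover have "keep {42, 43, 44, 45, 46, 47, 48} R R'" "R' 46 = L - 2" using I by (auto simp: I_def keep_def)
  moreover have "33 * (L - 2) <= 33 * L" by simp
  moreover have "path_at M' (Ps l) A p l" if "l <= tp" for l using I that L3 by (auto simp: I_def)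
  ultimately show ?case using 1 I lg c cp by (auto simp: I_def)
 qed
qed

end

section \<open>Splitting a block that has become too heavy\<close>

definition find_split :: com where
 "find_split = While (Bin Less (Reg 53) (Reg 51)) (Seq (Assign 59 (node (Reg 52) (Reg 60)))
  (Seq (Assign 53 (Bin Add (Reg 53) (Ld (Lit 3) (Reg 59)))) (Seq (Assign 54 (Bin Add (Reg 54) (Ld (Lit 2) (Reg 59))))
  (Assign 52 (Ld (Lit 1) (Reg 59))))))"

text \<open>The right part receives the totals of the old block minus those of the left part; for
  this reason the old entries are overwritten last.\<close>

definition relink :: com where
 "relink = Seq (Assign 49 (node (Reg 52) (Reg 47)))
  (Seq (St (Lit 1) (Reg 49) (Ld (Lit 1) (Reg 48))) (Seq (St (Lit 1) (Reg 48) (Reg 52))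
  (Seq (St (Lit 3) (Reg 49) (Bin Sub (Ld (Lit 3) (Reg 48)) (Reg 53)))
  (Seq (St (Lit 2) (Reg 49) (Bin Sub (Ld (Lit 2) (Reg 48)) (Reg 54)))
  (Seq (St (Lit 3) (Reg 48) (Reg 53)) (St (Lit 2) (Reg 48) (Reg 54)))))))"

context progs
begin

text \<open>The elements to be moved are visited along level 0. After a deletion the next live one
  slides to the same position, so register 54 stays constant, while register 56 counts the
  insertions.\<close>

definition move_half :: com where
 "move_half = Seq (Assign 55 (Reg 52)) (Seq (Assign 56 (Lit 0)) (Seq (Assign 57 (Ld (Lit 3) (Reg 49))) (Seq (Assign 58 (Lit 0))
  (For 58 57 (Seq (If (Ld (Lit 2) (node (Reg 55) (Lit 0)))
    (Seq (Assign 10 (Bin Add (Lit 16) (Reg 48))) (Seq (Assign 11 (Reg 54)) (Seq pDel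
    (Seq (Assign 10 (Bin Add (Lit 16) (Reg 49))) (Seq (Assign 11 (Reg 56)) (Seq (Assign 12 (Ld (Lit 4) (Reg 55)))
    (Seq pIns (Assign 56 (Bin Add (Reg 56) (Lit 1)))))))))) Skip)
   (Assign 55 (Ld (Lit 1) (node (Reg 55) (Lit 0)))))))))"

definition split_block :: com where
 "split_block = Seq (Assign 60 (Bin Sub (Reg 47) (Lit 1))) (Seq (Assign 52 (Reg 42)) (Seq (Assign 53 (Lit 0)) (Seq (Assign 54 (Lit 0))
  (Seq find_split (Seq relink move_half)))))"

end

context tree
begin

lemma len_le_weight:
 assumes lev: "level M l bs es A vl" "distinct es" "hd es = 0" and bs: "bs = Xs @ mv @ Ys"
 shows "length mv <= weight (concat mv) + 1"
proof (cases mv)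
 case (Cons x mv')
 have ge: "1 <= weight b" if b: "b \<in> set mv'" for b
 proof -
  obtain B1 B2 where "mv' = B1 @ b # B2" using split_list[OF b] by blast
  then have e: "bs = (Xs @ x # B1) @ b # (B2 @ Ys)" using bs Cons by simp
  have "hd b ~= 0" by (rule hd_nonzero(2)[OF lev e]) simp
  then have "2 ^ (l - 1) <= weight b" using lev(1) e by (auto simp: level_def)
  moreover have "(1::nat) <= 2 ^ (l - 1)" by simp
  ultimately show ?thesis by linarith
 qed
 have "length mv' * 1 <= weight (concat mv')" using ge by (rule weight_concat_ge)
 then show ?thesis using Cons by simp
qed simp

text \<open>Sub-blocks weigh less than \<open>2 * q\<close>. Stopping as soon as the left part
  reaches \<open>q\<close> leaves it below \<open>3 * q\<close>, and more than \<open>q\<close> of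
  the total \<open>4 * q\<close> remains on the right. So both parts meet the lower bound for a
  block and stay below the upper one.\<close>

lemma find_split:
 assumes b: "bR R" "bM M" "std R" and r: "R 51 = q" "R 52 = hd b" "R 53 = 0" "R 54 = 0" "R 60 = l"
  and q: "q = 2 ^ l" and lev: "level M l Q es A vl" "bounded l Q" "distinct es" "hd es = 0" "set es \<subseteq> {..2 * U}" "0 \<notin> A" and l: "l < U"
  and Q: "Q = Q1 @ Qb @ Q2" "concat Qb = b" "weight b = 4 * q"
 shows "wp w find_split (\<lambda>\<tau> R' M'. \<tau> <= 200 * q \<and> bR R' \<and> M' = M \<and> std R' \<and> keep {52, 53, 54, 59} R R' \<and>
  (\<exists>c1 c2. b = c1 @ c2 \<and> c2 ~= [] \<and> hd c2 \<in> hd ` set Q \<and> R' 52 = hd c2 \<and> R' 53 = weight c1 \<and> R' 54 = live A c1 \<and>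
   q <= weight c1 \<and> weight c1 < 3 * q)) R M"
proof -
 have cc: "concat Q = es" "[] \<notin> set Q" using lev(1) by (auto simp: level_def)
 have q1: "q \<ge> 1" unfolding q by simp
 have bU: "weight b <= 2 * U"
 proof -
  have "weight b <= weight es" using cc Q by auto
  then show ?thesis using weight_es[OF lev(3,5)] by linarith
 qed
 define I where "I k \<tau> R' M' \<longleftrightarrow> M' = M \<and> keep {52, 53, 54, 59} R R' \<and> (\<exists>C1 C2. Qb = C1 @ C2 \<and> C2 ~= [] \<and> k = length C2 \<and>
  R' 52 = hd (hd C2) \<and> R' 53 = weight (concat C1) \<and> R' 54 = live A (concat C1) \<and> weight (concat C1) < 3 * q \<and> \<tau> <= 50 * length C1)"
  for k \<tau> R' M'
 define F where "F \<tau> R' M' \<longleftrightarrow> \<tau> <= 200 * q \<and> bR R' \<and> M' = M \<and> std R' \<and> keep {52, 53, 54, 59} R R' \<and>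
  (\<exists>c1 c2. b = c1 @ c2 \<and> c2 ~= [] \<and> hd c2 \<in> hd ` set Q \<and> R' 52 = hd c2 \<and> R' 53 = weight c1 \<and> R' 54 = live A c1 \<and>
   q <= weight c1 \<and> weight c1 < 3 * q)" for \<tau> :: nat and R' M'
 have Qbne: "Qb ~= []" using Q q1 by auto
 have "wp w find_split (\<lambda>\<tau>. F (0 + \<tau>)) R M" unfolding find_split_def
 proof (rule wp_While[where I = I and k = "length Qb"])
  have "hd (hd Qb) = hd b" using Qbne Q(1,2) cc(2) by (cases Qb) auto
  then show "I (length Qb) 0 R M" unfolding I_def using Qbne r q1
   by - (rule conjI, simp, rule conjI, simp add: keep_def, rule exI[of _ "[]"], rule exI[of _ Qb], auto)
 next
  fix k \<tau> R' M' assume I: "I k \<tau> R' M'" and b': "bR R'" "bM M'"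
  then obtain C1 C2 where C: "Qb = C1 @ C2" "C2 ~= []" "k = length C2" "R' 52 = hd (hd C2)" "R' 53 = weight (concat C1)"
   "R' 54 = live A (concat C1)" "weight (concat C1) < 3 * q" "\<tau> <= 50 * length C1" and M': "M' = M" and kp: "keep {52, 53, 54, 59} R R'"
   unfolding I_def by blast
  have st: "std R'" by (rule std_keep[OF kp]) (use b in simp_all)
  have r': "R' 51 = q" "R' 60 = l" using kp r by (auto simp: keep_def)
  obtain c C2' where c: "C2 = c # C2'" using C(2) by (cases C2) auto
  have cQ: "c \<in> set Q" using Q(1) C(1) c by simp
  have cne: "c ~= []" using cQ cc(2) by auto
  have cU: "hd c <= 2 * U" using level_heads[OF lev(1) cQ] lev(5) by auto
  have bc: "WT M (hd c) l = weight c" "LV M (hd c) l = live A c" using lev(1) cQ by (auto simp: level_def block_at_def)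
  have bd: "weight c < 2 * q" using lev(2) cQ by (auto simp: bounded_def q power_add)
  have len: "length C1 <= 3 * q"
   using len_le_weight[OF lev(1,3,4), of Q1 C1 "C2 @ Q2"] Q(1) C(1,7) by simp
  have bw: "weight (concat C1) + weight c + weight (concat C2') = 4 * q" using Q(2,3) C(1) c by auto
  have "live A (concat C1) + live A c <= weight (concat C1) + weight c" using live_le_weight[OF lev(6)] by (simp add: add_mono)
  then have small: "weight (concat C1) + weight c < Z" "live A (concat C1) + live A c < Z" "nd (hd c) l < Z" "nd (hd c) l < B"
   using bw Q(3) bU nd_Z nd_B cU l by auto
  have qq: "\<tau> + 4 <= 200 * q" using len C(8) q1 by linarith
  show "ok R' M' (Bin Less (Reg 53) (Reg 51)) \<and> leaves (Bin Less (Reg 53) (Reg 51)) <= 10 \<and>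
   (if ev R' M' (Bin Less (Reg 53) (Reg 51)) = 0 then F (\<tau> + 1 + expr_cost (Bin Less (Reg 53) (Reg 51))) R' M'
    else wp w (Seq (Assign 59 (node (Reg 52) (Reg 60))) (Seq (Assign 53 (Bin Add (Reg 53) (Ld (Lit 3) (Reg 59))))
     (Seq (Assign 54 (Bin Add (Reg 54) (Ld (Lit 2) (Reg 59)))) (Assign 52 (Ld (Lit 1) (Reg 59))))))
     (\<lambda>t R'' M''. bR R'' \<and> bM M'' \<and> (\<exists>k'<k. I k' (\<tau> + 1 + expr_cost (Bin Less (Reg 53) (Reg 51)) + t) R'' M'')) R' M')"
  proof (cases "weight (concat C1) < q")
   case False
   have "\<exists>c1 c2. b = c1 @ c2 \<and> c2 ~= [] \<and> hd c2 \<in> hd ` set Q \<and> R' 52 = hd c2 \<and> R' 53 = weight c1 \<and> R' 54 = live A c1 \<and>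
    q <= weight c1 \<and> weight c1 < 3 * q"
    by (rule exI[of _ "concat C1"], rule exI[of _ "concat C2"]) (use C c Q cne cQ False in auto)
   then show ?thesis using False C r' b' st kp M' qq by (simp add: F_def)
  next
   case True
   then have "C2' ~= []" using bw bd by auto
   then obtain d C3 where d: "C2' = d # C3" by (cases C2') auto
   have nx: "NX M (hd c) l = hd d"
   proof -
    have "linked M l (map hd (Q1 @ C1) @ hd c # hd d # map hd (C3 @ Q2))" using lev(1) Q(1) C(1) c d by (simp add: level_def)
    then show ?thesis by (rule linked_next)
   qed
   let ?R = "R'(59 := nd (hd c) l, 53 := weight (concat C1) + weight c, 54 := live A (concat C1) + live A c, 52 := hd d)"
   have "hd d < Z" using nx b' M' by (metis bM_cell)
   have I': "I (length C2') (35 + \<tau>) ?R M" unfolding I_def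
    by (rule conjI, simp, rule conjI, use kp in \<open>simp add: keep_def\<close>, rule exI[of _ "C1 @ [c]"], rule exI[of _ C2'])
     (use C c d True bd in auto)
   have "\<exists>k'<k. I k' (35 + \<tau>) ?R M" using I' C(3) c by auto
   then show ?thesis using True C(4-6) c r' b' st kp M' small bc nx \<open>hd d < Z\<close> by auto
  qed
 qed (use b in auto)
 then show ?thesis by (rule wp_mono) (simp add: F_def)
qed

lemma level_split:
 assumes lev: "level M l (Xs @ (c1 @ c2) # Ys) es A vl" and d: "distinct es" "set es \<subseteq> {..2 * U}" and l: "l < U"
  and c: "c1 ~= []" "c2 ~= []" "2 ^ (l - 1) <= weight c1" "2 ^ (l - 1) <= weight c2"
  and new: "block_at M' l A vl c1" "block_at M' l A vl c2" "NX M' (hd c1) l = hd c2" "NX M' (hd c2) l = NX M (hd c1) l"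
  and old: "\<And>e. e <= 2 * U ==> e \<notin> {hd c1, hd c2} ==> NX M' e l = NX M e l \<and> LV M' e l = LV M e l \<and> WT M' e l = WT M e l"
   "\<And>e us. e <= 2 * U ==> e \<notin> {hd c1, hd c2} ==> inst M (16 + nd e l) us ==> inst M' (16 + nd e l) us"
 shows "level M' l (Xs @ c1 # c2 # Ys) es A vl" "hd c2 \<notin> hd ` set (Xs @ (c1 @ c2) # Ys)"
proof -
 let ?bs = "Xs @ (c1 @ c2) # Ys"
 have es: "es = concat Xs @ (c1 @ c2) @ concat Ys" "[] \<notin> set ?bs" using lev by (auto simp: level_def)
 have h: "hd x <= 2 * U" if "x \<in> set ?bs" for x using level_heads[OF lev that] d by auto
 have ne: "hd x \<notin> {hd c1, hd c2}" if x: "x \<in> set (Xs @ Ys)" for x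
 proof -
  have "x ~= []" using x es(2) by auto
  then have "hd x \<in> set (concat (Xs @ Ys))" using x by (metis UN_I hd_in_set set_concat)
  moreover have "set (c1 @ c2) \<inter> set (concat (Xs @ Ys)) = {}" using d(1) unfolding es(1) by auto
  moreover have "hd c1 \<in> set (c1 @ c2)" "hd c2 \<in> set (c1 @ c2)" using c by auto
  ultimately show ?thesis by (metis IntI empty_iff insertE)
 qed
 have ne12: "hd c2 ~= hd c1"
 proof -
  have "distinct (c1 @ c2)" using d(1) unfolding es(1) by auto
  moreover have "hd c1 \<in> set c1" "hd c2 \<in> set c2" using c by auto
  ultimately show ?thesis by auto
 qed
 show "hd c2 \<notin> hd ` set ?bs"
 proof
  assume "hd c2 \<in> hd ` set ?bs"
  then obtain x where x: "x \<in> set ?bs" "hd x = hd c2" by (metis imageE)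
  then consider "x \<in> set (Xs @ Ys)" | "x = c1 @ c2" by auto
  then show False using ne[of x] ne12 c(1) x(2) by cases auto
 qed
 have bl: "block_at M' l A vl x" if x: "x \<in> set (Xs @ Ys)" for x
 proof -
  have xb: "x \<in> set ?bs" using x by auto
  have "block_at M l A vl x" using lev xb by (auto simp: level_def)
  then show ?thesis using old(1)[OF h[OF xb] ne[OF x]] old(2)[OF h[OF xb] ne[OF x]] by (simp add: block_at_def)
 qed
 have lk: "linked M l (map hd Xs @ hd c1 # map hd Ys)" using lev c(1) by (simp add: level_def)
 have "linked M l (map hd Xs @ [hd c1])" "linked M l (hd c1 # map hd Ys)" using lk linked_append by blast+
 have cg: "NX M' (hd x) l = NX M (hd x) l" if x: "x \<in> set (Xs @ Ys)" for x
  using old(1)[OF h ne[OF x]] x by auto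
 have "linked M' l (map hd Xs @ [hd c1])"
  using \<open>linked M l (map hd Xs @ [hd c1])\<close> cg
 proof (induction Xs)
  case (Cons x Xs)
  then show ?case by (cases Xs) auto
 qed simp
 moreover have "linked M' l (hd c2 # map hd Ys)"
 proof (cases Ys)
  case (Cons y Ys')
  have "linked M' l (map hd Ys) = linked M l (map hd Ys)" by (rule linked_cong) (use cg in auto)
  then show ?thesis using \<open>linked M l (hd c1 # map hd Ys)\<close> Cons new(4) by simp
 qed simp
 ultimately have "linked M' l (map hd Xs @ hd c1 # hd c2 # map hd Ys)"
  by (subst linked_append) (use new(3) in simp)
 then have lk': "linked M' l (map hd (Xs @ c1 # c2 # Ys))" by simp
 have inst: "inst M' (16 + nd e l) []" if e: "e <= 2 * U" "e \<notin> hd ` set (Xs @ c1 # c2 # Ys)" for e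
 proof -
  have "e \<notin> {hd c1, hd c2}" "e \<notin> hd ` set ?bs" using e c(1) by auto
  then show ?thesis using old(2)[OF e(1)] lev e(1) by (auto simp: level_def)
 qed
 have "hd x ~= 0 --> 2 ^ (l - 1) <= weight x" if "x \<in> set (Xs @ c1 # c2 # Ys)" for x
  using that lev c by (auto simp: level_def)
 then show "level M' l (Xs @ c1 # c2 # Ys) es A vl"
  unfolding level_def using es bl new c lk' inst by auto
qed

lemma move_half:
 assumes b: "bR R" "bM M" "std R" and r: "R 48 = v" "R 49 = v'" "R 52 = hd c2" "R 54 = live A c1"
  and v: "16 + v < B" "16 + v' < B" "v ~= v'" "M (adr 3 v') = length c2" "c2 ~= []"
  and inst: "inst M (16 + v) (vals A vl (c1 @ c2))" "inst M (16 + v') []"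
  and lev0: "level M 0 (map (\<lambda>e. [e]) es) es A vl" "set es \<subseteq> {..2 * U}" and es: "es = P0 @ c2 @ S0"
  and vl: "\<And>e. e \<in> A ==> e \<in> set es ==> M (adr 4 e) = vl e \<and> legal (vl e)" and lm: "live A (c1 @ c2) <= m"
 shows "wp w move_half (\<lambda>t R' M'. t <= 50 + length c2 * (2 * (gam * T) + 150) \<and> bR R' \<and> bM M' \<and> std R' \<and>
  keep {10, 11, 12, 13, 55, 56, 57, 58} R R' \<and> same {16 + v, 16 + v'} M M' \<and>
  inst M' (16 + v) (vals A vl c1) \<and> inst M' (16 + v') (vals A vl c2)) R M"
proof -
 have vZ: "16 + v < Z" "16 + v' < Z" "v < B" "v' < B" "v < Z" "v' < Z" using v B_lt_Z by linarith+
 have c2U: "e <= 2 * U" if "e \<in> set c2" for e using that lev0(2) es by auto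
 have lc: "length c2 < Z" using v(4) b(2) by (metis bM_cell)
 have U0: "0 < U" using U_ge by linarith
 define I where "I k R' M' \<longleftrightarrow> keep {10, 11, 12, 13, 55, 56, 58} (R(57 := length c2)) R' \<and> same {16 + v, 16 + v'} M M' \<and>
  inst M' (16 + v) (vals A vl c1 @ vals A vl (drop k c2)) \<and> inst M' (16 + v') (vals A vl (take k c2)) \<and>
  R' 56 = live A (take k c2) \<and> (k < length c2 --> R' 55 = c2 ! k)" for k R' M'
 let ?upd = "Seq (Assign 10 (Bin Add (Lit 16) (Reg 48))) (Seq (Assign 11 (Reg 54)) (Seq pDel
    (Seq (Assign 10 (Bin Add (Lit 16) (Reg 49))) (Seq (Assign 11 (Reg 56)) (Seq (Assign 12 (Ld (Lit 4) (Reg 55)))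
    (Seq pIns (Assign 56 (Bin Add (Reg 56) (Lit 1)))))))))"
 let ?body = "Seq (If (Ld (Lit 2) (node (Reg 55) (Lit 0))) ?upd Skip) (Assign 55 (Ld (Lit 1) (node (Reg 55) (Lit 0))))"
 let ?R = "R(55 := hd c2, 56 := 0, 57 := length c2, 58 := 0)"
 have hdZ: "hd c2 < Z" using r(3) b(1) by (metis bR_reg)
 have main: "wp w (For 58 57 ?body) (\<lambda>t R' M'. t <= 4 + (length c2 - 0) * (2 * (gam * T) + 120 + 8) \<and> bR R' \<and> bM M' \<and> I (length c2) R' M') ?R M"
 proof (rule wp_For[where a = 0 and z = "length c2" and I = I])
  show "I 0 ?R M" unfolding I_def using inst r v(5) by (auto simp: keep_def hd_conv_nth)
 next
  fix k R' M' assume k: "k < length c2" and I: "I k R' M'" and R': "R' 58 = k" "R' 57 = length c2" "bR R'" "bM M'"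
  have st: "std R'" by (rule std_keep[of "{10, 11, 12, 13, 55, 56, 58}" "R(57 := length c2)"]) (use I b in \<open>simp_all add: I_def\<close>)
  define g where "g = c2 ! k"
  have g: "g \<in> set c2" "g <= 2 * U" "g \<in> set es" using k es c2U by (auto simp: g_def)
  have r': "R' 48 = v" "R' 49 = v'" "R' 54 = live A c1" "R' 55 = g" "R' 56 = live A (take k c2)"
   using I r k by (auto simp: I_def keep_def g_def)
  have sm: "same {16 + v, 16 + v'} M M'" using I by (simp add: I_def)
  have lvg: "LV M' g 0 = (if g \<in> A then 1 else 0)"
  proof -
   have "block_at M 0 A vl [g]" using lev0(1) g(3) by (auto simp: level_def)
   then have "LV M g 0 = (if g \<in> A then 1 else 0)" by (simp add: block_at_def)
   moreover have "LV M' g 0 = LV M g 0" by (rule sameD[OF sm]) (use nd_B g U0 in auto)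
   ultimately show ?thesis by simp
  qed
  have nxt: "Suc k < length c2 ==> NX M' g 0 = c2 ! Suc k"
  proof -
   assume k1: "Suc k < length c2"
   have "c2 = take k c2 @ c2 ! k # c2 ! Suc k # drop (Suc (Suc k)) c2"
    using k k1 by (simp add: Cons_nth_drop_Suc)
   then have "es = (P0 @ take k c2) @ g # c2 ! Suc k # (drop (Suc (Suc k)) c2 @ S0)" using es by (metis append.assoc append_Cons g_def)
   moreover have "linked M 0 es" using lev0(1) by (simp add: level_def comp_def)
   ultimately have "NX M g 0 = c2 ! Suc k" by (metis linked_next)
   moreover have "NX M' g 0 = NX M g 0" by (rule sameD[OF sm]) (use nd_B g U0 in auto)
   ultimately show ?thesis by simp
  qed
  have gB: "nd g 0 < B" "nd g 0 < Z" "g < B" "g < Z" using nd_B nd_Z g U0 by auto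
  have dk: "drop k c2 = g # drop (Suc k) c2" "take (Suc k) c2 = take k c2 @ [g]"
   using k by (auto simp: g_def Cons_nth_drop_Suc take_Suc_conv_app_nth)
  have nz: "NX M'' g 0 < Z" if "bM M''" for M'' using that by simp
  show "wp w ?body (\<lambda>t R'' M''. t <= 2 * (gam * T) + 120 \<and> R'' 58 = k \<and> R'' 57 = length c2 \<and> bR R'' \<and> bM M'' \<and>
   I (Suc k) (R''(58 := Suc k)) M'') R' M'"
  proof (cases "g \<in> A")
   case False
   have "I (Suc k) (R'(55 := NX M' g 0, 58 := Suc k)) M'"
    using I False dk nxt by (auto simp: I_def keep_def)
   then show ?thesis using R' st r' lvg False gB by simp
  next
   case True
   have vg: "M (adr 4 g) = vl g" "legal (vl g)" using vl[OF True g(3)] by auto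
   have vg': "M' (adr 4 g) = vl g" using sameD[OF sm gB(3), of 4] vg by simp
   let ?X = "vals A vl c1 @ vals A vl (drop k c2)"
   have lX: "length ?X <= m"
   proof -
    have "live A c2 = live A (take k c2) + live A (drop k c2)" by (metis append_take_drop_id live_simps(3))
    then show ?thesis using lm by simp
   qed
   let ?R1 = "R'(10 := 16 + v, 11 := live A c1)"
   have lZ: "live A c1 < Z" "live A (take k c2) < Z" using r' R' by (metis bR_reg)+
   have b1: "bR ?R1" "std ?R1" using R' st vZ lZ by auto
   have del: "wp w pDel (\<lambda>t R2 M2. t <= gam * T \<and> bR R2 \<and> bM M2 \<and> keep {12, 13} ?R1 R2 \<and> std R2 \<and>
    inst M2 (16 + v) (take (live A c1) ?X @ drop (Suc (live A c1)) ?X) \<and> same {16 + v} M' M2) ?R1 M'"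
    by (rule pDel[OF b1(1) R'(4) b1(2)]) (use I v lX dk True in \<open>auto simp: I_def\<close>)
   have eX: "take (live A c1) ?X @ drop (Suc (live A c1)) ?X = vals A vl c1 @ vals A vl (drop (Suc k) c2)"
    using dk True by simp
   show ?thesis
   proof (simp add: R' st r' lvg True gB vZ lZ, rule wp_mono[OF del], elim conjE, goal_cases)
    case (1 t2 R2 M2)
    note 2 = this
    have r2: "R2 48 = v" "R2 49 = v'" "R2 54 = live A c1" "R2 55 = g" "R2 56 = live A (take k c2)" "R2 57 = length c2" "R2 58 = k"
     using 2(4) r' R' by (auto simp: keep_def)
    have i2: "inst M2 (16 + v') (vals A vl (take k c2))" using inst_same[OF 2(7)] I v(3) by (auto simp: I_def)
    have vg2: "M2 (adr 4 g) = vl g" using sameD[OF 2(7) gB(3), of 4] vg' by simp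
    let ?R2 = "R2(10 := 16 + v', 11 := live A (take k c2), 12 := vl g)"
    have b2: "bR ?R2" "std ?R2" using 2 vZ lZ legal_lt vg by auto
    have lt: "length (vals A vl (take k c2)) < m"
    proof -
     have "live A c2 = live A (take k c2) + live A (drop k c2)" by (metis append_take_drop_id live_simps(3))
     then show ?thesis using lm dk True by simp
    qed
    have ins: "wp w pIns (\<lambda>t R3 M3. t <= gam * T \<and> bR R3 \<and> bM M3 \<and> keep {12, 13} ?R2 R3 \<and> std R3 \<and>
     inst M3 (16 + v') (take (live A (take k c2)) (vals A vl (take k c2)) @ vl g # drop (live A (take k c2)) (vals A vl (take k c2)))
     \<and> same {16 + v'} M2 M3) ?R2 M2"
     by (rule pIns[OF b2(1) 2(3) b2(2)]) (use i2 v vg lt in auto)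
    have l1Z: "live A (take k c2) + 1 < Z" using lt bounds by simp
    show ?case
    proof (simp add: 2(2,3,5) r2 vZ lZ gB vg2, rule wp_mono[OF ins], elim conjE, goal_cases)
     case (1 t3 R3 M3)
     note 3 = this
     have r3: "R3 55 = g" "R3 56 = live A (take k c2)" "R3 57 = length c2" "R3 58 = k" using 3(4) r2 by (auto simp: keep_def)
     have i3: "inst M3 (16 + v') (vals A vl (take (Suc k) c2))" using 3(6) dk True by simp
     have i3': "inst M3 (16 + v) (vals A vl c1 @ vals A vl (drop (Suc k) c2))" using inst_same[OF 3(7)] 2(6) eX v(3) by auto
     have sm3: "same {16 + v, 16 + v'} M M3" using sm 2(7) 3(7) by (auto simp: same_def)
     have nx3: "NX M3 g 0 = NX M' g 0" using sameD[OF 3(7) gB(1), of 1] sameD[OF 2(7) gB(1), of 1] by simp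
     have kp: "keep {10, 11, 12, 13, 55, 56, 58} (R(57 := length c2)) (R3(56 := live A (take k c2) + 1, 55 := NX M3 g 0, 58 := Suc k))"
      using 3(4) 2(4) I by (auto simp: I_def keep_def)
     have "I (Suc k) (R3(56 := live A (take k c2) + 1, 55 := NX M3 g 0, 58 := Suc k)) M3"
      unfolding I_def using kp sm3 i3 i3' dk True nxt nx3 by simp
     then show ?case using 3 r3 l1Z gB \<open>t2 <= gam * T\<close> by simp
    qed
   qed
  qed
 qed (use b hdZ lc in auto)
 have time: "length c2 * (128 + 2 * (gam * T)) <= length c2 * (2 * (gam * T) + 150)" by (intro mult_mono) auto
 show ?thesis unfolding move_half_def using b r hdZ lc vZ v(4)
 proof (simp, intro wp_mono[OF main], elim conjE, goal_cases)
  case (1 t R' M')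
  have I: "I (length c2) R' M'" using 1 by simp
  have "std R'" by (rule std_keep[of "{10, 11, 12, 13, 55, 56, 58}" "R(57 := length c2)"]) (use I b in \<open>simp_all add: I_def\<close>)
  moreover have "keep {10, 11, 12, 13, 55, 56, 57, 58} R R'" using I by (auto simp: I_def keep_def)
  moreover have "t <= 4 + x ==> x <= y ==> t <= 37 + y" for x y by linarith
  from this[OF _ time] have "t <= 37 + length c2 * (2 * (gam * T) + 150)" using 1 by simp
  ultimately show ?case using 1 I by (simp add: I_def)
 qed
qed

lemma relink:
 assumes b: "bR R" "bM M" "std R" and r: "R 47 = l" "R 48 = v" "R 52 = h" "R 53 = pw" "R 54 = pl"
  and v: "v < B" "nd h l < B" "v ~= nd h l" "pw <= M (adr 3 v)" "pl <= M (adr 2 v)"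
 shows "wp w relink (\<lambda>t R' M'. t <= 100 \<and> R' = R(49 := nd h l) \<and> bM M' \<and>
  M' = M(adr 1 (nd h l) := M (adr 1 v), adr 1 v := h, adr 3 (nd h l) := M (adr 3 v) - pw,
   adr 2 (nd h l) := M (adr 2 v) - pl, adr 3 v := pw, adr 2 v := pl)) R M"
proof -
 have Zs: "v < Z" "nd h l < Z" "h < Z" "pw < Z" "pl < Z" using v B_lt_Z r b(1) by (metis bR_reg less_trans)+
 have "M (adr 3 v) - pw < Z" "M (adr 2 v) - pl < Z" using b(2) by (metis bM_cell diff_le_self le_less_trans)+
 then show ?thesis unfolding relink_def using b r v Zs by simp
qed

lemma split_block:
 assumes b: "bR R" "bM M" "std R" and r: "R 47 = l" "R 42 = hd b" "R 48 = nd (hd b) l" "R 51 = q"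
  and l: "1 <= l" "l <= tp" and q: "q = 2 ^ (l - 1)"
  and W: "distinct es" "set es \<subseteq> {..2 * U}" "hd es = 0" "0 \<notin> A"
  and lev: "level M l (Xs @ b # Ys) es A vl" "weight b = 4 * q"
  and low: "level M (l - 1) Q es A vl" "bounded (l - 1) Q" "hd ` set (Xs @ b # Ys) \<subseteq> hd ` set Q"
  and lev0: "level M 0 (map (\<lambda>e. [e]) es) es A vl"
  and vl: "\<And>e. e \<in> A ==> e \<in> set es ==> M (adr 4 e) = vl e \<and> legal (vl e)"
 shows "wp w split_block (\<lambda>t R' M'. t <= q * (6 * (gam * T) + 1000) \<and> bR R' \<and> bM M' \<and> std R' \<and>
  keep ({10, 11, 12, 13, 49} \<union> {52..60}) R R' \<and> same ({1, 2, 3} \<union> {16..}) M M' \<and>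
  (\<forall>l'\<le>tp. l' ~= l --> lev_same l' M M') \<and>
  (\<exists>c1 c2. b = c1 @ c2 \<and> level M' l (Xs @ c1 # c2 # Ys) es A vl \<and> weight c1 < 4 * q \<and> weight c2 < 4 * q \<and>
   hd c1 = hd b \<and> hd c2 \<in> hd ` set Q)) R M"
proof -
 have lU: "l < U" "l - 1 < U" "0 < U" using tp_U[OF l(2)] by auto
 have q1: "1 <= q" unfolding q by simp
 have cc: "concat Q = es" "[] \<notin> set Q" "concat (Xs @ b # Ys) = es" "[] \<notin> set (Xs @ b # Ys)" using low(1) lev(1) by (auto simp: level_def)
 obtain Q1 Qb Q2 where Q: "Q = Q1 @ Qb @ Q2" "concat Qb = b"
  using refine_block[OF cc(1,3) W(1) cc(2,4) low(3) refl] by blast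
 have es: "es = concat Xs @ b @ concat Ys" using cc(3) by simp
 have bne: "b ~= []" using cc(4) by auto
 have hbU: "hd b <= 2 * U" using level_heads[OF lev(1), of b] W(2) by auto
 define v where "v = nd (hd b) l"
 have vB: "v < B" "16 + v < B" "v < Z" using nd_B nd_Z hbU lU unfolding v_def by auto
 have bb: "WT M (hd b) l = weight b" "LV M (hd b) l = live A b" "inst M (16 + v) (vals A vl b)"
  using lev(1) by (auto simp: level_def block_at_def v_def)
 \<comment> \<open>Needed for legality: the timelines of both copies stay within \<open>m\<close>
   while updates are moved.\<close>
 have lm: "live A b <= m"
 proof -
  have "live A b <= 4 * q" using live_le_weight[OF W(4), of b] lev(2) by simp
  also have "\<dots> = 2 ^ (l + 1)" unfolding q using l(1) by (cases l) (auto simp: power_add)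
  also have "\<dots> <= 2 ^ (L - 1)" using l(2) Lb unfolding tp_def by (intro power_increasing) auto
  also have "2 ^ (L - 1) <= m"
  proof -
   have "L = Suc (L - 1)" using Lb by simp
   then have "U = 2 * 2 ^ (L - 1)" unfolding U_def by (metis power_Suc)
   then show ?thesis using mU by simp
  qed
  finally show ?thesis .
 qed
 let ?R = "R(60 := l - 1, 52 := hd b, 53 := 0, 54 := 0)"
 have lZ: "l < Z" "l - 1 < Z" "hd b < Z" using lU nd_Z hbU bounds by auto
 have b1: "bR ?R" "std ?R" using b lZ by auto
 have fs: "wp w find_split (\<lambda>\<tau> R' M'. \<tau> <= 200 * q \<and> bR R' \<and> M' = M \<and> std R' \<and> keep {52, 53, 54, 59} ?R R' \<and>
  (\<exists>c1 c2. b = c1 @ c2 \<and> c2 ~= [] \<and> hd c2 \<in> hd ` set Q \<and> R' 52 = hd c2 \<and> R' 53 = weight c1 \<and> R' 54 = live A c1 \<and>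
   q <= weight c1 \<and> weight c1 < 3 * q)) ?R M"
  by (rule find_split[OF b1(1) b(2) b1(2) _ _ _ _ _ q low(1,2) W(1,3,2,4) lU(2) Q lev(2)]) (use r in simp_all)
 show ?thesis unfolding split_block_def
 proof (simp add: b r lZ l, rule wp_mono[OF fs], elim conjE exE, goal_cases)
  case f: (1 t1 R1 M1 c1 c2)
  have M1: "M1 = M" by fact
  have c: "b = c1 @ c2" "c2 ~= []" "q <= weight c1" "weight c1 < 3 * q" "hd c2 \<in> hd ` set Q" by fact+
  have c1: "c1 ~= []" using c(3) q1 by auto
  then have c1: "c1 ~= []" "hd c1 = hd b" using c(1) by simp_all
  have wc2: "weight c1 + weight c2 = 4 * q" using lev(2) c(1) by simp
  \<comment> \<open>The sentinel heads the whole list and thus stays in the left part. Hence weight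
    and length of \<open>c2\<close> agree, and \<open>move_half\<close> may take the stored weight
    as its loop bound.\<close>
  have z2: "0 \<notin> set c2"
  proof -
   have "hd (concat Xs @ c1) = 0" using W(3) es c(1) c1(1) hd_append2[of "concat Xs @ c1" "c2 @ concat Ys"] by simp
   then have "0 \<in> set (concat Xs @ c1)" using c1(1) by (metis append_is_Nil_conv hd_in_set)
   moreover have "distinct ((concat Xs @ c1) @ c2 @ concat Ys)" using W(1) es c(1) by simp
   ultimately show ?thesis by auto
  qed
  have lc2: "length c2 = weight c2" using weight_eq_length[OF z2] by simp
  have "hd c2 \<in> set es" using es c by auto
  then have h2U: "hd c2 <= 2 * U" using W(2) by auto
  have ne: "hd c2 ~= hd b"
  proof -
   have "distinct b" using W(1) es by simp
   then have "distinct (c1 @ c2)" using c(1) by simp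
   moreover have "hd c1 \<in> set c1" "hd c2 \<in> set c2" using c c1 by auto
   ultimately show ?thesis using c1(2) by auto
  qed
  define v' where "v' = nd (hd c2) l"
  have v'B: "v' < B" "16 + v' < B" "v' ~= v" using nd_B h2U lU ne nd_inj unfolding v'_def v_def by auto
  have r1: "R1 47 = l" "R1 48 = v" "R1 42 = hd b" using \<open>keep {52, 53, 54, 59} ?R R1\<close> r by (auto simp: keep_def v_def)
  have rr: "R1 52 = hd c2" "R1 53 = weight c1" "R1 54 = live A c1" "bR R1" "std R1" by fact+
  have rl: "wp w relink (\<lambda>t R' M'. t <= 100 \<and> R' = R1(49 := nd (hd c2) l) \<and> bM M' \<and>
   M' = M(adr 1 (nd (hd c2) l) := M (adr 1 v), adr 1 v := hd c2, adr 3 (nd (hd c2) l) := M (adr 3 v) - weight c1,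
    adr 2 (nd (hd c2) l) := M (adr 2 v) - live A c1, adr 3 v := weight c1, adr 2 v := live A c1)) R1 M"
   by (rule relink[OF rr(4) b(2) rr(5) r1(1,2) rr(1-3)]) (use vB v'B bb c in \<open>simp_all add: v_def v'_def\<close>)
  show ?case unfolding M1 wp_Seq
  proof (rule wp_mono[OF rl], elim conjE, goal_cases)
   case g: (1 t2 R2 M2)
   have R2: "R2 = R1(49 := v')" using g by (simp add: v'_def)
   have M2: "M2 = M(adr 1 v' := M (adr 1 v), adr 1 v := hd c2, adr 3 v' := M (adr 3 v) - weight c1,
    adr 2 v' := M (adr 2 v) - live A c1, adr 3 v := weight c1, adr 2 v := live A c1)" using g by (simp add: v'_def)
   have v'Z: "v' < Z" using v'B B_lt_Z by simp
   have b2: "bR R2" "std R2" unfolding R2 using rr v'Z by auto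
   have ls2: "lev_same l' M M2" if "l' <= tp" "l' ~= l" for l'
    unfolding M2 v_def v'_def by (intro lev_same_upd lev_same_refl) (use that tp_U lU hbU h2U in auto)
   have sm2: "same {1, 2, 3} M M2" unfolding M2 using vB v'B by (auto simp: same_def)
   have in2: "inst M2 h us = inst M h us" if "16 <= h" "h < B" for h us
    by (rule inst_cong) (use sm2 that in \<open>auto simp: same_def\<close>)
   have iv': "inst M2 (16 + v') []"
   proof -
    have "hd c2 \<notin> hd ` set (Xs @ b # Ys)"
    proof
     assume "hd c2 \<in> hd ` set (Xs @ b # Ys)"
     then obtain x where x: "x \<in> set (Xs @ b # Ys)" "hd x = hd c2" by (metis imageE)
     then have "x \<in> set (Xs @ Ys)" using ne by auto
     moreover have "x ~= []" using x cc(4) by auto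
     ultimately have "hd c2 \<in> set (concat (Xs @ Ys))" using x(2) by (metis UN_I hd_in_set set_concat)
     moreover have "hd c2 \<in> set b" using c by auto
     moreover have "distinct (concat Xs @ b @ concat Ys)" using W(1) es by simp
     then have "set b \<inter> set (concat (Xs @ Ys)) = {}" by auto
     ultimately show False by (metis IntI empty_iff)
    qed
    then have "inst M (16 + v') []" using lev(1) h2U by (auto simp: level_def v'_def)
    then show ?thesis using in2 v'B by simp
   qed
   have vals2: "inst M2 (16 + v) (vals A vl (c1 @ c2))" using in2 vB bb(3) c(1) by simp
   have vv: "nd (hd c1) l = v" "nd (hd c2) l = v'" by (simp_all add: v_def v'_def c1(2))
   have bv: "M (adr 3 v) = weight c1 + weight c2" "M (adr 2 v) = live A c1 + live A c2" using bb c(1) by (simp_all add: v_def)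
   have nxs: "NX M2 (hd c1) l = hd c2" "NX M2 (hd c2) l = NX M (hd c1) l" "WT M2 (hd c1) l = weight c1" "LV M2 (hd c1) l = live A c1"
     "WT M2 (hd c2) l = weight c2" "LV M2 (hd c2) l = live A c2"
    using bv vB v'B unfolding M2 vv by simp_all
   have es2: "es = (concat Xs @ c1) @ c2 @ concat Ys" using es c(1) by simp
   have r2: "R2 48 = v" "R2 49 = v'" "R2 52 = hd c2" "R2 54 = live A c1" unfolding R2 using rr r1 by auto
   have w3: "M2 (adr 3 v') = length c2" using nxs(5) lc2 by (simp add: v'_def)
   have vl2: "M2 (adr 4 e) = vl e \<and> legal (vl e)" if "e \<in> A" "e \<in> set es" for e
    using vl[OF that] sameD[OF sm2, of e 4] nd_Z(4)[of e] that(2) W(2) by auto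
   have lev02: "level M2 0 (map (\<lambda>e. [e]) es) es A vl" by (rule level_frame[OF ls2 lev0 W(2)]) (use l in auto)
   have mh: "wp w move_half (\<lambda>t R' M'. t <= 50 + length c2 * (2 * (gam * T) + 150) \<and> bR R' \<and> bM M' \<and> std R' \<and>
    keep {10, 11, 12, 13, 55, 56, 57, 58} R2 R' \<and> same {16 + v, 16 + v'} M2 M' \<and>
    inst M' (16 + v) (vals A vl c1) \<and> inst M' (16 + v') (vals A vl c2)) R2 M2"
    by (rule move_half[OF b2(1) g(3) b2(2) r2 vB(2) v'B(2) v'B(3)[symmetric] w3 c(2) vals2 iv'
     lev02 W(2) es2 vl2]) (use l lm c(1) in auto)
   show ?case
   proof (rule wp_mono[OF mh], elim conjE, goal_cases)
    case h: (1 t3 R3 M3)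
    have sm3: "same {16 + v, 16 + v'} M2 M3" by fact
    have ls: "lev_same l' M M3" if l': "l' <= tp" "l' ~= l" for l'
    proof (rule lev_same_trans[OF ls2[OF l']])
     show "lev_same l' M2 M3" by (rule lev_same_same[OF sm3 tp_U[OF l'(1)]])
      (use nd_inj tp_U[OF l'(1)] lU l'(2) in \<open>auto simp: v_def v'_def\<close>)
    qed
    have a3: "M3 (adr h x) = M2 (adr h x)" if "h < 16" "x < B" for h x using sameD[OF sm3 that(2), of h] that(1) by auto
    have nx3: "NX M3 e l = NX M2 e l" "LV M3 e l = LV M2 e l" "WT M3 e l = WT M2 e l" if "e <= 2 * U" for e
     using a3 nd_B(1)[OF that lU(1)] by auto
    have hd1U: "hd c1 <= 2 * U" using hbU c1(2) by simp
    have old2: "NX M2 e l = NX M e l \<and> LV M2 e l = LV M e l \<and> WT M2 e l = WT M e l" if "e <= 2 * U" "e \<notin> {hd c1, hd c2}" for e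
    proof -
     have "nd e l ~= v" "nd e l ~= v'" "nd e l < B" using that nd_inj lU c1(2) nd_B by (auto simp: v_def v'_def)
     then show ?thesis unfolding M2 using vB v'B by simp
    qed
    have oldi: "inst M3 (16 + nd e l) us" if "e <= 2 * U" "e \<notin> {hd c1, hd c2}" "inst M (16 + nd e l) us" for e us
    proof (rule inst_same[OF sm3])
     show "inst M2 (16 + nd e l) us" using in2 nd_B that lU by auto
     show "16 + nd e l \<notin> {16 + v, 16 + v'}" using that nd_inj lU c1(2) by (auto simp: v_def v'_def)
    qed
    have bl1: "block_at M3 l A vl c1" using nx3[OF hd1U] nxs h(7) c1(2) by (simp add: block_at_def v_def)
    have bl2: "block_at M3 l A vl c2" using nx3[OF h2U] nxs h(8) by (simp add: block_at_def v'_def)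
    have w12: "2 ^ (l - 1) <= weight c1" "2 ^ (l - 1) <= weight c2" using wc2 c(3,4) q by simp_all
    have nn: "NX M3 (hd c1) l = hd c2" "NX M3 (hd c2) l = NX M (hd c1) l" using nx3[OF hd1U] nx3[OF h2U] nxs by simp_all
    have old3: "NX M3 e l = NX M e l \<and> LV M3 e l = LV M e l \<and> WT M3 e l = WT M e l" if "e <= 2 * U" "e \<notin> {hd c1, hd c2}" for e
     using nx3[OF that(1)] old2[OF that] by simp
    have lv: "level M3 l (Xs @ c1 # c2 # Ys) es A vl"
     by (rule level_split(1)[OF lev(1)[unfolded c(1)] W(1,2) lU(1) c1(1) c(2) w12 bl1 bl2 nn old3 oldi])
    have tm: "t3 + t2 + t1 + 20 <= q * (6 * (gam * T) + 1000)"
    proof -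
     define x where "x = 2 * (gam * T)"
     have "length c2 * (x + 150) <= (3 * q) * (x + 150)" using lc2 wc2 c(3) by (intro mult_right_mono) auto
     also have "\<dots> = 3 * (q * x) + 450 * q" by (simp add: algebra_simps)
     finally have "t3 <= 50 + 3 * (q * x) + 450 * q" using h(1) unfolding x_def by linarith
     moreover have "q * (6 * (gam * T) + 1000) = 3 * (q * x) + 1000 * q" by (simp add: algebra_simps x_def)
     ultimately show ?thesis using g(1) f(1) q1 by linarith
    qed
    have "keep ({10, 11, 12, 13, 49} \<union> {52..60}) R R3"
     using h(5) f(5) by (auto simp: keep_def R2)
    moreover have "same ({1, 2, 3} \<union> {16..}) M M3" using sm2 sm3 by (auto simp: same_def)
    moreover have "\<exists>c1 c2. b = c1 @ c2 \<and> level M3 l (Xs @ c1 # c2 # Ys) es A vl \<and> weight c1 < 4 * q \<and> weight c2 < 4 * q \<and>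
     hd c1 = hd b \<and> hd c2 \<in> hd ` set Q"
     by (rule exI[of _ c1], rule exI[of _ c2]) (use c lv c1 wc2 q1 in simp)
    ultimately show ?case using h(2-4) tm ls by (simp add: add.commute add.left_commute)
   qed
  qed
 qed
qed

end

context progs
begin

section \<open>Insertion, with splits paid for by a potential\<close>

definition ins_level0 :: com where
 "ins_level0 = Seq (Assign 50 (Bin Add (Ld (Lit 0) (Lit 2)) (Lit 1))) (Seq (St (Lit 0) (Lit 2) (Reg 50))
  (Seq (St (Lit 4) (Reg 50) (Reg 2)) (Seq (Assign 48 (node (Reg 42) (Lit 0))) (Seq (Assign 49 (node (Reg 50) (Lit 0)))
  (Seq (St (Lit 1) (Reg 49) (Ld (Lit 1) (Reg 48))) (Seq (St (Lit 1) (Reg 48) (Reg 50))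
  (Seq (St (Lit 2) (Reg 49) (Lit 1)) (Seq (St (Lit 3) (Reg 49) (Lit 1))
  (Seq (Assign 10 (Bin Add (Lit 16) (Reg 49))) (Seq (Assign 11 (Lit 0)) (Seq (Assign 12 (Reg 2)) pIns)))))))))))"

text \<open>Subtracting the live count recorded in front of the block turns the global position into
  one inside the block. Register 51 holds \<open>2 ^ (l - 1)\<close>, so the test detects the weight
  \<open>2 ^ (l + 1)\<close>.\<close>

definition ins_step :: com where
 "ins_step = Seq (Assign 42 (Ld (Lit 5) (Reg 47))) (Seq (Assign 48 (node (Reg 42) (Reg 47)))
  (Seq (St (Lit 2) (Reg 48) (Bin Add (Ld (Lit 2) (Reg 48)) (Lit 1)))
  (Seq (St (Lit 3) (Reg 48) (Bin Add (Ld (Lit 3) (Reg 48)) (Lit 1)))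
  (Seq (Assign 10 (Bin Add (Lit 16) (Reg 48))) (Seq (Assign 11 (Bin Sub (Reg 41) (Ld (Lit 6) (Reg 47))))
  (Seq (Assign 12 (Reg 2)) (Seq pIns
  (Seq (If (Bin Less (Ld (Lit 3) (Reg 48)) (Bin Mul (Lit 4) (Reg 51))) Skip split_block)
   (Assign 51 (Bin Add (Reg 51) (Reg 51)))))))))))"

definition plain_insert :: com where
 "plain_insert = Seq (Assign 41 (Reg 1)) (Seq walk (Seq ins_level0 (Seq (Assign 51 (Lit 1)) (Seq (Assign 47 (Lit 1))
  (Seq (For 47 46 ins_step) (St (Lit 0) (Lit 0) (Bin Add (Ld (Lit 0) (Lit 0)) (Lit 1))))))))"

end

context tree
begin

text \<open>Per unit \<open>q = 2 ^ (l - 1)\<close> of a split: at most \<open>3 * q\<close>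
  elements move, each by one deletion and one insertion, whence the factor 6.\<close>

definition split_cost :: nat where "split_cost = 6 * (gam * T) + 1000"

text \<open>The weight in excess of the minimum forced by the number of blocks, where the block of
  the sentinel has no minimum. An insertion raises it by 1; a split lowers it by
  \<open>2 ^ (l - 1)\<close> and pays for itself at \<open>split_cost\<close> per unit.\<close>

definition block_pot :: "nat => nat list list => nat" where
 "block_pot l bs = weight (concat bs) - (length bs - 1) * 2 ^ (l - 1)"

text \<open>Ensures that the subtraction in \<open>block_pot\<close> does not truncate.\<close>

lemma num_blocks:
 assumes lev: "level M l bs es A vl" "distinct es" "hd es = 0"
 shows "(length bs - 1) * 2 ^ (l - 1) <= weight es"
proof (cases bs)
 case (Cons x mv)
 have "2 ^ (l - 1) <= weight b" if b: "b \<in> set mv" for b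
 proof -
  obtain B1 B2 where "mv = B1 @ b # B2" using split_list[OF b] by blast
  then have e: "bs = (x # B1) @ b # B2" using Cons by simp
  have "hd b ~= 0" by (rule hd_nonzero(2)[OF lev e]) simp
  then show ?thesis using lev(1) e by (auto simp: level_def)
 qed
 then have "length mv * 2 ^ (l - 1) <= weight (concat mv)" by (rule weight_concat_ge)
 moreover have "es = x @ concat mv" using lev(1) Cons by (auto simp: level_def)
 ultimately show ?thesis using Cons by simp
qed simp

lemma ins_vals:
 assumes "e \<notin> set (c1 @ p # c2)" "e \<notin> A"
 defines "k \<equiv> live A (c1 @ [p])"
 shows "vals (insert e A) (vl(e := u)) (c1 @ p # e # c2) =
   take k (vals A vl (c1 @ p # c2)) @ u # drop k (vals A vl (c1 @ p # c2))"
  "live (insert e A) (c1 @ p # e # c2) = live A (c1 @ p # c2) + 1"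
proof -
 have v: "vals (insert e A) (vl(e := u)) b = vals A vl b" "live (insert e A) b = live A b" if "e \<notin> set b" for b
  by (rule vals_cong live_cong; use that in auto)+
 have s: "c1 @ p # c2 = (c1 @ [p]) @ c2" "c1 @ p # e # c2 = (c1 @ [p]) @ [e] @ c2" by simp_all
 have n: "e \<notin> set (c1 @ [p])" "e \<notin> set c2" using assms(1) by auto
 have "length (vals A vl (c1 @ [p])) = k" by (simp only: k_def length_vals)
 then have k: "take k (vals A vl (c1 @ [p]) @ vals A vl c2) = vals A vl (c1 @ [p])"
  "drop k (vals A vl (c1 @ [p]) @ vals A vl c2) = vals A vl c2" by (simp_all del: vals_simps)
 have o: "vals (insert e A) (vl(e := u)) [e] = [u]" by simp
 show "vals (insert e A) (vl(e := u)) (c1 @ p # e # c2) =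
   take k (vals A vl (c1 @ p # c2)) @ u # drop k (vals A vl (c1 @ p # c2))"
  unfolding s vals_simps(3)[of _ _ "c1 @ [p]"] vals_simps(3)[of _ _ "[e]"] k o v(1)[OF n(1)] v(1)[OF n(2)] by (simp del: vals_simps)
 show "live (insert e A) (c1 @ p # e # c2) = live A (c1 @ p # c2) + 1"
  unfolding s live_simps(3)[of _ "c1 @ [p]"] live_simps(3)[of _ "[e]"] v(2)[OF n(1)] v(2)[OF n(2)] by (simp del: live_simps(3))
qed

lemma ins_step:
 assumes b: "bR R" "bM M" "std R" and r: "R 47 = l" "R 41 = live A (E1 @ [p])" "R 2 = u" "R 51 = 2 ^ (l - 1)"
  and l: "1 <= l" "l <= tp"
  and E: "es = E1 @ p # E2" "es' = E1 @ p # e # E2" "distinct es'" "set es' \<subseteq> {..2 * U}" "hd es = 0" "0 \<notin> A" "A \<subseteq> set es"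
  and lev: "level M l bs es A vl" "bounded l bs" "path_at M bs A p l"
  and low: "level M (l - 1) Q es' (insert e A) (vl(e := u))" "bounded (l - 1) Q" "hd ` set bs \<subseteq> hd ` set Q"
  and lev0: "level M 0 (map (\<lambda>e. [e]) es') es' (insert e A) (vl(e := u))"
  and vl: "\<And>f. f \<in> insert e A ==> M (adr 4 f) = (vl(e := u)) f \<and> legal ((vl(e := u)) f)"
  and lm: "live A es < m"
 shows "wp w ins_step (\<lambda>\<tau> R' M'. bR R' \<and> bM M' \<and> std R' \<and> keep ({10, 11, 12, 13, 42, 48, 49, 51} \<union> {52..60}) R R' \<and>
  same ({1, 2, 3} \<union> {16..}) M M' \<and> (\<forall>l'\<le>tp. l' ~= l --> lev_same l' M M') \<and> R' 51 = 2 ^ l \<and>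
  (\<exists>bs'. level M' l bs' es' (insert e A) (vl(e := u)) \<and> bounded l bs' \<and> hd ` set bs \<subseteq> hd ` set bs' \<and> hd ` set bs' \<subseteq> hd ` set Q \<and>
   \<tau> + split_cost * block_pot l bs' <= split_cost * block_pot l bs + (7 * (gam * T) + 1200))) R M"
proof -
 define q where "q = (2::nat) ^ (l - 1)"
 have lU: "l < U" "l - 1 < U" using tp_U[OF l(2)] by auto
 have en: "e \<notin> set es" "e \<notin> A" "e ~= 0" "distinct es" "set es \<subseteq> {..2 * U}"
 proof -
  show 1: "e \<notin> set es" "distinct es" "set es \<subseteq> {..2 * U}" using E(1-4) by auto
  show "e \<notin> A" using 1 E(7) by auto
  have "0 \<in> set es" using E(1,5) by (metis append_is_Nil_conv hd_in_set list.distinct(1))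
  then show "e ~= 0" using 1(1) by metis
 qed
 have hd': "hd es' = 0" using E(1,2,5) by (cases E1) auto
 have w': "weight es' = weight es + 1" using E(1,2) en(3) by simp
 obtain Xs c Ys where c: "bs = Xs @ c # Ys" "p \<in> set c" "M (adr 5 l) = hd c" "M (adr 6 l) = live A (concat Xs)"
  using lev(3) by (auto simp: path_at_def)
 have cc: "concat bs = es" "[] \<notin> set bs" using lev(1) by (auto simp: level_def)
 obtain c1 c2 where c12: "c = c1 @ p # c2" using c(2) by (meson split_list)
 have sp: "E1 = concat Xs @ c1" "E2 = c2 @ concat Ys"
 proof -
  have e: "E1 @ p # E2 = (concat Xs @ c1) @ p # (c2 @ concat Ys)" using cc(1) c(1) c12 E(1) by simp
  have d: "distinct (E1 @ p # E2)" using en(4) E(1) by simp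
  show "E1 = concat Xs @ c1" "E2 = c2 @ concat Ys" using distinct_split_unique[OF d e] by auto
 qed
 let ?c' = "c1 @ p # e # c2" and ?A = "insert e A" and ?vl = "vl(e := u)"
 define k where "k = live A (c1 @ [p])"
 define v where "v = nd (hd c) l"
 have cin: "c \<in> set bs" using c(1) by simp
 have hcU: "hd c <= 2 * U" using level_heads[OF lev(1) cin] en(5) by auto
 have vB: "v < B" "16 + v < B" "v < Z" "16 + v < Z" "l < B" using nd_B nd_Z hcU lU bounds unfolding v_def by auto
 have bc: "WT M (hd c) l = weight c" "LV M (hd c) l = live A c" "inst M (16 + v) (vals A vl c)"
  using lev(1) cin by (auto simp: level_def block_at_def v_def)
 have enc: "e \<notin> set c" using en(1) E(1) sp c12 by auto
 note iv = ins_vals[OF enc[unfolded c12] en(2), folded c12]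
 have hc: "hd ?c' = hd c" unfolding c12 by (cases c1) auto
 have wc: "weight ?c' = weight c + 1" using c12 en(3) by simp
 have q4: "(2::nat) ^ (l + 1) = 4 * q" "(2::nat) ^ l = 2 * q" using l(1) unfolding q_def by (cases l; simp add: power_add)+
 have wb: "weight c + 1 <= 4 * q" using lev(2) cin q4 by (auto simp: bounded_def)
 have qU: "4 * q <= U"
 proof -
  have "(2::nat) ^ (l + 1) <= 2 ^ L" using l(2) Lb unfolding tp_def by (intro power_increasing) auto
  then show ?thesis using q4 U_def by simp
 qed
 have lc: "live A c <= weight c" "live A c <= live A es" by (rule live_le_weight[OF E(6)], use E(1) sp c12 in simp)
 have sm: "weight c + 1 < Z" "live A c + 1 < Z" "4 * q < Z" "q < Z" "2 * q < Z" using wb lc qU bounds by linarith+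
 have t: "live A (E1 @ [p]) = live A (concat Xs) + k" using sp by (simp add: k_def)
 have kc: "k <= live A c" "k < Z" using c12 sm lc by (auto simp: k_def)
 have uZ: "legal u" "u < Z" using vl[of e] legal_lt by auto
 have c4: "16 < Z" "4 < Z" by simp_all
 define M1 where "M1 = M(adr 2 v := live A c + 1, adr 3 v := weight c + 1)"
 have bM1: "bM M1" using b sm by (simp add: M1_def)
 have m6: "M1 (adr 6 l) = live A (concat Xs)" using c(4) vB by (simp add: M1_def)
 have in1: "inst M1 (16 + v) (vals A vl c)" using bc(3) vB by (simp add: M1_def)
 let ?R = "R(42 := hd c, 48 := v, 10 := 16 + v, 11 := k, 12 := u)"
 have hcZ: "hd c < Z" using nd_Z hcU by simp
 have b1: "bR ?R" "std ?R" using b vB kc uZ hcZ by auto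
 have ins: "wp w pIns (\<lambda>t R' M'. t <= gam * T \<and> bR R' \<and> bM M' \<and> keep {12, 13} ?R R' \<and> std R' \<and>
  inst M' (16 + v) (take k (vals A vl c) @ u # drop k (vals A vl c)) \<and> same {16 + v} M1 M') ?R M1"
  by (rule pIns[OF b1(1) bM1 b1(2)]) (use vB in1 kc lc lm uZ in auto)
 have sub: "live A (concat Xs) <= R 41" "R 41 - live A (concat Xs) = k" using t r by simp_all
 have st: "split_cost * (x + q) = split_cost * x + q * (6 * (gam * T) + 1000)" for x by (simp add: split_cost_def algebra_simps)
 have r41: "R 41 < Z" "R 41 - live A (concat Xs) < Z" using b kc sub by auto
 show ?thesis unfolding ins_step_def
 proof (simp add: b bM1 m6 r(1,3) vB v_def[symmetric] bc[folded v_def] c(3,4) sm sub uZ kc hcZ M1_def[symmetric], rule wp_mono[OF ins], elim conjE, goal_cases)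
  case f: (1 t1 R1 M2)
  have r1: "R1 48 = v" "R1 51 = q" "R1 47 = l" "R1 42 = hd c" using f(4) r by (auto simp: keep_def q_def)
  have kp1: "keep {10, 11, 12, 13, 42, 48} R R1" using f(4) by (auto simp: keep_def)
  have smM: "same ({1, 2, 3} \<union> {16..}) M M2" using f(7) vB by (auto simp: same_def M1_def)
  have wt2: "M2 (adr 3 v) = weight c + 1" "M2 (adr 2 v) = live A c + 1" using sameD[OF f(7) vB(1)] vB(1) by (simp_all add: M1_def)
  have ls1: "lev_same l' M M1" if "l' <= tp" "l' ~= l" for l'
   unfolding M1_def v_def by (intro lev_same_upd lev_same_refl) (use that tp_U lU hcU in auto)
  have ls: "lev_same l' M M2" if l': "l' <= tp" "l' ~= l" for l'
   by (rule lev_same_trans[OF ls1[OF l'] lev_same_node[OF f(7)[unfolded v_def] tp_U[OF l'(1)] lU(1) l'(2)]])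
  have a2: "M2 (adr h x) = M1 (adr h x)" if "h < 16" "x < B" for h x using sameD[OF f(7) that(2), of h] that(1) by auto
  have ndB: "nd x l < B" "16 + nd x l < B" if "x <= 2 * U" for x using nd_B that lU by auto
  have lv2: "level M2 l (Xs @ ?c' # Ys) es' ?A ?vl"
  proof (rule level_replace[OF lev(1)[unfolded c(1)] en(4,5) lU(1)])
   show "hd c ~= 0 --> 2 ^ (l - 1) <= weight ?c'" using lev(1) cin wc by (auto simp: level_def)
   show "block_at M2 l ?A ?vl ?c'" unfolding block_at_def hc v_def[symmetric]
    using f(6) iv wt2 wc by (simp add: k_def)
   show "es' = concat Xs @ ?c' @ concat Ys" using E(2) sp by simp
   show "(f \<in> A) = (f \<in> ?A) \<and> (f \<in> A --> vl f = ?vl f)" if "f \<in> set es" for f using that en(1) by auto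
   fix x us assume x: "x <= 2 * U"
   show "NX M2 x l = NX M x l" using a2 ndB[OF x] vB by (simp add: M1_def)
   assume xc: "x ~= hd c"
   have nv: "nd x l ~= v" using xc nd_inj lU by (simp add: v_def)
   show "LV M2 x l = LV M x l \<and> WT M2 x l = WT M x l" using a2 ndB[OF x] vB nv by (simp add: M1_def)
   assume "inst M (16 + nd x l) us"
   then have "inst M1 (16 + nd x l) us" using vB by (simp add: M1_def)
   then show "inst M2 (16 + nd x l) us" using inst_same[OF f(7)] nv by simp
  qed (use hc in auto)
  have hds: "hd ` set (Xs @ ?c' # Ys) = hd ` set bs" unfolding c(1) by (rule hd_replace) (use hc in auto)
  have bdX: "weight x < 4 * q" if "x \<in> set (Xs @ Ys)" for x using lev(2) that c(1) q4 by (auto simp: bounded_def)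
  have cnt: "concat (Xs @ ?c' # Ys) = es'" using lv2 by (auto simp: level_def)
  have lenb: "length bs - 1 = length Xs + length Ys" using c(1) by simp
  have p0: "(length Xs + length Ys) * q <= weight es" using num_blocks[OF lev(1) en(4) E(5)] lenb by (simp add: q_def)
  have pb: "block_pot l bs = weight es - (length Xs + length Ys) * q" using lenb cc(1) by (simp add: block_pot_def q_def)
  have sc1: "split_cost <= 6 * (gam * T) + 1000" by (simp add: split_cost_def)
  show ?case
  proof (cases "weight c + 1 < 4 * q")
   case True
   have bd: "bounded l (Xs @ ?c' # Ys)" using bdX True wc q4 unfolding bounded_def by auto
   have "length (Xs @ ?c' # Ys) - 1 = length Xs + length Ys" by simp
   then have "block_pot l (Xs @ ?c' # Ys) = weight es + 1 - (length Xs + length Ys) * q"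
    unfolding block_pot_def cnt w' q_def by simp
   then have "block_pot l (Xs @ ?c' # Ys) = block_pot l bs + 1" using pb p0 by simp
   then have pot: "split_cost * block_pot l (Xs @ ?c' # Ys) = split_cost * block_pot l bs + split_cost" by (simp add: distrib_left)
   have fin: "\<exists>bs'. level M2 l bs' es' ?A ?vl \<and> bounded l bs' \<and> hd ` set bs \<subseteq> hd ` set bs' \<and> hd ` set bs' \<subseteq> hd ` set Q \<and>
    100 + t1 + split_cost * block_pot l bs' <= split_cost * block_pot l bs + (7 * (gam * T) + 1200)"
    by (rule exI[of _ "Xs @ ?c' # Ys"]) (use lv2 bd hds low(3) pot sc1 f(1) in auto)
   have kp: "keep ({10, 11, 12, 13, 42, 48, 49, 51} \<union> {52..60}) R (R1(51 := q + q))" using kp1 by (auto simp: keep_def)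
   show ?thesis using True f r1 wt2 vB sm kp smM ls fin q4 by (auto elim!: ex_forward)
  next
   case False
   \<comment> \<open>The upper bound was strict before the insertion, so the weight is now exactly
     the value for which splitting is analysed.\<close>
   then have w4: "weight ?c' = 4 * q" using wb wc by simp
   have vl2: "M2 (adr 4 f) = ?vl f \<and> legal (?vl f)" if "f \<in> ?A" "f \<in> set es'" for f
    using vl[OF that(1)] sameD[OF smM, of f 4] nd_Z(4)[of f] that(2) E(4) by auto
   have sp': "wp w split_block (\<lambda>t R' M'. t <= q * (6 * (gam * T) + 1000) \<and> bR R' \<and> bM M' \<and> std R' \<and>
    keep ({10, 11, 12, 13, 49} \<union> {52..60}) R1 R' \<and> same ({1, 2, 3} \<union> {16..}) M2 M' \<and>
    (\<forall>l'\<le>tp. l' ~= l --> lev_same l' M2 M') \<and>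
    (\<exists>d1 d2. ?c' = d1 @ d2 \<and> level M' l (Xs @ d1 # d2 # Ys) es' ?A ?vl \<and> weight d1 < 4 * q \<and> weight d2 < 4 * q \<and>
     hd d1 = hd ?c' \<and> hd d2 \<in> hd ` set Q)) R1 M2"
   proof (rule split_block[OF f(2,3,5) r1(3) _ _ r1(2) l q_def E(3,4) hd' _ lv2 w4 _ low(2)])
    show "R1 42 = hd ?c'" "R1 48 = nd (hd ?c') l" using r1 hc by (simp_all add: v_def)
    show "0 \<notin> ?A" using E(6) en(3) by simp
    show "level M2 (l - 1) Q es' ?A ?vl" by (rule level_frame[OF ls low(1) E(4)]) (use l in auto)
    show "hd ` set (Xs @ ?c' # Ys) \<subseteq> hd ` set Q" using hds low(3) by simp
    show "level M2 0 (map (\<lambda>e. [e]) es') es' ?A ?vl" by (rule level_frame[OF ls lev0 E(4)]) (use l in auto)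
   qed (use vl2 in auto)
   show ?thesis
   proof (simp add: f(2-5) r1 wt2 vB sm False, rule wp_mono[OF sp'], elim conjE exE, goal_cases)
    case g: (1 t2 R2 M3 d1 d2)
    have r2: "R2 51 = q" using g(5) r1 by (auto simp: keep_def)
    have kp: "keep ({10, 11, 12, 13, 42, 48, 49, 51} \<union> {52..60}) R (R2(51 := q + q))" using kp1 g(5) by (auto simp: keep_def)
    have smF: "same ({1, 2, 3} \<union> {16..}) M M3" using smM g(6) by (auto simp: same_def)
    have lsF: "lev_same l' M M3" if "l' <= tp" "l' ~= l" for l' using ls[OF that] g(7) that lev_same_trans by blast
    let ?bs = "Xs @ d1 # d2 # Ys"
    have bd: "bounded l ?bs" using bdX g q4 unfolding bounded_def by auto
    have cnt3: "concat ?bs = es'" using g(9) by (auto simp: level_def)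
    have p1: "(length ?bs - 1) * q <= weight es'" using num_blocks[OF g(9) E(3) hd'] by (simp add: q_def)
    have "length ?bs - 1 = length Xs + length Ys + 1" by simp
    then have e1: "(length ?bs - 1) * q = (length Xs + length Ys) * q + q" by simp
    have "block_pot l ?bs = weight es + 1 - ((length Xs + length Ys) * q + q)"
     using e1 unfolding block_pot_def cnt3 w' q_def by simp
    \<comment> \<open>There is one element more and one block more than before.\<close>
    then have "block_pot l ?bs + q = block_pot l bs + 1" using pb p0 p1 e1 w' by simp
    then have "split_cost * (block_pot l ?bs + q) = split_cost * (block_pot l bs + 1)" by simp
    then have pot: "split_cost * block_pot l ?bs + q * (6 * (gam * T) + 1000) = split_cost * block_pot l bs + split_cost"
     unfolding st by (simp add: distrib_left)
    have hs: "hd ` set bs \<subseteq> hd ` set ?bs" "hd ` set ?bs \<subseteq> hd ` set Q" using hds[symmetric] low(3) g(12,13) by auto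
    have fin: "\<exists>bs'. level M3 l bs' es' ?A ?vl \<and> bounded l bs' \<and> hd ` set bs \<subseteq> hd ` set bs' \<and> hd ` set bs' \<subseteq> hd ` set Q \<and>
     100 + t1 + t2 + split_cost * block_pot l bs' <= split_cost * block_pot l bs + (7 * (gam * T) + 1200)"
    proof (rule exI[of _ ?bs], intro conjI)
     show "100 + t1 + t2 + split_cost * block_pot l ?bs <= split_cost * block_pot l bs + (7 * (gam * T) + 1200)"
      using pot sc1 f(1) g(1) by linarith
    qed (use g(9) bd hs in simp_all)
    show ?case using g(2-4) r2 sm kp smF lsF fin q4 by (auto elim!: ex_forward)
   qed
  qed
 qed
qed

end

context tree
begin

lemma level0_insert:
 assumes lev: "level M 0 (map (\<lambda>f. [f]) es) es A vl" and E: "es = E1 @ p # E2" "es' = E1 @ p # e # E2" "distinct es'" "set es' \<subseteq> {..2 * U}"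
  and e: "e ~= 0" "e \<notin> A"
  and new: "NX M' e 0 = NX M p 0" "NX M' p 0 = e" "LV M' e 0 = 1" "WT M' e 0 = 1" "inst M' (16 + nd e 0) [u]"
  and old: "\<And>x. x <= 2 * U ==> x ~= e ==> (x ~= p --> NX M' x 0 = NX M x 0) \<and> LV M' x 0 = LV M x 0 \<and> WT M' x 0 = WT M x 0"
   "\<And>x us. x <= 2 * U ==> x ~= e ==> inst M (16 + nd x 0) us ==> inst M' (16 + nd x 0) us"
 shows "level M' 0 (map (\<lambda>f. [f]) es') es' (insert e A) (vl(e := u))"
proof -
 have en: "e \<notin> set es" "p ~= e" "set es \<subseteq> {..2 * U}" using E by auto
 have bl: "block_at M' 0 (insert e A) (vl(e := u)) [f]" if f: "f \<in> set es'" for f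
 proof (cases "f = e")
  case False
  then have f': "f \<in> set es" "f <= 2 * U" using f E by auto
  then have "block_at M 0 A vl [f]" using lev by (auto simp: level_def)
  then show ?thesis using old[OF f'(2) False] False by (cases "f \<in> A") (simp_all add: block_at_def)
 qed (use new e in \<open>simp add: block_at_def\<close>)
 have lk: "linked M 0 (E1 @ p # E2)" using lev E(1) by (simp add: level_def comp_def)
 have c1: "linked M' 0 (E1 @ [p])"
 proof -
  have "linked M 0 (E1 @ [p])" using lk linked_append by blast
  moreover have "NX M' f 0 = NX M f 0" if "f \<in> set E1" for f using old(1)[of f] that E by auto
  ultimately show ?thesis
  proof (induction E1)
   case (Cons x E1)
   then show ?case by (cases E1) auto
  qed simp
 qed
 have "linked M 0 (p # E2)" using lk linked_append by blast
 moreover have "linked M' 0 E2 = linked M 0 E2" by (rule linked_cong) (use old(1) E in auto)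
 ultimately have "linked M' 0 (p # e # E2)" using new by (cases E2) auto
 with c1 have "linked M' 0 es'" unfolding E(2) using linked_append by blast
 moreover have "inst M' (16 + nd x 0) []" if "x <= 2 * U" "x \<notin> set es'" for x
 proof -
  have "x ~= e" "x \<notin> set es" using that E by auto
  moreover from this have "inst M (16 + nd x 0) []" using lev that(1) by (auto simp: level_def)
  ultimately show ?thesis using old(2) that(1) by blast
 qed
 ultimately show ?thesis using bl unfolding level_def by (auto simp: comp_def image_image)
qed

lemma ins_level0:
 assumes b: "bR R" "bM M" "std R" and r: "R 42 = p" "R 2 = u" and e: "e = M (adr 0 2) + 1" "e <= 2 * U" "p <= 2 * U" "e ~= p"
  and u: "legal u" and inst: "inst M (16 + nd e 0) []"
 shows "wp w ins_level0 (\<lambda>t R' M'. t <= gam * T + 150 \<and> bR R' \<and> bM M' \<and> std R' \<and> keep {10, 11, 12, 13, 48, 49, 50} R R' \<and>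
  same {0, 1, 2, 3, 4, 16 + nd e 0} M M' \<and> M' (adr 0 0) = M (adr 0 0) \<and> M' (adr 0 2) = e \<and> M' (adr 4 e) = u \<and>
  (\<forall>x\<le>2 * U. x ~= e --> M' (adr 4 x) = M (adr 4 x)) \<and>
  NX M' e 0 = NX M p 0 \<and> NX M' p 0 = e \<and> LV M' e 0 = 1 \<and> WT M' e 0 = 1 \<and> inst M' (16 + nd e 0) [u] \<and>
  (\<forall>x\<le>2 * U. x ~= e --> (x ~= p --> NX M' x 0 = NX M x 0) \<and> LV M' x 0 = LV M x 0 \<and> WT M' x 0 = WT M x 0) \<and>
  (\<forall>l\<le>tp. 1 <= l --> lev_same l M M')) R M"
proof -
 have U0: "0 < U" using U_ge by linarith
 define v v' where "v = nd p 0" and "v' = nd e 0"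
 have B: "v < B" "v' < B" "16 + v' < B" "v < Z" "v' < Z" "16 + v' < Z" "e < B" "e < Z" "0 < B" "2 < B"
  using nd_B nd_Z e U0 B_big unfolding v_def v'_def by auto
 have vv: "v ~= v'" using nd_inj[OF U0 U0, of p e] e(4) unfolding v_def v'_def by simp
 have uZ: "u < Z" using legal_lt u by auto
 define M1 where "M1 = M(adr 0 2 := e, adr 4 e := u, adr 1 v' := M (adr 1 v), adr 1 v := e, adr 2 v' := 1, adr 3 v' := 1)"
 have bM1: "bM M1" unfolding M1_def using b(2) B uZ by simp
 let ?R = "R(50 := e, 48 := v, 49 := v', 10 := 16 + v', 11 := 0, 12 := u)"
 have b1: "bR ?R" "std ?R" using b B uZ by auto
 have i1: "inst M1 (16 + v') []" using inst B by (simp add: M1_def v'_def)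
 have ins: "wp w pIns (\<lambda>t R' M'. t <= gam * T \<and> bR R' \<and> bM M' \<and> keep {12, 13} ?R R' \<and> std R' \<and>
  inst M' (16 + v') (take 0 [] @ u # drop 0 []) \<and> same {16 + v'} M1 M') ?R M1"
  by (rule pIns[OF b1(1) bM1 b1(2)]) (use B i1 u m in auto)
 show ?thesis unfolding ins_level0_def
 proof (simp add: b r B v_def[symmetric] v'_def[symmetric] vv uZ e(1)[symmetric] M1_def[symmetric] bM1, rule wp_mono[OF ins], elim conjE, goal_cases)
  case f: (1 t R' M')
  have sm: "same {16 + v'} M1 M'" by fact
  have a: "M' (adr h x) = M1 (adr h x)" if "h < 16" "x < B" for h x using sameD[OF sm that(2), of h] that(1) by auto
  have nB: "nd x 0 < B" if "x <= 2 * U" for x using nd_B that U0 by auto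
  have nv: "nd x 0 = v \<longleftrightarrow> x = p" "nd x 0 = v' \<longleftrightarrow> x = e" for x using nd_inj[OF U0 U0] unfolding v_def v'_def by auto
  have old: "(x ~= p --> NX M' x 0 = NX M x 0) \<and> LV M' x 0 = LV M x 0 \<and> WT M' x 0 = WT M x 0" if "x <= 2 * U" "x ~= e" for x
   using a nB[OF that(1)] nv[of x] that(2) B by (simp add: M1_def)
  have ls1: "lev_same l M M1" if "l <= tp" "1 <= l" for l
   unfolding M1_def v_def v'_def by (intro lev_same_upd lev_same_upd_other lev_same_refl) (use that tp_U U0 e B in auto)
  have ls: "lev_same l M M'" if "l <= tp" "1 <= l" for l
   by (rule lev_same_trans[OF ls1[OF that] lev_same_node[OF sm[unfolded v'_def] tp_U[OF that(1)] U0]]) (use that in simp)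
  have smM: "same {0, 1, 2, 3, 4, 16 + v'} M M'" using sm B by (auto simp: same_def M1_def)
  have vals: "M' (adr 0 0) = M (adr 0 0)" "M' (adr 0 2) = e" "M' (adr 4 e) = u" "M' (adr 1 v') = M (adr 1 v)" "M' (adr 1 v) = e"
   "M' (adr 2 v') = 1" "M' (adr 3 v') = 1" using a B vv by (simp_all add: M1_def)
  have v4: "M' (adr 4 x) = M (adr 4 x)" if "x <= 2 * U" "x ~= e" for x using a[of 4 x] nd_Z(4)[OF that(1)] that B by (simp add: M1_def)
  have kp: "keep {10, 11, 12, 13, 48, 49, 50} R R'" using f(4) by (auto simp: keep_def)
  show ?case using f(1-3,5,6) kp smM vals v4 old ls by simp
 qed
qed

text \<open>Level 0 contributes nothing: its blocks are single elements and never split.\<close>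

definition levels_pot :: "(nat => nat list list) => nat => nat" where
 "levels_pot Ps z = (\<Sum>l=1..<z. block_pot l (Ps l))"

lemma wf_tree_frame:
 assumes "wf_tree M Ps es A vl" "\<And>l. l <= tp ==> lev_same l M M'"
 shows "wf_tree M' Ps es A vl"
proof -
 have "level M' l (Ps l) es A vl" if "l <= tp" for l
  by (rule level_frame[OF assms(2)[OF that]]) (use assms(1) that in \<open>auto simp: wf_tree_def\<close>)
 then show ?thesis using assms(1) unfolding wf_tree_def by simp
qed

text \<open>Elements are numbered consecutively by the counter in cell 2 of region 0, which never
  decreases between rebuilds; bounding it by \<open>2 * U\<close> keeps node numbers below
  \<open>B\<close>. Region 15 is a spare copy for the last step of a query.\<close>

definition tree_at :: "mem => (nat => nat list list) => nat list => nat set => (nat => nat) => nat list => bool" where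
 "tree_at M Ps es A vl us \<longleftrightarrow> bM M \<and> wf_tree M Ps es A vl \<and> (\<forall>e\<in>A. M (adr 4 e) = vl e \<and> legal (vl e)) \<and> vals A vl es = us \<and>
   M (adr 0 0) = length us \<and> set es = {0..M (adr 0 2)} \<and> M (adr 0 2) <= 2 * U \<and> clean M \<and> inst M 15 []"

lemma ex_target:
 assumes "i <= live A es" "es ~= []" "hd es = 0" "0 \<notin> A"
 shows "\<exists>E1 p. target es A i E1 p"
proof (cases "i = 0")
 case True
 have "es = [] @ 0 # tl es" using assms by (cases es) auto
 then show ?thesis using True unfolding target_def by blast
next
 case False
 have "0 < i ==> i <= live A es ==> \<exists>E1 p E2. es = E1 @ p # E2 \<and> p \<in> A \<and> i = live A E1 + 1"
 proof (induction es rule: rev_induct)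
  case (snoc x es)
  show ?case
  proof (cases "i <= live A es")
   case True
   then obtain E1 p E2 where "es = E1 @ p # E2" "p \<in> A" "i = live A E1 + 1" using snoc by blast
   then show ?thesis by (intro exI[of _ E1] exI[of _ p] exI[of _ "E2 @ [x]"]) simp
  next
   case False
   then have "x \<in> A" "i = live A es + 1" using snoc.prems by (auto split: if_splits)
   then show ?thesis by (intro exI[of _ es] exI[of _ x] exI[of _ "[]"]) simp
  qed
 qed simp
 then show ?thesis using False assms(1) unfolding target_def by blast
qed

text \<open>The sentinel is not live, so the same formula also covers \<open>i = 0\<close>.\<close>

lemma target_live: "target es A i E1 p ==> hd es = 0 ==> 0 \<notin> A ==> live A (E1 @ [p]) = i"
 by (auto simp: target_def)

definition insert_cost :: nat where "insert_cost = L * (8 * (gam * T) + 4000)"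

end

context tree
begin

text \<open>Levels are treated from the bottom up, because a split on level \<open>l\<close> cuts
  along the blocks of level \<open>l - 1\<close>, which must already contain the new element. The
  cut falls on one of their first elements, so the levels remain nested.\<close>

lemma plain_insert:
 assumes b: "bR R" "std R" and r: "R 1 = i" "R 2 = u" and inv: "tree_at M Ps es A vl us"
  and i: "i <= length us" "length us < m" "legal u" and cnt: "M (adr 0 2) < 2 * U"
 shows "wp w plain_insert (\<lambda>t R' M'. bR R' \<and> bM M' \<and> std R' \<and> keep ({10, 11, 12, 13} \<union> {41..60}) R R' \<and>
  same ({0..7} \<union> {16..}) M M' \<and> M' (adr 0 2) = M (adr 0 2) + 1 \<and> (\<exists>Ps' es' A' vl'. tree_at M' Ps' es' A' vl' (ins_at i u us) \<and>
   t + split_cost * levels_pot Ps' (L - 2) <= split_cost * levels_pot Ps (L - 2) + insert_cost)) R M"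
proof -
 define e where "e = M (adr 0 2) + 1"
 have I0: "bM M" "wf_tree M Ps es A vl" "vals A vl es = us" "M (adr 0 0) = length us" "set es = {0..M (adr 0 2)}" "clean M" "inst M 15 []"
  and vl: "\<And>f. f \<in> A ==> M (adr 4 f) = vl f \<and> legal (vl f)" using inv by (auto simp: tree_at_def)
 have W: "distinct es" "set es \<subseteq> {..2 * U}" "es ~= []" "hd es = 0" "0 \<notin> A" "A \<subseteq> set es" "Ps 0 = map (\<lambda>e. [e]) es"
  and lev: "\<And>l. l <= tp ==> level M l (Ps l) es A vl \<and> bounded l (Ps l)"
  and hds: "\<And>l. l < tp ==> hd ` set (Ps (l + 1)) \<subseteq> hd ` set (Ps l)" using I0(2) by (auto simp: wf_tree_def)
 have lus: "live A es = length us" using I0(3) by (metis length_vals)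
 obtain E1 p where tg: "target es A i E1 p" using ex_target[of i A es] i(1) lus W by auto
 then obtain E2 where es: "es = E1 @ p # E2" by (auto simp: target_def)
 have tl: "live A (E1 @ [p]) = i" by (rule target_live[OF tg W(4,5)])
 define es' A' vl' where "es' = E1 @ p # e # E2" and "A' = insert e A" and "vl' = vl(e := u)"
 have e: "e <= 2 * U" "e \<notin> set es" "e \<notin> A" "e ~= 0" using cnt I0(5) W(6) by (auto simp: e_def)
 have pU: "p <= 2 * U" "p ~= e" using W(2) e es by auto
 have E: "distinct es'" "set es' \<subseteq> {..2 * U}" "hd es' = 0" "0 \<notin> A'" "A' \<subseteq> set es'" "set es' = insert e (set es)"
  using W e es by (auto simp: es'_def A'_def hd_append)
 have U0: "0 < U" using U_ge by linarith
 have Zs: "i < Z" "L - 2 < Z" "1 < Z" "length us + 1 < Z" "0 < B" "2 < B" using i bounds B_big B_lt_Z by linarith+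
 have L3: "tp + 1 = L - 2" "1 <= L - 2" unfolding tp_def using Lb by auto
 let ?R = "R(41 := i)"
 have b1: "bR ?R" "std ?R" using b Zs by auto
 have wk: "wp w walk (\<lambda>\<tau> R' M'. \<tau> <= 2100 * L \<and> bR R' \<and> bM M' \<and> std R' \<and> keep {42, 43, 44, 45, 46, 47, 48} ?R R' \<and>
  same {5, 6, 7} M M' \<and> R' 42 = p \<and> R' 46 = L - 2 \<and> (\<forall>l\<le>tp. path_at M' (Ps l) A p l) \<and>
  (\<exists>lg. R' 44 = length lg \<and> length lg <= 33 * L \<and> concat (map snd lg) = E1 \<and> logged M' Ps lg)) ?R M"
  by (rule walk[OF b1(1) I0(1) b1(2) _ I0(2) tg]) simp
 show ?thesis unfolding plain_insert_def
 proof (simp add: b r Zs I0(1), rule wp_mono[OF wk], elim conjE, goal_cases)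
  case f: (1 t1 R1 M1)
  have sm1: "same {5, 6, 7} M M1" by fact
  have lev1: "level M1 l (Ps l) es A vl" if "l <= tp" for l
   by (rule level_frame[OF lev_same_low[OF sm1 tp_U[OF that]] lev[OF that, THEN conjunct1] W(2)]) auto
  have r1: "R1 42 = p" "R1 2 = u" "R1 41 = i" "R1 46 = L - 2" using f(5,7,8) r by (auto simp: keep_def)
  have m1: "M1 (adr 0 2) = M (adr 0 2)" "M1 (adr 0 0) = length us" using sameD[OF sm1] Zs I0(4) by auto
  have m14: "M1 (adr 4 x) = M (adr 4 x)" if "x <= 2 * U" for x by (rule sameD[OF sm1]) (use nd_Z(4)[OF that] in auto)
  have ie: "inst M1 (16 + nd e 0) []" using lev1[of 0] e W(7) by (auto simp: level_def)
  have i0: "wp w ins_level0 (\<lambda>t R' M'. t <= gam * T + 150 \<and> bR R' \<and> bM M' \<and> std R' \<and> keep {10, 11, 12, 13, 48, 49, 50} R1 R' \<and>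
   same {0, 1, 2, 3, 4, 16 + nd e 0} M1 M' \<and> M' (adr 0 0) = M1 (adr 0 0) \<and> M' (adr 0 2) = e \<and> M' (adr 4 e) = u \<and>
   (\<forall>x\<le>2 * U. x ~= e --> M' (adr 4 x) = M1 (adr 4 x)) \<and>
   NX M' e 0 = NX M1 p 0 \<and> NX M' p 0 = e \<and> LV M' e 0 = 1 \<and> WT M' e 0 = 1 \<and> inst M' (16 + nd e 0) [u] \<and>
   (\<forall>x\<le>2 * U. x ~= e --> (x ~= p --> NX M' x 0 = NX M1 x 0) \<and> LV M' x 0 = LV M1 x 0 \<and> WT M' x 0 = WT M1 x 0) \<and>
   (\<forall>l\<le>tp. 1 <= l --> lev_same l M1 M')) R1 M1"
   by (rule ins_level0[OF f(2-4) r1(1,2)]) (use m1 e pU i ie in \<open>auto simp: e_def\<close>)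
  show ?case
  proof (simp add: wp_Seq, rule wp_mono[OF i0], elim conjE, goal_cases)
   case g: (1 t2 R2 M2)
   have sm2: "same {0, 1, 2, 3, 4, 16 + nd e 0} M1 M2" by fact
   have lev0: "level M2 0 (map (\<lambda>f. [f]) es') es' A' vl'" unfolding A'_def vl'_def
   proof (rule level0_insert[OF lev1[of 0, unfolded W(7)] es es'_def E(1,2) e(4,3)])
    fix x us assume "x <= 2 * U" "x ~= e" "inst M1 (16 + nd x 0) us"
    then show "inst M2 (16 + nd x 0) us" using inst_same[OF sm2] nd_inj[OF U0 U0] by auto
   qed (use g in auto)
   have ls2: "lev_same l M1 M2" if "l <= tp" "1 <= l" for l using g that by blast
   have vl2: "M2 (adr 4 x) = vl' x \<and> legal (vl' x)" if "x \<in> A'" for x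
   proof (cases "x = e")
    case False
    then have x: "x \<in> A" "x <= 2 * U" using that W by (auto simp: A'_def)
    then have "M2 (adr 4 x) = M (adr 4 x)" using g(10) m14 False by auto
    then show ?thesis using vl[OF x(1)] False by (simp add: vl'_def)
   qed (use g i in \<open>simp add: vl'_def\<close>)
   have path2: "path_at M2 (Ps l) A p l" if "l <= tp" for l
   proof -
    have "l < B" using tp_U[OF that] bounds by linarith
    then have "M2 (adr 5 l) = M1 (adr 5 l)" "M2 (adr 6 l) = M1 (adr 6 l)" using sameD[OF sm2] by auto
    then show ?thesis using f(9) that by (auto simp: path_at_def)
   qed
   \<comment> \<open>The bound of \<open>ins_step\<close> plus 8 steps of loop overhead.\<close>
   define c where "c = 7 * (gam * T) + 1208"
   \<comment> \<open>Below \<open>l\<close> the new partitions \<open>Qs\<close> are in place. From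
     \<open>l\<close> on the memory is still that of the old tree, so the recorded path remains
     valid there.\<close>
   define I where "I l \<tau> R' M' \<longleftrightarrow> keep ({10, 11, 12, 13, 42, 47, 48, 49, 51} \<union> {52..60}) R2 R' \<and> same ({1, 2, 3} \<union> {16..}) M2 M' \<and>
    R' 51 = 2 ^ (l - 1) \<and> (\<forall>k\<le>tp. l <= k --> lev_same k M2 M') \<and> (\<exists>Qs. Qs 0 = map (\<lambda>f. [f]) es' \<and>
     (\<forall>k<l. level M' k (Qs k) es' A' vl' \<and> bounded k (Qs k) \<and> hd ` set (Ps k) \<subseteq> hd ` set (Qs k)) \<and>
     (\<forall>k. k + 1 < l --> hd ` set (Qs (k + 1)) \<subseteq> hd ` set (Qs k)) \<and>
     \<tau> + split_cost * levels_pot Qs l <= split_cost * levels_pot Ps l + (l - 1) * c)" for l \<tau> R' M'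
   let ?R2 = "R2(51 := 1, 47 := 1)"
   have b2: "bR ?R2" using g(2) Zs by simp
   have r2: "R2 2 = u" "R2 41 = i" "R2 46 = L - 2" "R2 5 = U" using g(4,5) r1 by (auto simp: keep_def)
   define F where "F t R' M' \<longleftrightarrow> bR R' \<and> bM M' \<and> (\<exists>\<tau>. t = \<tau> + 4 \<and> I (L - 2) \<tau> R' M')" for t R' M'
   have lp: "wp w (For 47 46 ins_step) (\<lambda>t. F (0 + t)) ?R2 M2"
   proof (rule wp_For_acc[where I = I and a = 1 and z = "L - 2", OF _ _ _ _ _ b2 g(3)])
    have "bounded 0 (map (\<lambda>f. [f]) es')" by (auto simp: bounded_def)
    moreover have "hd ` set (Ps 0) \<subseteq> hd ` set (map (\<lambda>f. [f]) es')" using W(7) E(6) by (auto simp: image_image)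
    ultimately show "I 1 0 ?R2 M2" unfolding I_def
     by (intro conjI exI[of _ "\<lambda>k. map (\<lambda>f. [f]) es'"]) (use lev0 in \<open>simp_all add: keep_def levels_pot_def\<close>)
   next
    fix l \<tau> R' M' assume l: "1 <= l" "l < L - 2" and I: "I l \<tau> R' M'" and R': "R' 47 = l" "R' 46 = L - 2" "bR R'" "bM M'"
    obtain Qs where Q: "Qs 0 = map (\<lambda>f. [f]) es'"
     "\<And>k. k < l ==> level M' k (Qs k) es' A' vl' \<and> bounded k (Qs k) \<and> hd ` set (Ps k) \<subseteq> hd ` set (Qs k)"
     "\<And>k. k + 1 < l ==> hd ` set (Qs (k + 1)) \<subseteq> hd ` set (Qs k)"
     "\<tau> + split_cost * levels_pot Qs l <= split_cost * levels_pot Ps l + (l - 1) * c" using I unfolding I_def by blast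
    have kp: "keep ({10, 11, 12, 13, 42, 47, 48, 49, 51} \<union> {52..60}) R2 R'" and sm: "same ({1, 2, 3} \<union> {16..}) M2 M'"
     and r51: "R' 51 = 2 ^ (l - 1)" and ls: "\<And>k. k <= tp ==> l <= k ==> lev_same k M2 M'" using I by (auto simp: I_def)
    have st: "std R'" by (rule std_keep[OF kp]) (use g in simp_all)
    have ltp: "l <= tp" "l < B" using l L3 tp_U[of l] bounds by auto
    have r': "R' 2 = u" "R' 41 = live A (E1 @ [p])" using kp r2 tl by (auto simp: keep_def)
    have levl: "level M' l (Ps l) es A vl"
     by (rule level_frame[OF ls[OF ltp(1)] level_frame[OF ls2[OF ltp(1) l(1)] lev1[OF ltp(1)] W(2)] W(2)]) simp
    have pth: "path_at M' (Ps l) A p l"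
     using path2[OF ltp(1)] sameD[OF sm ltp(2), of 5] sameD[OF sm ltp(2), of 6] by (simp add: path_at_def)
    have vl': "M' (adr 4 x) = vl' x \<and> legal (vl' x)" if "x \<in> A'" for x
     using vl2[OF that] sameD[OF sm, of x 4] nd_Z(4)[of x] that E(2,5) by auto
    have l1: "l - 1 < l" "l - 1 < tp" "l - 1 + 1 = l" using l ltp by auto
    have hs: "hd ` set (Ps l) \<subseteq> hd ` set (Qs (l - 1))" using hds[OF l1(2)] Q(2)[OF l1(1)] l1(3) by auto
    have step: "wp w ins_step (\<lambda>\<tau> R'' M''. bR R'' \<and> bM M'' \<and> std R'' \<and> keep ({10, 11, 12, 13, 42, 48, 49, 51} \<union> {52..60}) R' R'' \<and>
     same ({1, 2, 3} \<union> {16..}) M' M'' \<and> (\<forall>l'\<le>tp. l' ~= l --> lev_same l' M' M'') \<and> R'' 51 = 2 ^ l \<and>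
     (\<exists>bs'. level M'' l bs' es' (insert e A) (vl(e := u)) \<and> bounded l bs' \<and> hd ` set (Ps l) \<subseteq> hd ` set bs' \<and> hd ` set bs' \<subseteq> hd ` set (Qs (l - 1)) \<and>
      \<tau> + split_cost * block_pot l bs' <= split_cost * block_pot l (Ps l) + (7 * (gam * T) + 1200))) R' M'"
    proof (rule ins_step[OF R'(3,4) st R'(1) r'(2,1) r51 l(1) ltp(1) es es'_def E(1,2) W(4-6) levl _ pth])
     show "level M' (l - 1) (Qs (l - 1)) es' (insert e A) (vl(e := u))" "bounded (l - 1) (Qs (l - 1))"
      using Q(2)[OF l1(1)] by (simp_all add: A'_def vl'_def)
     show "level M' 0 (map (\<lambda>e. [e]) es') es' (insert e A) (vl(e := u))" using Q(2)[of 0] l(1) Q(1) by (simp add: A'_def vl'_def)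
     show "bounded l (Ps l)" using lev[OF ltp(1)] by simp
    qed (use hs vl'[unfolded A'_def vl'_def] lus i in auto)
    show "wp w ins_step (\<lambda>t R'' M''. R'' 47 = l \<and> R'' 46 = L - 2 \<and> bR R'' \<and> bM M'' \<and> I (Suc l) (\<tau> + t + 8) (R''(47 := Suc l)) M'') R' M'"
    proof (rule wp_mono[OF step], elim conjE exE, goal_cases)
     case h: (1 t R'' M'' bs')
     have r'': "R'' 47 = l" "R'' 46 = L - 2" using h(4) R' by (auto simp: keep_def)
     have kp': "keep ({10, 11, 12, 13, 42, 47, 48, 49, 51} \<union> {52..60}) R2 (R''(47 := Suc l))" using kp h(4) by (auto simp: keep_def)
     have sm': "same ({1, 2, 3} \<union> {16..}) M2 M''" using sm h(5) by (auto simp: same_def)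
     have ls': "lev_same k M2 M''" if "k <= tp" "Suc l <= k" for k
      by (rule lev_same_trans[OF ls[OF that(1)]]) (use h(6) that in auto)
     let ?Qs = "Qs(l := bs')"
     have lk: "level M'' k (?Qs k) es' A' vl' \<and> bounded k (?Qs k) \<and> hd ` set (Ps k) \<subseteq> hd ` set (?Qs k)" if "k < Suc l" for k
     proof (cases "k = l")
      case False
      then have k: "k < l" "k <= tp" using that ltp by auto
      have "level M'' k (Qs k) es' A' vl'" by (rule level_frame[OF _ Q(2)[OF k(1), THEN conjunct1] E(2)]) (use h(6) k in auto)
      then show ?thesis using Q(2)[OF k(1)] False by simp
     qed (use h in \<open>simp add: A'_def vl'_def\<close>)
     have hk: "hd ` set (?Qs (k + 1)) \<subseteq> hd ` set (?Qs k)" if "k + 1 < Suc l" for k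
     proof (cases "k + 1 = l")
      case True
      then have "k = l - 1" "k ~= l" by auto
      then show ?thesis using h(11) True by simp
     qed (use Q(3)[of k] that in auto)
     have pot: "levels_pot ?Qs (Suc l) = levels_pot Qs l + block_pot l bs'" "levels_pot Ps (Suc l) = levels_pot Ps l + block_pot l (Ps l)"
      using l(1) by (auto simp: levels_pot_def intro!: sum.cong)
     have cl: "(Suc l - 1) * c = (l - 1) * c + c" using l(1) by (cases l) auto
     have "\<tau> + t + 8 + split_cost * levels_pot ?Qs (Suc l) <= split_cost * levels_pot Ps (Suc l) + (Suc l - 1) * c"
      unfolding pot cl distrib_left using Q(4) h(12) by (simp add: c_def)
     note a0 = this
     have a1: "?Qs 0 = map (\<lambda>f. [f]) es'" using Q(1) l(1) by simp
     have a2: "\<forall>k<Suc l. level M'' k (?Qs k) es' A' vl' \<and> bounded k (?Qs k) \<and> hd ` set (Ps k) \<subseteq> hd ` set (?Qs k)" using lk by blast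
     have a3: "\<forall>k. k + 1 < Suc l --> hd ` set (?Qs (k + 1)) \<subseteq> hd ` set (?Qs k)" using hk by blast
     have a4: "(R''(47 := Suc l)) 51 = 2 ^ (Suc l - 1)" using h(7) by simp
     have a5: "\<forall>k\<le>tp. Suc l <= k --> lev_same k M2 M''" using ls' by blast
     have "I (Suc l) (\<tau> + t + 8) (R''(47 := Suc l)) M''" unfolding I_def
      by (rule conjI[OF kp' conjI[OF sm' conjI[OF a4 conjI[OF a5 exI[of _ ?Qs]]]]]) (rule conjI[OF a1 conjI[OF a2 conjI[OF a3 a0]]])
     then show ?case using r'' h(1,2) by simp
    qed
   next
    fix \<tau> R' M' assume "I (L - 2) \<tau> R' M'" "bR R'" "bM M'"
    then show "F (\<tau> + 4) R' M'" by (auto simp: F_def)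
   qed (use r2 Zs L3 in auto)
   show ?case
   proof (simp add: g(2,3) Zs, rule wp_mono[OF lp], goal_cases)
    case (1 t3 R3 M3)
    then obtain \<tau> where \<tau>: "t3 = \<tau> + 4" and I: "I (L - 2) \<tau> R3 M3" and b3: "bR R3" "bM M3" by (auto simp: F_def)
    obtain Qs where Q: "Qs 0 = map (\<lambda>f. [f]) es'"
     "\<And>k. k < L - 2 ==> level M3 k (Qs k) es' A' vl' \<and> bounded k (Qs k) \<and> hd ` set (Ps k) \<subseteq> hd ` set (Qs k)"
     "\<And>k. k + 1 < L - 2 ==> hd ` set (Qs (k + 1)) \<subseteq> hd ` set (Qs k)"
     "\<tau> + split_cost * levels_pot Qs (L - 2) <= split_cost * levels_pot Ps (L - 2) + (L - 2 - 1) * c" using I unfolding I_def by blast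
    have kp: "keep ({10, 11, 12, 13, 42, 47, 48, 49, 51} \<union> {52..60}) R2 R3" and sm: "same ({1, 2, 3} \<union> {16..}) M2 M3" using I by (auto simp: I_def)
    have st: "std R3" by (rule std_keep[OF kp]) (use g in simp_all)
    have m3: "M3 (adr 0 0) = length us" "M3 (adr 0 2) = e" using sameD[OF sm] Zs g m1 by auto
    let ?M = "M3(adr 0 0 := length us + 1)"
    have wf: "wf_tree ?M Qs es' A' vl'"
    proof (rule wf_tree_frame)
     have "es' ~= []" by (simp add: es'_def)
     moreover have "level M3 l (Qs l) es' A' vl' \<and> bounded l (Qs l)" if "l <= tp" for l using Q(2)[of l] that L3 by simp
     moreover have "hd ` set (Qs (l + 1)) \<subseteq> hd ` set (Qs l)" if "l < tp" for l by (rule Q(3)) (use that L3 in simp)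
     ultimately show "wf_tree M3 Qs es' A' vl'" unfolding wf_tree_def using E(1-5) Q(1) by blast
     show "lev_same l M3 ?M" if "l <= tp" for l by (rule lev_same_upd_other) (use tp_U[OF that] Zs in auto)
    qed
    have smF: "same ({0..7} \<union> {16..}) M ?M" using sm1 sm2 sm Zs by (auto simp: same_def)
    have vls: "vals A' vl' es' = ins_at i u us" unfolding A'_def vl'_def es'_def ins_at_def
     using ins_vals(1)[of e E1 p E2 A vl u] e es tl I0(3) by (simp del: vals_simps live_simps)
    have vlF: "?M (adr 4 x) = vl' x \<and> legal (vl' x)" if "x \<in> A'" for x
     using vl2[OF that] sameD[OF sm, of x 4] nd_Z(4)[of x] that E(2,5) Zs by auto
    have "set es' = {0..e}" using E(6) I0(5) by (auto simp: e_def)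
    moreover have "clean ?M" by (rule clean_same[OF smF _ _ I0(6)]) auto
    moreover have "inst ?M 15 []" by (rule inst_same[OF smF _ I0(7)]) auto
    moreover have "bM ?M" using b3 Zs by simp
    ultimately have ta: "tree_at ?M Qs es' A' vl' (ins_at i u us)" unfolding tree_at_def
     using wf vlF vls m3 e(1) Zs by simp
    have tm: "t1 + t2 + t3 + 60 + split_cost * levels_pot Qs (L - 2) <= split_cost * levels_pot Ps (L - 2) + insert_cost"
    proof -
     define x where "x = gam * T"
     have "(L - 2 - 1) * c <= (L - 1) * c" by (intro mult_right_mono) auto
     also have "(L - 1) * c + c = L * c" using Lb by (cases L) auto
     then have "(L - 1) * c = L * c - c" by simp
     finally have 1: "(L - 2 - 1) * c + c <= L * c" using Lb by (cases L) auto
     have 2: "L * c = 7 * (L * x) + 1208 * L" by (simp add: c_def x_def algebra_simps)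
     have 3: "insert_cost = 8 * (L * x) + 4000 * L" by (simp add: insert_cost_def x_def algebra_simps)
     have "1 * x <= L * x" using Lb by (intro mult_right_mono) auto
     moreover have "t2 <= x + 150" "t1 <= 2100 * L" using g(1) f(1) by (auto simp: x_def)
     moreover have "c \<ge> 1208" by (simp add: c_def)
     ultimately show ?thesis using 1 2 3 Q(4) \<tau> Lb by linarith
    qed
    have kpF: "keep ({10, 11, 12, 13} \<union> {41..60}) R R3" using kp g(5) f(5) by (auto simp: keep_def)
    have ex: "\<exists>Ps' es' A' vl'. tree_at ?M Ps' es' A' vl' (ins_at i u us) \<and>
     t1 + t2 + t3 + 60 + split_cost * levels_pot Ps' (L - 2) <= split_cost * levels_pot Ps (L - 2) + insert_cost" using ta tm by blast
    have m02: "?M (adr 0 2) = M (adr 0 2) + 1" using m3 Zs by (simp add: e_def)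
    show ?case using b3 st kpF smF m02 m3 Zs ex by (auto elim!: ex_forward)
   qed
  qed
 qed
qed

end

context progs
begin

section \<open>Deletion: elements die but remain in their blocks\<close>

definition del_step :: com where
 "del_step = Seq (Assign 42 (Ld (Lit 5) (Reg 47))) (Seq (Assign 48 (node (Reg 42) (Reg 47)))
  (Seq (St (Lit 2) (Reg 48) (Bin Sub (Ld (Lit 2) (Reg 48)) (Lit 1)))
  (Seq (Assign 10 (Bin Add (Lit 16) (Reg 48)))
  (Seq (Assign 11 (Bin Sub (Bin Sub (Reg 41) (Lit 1)) (Ld (Lit 6) (Reg 47)))) pDel))))"

text \<open>The removed update is handed back in register 61, for the benefit of a rebuild, which
  empties the list by deletions.\<close>

definition plain_delete :: com where
 "plain_delete = Seq (Assign 41 (Bin Add (Reg 1) (Lit 1))) (Seq walk (Seq (Assign 61 (Ld (Lit 4) (Reg 42))) (Seq (Assign 47 (Lit 0))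
  (Seq (For 47 46 del_step) (St (Lit 0) (Lit 0) (Bin Sub (Ld (Lit 0) (Lit 0)) (Lit 1)))))))"

end

context tree
begin

lemma del_vals:
 assumes "p \<notin> set (c1 @ c2)" "p \<in> A"
 defines "k \<equiv> live A c1"
 shows "vals (A - {p}) vl (c1 @ p # c2) = take k (vals A vl (c1 @ p # c2)) @ drop (Suc k) (vals A vl (c1 @ p # c2))"
  "live A (c1 @ p # c2) = live (A - {p}) (c1 @ p # c2) + 1"
proof -
 have v: "vals (A - {p}) vl b = vals A vl b" "live (A - {p}) b = live A b" if "p \<notin> set b" for b
  by (rule vals_cong live_cong; use that in auto)+
 have n: "p \<notin> set c1" "p \<notin> set c2" using assms(1) by auto
 have "length (vals A vl c1) = k" by (simp only: k_def length_vals)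
 then have "take k (vals A vl c1 @ vl p # vals A vl c2) = vals A vl c1"
  "drop (Suc k) (vals A vl c1 @ vl p # vals A vl c2) = vals A vl c2" by simp_all
 then show "vals (A - {p}) vl (c1 @ p # c2) = take k (vals A vl (c1 @ p # c2)) @ drop (Suc k) (vals A vl (c1 @ p # c2))"
  using assms(2) v(1)[OF n(1)] v(1)[OF n(2)] by simp
 show "live A (c1 @ p # c2) = live (A - {p}) (c1 @ p # c2) + 1"
  using assms(2) v(2)[OF n(1)] v(2)[OF n(2)] by simp
qed

lemma del_step:
 assumes b: "bR R" "bM M" "std R" and r: "R 47 = l" "R 41 = live A E1 + 1" and l: "l <= tp"
  and E: "es = E1 @ p # E2" "distinct es" "set es \<subseteq> {..2 * U}" "0 \<notin> A" "p \<in> A"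
  and lev: "level M l bs es A vl" "path_at M bs A p l" and lm: "live A es <= m"
 shows "wp w del_step (\<lambda>t R' M'. t <= gam * T + 80 \<and> bR R' \<and> bM M' \<and> std R' \<and> keep {10, 11, 12, 13, 42, 48} R R' \<and>
  same ({2} \<union> {16..}) M M' \<and> (\<forall>l'\<le>tp. l' ~= l --> lev_same l' M M') \<and> level M' l bs es (A - {p}) vl) R M"
proof -
 have lU: "l < U" using tp_U[OF l] by auto
 obtain Xs c Ys where c: "bs = Xs @ c # Ys" "p \<in> set c" "M (adr 5 l) = hd c" "M (adr 6 l) = live A (concat Xs)"
  using lev(2) by (auto simp: path_at_def)
 have cc: "concat bs = es" "[] \<notin> set bs" using lev(1) by (auto simp: level_def)
 obtain c1 c2 where c12: "c = c1 @ p # c2" using c(2) by (meson split_list)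
 have sp: "E1 = concat Xs @ c1"
 proof -
  have e: "E1 @ p # E2 = (concat Xs @ c1) @ p # (c2 @ concat Ys)" using cc(1) c(1) c12 E(1) by simp
  have d: "distinct (E1 @ p # E2)" using E(1,2) by simp
  show "E1 = concat Xs @ c1" using distinct_split_unique[OF d e] by auto
 qed
 define k where "k = live A c1"
 define v where "v = nd (hd c) l"
 have cin: "c \<in> set bs" using c(1) by simp
 have hcU: "hd c <= 2 * U" using level_heads[OF lev(1) cin] E(3) by auto
 have vB: "v < B" "16 + v < B" "v < Z" "16 + v < Z" "l < B" "hd c < Z" using nd_B nd_Z hcU lU bounds unfolding v_def by auto
 have bc: "WT M (hd c) l = weight c" "LV M (hd c) l = live A c" "inst M (16 + v) (vals A vl c)"
  using lev(1) cin by (auto simp: level_def block_at_def v_def)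
 have "distinct c" using E(2) cc(1) c(1) by auto
 then have pc: "p \<notin> set (c1 @ c2)" using c12 by auto
 note dv = del_vals[OF pc E(5), folded c12]
 have lc: "live A c <= live A es" using cc(1) c(1) by auto
 have kc: "k < live A c" "live A c < Z" "live A c - 1 < Z" "k < Z" "1 <= live A c" using c12 E(5) lc lm bounds by (auto simp: k_def)
 define M1 where "M1 = M(adr 2 v := live A c - 1)"
 have bM1: "bM M1" using b kc by (simp add: M1_def)
 have in1: "inst M1 (16 + v) (vals A vl c)" using bc(3) vB by (simp add: M1_def)
 have m6: "M1 (adr 6 l) = live A (concat Xs)" using c(4) vB by (simp add: M1_def)
 let ?R = "R(42 := hd c, 48 := v, 10 := 16 + v, 11 := k)"
 have b1: "bR ?R" "std ?R" using b vB kc by auto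
 have del: "wp w pDel (\<lambda>t R' M'. t <= gam * T \<and> bR R' \<and> bM M' \<and> keep {12, 13} ?R R' \<and> std R' \<and>
  inst M' (16 + v) (take k (vals A vl c) @ drop (Suc k) (vals A vl c)) \<and> same {16 + v} M1 M') ?R M1"
  by (rule pDel[OF b1(1) bM1 b1(2)]) (use vB in1 kc lc lm in auto)
 have sub: "1 <= R 41" "live A (concat Xs) <= R 41 - 1" "R 41 - 1 - live A (concat Xs) = k" "R 41 - 1 < Z"
  using r(2) sp b(1) bR_reg[OF b(1), of 41] by (auto simp: k_def simp del: bR_reg)
 show ?thesis unfolding del_step_def
 proof (simp add: b bM1 m6 r(1) vB v_def[symmetric] bc[folded v_def] c(3,4) sub kc M1_def[symmetric] del: diff_diff_left, rule wp_mono[OF del], elim conjE, goal_cases)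
  case f: (1 t R1 M2)
  have kp: "keep {10, 11, 12, 13, 42, 48} R R1" using f(4) by (auto simp: keep_def)
  have sm: "same ({2} \<union> {16..}) M M2" using f(7) vB by (auto simp: same_def M1_def)
  have wt2: "M2 (adr 3 v) = weight c" "M2 (adr 2 v) = live A c - 1" using sameD[OF f(7) vB(1)] vB(1) bc by (simp_all add: M1_def v_def)
  have ls1: "lev_same l' M M1" if "l' <= tp" "l' ~= l" for l'
   unfolding M1_def v_def by (intro lev_same_upd lev_same_refl) (use that tp_U lU hcU in auto)
  have ls: "lev_same l' M M2" if l': "l' <= tp" "l' ~= l" for l'
   by (rule lev_same_trans[OF ls1[OF l'] lev_same_node[OF f(7)[unfolded v_def] tp_U[OF l'(1)] lU(1) l'(2)]])
  have a2: "M2 (adr h x) = M1 (adr h x)" if "h < 16" "x < B" for h x using sameD[OF f(7) that(2), of h] that(1) by auto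
  have ndB: "nd x l < B" "16 + nd x l < B" if "x <= 2 * U" for x using nd_B that lU by auto
  have lv2: "level M2 l (Xs @ c # Ys) es (A - {p}) vl"
  proof (rule level_replace[OF lev(1)[unfolded c(1)] E(2,3) lU(1)])
   show "c ~= []" using c12 by simp
   show "hd c ~= 0 --> 2 ^ (l - 1) <= weight c" using lev(1) cin by (auto simp: level_def)
   show "block_at M2 l (A - {p}) vl c" unfolding block_at_def v_def[symmetric]
    using f(6) dv wt2 by (simp add: k_def)
   show "es = concat Xs @ c @ concat Ys" using cc(1) c(1) by simp
   show "(f \<in> A) = (f \<in> A - {p}) \<and> (f \<in> A --> vl f = vl f)" if "f \<notin> set c" for f using that c(2) by auto
   fix x us assume x: "x <= 2 * U"
   show "NX M2 x l = NX M x l" using a2 ndB[OF x] vB by (simp add: M1_def)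
   assume xc: "x ~= hd c"
   have nv: "nd x l ~= v" using xc nd_inj lU by (simp add: v_def)
   show "LV M2 x l = LV M x l \<and> WT M2 x l = WT M x l" using a2 ndB[OF x] vB nv by (simp add: M1_def)
   assume "inst M (16 + nd x l) us"
   then have "inst M1 (16 + nd x l) us" using vB by (simp add: M1_def)
   then show "inst M2 (16 + nd x l) us" using inst_same[OF f(7)] nv by simp
  qed simp
  show ?case using f(1-3,5) kp sm ls lv2 c(1) by simp
 qed
qed

definition delete_cost :: nat where "delete_cost = L * (gam * T + 3000)"

lemma plain_delete:
 assumes b: "bR R" "std R" and r: "R 1 = i" and inv: "tree_at M Ps es A vl us"
  and i: "i < length us" "length us <= m"
 shows "wp w plain_delete (\<lambda>t R' M'. t <= delete_cost \<and> bR R' \<and> bM M' \<and> std R' \<and> keep ({10, 11, 12, 13} \<union> {41..48} \<union> {61}) R R' \<and>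
  R' 61 = us ! i \<and> same ({0..7} \<union> {16..}) M M' \<and> M' (adr 0 2) = M (adr 0 2) \<and> (\<exists>A'. tree_at M' Ps es A' vl (del_at i us))) R M"
proof -
 have I0: "bM M" "wf_tree M Ps es A vl" "vals A vl es = us" "M (adr 0 0) = length us" "set es = {0..M (adr 0 2)}" "M (adr 0 2) <= 2 * U" "clean M" "inst M 15 []"
  and vl: "\<And>f. f \<in> A ==> M (adr 4 f) = vl f \<and> legal (vl f)" using inv by (auto simp: tree_at_def)
 have W: "distinct es" "set es \<subseteq> {..2 * U}" "es ~= []" "hd es = 0" "0 \<notin> A" "A \<subseteq> set es" "Ps 0 = map (\<lambda>e. [e]) es"
  and lev: "\<And>l. l <= tp ==> level M l (Ps l) es A vl \<and> bounded l (Ps l)"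
  and hds: "\<And>l. l < tp ==> hd ` set (Ps (l + 1)) \<subseteq> hd ` set (Ps l)" using I0(2) by (auto simp: wf_tree_def)
 have lus: "live A es = length us" using I0(3) by (metis length_vals)
 obtain E1 p where tg: "target es A (i + 1) E1 p" using ex_target[of "i + 1" A es] i(1) lus W by auto
 then obtain E2 where es: "es = E1 @ p # E2" and pA: "p \<in> A" and tl: "i = live A E1" by (auto simp: target_def)
 have pU: "p <= 2 * U" using W(2) es by auto
 have pn: "p \<notin> set (E1 @ E2)" using W(1) es by auto
 have Zs: "i < Z" "i + 1 < Z" "L - 2 < Z" "1 < Z" "0 < B" "2 < B" "p < B" using i bounds B_big B_lt_Z nd_Z(4)[OF pU] by linarith+
 have L3: "tp + 1 = L - 2" "1 <= L - 2" unfolding tp_def using Lb by auto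
 let ?R = "R(41 := i + 1)"
 have b1: "bR ?R" "std ?R" using b Zs by auto
 have wk: "wp w walk (\<lambda>\<tau> R' M'. \<tau> <= 2100 * L \<and> bR R' \<and> bM M' \<and> std R' \<and> keep {42, 43, 44, 45, 46, 47, 48} ?R R' \<and>
  same {5, 6, 7} M M' \<and> R' 42 = p \<and> R' 46 = L - 2 \<and> (\<forall>l\<le>tp. path_at M' (Ps l) A p l) \<and>
  (\<exists>lg. R' 44 = length lg \<and> length lg <= 33 * L \<and> concat (map snd lg) = E1 \<and> logged M' Ps lg)) ?R M"
  by (rule walk[OF b1(1) I0(1) b1(2) _ I0(2) tg]) simp
 show ?thesis unfolding plain_delete_def
 proof (simp add: b r Zs I0(1), rule wp_mono[OF wk], elim conjE, goal_cases)
  case f: (1 t1 R1 M1)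
  have sm1: "same {5, 6, 7} M M1" by fact
  have lev1: "level M1 l (Ps l) es A vl" if "l <= tp" for l
   by (rule level_frame[OF lev_same_low[OF sm1 tp_U[OF that]] lev[OF that, THEN conjunct1] W(2)]) auto
  have r1: "R1 42 = p" "R1 41 = live A E1 + 1" "R1 46 = L - 2" using f(5,7,8) tl by (auto simp: keep_def)
  have a1: "M1 (adr h x) = M (adr h x)" if "h \<notin> {5, 6, 7}" "x < B" for h x by (rule sameD[OF sm1 that(2,1)])
  have v1: "M1 (adr 4 p) = vl p" "vl p < Z" using a1[of 4 p] Zs vl[OF pA] legal_lt by auto
  let ?R2 = "R1(61 := vl p, 47 := 0)"
  have b2: "bR ?R2" "std ?R2" using f v1 by auto
  define I where "I l R' M' \<longleftrightarrow> keep {10, 11, 12, 13, 42, 47, 48} ?R2 R' \<and> same ({2} \<union> {16..}) M1 M' \<and>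
   (\<forall>k\<le>tp. l <= k --> lev_same k M1 M') \<and> (\<forall>k<l. k <= tp --> level M' k (Ps k) es (A - {p}) vl)" for l R' M'
  have lp: "wp w (For 47 46 del_step) (\<lambda>t R' M'. t <= 4 + (L - 2 - 0) * (gam * T + 80 + 8) \<and> bR R' \<and> bM M' \<and> I (L - 2) R' M') ?R2 M1"
  proof (rule wp_For[where I = I and a = 0 and z = "L - 2"])
   show "I 0 ?R2 M1" by (simp add: I_def keep_def)
  next
   fix l R' M' assume l: "l < L - 2" and I: "I l R' M'" and R': "R' 47 = l" "R' 46 = L - 2" "bR R'" "bM M'"
   have kp: "keep {10, 11, 12, 13, 42, 47, 48} ?R2 R'" and sm: "same ({2} \<union> {16..}) M1 M'"
    and ls: "\<And>k. k <= tp ==> l <= k ==> lev_same k M1 M'"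
    and lk: "\<And>k. k < l ==> k <= tp ==> level M' k (Ps k) es (A - {p}) vl" using I by (auto simp: I_def)
   have st: "std R'" by (rule std_keep[OF kp]) (use b2 in simp_all)
   have ltp: "l <= tp" "l < B" using l L3 tp_U[of l] bounds by auto
   have r41: "R' 41 = live A E1 + 1" using kp r1 by (auto simp: keep_def)
   have levl: "level M' l (Ps l) es A vl" by (rule level_frame[OF ls[OF ltp(1)] lev1[OF ltp(1)] W(2)]) simp
   have pth: "path_at M' (Ps l) A p l"
    using f(9) ltp(1) sameD[OF sm ltp(2), of 5] sameD[OF sm ltp(2), of 6] by (simp add: path_at_def)
   have lm: "live A es <= m" using lus i by simp
   show "wp w del_step (\<lambda>t R'' M''. t <= gam * T + 80 \<and> R'' 47 = l \<and> R'' 46 = L - 2 \<and> bR R'' \<and> bM M'' \<and> I (Suc l) (R''(47 := Suc l)) M'') R' M'"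
   proof (rule wp_mono[OF del_step[OF R'(3,4) st R'(1) r41 ltp(1) es W(1,2,5) pA levl pth lm]], elim conjE, goal_cases)
    case h: (1 t R'' M'')
    have r'': "R'' 47 = l" "R'' 46 = L - 2" using h(5) R' by (auto simp: keep_def)
    have kp': "keep {10, 11, 12, 13, 42, 47, 48} ?R2 (R''(47 := Suc l))" using kp h(5) by (auto simp: keep_def)
    have sm': "same ({2} \<union> {16..}) M1 M''" using sm h(6) by (auto simp: same_def)
    have ls': "lev_same k M1 M''" if "k <= tp" "Suc l <= k" for k
     by (rule lev_same_trans[OF ls[OF that(1)]]) (use h(7) that in auto)
    have lk': "level M'' k (Ps k) es (A - {p}) vl" if "k < Suc l" "k <= tp" for k
    proof (cases "k = l")
     case False
     then have k: "k < l" using that by auto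
     show ?thesis by (rule level_frame[OF _ lk[OF k that(2)] W(2)]) (use h(7) k that in auto)
    qed (use h in simp)
    show ?case using h(1-3) r'' kp' sm' ls' lk' by (simp add: I_def)
   qed
  qed (use b2 f(3) r1 Zs in auto)
  show ?case
  proof (simp add: f(2-4) r1 v1 Zs, rule wp_mono[OF lp], elim conjE, goal_cases)
   case g: (1 t3 R3 M3)
   have kp: "keep {10, 11, 12, 13, 42, 47, 48} ?R2 R3" and sm: "same ({2} \<union> {16..}) M1 M3"
    and lk: "\<And>k. k <= tp ==> level M3 k (Ps k) es (A - {p}) vl" using g(4) L3 by (auto simp: I_def)
   have st: "std R3" by (rule std_keep[OF kp]) (use b2 in simp_all)
   have m3: "M3 (adr 0 0) = length us" "M3 (adr 0 2) = M (adr 0 2)" using sameD[OF sm] Zs a1 I0(4) by auto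
   let ?M = "M3(adr 0 0 := length us - 1)"
   have wf: "wf_tree ?M Ps es (A - {p}) vl"
   proof (rule wf_tree_frame)
    show "wf_tree M3 Ps es (A - {p}) vl" unfolding wf_tree_def using W lk lev hds by auto
    show "lev_same l M3 ?M" if "l <= tp" for l by (rule lev_same_upd_other) (use tp_U[OF that] Zs in auto)
   qed
   have smF: "same ({0..7} \<union> {16..}) M ?M" using sm1 sm Zs by (auto simp: same_def)
   have dv: "vals (A - {p}) vl es = del_at i us" using del_vals(1)[OF pn pA, of vl, folded es] I0(3) tl by (simp only: del_at_def)
   have usi: "us ! i = vl p"
   proof -
    have "us = vals A vl E1 @ vl p # vals A vl E2" using I0(3) es pA by simp
    moreover have "length (vals A vl E1) = i" using tl by simp
    ultimately show ?thesis by (metis nth_append_length)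
   qed
   have vlF: "?M (adr 4 x) = vl x \<and> legal (vl x)" if "x \<in> A - {p}" for x
   proof -
    have "x \<in> A" "x <= 2 * U" using that W by auto
    then show ?thesis using vl[of x] sameD[OF sm, of x 4] a1[of 4 x] nd_Z(4)[of x] Zs by auto
   qed
   have "clean ?M" by (rule clean_same[OF smF _ _ I0(7)]) auto
   moreover have "inst ?M 15 []" by (rule inst_same[OF smF _ I0(8)]) auto
   moreover have lZ: "length us - 1 < Z" using i bounds by simp
   moreover have "bM ?M" using g lZ by simp
   ultimately have ta: "tree_at ?M Ps es (A - {p}) vl (del_at i us)" unfolding tree_at_def
    using wf vlF dv m3 I0(5,6) i Zs by simp
   have tm: "t1 + t3 + 60 <= delete_cost"
   proof -
    define x where "x = gam * T"
    have "(L - 2 - 0) * (x + 80 + 8) <= L * (x + 88)" by (intro mult_mono) auto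
    moreover have "L * (x + 88) = L * x + 88 * L" by (simp add: algebra_simps)
    moreover have "delete_cost = L * x + 3000 * L" by (simp add: delete_cost_def x_def algebra_simps)
    ultimately show ?thesis using f(1) g(1) Lb unfolding x_def[symmetric] by linarith
   qed
   have kpF: "keep ({10, 11, 12, 13} \<union> {41..48} \<union> {61}) R R3" using kp f(5) by (auto simp: keep_def)
   have r61: "R3 61 = us ! i" using kp usi by (auto simp: keep_def)
   have ex: "\<exists>A'. tree_at ?M Ps es A' vl (del_at i us)" using ta by blast
   have m02: "?M (adr 0 2) = M (adr 0 2)" using m3 Zs by simp
   show ?case using g(2,3) st kpF smF m02 m3 Zs ex r61 tm lZ i by (simp add: add.commute add.left_commute)
  qed
 qed
qed

end

context progs
begin

section \<open>Queries about a prefix of the timeline\<close>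

definition query_step :: com where
 "query_step = Seq (Assign 14 (Bin Add (Lit 16) (Ld (Lit 7) (Reg 62)))) (Seq (Assign 21 (Ld (Lit 2) (Ld (Lit 7) (Reg 62)))) process)"

text \<open>Element \<open>p\<close> itself is appended to the log as a block of level 0, so that
  the log covers exactly the first \<open>i\<close> updates; the sentinel contributes no update. The
  final state is built in the spare copy, queried there, and removed again.\<close>

definition tree_query :: com where
 "tree_query = Seq (Assign 41 (Reg 1)) (Seq walk (Seq (St (Lit 7) (Reg 44) (node (Reg 42) (Lit 0)))
  (Seq (Assign 44 (Bin Add (Reg 44) (Lit 1))) (Seq (Assign 16 (Lit 0)) (Seq (Assign 62 (Lit 0)) (Seq (For 62 44 query_step)
  (Seq (Assign 10 (Lit 15)) (Seq insUS (Seq (Assign 11 (Reg 16)) (Seq (Assign 12 (Reg 2)) (Seq pQry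
  (Seq (Assign 38 (Reg 13)) (Seq (Assign 10 (Lit 15)) (Seq (delUS 16) (Assign 0 (Reg 38))))))))))))))))"

end

context tree
begin

text \<open>Processing a block restores the timeline of its copy, but not necessarily the same
  memory contents. \<open>level\<close> speaks about timelines only, so it survives.\<close>

lemma level_same_inst:
 assumes lev: "level M l' bs' es A vl" "level M l bs es A vl" "distinct es" "set es \<subseteq> {..2 * U}" and l: "l < U" "l' < U" "l = l' --> bs = bs'"
  and c: "c \<in> set bs" and same: "same ({16 + nd (hd c) l} \<union> H) M M'" "H \<subseteq> {8..12}" and inst: "inst M' (16 + nd (hd c) l) (vals A vl c)"
 shows "level M' l' bs' es A vl"
proof (cases "l = l'")
 case False
 have "lev_same l' M M'" by (rule lev_same_same[OF same(1) l(2)]) (use same(2) nd_inj[OF l(1,2)] nd_inj[OF l(2,1)] False in auto)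
 then show ?thesis by (rule level_frame) (use lev in auto)
next
 case True
 then obtain Xs Ys where bs: "bs' = Xs @ c # Ys" using c l(3) by (meson split_list)
 have c': "block_at M l A vl c" "hd c ~= 0 --> 2 ^ (l - 1) <= weight c" "c ~= []" using lev(2) c by (auto simp: level_def)
 have a: "M' (adr k (nd x l)) = M (adr k (nd x l))" if "x <= 2 * U" "k \<in> {1, 2, 3}" for x k
  by (rule sameD[OF same(1)]) (use nd_B[OF that(1) l(1)] that(2) same(2) in auto)
 have hc: "hd c <= 2 * U" using level_heads[OF lev(2) c] lev(4) by auto
 have "level M' l (Xs @ c # Ys) es A vl"
 proof (rule level_replace[OF _ lev(3,4) l(1)])
  show "level M l (Xs @ c # Ys) es A vl" using lev(1) True bs by simp
  show "block_at M' l A vl c" using c'(1) a[OF hc] inst by (simp add: block_at_def)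
  show "es = concat Xs @ c @ concat Ys" using lev(1) bs by (simp add: level_def)
  show "inst M' (16 + nd x l) us" if "x ~= hd c" "inst M (16 + nd x l) us" for x us
   by (rule inst_same[OF same(1) _ that(2)]) (use that(1) nd_inj[OF l(1,1)] same(2) in auto)
 qed (use c' a in auto)
 then show ?thesis using True bs by simp
qed

definition query_cost :: nat where "query_cost = 40 * process_cost + 2 * (gam * K) + 60 * K + gam + 8000"

text \<open>A quarter of \<open>U\<close> for the block, a quarter for the prepended updates, and
  \<open>U \<le> 2 * m\<close>.\<close>

lemma capacity: "l <= tp ==> 2 ^ (l + 1) + K * n <= m"
proof -
 assume l: "l <= tp"
 then have "(2::nat) ^ (l + 1) <= 2 ^ (L - 2)" using Lb unfolding tp_def by (intro power_increasing) auto
 moreover have "U = 4 * 2 ^ (L - 2)"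
 proof -
  obtain j where "L = j + 2" using Lb by (intro that[of "L - 2"]) simp
  then show ?thesis unfolding U_def by (simp add: power_add)
 qed
 ultimately show ?thesis using mU KU by linarith
qed

lemma tree_query:
 assumes b: "bR R" "std R" and r: "R 1 = i" "R 2 = q" and inv: "tree_at M Ps es A vl us"
  and i: "i <= length us" "length us <= m" "q \<in> legal_queries D n m"
 shows "wp w tree_query (\<lambda>t R' M'. t <= query_cost * (L * (n * T)) \<and> tree_at M' Ps es A vl us \<and>
  R' 0 = answer D n q (result_state D n (take i us))) R M"
proof -
 have I0: "bM M" "wf_tree M Ps es A vl" "vals A vl es = us" "M (adr 0 0) = length us" "set es = {0..M (adr 0 2)}" "M (adr 0 2) <= 2 * U" "clean M" "inst M 15 []"
  and vl: "\<And>f. f \<in> A ==> M (adr 4 f) = vl f \<and> legal (vl f)" using inv by (auto simp: tree_at_def)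
 have W: "distinct es" "set es \<subseteq> {..2 * U}" "es ~= []" "hd es = 0" "0 \<notin> A" "A \<subseteq> set es" "Ps 0 = map (\<lambda>e. [e]) es"
  and lev: "\<And>l. l <= tp ==> level M l (Ps l) es A vl \<and> bounded l (Ps l)"
  and hds: "\<And>l. l < tp ==> hd ` set (Ps (l + 1)) \<subseteq> hd ` set (Ps l)" using I0(2) by (auto simp: wf_tree_def)
 have lus: "live A es = length us" using I0(3) by (metis length_vals)
 obtain E1 p where tg: "target es A i E1 p" using ex_target[of i A es] i(1) lus W by auto
 then obtain E2 where es: "es = E1 @ p # E2" by (auto simp: target_def)
 have tl: "live A (E1 @ [p]) = i" by (rule target_live[OF tg W(4,5)])
 have pU: "p <= 2 * U" using W(2) es by auto
 have U0: "0 < U" using U_ge by linarith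
 have qZ: "q < Z" using i(3) operand_lt_Z by (auto simp: legal_queries_def)
 have Zs: "i < Z" "15 < B" "8 < B" "nd p 0 < B" "nd p 0 < Z" using i bounds B_big nd_B[OF pU U0] nd_Z(1)[OF pU U0] by auto
 let ?R = "R(41 := i)"
 have b1: "bR ?R" "std ?R" using b Zs by auto
 have wk: "wp w walk (\<lambda>\<tau> R' M'. \<tau> <= 2100 * L \<and> bR R' \<and> bM M' \<and> std R' \<and> keep {42, 43, 44, 45, 46, 47, 48} ?R R' \<and>
  same {5, 6, 7} M M' \<and> R' 42 = p \<and> R' 46 = L - 2 \<and> (\<forall>l\<le>tp. path_at M' (Ps l) A p l) \<and>
  (\<exists>lg. R' 44 = length lg \<and> length lg <= 33 * L \<and> concat (map snd lg) = E1 \<and> logged M' Ps lg)) ?R M"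
  by (rule walk[OF b1(1) I0(1) b1(2) _ I0(2) tg]) simp
 show ?thesis unfolding tree_query_def
 proof (simp add: b r Zs I0(1), rule wp_mono[OF wk], elim conjE exE, goal_cases)
  case f: (1 t1 R1 M1 lg)
  have sm1: "same {5, 6, 7} M M1" by fact
  define lg' where "lg' = lg @ [(0, [p])]"
  have kL: "length lg + 1 <= 33 * L + 1" "33 * L + 1 < B" using f(11) L_U U_ge B_big by auto
  have kB: "k < B" "k < Z" if "k <= length lg + 1" for k using that kL B_lt_Z by linarith+
  let ?M = "M1(adr 7 (length lg) := nd p 0)" and ?R1 = "R1(44 := length lg + 1, 16 := 0, 62 := 0)"
  have bM': "bM ?M" "bR ?R1" "std ?R1" using f Zs kB by auto
  have smM: "same {5, 6, 7} M ?M" using sm1 kB by (auto simp: same_def)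
  have levM: "level ?M l (Ps l) es A vl" if "l <= tp" for l
   by (rule level_frame[OF lev_same_low[OF smM tp_U[OF that]] lev[OF that, THEN conjunct1] W(2)]) auto
  have lgs: "fst (lg' ! k) <= tp \<and> snd (lg' ! k) \<in> set (Ps (fst (lg' ! k))) \<and>
   ?M (adr 7 k) = nd (hd (snd (lg' ! k))) (fst (lg' ! k))" if k: "k < length lg + 1" for k
  proof (cases "k < length lg")
   case True
   then show ?thesis using f(13) kB[of k] kB[of "length lg"] by (auto simp: lg'_def nth_append logged_def)
  next
   case False
   then have "k = length lg" using k by simp
   then show ?thesis using W(7) es by (simp add: lg'_def)
  qed
  have cc: "concat (map snd lg') = E1 @ [p]" using f(12) by (simp add: lg'_def)
  have legalv: "set (vals A vl c) \<subseteq> legal_updates D n m" for c using vl by (auto simp: vals_def)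
  \<comment> \<open>After \<open>k\<close> blocks, region 8 holds a short list of updates that leads
    to the state after all of them. The levels are claimed anew rather than framed, because the
    memory of the copies has changed.\<close>
  define I where "I k R' M' \<longleftrightarrow> keep ({10..22} \<union> {62}) ?R1 R' \<and> same ({8, 9, 10, 11, 12} \<union> {16..}) ?M M' \<and> clean M' \<and>
   (\<forall>l\<le>tp. level M' l (Ps l) es A vl) \<and>
   (\<exists>ul. set ul \<subseteq> legal_updates D n m \<and> length ul <= K * n \<and> R' 16 = length ul \<and> (\<forall>k<length ul. M' (adr 8 k) = ul ! k) \<and>
    result_state D n ul = result_state D n (vals A vl (concat (map snd (take k lg')))))" for k R' M'
  have lp: "wp w (For 62 44 query_step) (\<lambda>t R' M'. t <= 4 + (length lg + 1 - 0) * (process_cost * (n * T) + 60 + 8) \<and>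
   bR R' \<and> bM M' \<and> I (length lg + 1) R' M') ?R1 ?M"
  proof (rule wp_For[where I = I and a = 0 and z = "length lg + 1"])
   have "clean ?M" by (rule clean_same[OF smM _ _ I0(7)]) auto
   then show "I 0 ?R1 ?M" unfolding I_def by (intro conjI exI[of _ "[]"]) (use levM in \<open>simp_all add: keep_def\<close>)
  next
   fix k R' M' assume k: "k < length lg + 1" and I: "I k R' M'" and R': "R' 62 = k" "R' 44 = length lg + 1" "bR R'" "bM M'"
   obtain l c where lc: "lg' ! k = (l, c)" by (cases "lg' ! k")
   have l: "l <= tp" "c \<in> set (Ps l)" "?M (adr 7 k) = nd (hd c) l" using lgs[OF k] lc by auto
   obtain ul where ul: "set ul \<subseteq> legal_updates D n m" "length ul <= K * n" "R' 16 = length ul" "\<forall>k<length ul. M' (adr 8 k) = ul ! k"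
    "result_state D n ul = result_state D n (vals A vl (concat (map snd (take k lg'))))" using I unfolding I_def by blast
   have kp: "keep ({10..22} \<union> {62}) ?R1 R'" and sm: "same ({8, 9, 10, 11, 12} \<union> {16..}) ?M M'" and cl: "clean M'"
    and ins: "\<And>l. l <= tp ==> level M' l (Ps l) es A vl" using I by (auto simp: I_def)
   have st: "std R'" by (rule std_keep[OF kp]) (use bM' in auto)
   have hc: "hd c <= 2 * U" using level_heads[OF levM[OF l(1)] l(2)] W(2) by auto
   define v where "v = nd (hd c) l"
   have vB: "v < B" "16 + v < B" "v < Z" "16 + v < Z" using nd_B nd_Z hc tp_U[OF l(1)] unfolding v_def by auto
   have bc: "?M (adr 2 v) = live A c" "inst M' (16 + v) (vals A vl c)" using levM[OF l(1)] ins[OF l(1)] l(2) by (auto simp: level_def block_at_def v_def)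
   have m7: "M' (adr 7 k) = v" "M' (adr 2 v) = live A c" using sameD[OF sm] kB[of k] k l(3) bc(1) vB by (auto simp: v_def)
   have wc: "weight c < 2 ^ (l + 1)" using lev[OF l(1)] l(2) by (auto simp: bounded_def)
   have cap: "live A c + K * n <= m" "live A c < Z" using live_le_weight[OF W(5), of c] wc capacity[OF l(1)] bounds by linarith+
   let ?R2 = "R'(14 := 16 + v, 21 := live A c)"
   have b2: "bR ?R2" "std ?R2" using R' st vB cap by auto
   have pr: "wp w process (\<lambda>t R'' M''. t <= process_cost * (n * T) \<and>
    bR R'' \<and> bM M'' \<and> std R'' \<and> keep {10, 11, 12, 13, 15, 16, 17, 18, 19, 20, 22} ?R2 R'' \<and> same {16 + v, 8, 9, 10, 11, 12} M' M'' \<and>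
    inst M'' (16 + v) (vals A vl c) \<and> clean M'' \<and> (\<exists>us'. set us' \<subseteq> legal_updates D n m \<and> result_state D n us' = result_state D n (ul @ vals A vl c) \<and>
     length us' <= K * n \<and> R'' 16 = length us' \<and> (\<forall>k<length us'. M'' (adr 8 k) = us' ! k))) ?R2 M'"
    by (rule process[OF legalv ul(1,2) b2(1) R'(4) b2(2)]) (use vB bc(2) cl ul cap in auto)
   show "wp w query_step (\<lambda>t R'' M''. t <= process_cost * (n * T) + 60 \<and> R'' 62 = k \<and> R'' 44 = length lg + 1 \<and> bR R'' \<and> bM M'' \<and>
    I (Suc k) (R''(62 := Suc k)) M'') R' M'" unfolding query_step_def
   proof (simp add: R' st m7 vB cap, rule wp_mono[OF pr], elim conjE exE, goal_cases)
    case g: (1 t R'' M'' us')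
    have r'': "R'' 62 = k" "R'' 44 = length lg + 1" using g(5) R' by (auto simp: keep_def)
    have kp': "keep ({10..22} \<union> {62}) ?R1 (R''(62 := Suc k))" using kp g(5) by (auto simp: keep_def)
    have sm': "same ({8, 9, 10, 11, 12} \<union> {16..}) ?M M''" using sm g(6) by (auto simp: same_def)
    have sg: "same ({16 + nd (hd c) l} \<union> {8, 9, 10, 11, 12}) M' M''" using g(6) by (auto simp: same_def v_def)
    have ins': "level M'' l' (Ps l') es A vl" if "l' <= tp" for l'
     by (rule level_same_inst[OF ins[OF that] ins[OF l(1)] W(1,2) tp_U[OF l(1)] tp_U[OF that] _ l(2) sg _ g(7)[unfolded v_def]]) auto
    have "k < length lg'" using k by (simp add: lg'_def)
    then have tk: "take (Suc k) lg' = take k lg' @ [(l, c)]" using lc by (simp add: take_Suc_conv_app_nth)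
    have rs: "result_state D n us' = result_state D n (vals A vl (concat (map snd (take (Suc k) lg'))))"
     using g(10) ul(5) by (simp add: tk result_state_append)
    have "I (Suc k) (R''(62 := Suc k)) M''" unfolding I_def
     by (intro conjI exI[of _ us']) (use kp' sm' g(8-13) ins' rs in simp_all)
    then show ?case using g(1-3) r'' by simp
   qed
  qed (use bM' kB in auto)
  show ?case
  proof (simp add: f(2-4,7,10) kB Zs, rule wp_mono[OF lp], elim conjE, goal_cases)
   case g: (1 t2 R2 M2)
   obtain ul where ul: "set ul \<subseteq> legal_updates D n m" "length ul <= K * n" "R2 16 = length ul" "\<forall>k<length ul. M2 (adr 8 k) = ul ! k"
    "result_state D n ul = result_state D n (vals A vl (concat (map snd (take (length lg + 1) lg'))))" using g(4) unfolding I_def by blast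
   have kp: "keep ({10..22} \<union> {62}) ?R1 R2" and sm: "same ({8, 9, 10, 11, 12} \<union> {16..}) ?M M2" and cl: "clean M2"
    and ins: "\<And>l. l <= tp ==> level M2 l (Ps l) es A vl" using g(4) by (auto simp: I_def)
   have st: "std R2" by (rule std_keep[OF kp]) (use bM' in auto)
   have tk: "take (length lg + 1) lg' = lg'" by (simp add: lg'_def)
   have vt: "vals A vl (E1 @ [p]) = take i us"
   proof -
    have "us = vals A vl (E1 @ [p]) @ vals A vl E2" using I0(3) es by simp
    moreover have "length (vals A vl (E1 @ [p])) = i" using tl by (simp only: length_vals)
    ultimately show ?thesis by (metis append_eq_conv_conj)
   qed
   have rs: "result_state D n ul = result_state D n (take i us)" using ul(5) unfolding tk cc vt .
   have i15: "inst M2 15 []" using inst_same[OF sm, of 15] inst_same[OF smM, of 15] I0(8) by auto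
   have Km: "K * n <= m" "length ul <= m" "length ul < Z" using capacity[of 0] ul(2) bounds by auto
   let ?R2 = "R2(10 := 15)"
   have b2: "bR ?R2" "std ?R2" using g st by auto
   have iu: "wp w insUS (\<lambda>t R' M'. t <= 10 + length ul * (gam * T + 30) \<and> bR R' \<and> bM M' \<and>
    keep {11, 12, 13, 20} ?R2 R' \<and> std R' \<and> inst M' 15 (ul @ []) \<and> same {15} M2 M') ?R2 M2"
    by (rule insUS[OF b2(1) g(3) b2(2)]) (use Zs i15 ul Km in auto)
   have r2: "R2 2 = q" using kp f(5) r by (auto simp: keep_def)
   show ?case
   proof (simp add: g(2,3), rule wp_mono[OF iu], elim conjE, goal_cases)
    case h: (1 t3 R3 M3)
    have r3: "R3 2 = q" "R3 16 = length ul" "R3 10 = 15" using h(4) r2 ul by (auto simp: keep_def)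
    let ?R3 = "R3(11 := length ul, 12 := q)"
    have b3: "bR ?R3" "std ?R3" using h Km qZ by auto
    have pq: "wp w pQry (\<lambda>t R' M'. t <= gam * T \<and> bR R' \<and> bM M' \<and> keep {12, 13} ?R3 R' \<and> std R' \<and>
     inst M' 15 ul \<and> same {15} M3 M' \<and> R' 13 = answer D n q (result_state D n ul)) ?R3 M3"
     by (rule pQry[OF b3(1) h(3) b3(2)]) (use h r3 Zs Km i in auto)
    show ?case
    proof (simp add: h(2,3) r3 Km qZ, rule wp_mono[OF pq], elim conjE, goal_cases)
     case j: (1 t4 R4 M4)
     have r4: "R4 16 = length ul" using j(4) r3 by (auto simp: keep_def)
     have aZ: "answer D n q (result_state D n ul) < Z" using j(2,8) bR_reg by metis
     let ?R4 = "R4(38 := answer D n q (result_state D n ul), 10 := 15)"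
     have b4: "bR ?R4" "std ?R4" using j aZ by auto
     have du: "wp w (delUS 16) (\<lambda>t R' M'. t <= 10 + length ul * (gam * T + 30) \<and> bR R' \<and> bM M' \<and>
      keep {11, 12, 13, 20} ?R4 R' \<and> std R' \<and> inst M' 15 [] \<and> same {15} M4 M') ?R4 M4"
      by (rule delUS[OF b4(1) j(3) b4(2)]) (use j r4 Zs Km in auto)
     show ?case
     proof (simp add: j(2,3,8) aZ, rule wp_mono[OF du], elim conjE, goal_cases)
      case k: (1 t5 R5 M5)
      have smF: "same ({8, 9, 10, 11, 12, 15} \<union> {16..}) ?M M5" using sm h(7) j(7) k(7) by (auto simp: same_def)
      have smG: "same ({5, 6, 7, 8, 9, 10, 11, 12, 15} \<union> {16..}) M M5" using smM smF by (auto simp: same_def)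
      have s15: "same {15} M2 M5" using h(7) j(7) k(7) by (auto simp: same_def)
      have "level M5 l (Ps l) es A vl" if "l <= tp" for l
       by (rule level_frame[OF lev_same_low[OF s15 tp_U[OF that]] ins[OF that] W(2)]) auto
      then have wf: "wf_tree M5 Ps es A vl" using I0(2) unfolding wf_tree_def by simp
      have vlF: "M5 (adr 4 x) = vl x \<and> legal (vl x)" if "x \<in> A" for x
      proof -
       have "x <= 2 * U" using that W by auto
       then show ?thesis using vl[OF that] sameD[OF smG, of x 4] nd_Z(4)[of x] by auto
      qed
      have m0: "M5 (adr 0 0) = M (adr 0 0)" "M5 (adr 0 2) = M (adr 0 2)" using sameD[OF smG] B_big by auto
      have cl5: "clean M5" by (rule clean_same[OF s15 _ _ cl]) auto
      have ta: "tree_at M5 Ps es A vl us" unfolding tree_at_def using k(3,6) wf vlF I0(3-6) m0 cl5 by simp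
      have r38: "R5 38 = answer D n q (result_state D n (take i us))" using k(4) rs by (simp add: keep_def)
      have tm: "t1 + t2 + t3 + t4 + t5 + 100 <= query_cost * (L * (n * T))"
      proof -
       define z where "z = L * (n * T)"
       have nT: "T <= n * T" "1 <= n * T" "n <= n * T" using n T mult_le_mono[OF n T] by auto
       have Lz: "n * T <= z" "L <= z" "5 <= z" unfolding z_def using mult_le_mono[of 1 L "n * T" "n * T"] mult_le_mono[of L L 1 "n * T"] mult_le_mono[of 5 L 1 "n * T"] Lb nT by simp_all
       \<comment> \<open>At most \<open>33 * L\<close> logged blocks and the final one make at most
         \<open>34 * L\<close>.\<close>
       have "(length lg + 1 - 0) * (process_cost * (n * T) + 60 + 8) <= (34 * L) * (process_cost * (n * T) + 68)"
        using f(11) Lb by (intro mult_mono) auto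
       also have "\<dots> = 34 * (process_cost * z) + 2312 * L" by (simp add: z_def algebra_simps)
       finally have a: "t2 <= 4 + 34 * (process_cost * z) + 2312 * L" using g(1) by linarith
       have "length ul * (gam * T + 30) <= K * n * (gam * T + 30)" by (rule mult_right_mono[OF ul(2)]) simp
       also have "\<dots> = gam * K * (n * T) + 30 * (K * n)" by (simp add: algebra_simps)
       also have "\<dots> <= gam * K * z + 30 * (K * z)" using order_trans[OF nT(3) Lz(1)] Lz(1) by (intro add_mono mult_left_mono) simp_all
       finally have c: "length ul * (gam * T + 30) <= gam * K * z + 30 * (K * z)" .
       have d: "gam * T <= gam * z" using order_trans[OF nT(1) Lz(1)] by (rule mult_left_mono) simp
       have "query_cost * z = 40 * (process_cost * z) + 2 * (gam * K * z) + 60 * (K * z) + gam * z + 8000 * z"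
        by (simp add: query_cost_def algebra_simps)
       moreover have "t3 <= 10 + (gam * K * z + 30 * (K * z))" "t5 <= 10 + (gam * K * z + 30 * (K * z))" "t4 <= gam * z" "t1 <= 2100 * L"
        using h(1) k(1) j(1) c d f(1) by linarith+
       ultimately show ?thesis using a Lz unfolding z_def[symmetric] by linarith
      qed
      show ?case using k(2,3) ta r38 tm by simp
     qed
    qed
   qed
  qed
 qed
qed

end

section \<open>Rebuilding the list after many deletions\<close>

context progs
begin

text \<open>Deleting all updates one by one returns every copy to the empty timeline, which makes
  the regions reusable although their contents are opaque. What remains to be reset are the weights
  at the nodes of the sentinel, numbered \<open>l\<close> on level \<open>l\<close>, and the
  counter.\<close>

definition rebuild :: com where
 "rebuild = Seq (Assign 65 (Reg 2)) (Seq (Assign 66 (Reg 1)) (Seq (Assign 63 (Ld (Lit 0) (Lit 0))) (Seq (Assign 64 (Lit 0))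
  (Seq (For 64 63 (Seq (Assign 1 (Lit 0)) (Seq plain_delete (St (Lit 13) (Reg 64) (Reg 61)))))
  (Seq (Assign 62 (Bin Sub (Reg 4) (Lit 2))) (Seq (Assign 64 (Lit 0)) (Seq (For 64 62 (St (Lit 3) (Reg 64) (Lit 0)))
  (Seq (St (Lit 0) (Lit 2) (Lit 0)) (Seq (Assign 64 (Lit 0))
  (Seq (For 64 63 (Seq (Assign 1 (Reg 64)) (Seq (Assign 2 (Ld (Lit 13) (Reg 64))) plain_insert)))
  (Seq (Assign 1 (Reg 66)) (Assign 2 (Reg 65)))))))))))))"

text \<open>\<open>2 * U\<close> is the limit for element numbers. A rebuild brings the counter down
  to the current length, which is below \<open>U\<close>.\<close>

definition tree_insert :: com where
 "tree_insert = Seq (If (Bin Less (Ld (Lit 0) (Lit 2)) (Bin Add (Reg 5) (Reg 5))) Skip rebuild) plain_insert"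

end

context tree
begin

lemma level_init:
 assumes "M (adr 3 l) = 0" "M (adr 2 l) = 0" "\<And>e. e <= 2 * U ==> inst M (16 + nd e l) []"
 shows "level M l [[0]] [0] {} vl"
 using assms assms(3)[of 0] by (simp add: level_def block_at_def nd_def)

lemma tree_init:
 assumes "bM M" "\<And>l. l <= tp ==> level M l [[0]] [0] {} vl" "M (adr 0 0) = 0" "M (adr 0 2) = 0" "clean M" "inst M 15 []"
 shows "tree_at M (\<lambda>l. [[0]]) [0] {} vl []" "levels_pot (\<lambda>l. [[0]]) z = 0"
 using assms by (auto simp: tree_at_def wf_tree_def bounded_def levels_pot_def block_pot_def)

text \<open>Makes the number of dead elements a genuine difference, without truncation.\<close>

lemma tree_count: "tree_at M Ps es A vl us ==> length us <= M (adr 0 2)"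
proof -
 assume a: "tree_at M Ps es A vl us"
 then have "length us = live A es" by (metis length_vals tree_at_def)
 also have "\<dots> <= weight es" by (rule live_le_weight) (use a in \<open>auto simp: tree_at_def wf_tree_def\<close>)
 also have "\<dots> = card (set (filter (\<lambda>e. e ~= 0) es))" unfolding weight_def
  by (rule distinct_card[symmetric]) (use a in \<open>auto simp: tree_at_def wf_tree_def\<close>)
 also have "\<dots> <= card {1..M (adr 0 2)}" using a by (intro card_mono) (auto simp: tree_at_def)
 finally show ?thesis by simp
qed

lemma tree_upd13:
 assumes "tree_at M Ps es A vl us" "x < B" "v < Z"
 shows "tree_at (M(adr 13 x := v)) Ps es A vl us"
proof -
 have "wf_tree (M(adr 13 x := v)) Ps es A vl"
  by (rule wf_tree_frame[of M]) (use assms lev_same_upd_other[OF lev_same_refl tp_U] in \<open>auto simp: tree_at_def\<close>)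
 moreover have "e < B" if "e \<in> A" for e
  using assms(1) that nd_Z(4)[of e] by (auto simp: tree_at_def wf_tree_def)
 ultimately show ?thesis using assms B_big unfolding tree_at_def by auto
qed

lemma rebuild:
 assumes b: "bR R" "std R" and r: "R 1 = i" "R 2 = u" and inv: "tree_at M Ps es A vl us" and len: "length us <= m"
 shows "wp w rebuild (\<lambda>t R' M'. bR R' \<and> bM M' \<and> std R' \<and> R' 1 = i \<and> R' 2 = u \<and> M' (adr 0 2) = length us \<and>
  (\<exists>Ps' es' A' vl'. tree_at M' Ps' es' A' vl' us \<and>
   t + split_cost * levels_pot Ps' (L - 2) <= length us * (delete_cost + insert_cost + 120) + 30 * L + 200)) R M"
proof -
 define N where "N = length us"
 have I0: "bM M" "M (adr 0 0) = N" "set us \<subseteq> legal_updates D n m"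
  using inv by (auto simp: tree_at_def N_def vals_def)
 have Zs: "N < Z" "N <= m" "0 < B" "2 < B" "i < Z" "u < Z" "L - 2 < Z" "2 <= L" "L - 2 <= L" "0 < U"
  using len bounds b r B_big bR_reg[of R 1] bR_reg[of R 2] Lb U_ge by (auto simp: N_def simp del: bR_reg)
 have L3: "tp + 1 = L - 2" unfolding tp_def using Lb by auto
 have kB: "k < B" "k < Z" "k + 1 < Z" if "k < N" for k using that Zs bounds by linarith+
 have ul: "us ! k < Z" "legal (us ! k)" if "k < N" for k
  using that I0(3) legal_lt(2) nth_mem[of k us] unfolding N_def by blast+
 let ?ks = "{1, 2} \<union> {10, 11, 12, 13} \<union> {41..62} \<union> {64} :: nat set"
 let ?R = "R(65 := u, 66 := i, 63 := N, 64 := 0)"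
 define I where "I k R' M' \<longleftrightarrow> keep ?ks ?R R' \<and> (\<exists>A'. tree_at M' Ps es A' vl (drop k us)) \<and>
  (\<forall>j<k. M' (adr 13 j) = us ! j)" for k R' M'
 have lp1: "wp w (For 64 63 (Seq (Assign 1 (Lit 0)) (Seq plain_delete (St (Lit 13) (Reg 64) (Reg 61)))))
  (\<lambda>t R' M'. t <= 4 + (N - 0) * (delete_cost + 20 + 8) \<and> bR R' \<and> bM M' \<and> I N R' M') ?R M"
 proof (rule wp_For[where I = I and a = 0 and z = N])
  show "I 0 ?R M" using inv by (auto simp: I_def keep_def)
 next
  fix k R' M' assume k: "k < N" and I: "I k R' M'" and R': "R' 64 = k" "R' 63 = N" "bR R'" "bM M'"
  obtain A' where ta: "tree_at M' Ps es A' vl (drop k us)" and kp: "keep ?ks ?R R'" and m13: "\<forall>j<k. M' (adr 13 j) = us ! j"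
   using I by (auto simp: I_def)
  have st: "std R'" by (rule std_keep[OF kp]) (use b in simp_all)
  let ?R' = "R'(1 := 0)"
  have b1: "bR ?R'" "std ?R'" using R' by (simp, intro std_cong[OF st]) simp_all
  have d0: "0 < length (drop k us)" "length (drop k us) <= m" using k Zs by (auto simp: N_def)
  show "wp w (Seq (Assign 1 (Lit 0)) (Seq plain_delete (St (Lit 13) (Reg 64) (Reg 61))))
   (\<lambda>t R'' M''. t <= delete_cost + 20 \<and> R'' 64 = k \<and> R'' 63 = N \<and> bR R'' \<and> bM M'' \<and> I (Suc k) (R''(64 := Suc k)) M'') R' M'"
  proof (simp add: R', rule wp_mono[OF plain_delete[OF b1 _ ta d0]], simp, elim conjE exE, goal_cases)
   case (1 t R'' M'' A'')
   note f = this
   have r: "R'' 64 = k" "R'' 63 = N" using f(5) R' by (auto simp: keep_def)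
   have r61: "R'' 61 = us ! k" using f(6) k by (simp add: N_def)
   have kp': "keep ?ks ?R (R''(64 := Suc k))" using kp f(5) by (auto simp: keep_def)
   have "del_at 0 (drop k us) = drop (Suc k) us" by (simp add: del_at_def drop_Suc tl_drop)
   then have ta': "tree_at (M''(adr 13 k := us ! k)) Ps es A'' vl (drop (Suc k) us)"
    using tree_upd13[OF f(9) kB(1)[OF k] ul(1)[OF k]] by simp
   have "M'' (adr 13 j) = us ! j" if "j < k" for j using m13 that sameD[OF f(7), of j 13] kB[of j] k by auto
   then have "I (Suc k) (R''(64 := Suc k)) (M''(adr 13 k := us ! k))" unfolding I_def
    using kp' ta' kB k by (auto simp: less_Suc_eq)
   then show ?case using f(1-4) r r61 kB[OF k] ul[OF k] by simp
  qed
 qed (use b Zs I0(1) in auto)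
 show ?thesis unfolding rebuild_def
 proof (simp add: b r I0 Zs, rule wp_mono[OF lp1], elim conjE, goal_cases)
  case f: (1 t1 R1 M1)
  obtain A1 where ta1: "tree_at M1 Ps es A1 vl []" and kp1: "keep ?ks ?R R1" and m13: "\<forall>j<N. M1 (adr 13 j) = us ! j"
   using f(4) by (auto simp: I_def N_def)
  have st1: "std R1" by (rule std_keep[OF kp1]) (use b in simp_all)
  have W1: "wf_tree M1 Ps es A1 vl" "vals A1 vl es = []" "M1 (adr 0 0) = 0" "clean M1" "inst M1 15 []" using ta1 by (auto simp: tree_at_def)
  have A1: "A1 = {}"
  proof -
   have "A1 \<subseteq> set es" using W1(1) by (simp add: wf_tree_def)
   moreover have "filter (\<lambda>e. e \<in> A1) es = []" using W1(2) by (simp add: vals_def)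
   ultimately show ?thesis by (auto simp: filter_empty_conv)
  qed
  have e0: "live {} c = 0" "vals {} vl c = []" for c by (auto simp: live_def vals_def)
  \<comment> \<open>With no live element left, every node has an empty copy, whether or not it heads
    a block.\<close>
  have lev1: "inst M1 (16 + nd e l) []" "M1 (adr 2 l) = 0" if "l <= tp" "e <= 2 * U" for l e
  proof -
   have lv: "level M1 l (Ps l) es {} vl" and es: "es ~= []" "hd es = 0" using W1(1) that(1) A1 by (auto simp: wf_tree_def)
   show "inst M1 (16 + nd e l) []"
   proof (cases "e \<in> hd ` set (Ps l)")
    case True
    then obtain c where "c \<in> set (Ps l)" "e = hd c" by auto
    then show ?thesis using lv e0 by (auto simp: level_def block_at_def)
   qed (use lv that(2) in \<open>auto simp: level_def\<close>)
   obtain c Cs where P: "Ps l = c # Cs" using lv es by (cases "Ps l") (auto simp: level_def)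
   have "c ~= []" "es = c @ concat Cs" using lv P by (auto simp: level_def)
   then have "hd c = 0" using es(2) by simp
   then show "M1 (adr 2 l) = 0" using lv P e0 by (simp add: level_def block_at_def nd_def)
  qed
  let ?R1 = "R1(62 := L - 2, 64 := 0)"
  have b1: "bR ?R1" "std ?R1" using f Zs st1 by auto
  define J where "J k R' M' \<longleftrightarrow> keep {64} ?R1 R' \<and> same {3} M1 M' \<and> (\<forall>l<k. M' (adr 3 l) = 0)" for k :: nat and R' M'
  have lp2: "wp w (For 64 62 (St (Lit 3) (Reg 64) (Lit 0)))
   (\<lambda>t R' M'. t <= 4 + (L - 2 - 0) * (20 + 8) \<and> bR R' \<and> bM M' \<and> J (L - 2) R' M') ?R1 M1"
  proof (rule wp_For[where I = J and a = 0 and z = "L - 2"])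
   show "J 0 ?R1 M1" by (simp add: J_def keep_def)
  next
   fix k R' M' assume k: "k < L - 2" and J: "J k R' M'" and R': "R' 64 = k" "R' 62 = L - 2" "bR R'" "bM M'"
   have st: "std R'" by (rule std_keep[of "{64}" ?R1]) (use J b1 in \<open>simp_all add: J_def\<close>)
   have k2: "k < B" "k < Z" using k L_U bounds by linarith+
   have "J (Suc k) (R'(64 := Suc k)) (M'(adr 3 k := 0))" using J k2 k L_U bounds
    unfolding J_def by (auto simp: keep_def same_def less_Suc_eq)
   then show "wp w (St (Lit 3) (Reg 64) (Lit 0)) (\<lambda>t R'' M''. t <= 20 \<and> R'' 64 = k \<and> R'' 62 = L - 2 \<and> bR R'' \<and> bM M'' \<and>
    J (Suc k) (R''(64 := Suc k)) M'') R' M'" using R' st k2 by simp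
  qed (use b1 f(3) Zs in auto)
  show ?case
  proof (simp add: f(2,3) st1 Zs, rule wp_mono[OF lp2], elim conjE, goal_cases)
   case g: (1 t2 R2 M2)
   have kp2: "keep {64} ?R1 R2" and sm2: "same {3} M1 M2" and w0: "\<forall>l<L - 2. M2 (adr 3 l) = 0" using g(4) by (auto simp: J_def)
   have st2: "std R2" by (rule std_keep[OF kp2]) (use b1 in simp_all)
   let ?M = "M2(adr 0 2 := 0)" and ?R2 = "R2(64 := 0)"
   have smM: "same {0, 3} M1 ?M" using sm2 Zs by (auto simp: same_def)
   have lv: "level ?M l [[0]] [0] {} vl" if l: "l <= tp" for l
   proof (rule level_init)
    have lB: "l < B" using tp_U[OF l] bounds by linarith
    show "?M (adr 3 l) = 0" using w0 l L3 lB Zs by simp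
    show "?M (adr 2 l) = 0" using lev1(2)[OF l, of 0] sameD[OF smM lB, of 2] by simp
    show "inst ?M (16 + nd e l) []" if "e <= 2 * U" for e by (rule inst_same[OF smM _ lev1(1)[OF l that]]) auto
   qed
   have c3: "clean ?M" by (rule clean_same[OF smM _ _ W1(4)]) auto
   have i3: "inst ?M 15 []" by (rule inst_same[OF smM _ W1(5)]) auto
   have bM3: "bM ?M" using g by simp
   have m03: "?M (adr 0 0) = 0" "?M (adr 0 2) = 0" using Zs W1(3) sameD[OF sm2, of 0 0] by auto
   have ti: "tree_at ?M (\<lambda>l. [[0]]) [0] {} vl []" "levels_pot (\<lambda>l. [[0]]) (L - 2) = 0"
    using tree_init[OF bM3 lv m03 c3 i3] by simp_all
   have m13': "?M (adr 13 j) = us ! j" if "j < N" for j using m13 that sameD[OF smM, of j 13] kB[of j] by auto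
   have b2: "bR ?R2" using g by simp
   have kpR: "keep ?ks ?R ?R2" using kp1 kp2 by (auto simp: keep_def)
   \<comment> \<open>Time and split potential are bounded together: the new list starts with
     potential 0, but the potential it acquires has to be paid for as well.\<close>
   define G where "G k \<tau> R' M' \<longleftrightarrow> keep ?ks ?R R' \<and> (\<forall>j<N. M' (adr 13 j) = us ! j) \<and> M' (adr 0 2) = k \<and>
    (\<exists>Ps es A vl. tree_at M' Ps es A vl (take k us) \<and> \<tau> + split_cost * levels_pot Ps (L - 2) <= k * (insert_cost + 40))" for k \<tau> R' M'
   define F where "F t R' M' \<longleftrightarrow> bR R' \<and> bM M' \<and> (\<exists>\<tau>. t = \<tau> + 4 \<and> G N \<tau> R' M')" for t R' M'
   have lp3: "wp w (For 64 63 (Seq (Assign 1 (Reg 64)) (Seq (Assign 2 (Ld (Lit 13) (Reg 64))) plain_insert))) (\<lambda>t. F (0 + t)) ?R2 ?M"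
   proof (rule wp_For_acc[where I = G and a = 0 and z = N, OF _ _ _ _ _ b2 bM3])
    have "tree_at ?M (\<lambda>l. [[0]]) [0] {} vl (take 0 us) \<and> 0 + split_cost * levels_pot (\<lambda>l. [[0]]) (L - 2) <= 0 * (insert_cost + 40)"
     using ti by simp
    then show "G 0 0 ?R2 ?M" unfolding G_def using kpR m13' by (intro conjI) (simp, simp, simp, blast)
   next
    fix k \<tau> R' M' assume k: "k < N" and G: "G k \<tau> R' M'" and R': "R' 64 = k" "R' 63 = N" "bR R'" "bM M'"
    obtain Ps es A vl where ta: "tree_at M' Ps es A vl (take k us)" and \<tau>: "\<tau> + split_cost * levels_pot Ps (L - 2) <= k * (insert_cost + 40)"
     and kp: "keep ?ks ?R R'" and m13: "\<And>j. j < N ==> M' (adr 13 j) = us ! j" and m02: "M' (adr 0 2) = k" using G unfolding G_def by blast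
    have st: "std R'" by (rule std_keep[OF kp]) (use b in simp_all)
    let ?R' = "R'(1 := k, 2 := us ! k)"
    have kl: "length (take k us) = k" using k by (simp add: N_def)
    have b1: "bR ?R'" "std ?R'" using R' kB[OF k] ul[OF k] by (simp, intro std_cong[OF st]) simp_all
    have pre: "k <= length (take k us)" "length (take k us) < m" "M' (adr 0 2) < 2 * U" using kl k Zs nm_U m02 by linarith+
    have st6: "R' 6 = B" using st by simp
    show "wp w (Seq (Assign 1 (Reg 64)) (Seq (Assign 2 (Ld (Lit 13) (Reg 64))) plain_insert))
     (\<lambda>t R'' M''. R'' 64 = k \<and> R'' 63 = N \<and> bR R'' \<and> bM M'' \<and> G (Suc k) (\<tau> + t + 8) (R''(64 := Suc k)) M'') R' M'"
    proof (simp add: R' kB[OF k] st6 m13[OF k], rule wp_mono[OF plain_insert[OF b1 _ _ ta pre(1,2) ul(2)[OF k] pre(3)]], simp, simp, elim conjE exE, goal_cases)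
     case (1 t R'' M'' Ps' es' A' vl')
     note h = this
     have r: "R'' 64 = k" "R'' 63 = N" using h(4) R' by (auto simp: keep_def)
     have kp': "keep ?ks ?R (R''(64 := Suc k))" using kp h(4) by (auto simp: keep_def)
     have "ins_at k (us ! k) (take k us) = take (Suc k) us" using k by (simp add: ins_at_def take_Suc_conv_app_nth N_def)
     then have ta': "tree_at M'' Ps' es' A' vl' (take (Suc k) us)" using h(7) by simp
     have m: "M'' (adr 13 j) = us ! j" if "j < N" for j using m13[OF that] sameD[OF h(5), of j 13] kB[OF that] by auto
     have "\<tau> + t + 17 + split_cost * levels_pot Ps' (L - 2) <= Suc k * (insert_cost + 40)" using \<tau> h(8) by simp
     then have "G (Suc k) (17 + (\<tau> + t)) (R''(64 := Suc k)) M''" unfolding G_def using kp' m h(6) m02 ta' by auto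
     then show ?case using h(1,2) r by simp
    qed
   next
    fix \<tau> R' M' assume "G N \<tau> R' M'" "bR R'" "bM M'"
    then show "F (\<tau> + 4) R' M'" by (auto simp: F_def)
   qed (use g kpR Zs in \<open>auto simp: keep_def\<close>)
   show ?case
   proof (simp add: g(2,3) st2 Zs, rule wp_mono[OF lp3], goal_cases)
    case (1 t3 R3 M3)
    then obtain \<tau> where \<tau>: "t3 = \<tau> + 4" and G: "G N \<tau> R3 M3" and b3: "bR R3" "bM M3" by (auto simp: F_def)
    obtain Ps' es' A' vl' where ta: "tree_at M3 Ps' es' A' vl' us" and \<tau>': "\<tau> + split_cost * levels_pot Ps' (L - 2) <= N * (insert_cost + 40)"
     using G unfolding G_def N_def by auto
    have kp: "keep ?ks ?R R3" and m02: "M3 (adr 0 2) = N" using G by (auto simp: G_def)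
    have r3: "R3 66 = i" "R3 65 = u" using kp by (auto simp: keep_def)
    have st: "std R3" by (rule std_keep[OF kp]) (use b in simp_all)
    have st': "std (R3(1 := i, 2 := u))" by (rule std_cong[OF st]) simp_all
    have tm: "t1 + t2 + t3 + 80 + split_cost * levels_pot Ps' (L - 2) <= length us * (delete_cost + insert_cost + 120) + 30 * L + 200"
    proof -
     have "N * (delete_cost + insert_cost + 120) = N * (delete_cost + 20 + 8) + N * (insert_cost + 40) + 52 * N" by (simp add: algebra_simps)
     moreover have "t2 <= 4 + (L - 2) * 28" using g(1) by simp
     moreover have "t1 <= 4 + N * (delete_cost + 20 + 8)" using f(1) by simp
     ultimately show ?thesis using \<tau> \<tau>' Zs unfolding N_def[symmetric] by linarith
    qed
    have ex: "\<exists>Ps' es' A' vl'. tree_at M3 Ps' es' A' vl' us \<and>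
     t1 + t2 + t3 + 80 + split_cost * levels_pot Ps' (L - 2) <= length us * (delete_cost + insert_cost + 120) + 30 * L + 200" using ta tm by blast
    show ?case using b3 st' r3 Zs m02 ex unfolding N_def by (auto elim!: ex_forward)
   qed
  qed
 qed
qed

text \<open>Charged per dead element. It covers taking one live element out and putting it back; the
  term with \<open>L\<close>, collected at least \<open>U\<close> times, covers the fixed cost of a
  rebuild.\<close>

definition rebuild_cost :: nat where "rebuild_cost = delete_cost + insert_cost + 120 + 70 * L"

text \<open>Counter minus length is the number of dead elements. A rebuild starts with
  \<open>2 * U\<close> elements, fewer than \<open>U\<close> of which are live, so at least
  \<open>U\<close> dead ones pay for it.\<close>

definition tree_inv :: "nat list => mem => nat => bool" where
 "tree_inv us M p \<longleftrightarrow> length us <= m \<and> (\<exists>Ps es A vl. tree_at M Ps es A vl us \<and>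
   p = split_cost * levels_pot Ps (L - 2) + rebuild_cost * (M (adr 0 2) - length us))"

definition tree_cost :: nat where "tree_cost = query_cost + 30 * gam + 40000"

lemma tree_costs:
 "insert_cost + 60 <= tree_cost * (L * (n * T))" "delete_cost + rebuild_cost <= tree_cost * (L * (n * T))"
 "query_cost * (L * (n * T)) <= tree_cost * (L * (n * T))"
proof -
 define x z where "x = gam * (L * T)" and "z = L * (n * T)"
 have "L * T <= z" unfolding z_def using n by (intro mult_left_mono) auto
 then have 1: "x <= gam * z" unfolding x_def by (rule mult_left_mono) simp
 have "1 <= n * T" using mult_le_mono[OF n T] by simp
 then have 2: "L <= z" unfolding z_def using mult_le_mono[of L L 1 "n * T"] by simp
 have 3: "insert_cost = 8 * x + 4000 * L" "delete_cost = x + 3000 * L" by (simp_all add: insert_cost_def delete_cost_def x_def algebra_simps)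
 have 4: "tree_cost * z = query_cost * z + 30 * (gam * z) + 40000 * z" by (simp add: tree_cost_def algebra_simps)
 show "insert_cost + 60 <= tree_cost * (L * (n * T))" "delete_cost + rebuild_cost <= tree_cost * (L * (n * T))"
  unfolding z_def[symmetric] 4 rebuild_cost_def using 1 2 3 Lb by linarith+
 show "query_cost * (L * (n * T)) <= tree_cost * (L * (n * T))" unfolding z_def[symmetric] 4 by linarith
qed

text \<open>Zeroed memory already is the list consisting of the sentinel alone.\<close>

lemma tree_inv_blank: "tree_inv [] blank 0"
proof -
 have "tree_at blank (\<lambda>l. [[0]]) [0] {} id []" "levels_pot (\<lambda>l. [[0]]) (L - 2) = 0"
  by (rule tree_init; use inst_blank in \<open>auto intro!: level_init simp: blank_def bM_def clean_def\<close>)+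
 then have "tree_at blank (\<lambda>l. [[0]]) [0] {} id [] \<and>
  0 = split_cost * levels_pot (\<lambda>l. [[0]]) (L - 2) + rebuild_cost * (blank (adr 0 2) - length [])" by (simp add: blank_def)
 then show ?thesis unfolding tree_inv_def by auto
qed

lemma tree_insert:
 assumes b: "bR R" "std R" and r: "R 1 = i" "R 2 = u" and inv: "tree_inv us M p"
  and i: "i <= length us" "length us < m" "legal u"
 shows "wp w tree_insert (\<lambda>t R' M'. \<exists>p'. tree_inv (ins_at i u us) M' p' \<and> t + p' <= p + tree_cost * (L * (n * T))) R M"
proof -
 obtain Ps es A vl where ta: "tree_at M Ps es A vl us" and p: "p = split_cost * levels_pot Ps (L - 2) + rebuild_cost * (M (adr 0 2) - length us)"
  using inv by (auto simp: tree_inv_def)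
 have M: "bM M" "M (adr 0 2) <= 2 * U" using ta by (auto simp: tree_at_def)
 have UZ: "U + U < Z" "0 < B" "2 < B" using nd_Z(3)[of "U + U"] B_big by auto
 show ?thesis
 proof (cases "M (adr 0 2) < U + U")
  case True
  have lt: "M (adr 0 2) < 2 * U" using True by simp
  show ?thesis unfolding tree_insert_def
  proof (simp add: b M UZ True, rule wp_mono[OF plain_insert[OF b r ta i lt]], elim conjE exE, goal_cases)
   case (1 t R' M' Ps' es' A' vl')
   note f = this
   have "tree_inv (ins_at i u us) M' (split_cost * levels_pot Ps' (L - 2) + rebuild_cost * (M' (adr 0 2) - length (ins_at i u us)))"
    unfolding tree_inv_def using f(7) i by auto
   moreover have "M' (adr 0 2) - length (ins_at i u us) = M (adr 0 2) - length us" using f(6) by simp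
   ultimately show ?case using f(8) p tree_costs(1) by (intro exI[of _ "split_cost * levels_pot Ps' (L - 2) + rebuild_cost * (M (adr 0 2) - length us)"]) simp
  qed
 next
  case False
  then have c: "M (adr 0 2) = 2 * U" using M by simp
  have NU: "length us <= U" using i nm_U by simp
  show ?thesis unfolding tree_insert_def
  proof (simp add: b M(1) UZ False, rule wp_mono[OF rebuild[OF b r ta]], use i in simp, elim conjE exE, goal_cases)
   case (1 t R' M' Ps' es' A' vl')
   note f = this
   have lt: "M' (adr 0 2) < 2 * U" using f(6) NU U_ge by linarith
   show ?case
   proof (rule wp_mono[OF plain_insert[OF f(1,3,4,5,7) i lt]], elim conjE exE, goal_cases)
    case (1 t' R'' M'' Ps'' es'' A'' vl'')
    note g = this
    have "tree_inv (ins_at i u us) M'' (split_cost * levels_pot Ps'' (L - 2) + rebuild_cost * (M'' (adr 0 2) - length (ins_at i u us)))"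
     unfolding tree_inv_def using g(7) i by auto
    moreover have "M'' (adr 0 2) - length (ins_at i u us) = 0" using g(6) f(6) by simp
    ultimately have ti: "tree_inv (ins_at i u us) M'' (split_cost * levels_pot Ps'' (L - 2))" by simp
    have "length us * (delete_cost + insert_cost + 120) <= U * (delete_cost + insert_cost + 120)" using NU by (rule mult_right_mono) simp
    moreover have "rebuild_cost * U = U * (delete_cost + insert_cost + 120) + 70 * (U * L)" by (simp add: rebuild_cost_def algebra_simps)
    moreover have "1 * L <= U * L" using U_ge by (intro mult_right_mono) auto
    moreover have "rebuild_cost * U <= rebuild_cost * (M (adr 0 2) - length us)" using c NU by (intro mult_left_mono) auto
    ultimately have "t + 60 + t' + split_cost * levels_pot Ps'' (L - 2) <= p + (insert_cost + 60)"
     using g(8) f(8) p Lb by linarith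
    then show ?case using ti tree_costs(1) by (intro exI[of _ "split_cost * levels_pot Ps'' (L - 2)"]) simp
   qed
  qed
 qed
qed

lemma tree_delete:
 assumes b: "bR R" "std R" and r: "R 1 = i" and inv: "tree_inv us M p" and i: "i < length us"
 shows "wp w plain_delete (\<lambda>t R' M'. \<exists>p'. tree_inv (del_at i us) M' p' \<and> t + p' <= p + tree_cost * (L * (n * T))) R M"
proof -
 obtain Ps es A vl where ta: "tree_at M Ps es A vl us" and p: "p = split_cost * levels_pot Ps (L - 2) + rebuild_cost * (M (adr 0 2) - length us)"
  and len: "length us <= m" using inv by (auto simp: tree_inv_def)
 show ?thesis
 proof (rule wp_mono[OF plain_delete[OF b r ta i len]], elim conjE exE, goal_cases)
  case (1 t R' M' A')
  note f = this
  have ti: "tree_inv (del_at i us) M' (split_cost * levels_pot Ps (L - 2) + rebuild_cost * (M' (adr 0 2) - length (del_at i us)))"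
   unfolding tree_inv_def using f(9) i len by auto
  have "M' (adr 0 2) - length (del_at i us) = M (adr 0 2) - length us + 1" using f(8) i tree_count[OF ta] by simp
  then have "t + (split_cost * levels_pot Ps (L - 2) + rebuild_cost * (M' (adr 0 2) - length (del_at i us))) <= p + (delete_cost + rebuild_cost)"
   using p f(1) by (simp add: distrib_left)
  then show ?case using ti tree_costs(2) by (intro exI[of _ "split_cost * levels_pot Ps (L - 2) + rebuild_cost * (M' (adr 0 2) - length (del_at i us))"]) simp
 qed
qed

lemma tree_query_inv:
 assumes b: "bR R" "std R" and r: "R 1 = i" "R 2 = q" and inv: "tree_inv us M p"
  and i: "i <= length us" "q \<in> legal_queries D n m"
 shows "wp w tree_query (\<lambda>t R' M'. R' 0 = answer D n q (result_state D n (take i us)) \<and>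
  (\<exists>p'. tree_inv us M' p' \<and> t + p' <= p + tree_cost * (L * (n * T)))) R M"
proof -
 obtain Ps es A vl where ta: "tree_at M Ps es A vl us" and p: "p = split_cost * levels_pot Ps (L - 2) + rebuild_cost * (M (adr 0 2) - length us)"
  and len: "length us <= m" using inv by (auto simp: tree_inv_def)
 show ?thesis
 proof (rule wp_mono[OF tree_query[OF b r ta i(1) len i(2)]], elim conjE, goal_cases)
  case (1 t R' M')
  have "set es = {0..M (adr 0 2)}" "set es = {0..M' (adr 0 2)}" using ta 1(2) unfolding tree_at_def by blast+
  then have "M' (adr 0 2) = M (adr 0 2)" by simp
  then have "tree_inv us M' p" unfolding tree_inv_def using 1(2) p len by auto
  moreover have "t + p <= p + tree_cost * (L * (n * T))" using order_trans[OF 1(1) tree_costs(3)] by simp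
  ultimately show ?case using 1(3) by (intro conjI exI[of _ p])
 qed
qed

end

section \<open>Combination of the two structures\<close>

text \<open>The usual telescoping sum. The potential is an argument of the invariant, because it
  depends on witnesses that the memory alone does not show.\<close>

lemma serves_amortized:
 assumes step: "\<And>us M p r. IV us M p ==> legal_request D Fully n m us r ==>
   \<exists>t R M' p'. call w P n r M t (R, M') \<and> correct_reply D n us r R \<and> IV (apply_request r us) M' p' \<and> t + p' <= p + (c :: nat)"
 shows "IV us M p ==> legal_requests D Fully n m us rs ==> \<exists>ts. serves D P w n us M rs ts \<and> sum_list ts <= p + length rs * c"
proof (induction rs arbitrary: us M p)
 case (Cons r rs)
 obtain t R M' p' where s: "call w P n r M t (R, M')" "correct_reply D n us r R" "IV (apply_request r us) M' p'" "t + p' <= p + c"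
  using step[OF Cons.prems(1), of r] Cons.prems(2) by auto
 obtain ts where "serves D P w n (apply_request r us) M' rs ts" "sum_list ts <= p' + length rs * c"
  using Cons.IH[OF s(3)] Cons.prems(2) by auto
 then show ?case using s by (intro exI[of _ "t # ts"]) auto
qed simp

text \<open>The second alternative is taken if \<open>2 ^ L\<close> is large compared with \<open>(n * L)\<^sup>2\<close>. Then
 \<open>n * log m\<close> is smaller than \<open>sqrt m\<close>, and \<open>2 ^ L <= 2 * m\<close>.\<close>

definition two_schemes :: "nat => nat => com => com => com" where
 "two_schemes cB k c d = Seq (Assign 3 (Reg 0)) (Seq (Assign 4 (Bin Div WordSize (Lit (20 * cB))))
  (Seq (Assign 5 (Bin Shl (Lit 1) (Reg 4))) (Seq (Assign 6 (Bin Shl (Lit 1) (Bin Mul (Lit cB) (Reg 4))))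
  (If (Bin Less (Bin Mul (Lit k) (Bin Mul (Bin Mul (Reg 3) (Reg 4)) (Bin Mul (Reg 3) (Reg 4)))) (Reg 5)) d c))))"

context progs
begin

text \<open>Large enough for the test by itself to imply \<open>L \<ge> 5\<close>,
  \<open>4 * (K * n) \<le> U\<close> and \<open>2 * n < U\<close>; see
  \<open>tall_tree\<close>.\<close>

definition threshold :: "nat => nat" where "threshold K = 64 * (K + 1)"

definition retro :: "nat => implementation" where
 "retro K = \<lparr>insert_prog = two_schemes cB (threshold K) sqrt_insert tree_insert,
   delete_prog = two_schemes cB (threshold K) sqrt_delete plain_delete,
   query_prog = two_schemes cB (threshold K) sqrt_query tree_query\<rparr>"

end

context machine
begin

text \<open>Depends on \<open>n\<close>, \<open>L\<close> and a constant only, so all calls of a run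
  choose the same scheme.\<close>

definition tall :: bool where "tall \<longleftrightarrow> threshold K * (n * L * (n * L)) < U"

lemma two_schemes:
 assumes "bR R" "bM M" "R 0 = n"
  and c: "wp w (if tall then d else c) G (R(3 := n, 4 := L, 5 := U, 6 := B)) M"
 shows "wp w (two_schemes cB (threshold K) c d) (\<lambda>t R' M'. \<exists>t'. t <= t' + 100 \<and> G t' R' M') R M"
proof -
 have cZ: "threshold K < Z" "20 * cB < Z" "cB < Z"
 proof -
  have "cB < 2 ^ cB" by simp
  then have "64 * cB <= 64 * 2 ^ cB" by simp
  also have "\<dots> = 2 ^ (cB + 6)" by (simp add: power_add)
  also have "\<dots> <= 2 ^ (cB * L)"
  proof (intro power_increasing)
   have "cB * 2 <= cB * L" using L by (intro mult_left_mono) auto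
   then show "cB + 6 <= cB * L" using cB by linarith
  qed simp
  finally have "64 * cB <= B" by (simp add: B_def)
  moreover have "K + 1 <= cB" using K by simp
  ultimately have x: "64 * cB < Z" "64 * (K + 1) <= 64 * cB" using B_lt_Z by simp_all
  show "threshold K < Z" unfolding threshold_def by (rule le_less_trans[OF x(2,1)])
  show "20 * cB < Z" "cB < Z" by (rule le_less_trans[OF _ x(1)], simp)+
 qed
 have sh: "2 ^ L = U" "2 ^ (cB * L) = B" "w div (20 * cB) = L"
  using cB by (simp_all add: U_def B_def w_def)
 have Zs: "n < Z" "L < Z" "U < Z" "B < Z" "1 < Z" using bounds B_lt_Z by auto
 let ?R = "R(3 := n, 4 := L, 5 := U, 6 := B)"
 have bR': "bR ?R" using assms Zs by simp
 have e: "wp w (two_schemes cB (threshold K) c d) Q R M \<longleftrightarrow> wp w (if tall then d else c) (\<lambda>t. Q (28 + t)) ?R M" for Q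
  unfolding two_schemes_def by (simp add: assms(1-3) cZ sh Zs tall_def)
 show ?thesis unfolding e proof (rule wp_mono[OF c])
  fix t R' M' assume "G t R' M'"
  then show "\<exists>t'. 28 + t <= t' + 100 \<and> G t' R' M'" by (intro exI[of _ t]) simp
 qed
qed

definition sqrt_or_tree_time :: nat where "sqrt_or_tree_time = (if tall then L * n else s)"

lemma sqrt_step:
 assumes inv: "sqrt_inv us M p" and r: "legal_request D Fully n m us r" and R: "bR R" "std R"
  "R 1 = (case r of Insert i u => i | Delete i => i | Query i q => i)" "R 2 = (case r of Insert i u => u | Delete i => 0 | Query i q => q)"
 shows "wp w (case r of Insert i u => sqrt_insert | Delete i => sqrt_delete | Query i q => sqrt_query)
  (\<lambda>t R' M'. correct_reply D n us r R' \<and> (\<exists>p'. sqrt_inv (apply_request r us) M' p' \<and> t + sqrt_pot M' p' <= sqrt_pot M p + sqrt_cost * (s * T))) R M"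
proof (cases r)
 case (Insert i u)
 show ?thesis unfolding Insert
  by (simp, rule wp_mono[OF sqrt_insert[OF R(1,2) _ _ inv]]) (use R r Insert in \<open>auto simp: ins_at_def\<close>)
next
 case (Delete i)
 show ?thesis unfolding Delete
  by (simp, rule wp_mono[OF sqrt_delete[OF R(1,2) _ inv]]) (use R r Delete in \<open>auto simp: del_at_def\<close>)
next
 case (Query i q)
 show ?thesis unfolding Query
  by (simp, rule wp_mono[OF sqrt_query[OF R(1,2) _ _ inv]]) (use R r Query in auto)
qed

end

context tree
begin

lemma tree_step:
 assumes inv: "tree_inv us M p" and r: "legal_request D Fully n m us r" and R: "bR R" "std R"
  "R 1 = (case r of Insert i u => i | Delete i => i | Query i q => i)" "R 2 = (case r of Insert i u => u | Delete i => 0 | Query i q => q)"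
 shows "wp w (case r of Insert i u => tree_insert | Delete i => plain_delete | Query i q => tree_query)
  (\<lambda>t R' M'. correct_reply D n us r R' \<and> (\<exists>p'. tree_inv (apply_request r us) M' p' \<and> t + p' <= p + tree_cost * (L * (n * T)))) R M"
proof (cases r)
 case (Insert i u)
 show ?thesis unfolding Insert
  by (simp, rule wp_mono[OF tree_insert[OF R(1,2) _ _ inv]]) (use R r Insert in \<open>auto simp: ins_at_def\<close>)
next
 case (Delete i)
 show ?thesis unfolding Delete
  by (simp, rule wp_mono[OF tree_delete[OF R(1,2) _ inv]]) (use R r Delete in \<open>auto simp: del_at_def\<close>)
next
 case (Query i q)
 show ?thesis unfolding Query
  by (simp, rule wp_mono[OF tree_query_inv[OF R(1,2) _ _ inv]]) (use R r Query in auto)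
qed

lemma tree_inv_bM: "tree_inv us M p ==> bM M"
 by (auto simp: tree_inv_def tree_at_def)

lemma tree_cost_eq: "tree_cost = 40 * (3 * gam * K + gam + 300 * K + 300 * cP + 400 + 2 * (gam * K) + 60 * K + 60) +
  2 * (gam * K) + 60 * K + gam + 8000 + 30 * gam + 40000"
 by (simp add: tree_cost_def query_cost_def process_cost_def transfer_cost_def)

end

text \<open>\<open>tree_cost\<close> written out in parameters that do not involve \<open>n\<close>
  and \<open>m\<close>, so that the final constant can be chosen before these are fixed. It also
  dominates \<open>sqrt_cost\<close>.\<close>

definition total_cost :: "nat => nat => nat => nat" where
 "total_cost g k c = 40 * (3 * g * k + g + 300 * k + 300 * c + 400 + 2 * (g * k) + 60 * k + 60) +
  2 * (g * k) + 60 * k + g + 8000 + 30 * g + 40000"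

section \<open>Comparing both schemes with the claimed bound\<close>

context machine
begin

text \<open>From \<open>2 * n < U\<close> it follows that \<open>n\<close> has fewer than
  \<open>L\<close> binary digits. The maximum that defines \<open>L\<close> must then be
  \<open>m\<close>, whence \<open>U \<le> 2 * m\<close>.\<close>

lemma tall_tree:
 assumes tall
 shows "tree cB L cP cX cY P X Y D n m T K"
proof unfold_locales
 define y where "y = n * L * (n * L)"
 have lt: "64 * y + 64 * (K * y) < U" using assms by (simp add: tall_def threshold_def y_def algebra_simps)
 have nL: "2 * n <= n * L" using L by simp
 then have nL2: "2 <= n * L" "1 <= n * L" using n by linarith+
 have y: "n <= y" "4 <= y" using mult_le_mono[OF nL nL2(2)] mult_le_mono[OF nL2(1,1)] unfolding y_def by linarith+
 have "(2::nat) ^ 5 < 2 ^ L" using lt y U_def by simp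
 then have "5 < L" by (rule power_less_imp_less_exp[rotated]) simp
 then show "5 <= L" by simp
 have "4 * (K * n) <= 64 * (K * y)" using y by (intro mult_le_mono) auto
 then show "4 * (K * n) <= U" using lt by linarith
 have "2 ^ (L - 1) <= max n m" unfolding L_def using floorlog_bounds[of "max n m" 2] n by auto
 moreover have "U = 2 * 2 ^ (L - 1)" using L unfolding U_def by (cases L) auto
 moreover have "2 * n < U" using lt y by linarith
 ultimately show "U <= 2 * m" by linarith
qed

text \<open>Adds the constant overhead of choosing the scheme, for either invariant.\<close>

lemma request_step:
 fixes IV :: "nat list => mem => nat => bool" and c :: nat
 assumes step: "\<And>us M p r R. IV us M p ==> legal_request D Fully n m us r ==> bR R ==> std R ==>
   R 1 = (case r of Insert i u => i | Delete i => i | Query i q => i) ==> R 2 = (case r of Insert i u => u | Delete i => 0 | Query i q => q) ==>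
   wp w (if tall then (case r of Insert i u => tree_insert | Delete i => plain_delete | Query i q => tree_query)
    else (case r of Insert i u => sqrt_insert | Delete i => sqrt_delete | Query i q => sqrt_query))
   (\<lambda>t R' M'. correct_reply D n us r R' \<and> (\<exists>p'. IV (apply_request r us) M' p' \<and> t + p' <= p + c)) R M"
  and bM: "\<And>us M p. IV us M p ==> bM M \<and> length us <= m"
  and inv: "IV us M p" and r: "legal_request D Fully n m us r"
 shows "\<exists>t R M' p'. call w (retro K) n r M t (R, M') \<and> correct_reply D n us r R \<and> IV (apply_request r us) M' p' \<and> t + p' <= p + (c + 100)"
proof -
 define R0 where "R0 = (case r of Insert i u => args [n, i, u] | Delete i => args [n, i] | Query i q => args [n, i, q])"
 define a where "a = (case r of Insert i u => tree_insert | Delete i => plain_delete | Query i q => tree_query)"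
 define b where "b = (case r of Insert i u => sqrt_insert | Delete i => sqrt_delete | Query i q => sqrt_query)"
 have M: "bM M" "length us <= m" using bM[OF inv] by auto
 have iZ: "i < Z" if "i <= length us" for i using that M bounds by linarith
 have qZ: "q < Z" if "q \<in> legal_queries D n m" for q using that operand_lt_Z by (auto simp: legal_queries_def)
 have bR0: "bR R0" unfolding bR_def R0_def using r iZ qZ legal_lt(2) bounds
  by (cases r) (auto simp: args_def nth_Cons split: nat.split)
 have R0: "R0 0 = n" "R0 1 = (case r of Insert i u => i | Delete i => i | Query i q => i)"
  "R0 2 = (case r of Insert i u => u | Delete i => 0 | Query i q => q)"
  unfolding R0_def by (cases r; simp add: args_def nth_Cons')+
 let ?R = "R0(3 := n, 4 := L, 5 := U, 6 := B)"
 have b1: "bR ?R" "std ?R" using bR0 bounds B_lt_Z by (simp_all add: std_def)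
 have st: "wp w (if tall then a else b) (\<lambda>t R' M'. correct_reply D n us r R' \<and> (\<exists>p'. IV (apply_request r us) M' p' \<and> t + p' <= p + c)) ?R M"
  unfolding a_def b_def by (rule step[OF inv r b1]) (use R0 in simp_all)
 have "wp w (two_schemes cB (threshold K) b a) (\<lambda>t R' M'. \<exists>t'. t <= t' + 100 \<and> correct_reply D n us r R' \<and>
  (\<exists>p'. IV (apply_request r us) M' p' \<and> t' + p' <= p + c)) R0 M"
  by (rule two_schemes[OF bR0 M(1) R0(1) st])
 then obtain t R' M' t' p' where x: "exec w (two_schemes cB (threshold K) b a) (R0, M) t (R', M')" "t <= t' + 100" "correct_reply D n us r R'"
  "IV (apply_request r us) M' p'" "t' + p' <= p + c" by (auto simp: wp_def)
 have "call w (retro K) n r M t (R', M')" using x(1) by (cases r) (simp_all add: retro_def R0_def a_def b_def)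
 moreover have "t + p' <= p + (c + 100)" using x by linarith
 ultimately show ?thesis using x by blast
qed

lemma retro_serves:
 assumes "legal_requests D Fully n m [] rs"
 shows "\<exists>ts. serves D (retro K) w n [] blank rs ts \<and>
  sum_list ts <= length rs * (total_cost gam K cP * ((if tall then L * n else s) * T) + 100)"
proof (cases tall)
 case True
 interpret tree cB L cP cX cY P X Y D n m T K by (rule tall_tree[OF True])
 have "\<exists>ts. serves D (retro K) w n [] blank rs ts \<and> sum_list ts <= 0 + length rs * (tree_cost * (L * (n * T)) + 100)"
 proof (rule serves_amortized[where IV = tree_inv and m = m])
  fix us M p r assume i: "tree_inv us M p" and r: "legal_request D Fully n m us r"
  show "\<exists>t R M' p'. call w (retro K) n r M t (R, M') \<and> correct_reply D n us r R \<and> tree_inv (apply_request r us) M' p' \<and>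
   t + p' <= p + (tree_cost * (L * (n * T)) + 100)"
   by (rule request_step[where IV = tree_inv and c = "tree_cost * (L * (n * T))", OF _ _ i r]) (use True tree_step tree_inv_bM in \<open>auto simp: tree_inv_def\<close>)
 qed (use tree_inv_blank assms in auto)
 moreover have "tree_cost = total_cost gam K cP" by (simp add: tree_cost_eq total_cost_def)
 ultimately show ?thesis using True by (simp add: mult.assoc)
next
 case False
 define IV where "IV us M p \<longleftrightarrow> (\<exists>q. sqrt_inv us M q \<and> p = sqrt_pot M q)" for us M p
 have st: "wp w (case r of Insert i u => sqrt_insert | Delete i => sqrt_delete | Query i q => sqrt_query)
   (\<lambda>t R' M'. correct_reply D n us r R' \<and> (\<exists>p'. IV (apply_request r us) M' p' \<and> t + p' <= p + sqrt_cost * (s * T))) R M"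
  if IV: "IV us M p" and R: "legal_request D Fully n m us r" "bR R" "std R"
   "R 1 = (case r of Insert i u => i | Delete i => i | Query i q => i)" "R 2 = (case r of Insert i u => u | Delete i => 0 | Query i q => q)"
  for us M p r R
 proof -
  obtain q where q: "sqrt_inv us M q" "p = sqrt_pot M q" using IV by (auto simp: IV_def)
  show ?thesis by (rule wp_mono[OF sqrt_step[OF q(1) R]]) (auto simp: IV_def q(2))
 qed
 have "\<exists>ts. serves D (retro K) w n [] blank rs ts \<and> sum_list ts <= sqrt_pot blank 0 + length rs * (sqrt_cost * (s * T) + 100)"
 proof (rule serves_amortized[where IV = IV and m = m])
  fix us M p r assume i: "IV us M p" and r: "legal_request D Fully n m us r"
  show "\<exists>t R M' p'. call w (retro K) n r M t (R, M') \<and> correct_reply D n us r R \<and> IV (apply_request r us) M' p' \<and>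
   t + p' <= p + (sqrt_cost * (s * T) + 100)"
   by (rule request_step[where IV = IV and c = "sqrt_cost * (s * T)", OF _ _ i r]) (use False st in \<open>auto simp: IV_def sqrt_inv_def\<close>)
 qed (use sqrt_inv_blank assms in \<open>auto simp: IV_def\<close>)
 then obtain ts where ts: "serves D (retro K) w n [] blank rs ts" "sum_list ts <= sqrt_pot blank 0 + length rs * (sqrt_cost * (s * T) + 100)"
  by blast
 have "sqrt_pot blank 0 = 0" by (simp add: sqrt_pot_def blank_def)
 then have "sum_list ts <= length rs * (sqrt_cost * (s * T) + 100)" using ts(2) by simp
 moreover have "sqrt_cost <= total_cost gam K cP" by (simp add: sqrt_cost_def total_cost_def)
 then have "length rs * (sqrt_cost * (s * T) + 100) <= length rs * (total_cost gam K cP * (s * T) + 100)"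
  by (intro mult_left_mono add_right_mono mult_right_mono) auto
 ultimately have "sum_list ts <= length rs * (total_cost gam K cP * (s * T) + 100)" by (rule order_trans)
 then show ?thesis using ts(1) False by auto
qed

text \<open>With \<open>y = n * L\<close>, the test compares \<open>k * (y * y)\<close> with
  \<open>U\<close>. If it succeeds, \<open>y * y \<le> m\<close>, so the time \<open>y\<close> is at
  most \<open>sqrt m\<close> as well. If it fails, \<open>m < U \<le> k * (y * y)\<close>, so
  \<open>sqrt m\<close> is at most \<open>k * y\<close>. Replacing \<open>L\<close> by
  \<open>2 * log 2 m\<close> requires \<open>n \<le> m\<close>; for \<open>n > m\<close> already
  \<open>sqrt m \<le> n\<close>.\<close>

lemma time_bound:
 "real (if tall then L * n else s) <= 2 * real (threshold K) * min (sqrt (real m)) (real n * log 2 (real m))"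
proof -
 define k where "k = threshold K"
 have k: "k \<ge> 64" by (simp add: k_def threshold_def)
 have lg: "1 <= log 2 (real m)" using m by (simp add: le_log_iff)
 \<comment> \<open>Here \<open>L\<close> is the rounded-down logarithm of \<open>m\<close> plus 1,
   and \<open>m \<ge> 2\<close> makes this logarithm at least 1.\<close>
 have logL: "real L <= 2 * log 2 (real m)" if "n <= m"
 proof -
  have "L = nat \<lfloor>log 2 (real m)\<rfloor> + 1" using that m by (simp add: L_def floorlog_def max_absorb2)
  then have "real L <= log 2 (real m) + 1" using lg by simp
  then show ?thesis using lg by linarith
 qed
 have mono: "x <= 2 * real k * y" if "x <= 2 * y" "0 <= y" for x y :: real
 proof -
  have "1 * (2 * y) <= real k * (2 * y)" using k that by (intro mult_right_mono) auto
  then show ?thesis using that by simp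
 qed
 show ?thesis
 proof (cases tall)
  case True
  interpret tree cB L cP cX cY P X Y D n m T K by (rule tall_tree[OF True])
  define y where "y = n * L"
  have ky: "k * (y * y) < U" using True by (simp add: tall_def k_def y_def)
  have "64 * (y * y) <= k * (y * y)" using k by (rule mult_right_mono) simp
  then have ym: "y * y <= m" using ky mU by linarith
  have "n <= y * y" unfolding y_def using n L by (simp add: mult.assoc) 
  then have nm: "n <= m" using ym by linarith
  have "real y * real y <= real m" using ym by (metis of_nat_le_iff of_nat_mult)
  then have "real y <= sqrt (real m)" by (intro real_le_rsqrt) (simp add: power2_eq_square)
  then have 1: "real y <= 2 * sqrt (real m)" by (smt (verit) real_sqrt_ge_zero of_nat_0_le_iff)
  have 2: "real y <= 2 * (real n * log 2 (real m))" using mult_left_mono[OF logL[OF nm], of "real n"] by (simp add: y_def)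
  have "real y <= 2 * min (sqrt (real m)) (real n * log 2 (real m))" using 1 2 by linarith
  then have "real y <= 2 * real k * min (sqrt (real m)) (real n * log 2 (real m))" by (rule mono) (use lg in simp)
  then show ?thesis using True by (simp add: y_def k_def mult.commute)
 next
  case False
  have s1: "real s <= 2 * real k * sqrt (real m)" by (rule mono) (use s_sqrt in \<open>auto intro: order_trans\<close>)
  have s2: "real s <= 2 * real k * (real n * log 2 (real m))"
  proof (cases "n <= m")
   case True
   have "s * s <= m"
   proof -
    have "real s * real s <= sqrt (real m) * sqrt (real m)" using s_sqrt by (intro mult_mono) auto
    then have "real (s * s) <= real m" by simp
    then show ?thesis by (simp only: of_nat_le_iff)
   qed
   also have "m <= k * (n * L * (n * L))" using False nm_U by (simp add: tall_def k_def)
   also have "\<dots> <= (k * (n * L)) * (k * (n * L))"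
   proof -
    have "k * 1 * (n * L * (n * L)) <= k * k * (n * L * (n * L))" using k by (intro mult_le_mono) auto
    then show ?thesis by (simp add: ac_simps)
   qed
   finally have "s\<^sup>2 <= (k * (n * L))\<^sup>2" by (simp add: power2_eq_square)
   then have "s <= k * (n * L)" by (rule power2_le_imp_le) simp
   then have "real s <= real k * (real n * real L)" by (metis of_nat_le_iff of_nat_mult)
   also have "\<dots> <= real k * (real n * (2 * log 2 (real m)))" using logL[OF True] by (intro mult_left_mono) auto
   finally show ?thesis by (simp add: ac_simps)
  next
   case False
   have "sqrt (real m) <= real m" using m by (intro real_le_lsqrt) (auto simp: power2_eq_square)
   also have "\<dots> <= real n * 1" using False by simp
   also have "\<dots> <= real n * log 2 (real m)" using lg by (intro mult_left_mono) auto
   finally have "real s <= 2 * (real n * log 2 (real m))" using s_sqrt lg by (smt (verit) mult_nonneg_nonneg of_nat_0_le_iff)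
   then show ?thesis by (rule mono) (use lg in simp)
  qed
  show ?thesis using s1 s2 False by (simp add: min_def k_def)
 qed
qed

end

section \<open>Choosing constants that work for all sizes\<close>

theorem theorem4:
  fixes D :: problem and T_op :: "nat \<Rightarrow> nat \<Rightarrow> real"
  assumes "data_structure D"
    and "extractable D T_op"
    and "constructible D T_op"
    and "partially_retroactive D T_op"
  shows "\<exists>C>0. amortized_fully_retroactive D
    (\<lambda>n m. C * (min (sqrt (real m)) (real n * log 2 (real m)) * T_op n m))"
proof -
  obtain cX KX X where X: "cX \<ge> width D" "\<And>n m S. n \<ge> 1 \<Longrightarrow> m \<ge> 2 \<Longrightarrow> S \<in> states D n m \<Longrightarrow> \<exists>qs t.
     extraction (word_size cX n m) n X (\<lambda>q. answer D n q S) blank 0 qs t S \<and>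
     set qs \<subseteq> legal_queries D n m \<and> length qs \<le> KX * n \<and> real t \<le> real (KX * n) * T_op n m"
    using assms(2) unfolding extractable_def by blast
  obtain cY KY Y where Y: "cY \<ge> width D" "\<And>n m S. n \<ge> 1 \<Longrightarrow> m \<ge> 2 \<Longrightarrow> S \<in> states D n m \<Longrightarrow> \<exists>t R M us.
     exec (word_size cY n m) Y (args [n, length S], args S) t (R, M) \<and>
     us = map M [0..<R 0] \<and> set us \<subseteq> legal_updates D n m \<and> result_state D n us = S \<and>
     length us \<le> KY * n \<and> real t \<le> real (KY * n) * T_op n m"
    using assms(3) unfolding constructible_def by blast
  obtain cP P where P: "cP \<ge> width D" "\<And>n m rs. n \<ge> 1 \<Longrightarrow> m \<ge> 2 \<Longrightarrow> legal_requests D Partially n m [] rs \<Longrightarrow>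
     \<exists>ts. serves D P (word_size cP n m) n [] blank rs ts \<and> (\<forall>t\<in>set ts. real t \<le> T_op n m)"
    using assms(4) unfolding partially_retroactive_def by blast
  \<comment> \<open>The real time bound is later rounded down to a natural \<open>T\<close> with
    \<open>T_op n m \<le> 2 * real T\<close>; the factor 2 compensates for this.\<close>
  define K where "K = 2 * (KX + KY)"
  define cB where "cB = cP + cX + cY + K + 8"
  define g where "g = total_cost (progs.gam P X Y) K cP"
  define C where "C = (real g + 100) * (2 * real (progs.threshold K))"
  have wd: "width D \<ge> 1" using assms(1) by (simp add: data_structure_def)
  have C: "C > 0" by (simp add: C_def progs.threshold_def add_pos_nonneg)
  have "20 * cB \<ge> width D" using P(1) by (simp add: cB_def)
  moreover have "\<exists>ts. serves D (progs.retro cB cP cX cY P X Y K) (word_size (20 * cB) n m) n [] blank rs ts \<and>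
      real (sum_list ts) \<le> real (length rs) * (C * (min (sqrt (real m)) (real n * log 2 (real m)) * T_op n m))"
    if n: "n \<ge> 1" and m: "m \<ge> 2" and rs: "legal_requests D Fully n m [] rs" for n m rs
  proof (cases rs)
    case Nil
    then show ?thesis by (intro exI[of _ "[]"]) simp
  next
    case (Cons r rs')
    \<comment> \<open>\<open>T_op\<close> is an arbitrary real function; that it is at least 1 is
      inferred from an actual call. On the empty timeline the first request is legal for the
      partially retroactive structure as well, and serving it takes at least one step.\<close>
    have "legal_request D Fully n m [] r" using rs Cons by simp
    then have "legal_requests D Partially n m [] [r]" by (cases r) auto
    from P(2)[OF n m this] obtain ts where "serves D P (word_size cP n m) n [] blank [r] ts" "\<forall>t\<in>set ts. real t \<le> T_op n m" by blast
    then obtain t s' where "call (word_size cP n m) P n r blank t s'" "real t \<le> T_op n m" by auto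
    moreover from this have "1 \<le> t" by (cases r) (auto dest: exec_pos)
    ultimately have T1: "1 \<le> T_op n m" by linarith
    define T where "T = nat \<lfloor>T_op n m\<rfloor>"
    have T_le: "1 \<le> T" "real T \<le> T_op n m" "T_op n m \<le> 2 * real T"
    proof -
      have "1 \<le> \<lfloor>T_op n m\<rfloor>" using T1 by (simp add: le_floor_iff)
      then have "real T = real_of_int \<lfloor>T_op n m\<rfloor>" "real_of_int 1 \<le> real_of_int \<lfloor>T_op n m\<rfloor>" by (simp_all add: T_def)
      moreover have "real_of_int \<lfloor>T_op n m\<rfloor> \<le> T_op n m" "T_op n m < real_of_int \<lfloor>T_op n m\<rfloor> + 1" by linarith+
      ultimately show "1 \<le> T" "real T \<le> T_op n m" "T_op n m \<le> 2 * real T" by linarith+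
    qed
    have tT: "t \<le> K * n * T" if "real t \<le> real (k * n) * T_op n m" "2 * k \<le> K" for t k
    proof -
      have "real t \<le> real (k * n) * (2 * real T)" using that(1) T_le(3) by (meson mult_left_mono of_nat_0_le_iff order_trans)
      also have "\<dots> = real (2 * k * n * T)" by simp
      finally have "t \<le> 2 * k * n * T" by (simp only: of_nat_le_iff)
      also have "\<dots> \<le> K * n * T" using that(2) by (intro mult_le_mono1)
      finally show ?thesis .
    qed
    have kK: "2 * KX \<le> K" "2 * KY \<le> K" "KX * n \<le> K * n" "KY * n \<le> K * n" by (auto simp: K_def)
    define L where "L = floorlog 2 (max n m)"
    have ws: "word_size c n m = c * L" for c by (simp add: word_size_def L_def)
    interpret machine cB L cP cX cY P X Y D n m T K
    proof unfold_locales
      show "L \<ge> 2"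
      proof (rule ccontr)
        assume "\<not> L \<ge> 2"
        then have "(2::nat) ^ L \<le> 2 ^ 1" by (intro power_increasing) auto
        moreover have "max n m < 2 ^ L" unfolding L_def using floorlog_bounds[of "max n m" 2] n by auto
        ultimately show False using m by simp
      qed
      show "L = floorlog 2 (max n m)" by (rule L_def)
      show "length S \<le> width D * n \<and> set S \<subseteq> operands D n m \<and> (\<forall>q\<in>legal_queries D n m. answer D n q S \<in> operands D n m)"
        if "S \<in> states D n m" for S using assms(1) n m that by (auto simp: data_structure_def)
      show "\<exists>ts. serves D P (cP * L) n [] blank rs ts \<and> (\<forall>t\<in>set ts. t \<le> T)" if rs: "legal_requests D Partially n m [] rs" for rs
      proof -
        obtain ts where ts: "serves D P (cP * L) n [] blank rs ts" "\<forall>t\<in>set ts. real t \<le> T_op n m"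
          using P(2)[OF n m rs] unfolding ws by blast
        have "t \<le> T" if "t \<in> set ts" for t using ts(2) that unfolding T_def by (metis le_nat_floor)
        then show ?thesis using ts(1) by blast
      qed
      show "\<exists>qs t. extraction (cX * L) n X (\<lambda>q. answer D n q S) blank 0 qs t S \<and>
         set qs \<subseteq> legal_queries D n m \<and> length qs \<le> K * n \<and> t \<le> K * n * T" if S: "S \<in> states D n m" for S
        using X(2)[OF n m S] unfolding ws using tT[OF _ kK(1)] kK(3) by (meson order_trans)
      show "\<exists>t R M us. exec (cY * L) Y (args [n, length S], args S) t (R, M) \<and>
         us = map M [0..<R 0] \<and> set us \<subseteq> legal_updates D n m \<and> result_state D n us = S \<and>
         length us \<le> K * n \<and> t \<le> K * n * T" if S: "S \<in> states D n m" for S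
      proof -
        obtain t R M us where y: "exec (cY * L) Y (args [n, length S], args S) t (R, M)" "us = map M [0..<R 0]" "set us \<subseteq> legal_updates D n m"
          "result_state D n us = S" "length us \<le> KY * n" "real t \<le> real (KY * n) * T_op n m" using Y(2)[OF n m S] unfolding ws by blast
        have "length us \<le> K * n" "t \<le> K * n * T" by (rule order_trans[OF y(5) kK(4)], rule tT[OF y(6) kK(2)])
        then show ?thesis using y(1-4) by blast
      qed
    qed (use n m T_le(1) wd P(1) X(1) Y(1) in \<open>auto simp: cB_def\<close>)
    define q where "q = (if tall then L * n else s)"
    define mn where "mn = min (sqrt (real m)) (real n * log 2 (real m))"
    have q1: "1 \<le> q" using s_ge n L mult_le_mono[of 1 L 1 n] by (simp add: q_def)
    have qb: "real q \<le> 2 * real (threshold K) * mn" using time_bound by (simp only: q_def mn_def)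
    obtain ts where ts: "serves D (retro K) w n [] blank rs ts" "sum_list ts \<le> length rs * (g * (q * T) + 100)"
      using retro_serves[OF rs] unfolding q_def g_def by blast
    \<comment> \<open>The additive overhead is absorbed because
      \<open>q * T \<ge> 1\<close>.\<close>
    have "real (g * (q * T) + 100) \<le> (real g + 100) * (real q * real T)"
      using mult_le_mono[OF q1 T_le(1)] by (simp add: algebra_simps) (metis of_nat_1 of_nat_le_iff of_nat_mult)
    also have "\<dots> \<le> (real g + 100) * ((2 * real (threshold K) * mn) * T_op n m)"
      by (intro mult_left_mono mult_mono qb T_le(2) order_trans[OF of_nat_0_le_iff qb]) simp_all
    also have "\<dots> = C * (mn * T_op n m)" by (simp add: C_def)
    finally have "real (g * (q * T) + 100) \<le> C * (mn * T_op n m)" .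
    then have "real (length rs) * real (g * (q * T) + 100) \<le> real (length rs) * (C * (mn * T_op n m))" by (rule mult_left_mono) simp
    moreover have "real (sum_list ts) \<le> real (length rs) * real (g * (q * T) + 100)" using ts(2) by (metis of_nat_le_iff of_nat_mult)
    moreover have "word_size (20 * cB) n m = w" by (simp add: ws w_def)
    ultimately show ?thesis using ts(1) unfolding mn_def by auto
  qed
  ultimately have "amortized_fully_retroactive D (\<lambda>n m. C * (min (sqrt (real m)) (real n * log 2 (real m)) * T_op n m))"
    unfolding amortized_fully_retroactive_def by blast
  then show ?thesis using C by blast
qed

end
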